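(* Let $K$ be an algebraically closed field, $Q$ a finite quiver, $I \subseteq KQ$ an admissible ideal and $\Lambda = KQ/I$, with Loewy length $L+1$. Let $\mathbf{d}$ be a dimension vector and $\mathbb{S} = (\mathbb{S}_0, \dots, \mathbb{S}_L)$ a semisimple sequence in $\Lambda$-mod with $\underline{\dim}\,\mathbb{S} = \mathbf{d}$. Let $\overline{\mathbf{Rep}\,\mathbb{S}}$ be the closure of $\mathbf{Rep}\,\mathbb{S}$ in $\mathbf{Rep}_{\mathbf{d}}(\Lambda)$. (1) Every module $M$ in $\overline{\mathbf{Rep}\,\mathbb{S}}$ (i.e., every $M \cong M_x$ with $x \in \overline{\mathbf{Rep}\,\mathbb{S}}$) has a filtration by submodules $M = M_0 \supseteq M_1 \supseteq \cdots \supseteq M_{L+1} = 0$ which is governed by $\mathbb{S}$, i.e., such that $M_l/M_{l+1}$ is semisimple and isomorphic to $\mathbb{S}_l$ for $0 \le l \le L$. In fact, the set $\mathbf{Filt}\,\mathbb{S}$, consisting of those points $x\in\mathbf{Rep}_{\mathbf{d}}(\Lambda)$ for which $M_x$ has at least one filtration governed by $\mathbb{S}$, is always closed in $\mathbf{Rep}_{\mathbf{d}}(\Lambda)$. (2) If $\Lambda$ is a truncated path algebra, i.e., $\Lambda = KQ/\langle \text{all paths of length } L+1\rangle$, and $\mathbf{Rep}\,\mathbb{S}$ is nonempty, then $\overline{\mathbf{Rep}\,\mathbb{S}} = \mathbf{Filt}\,\mathbb{S}$.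
   Context: Modules are finite dimensional left modules. $J$ is the Jacobson radical of $\Lambda = KQ/I$; $L$ is the maximal length of a path in $KQ\setminus I$, equivalently $L$ is minimal with $J^{L+1}=0$. Denote by $e_1,\dots,e_n$ the vertices of $Q$ (identified with the corresponding primitive idempotents), by $S_i = \Lambda e_i/Je_i$ the simple modules, and by $Q_1$ the set of arrows. Isomorphic semisimple modules are identified. For $\mathbf{d}=(d_1,\dots,d_n)$, $\mathbf{Rep}_{\mathbf{d}}(\Lambda)$ is the affine variety of all tuples $(x_\alpha)_{\alpha\in Q_1} \in \prod_{\alpha\in Q_1}\mathrm{Hom}_K(K^{d_{\mathrm{start}(\alpha)}},K^{d_{\mathrm{end}(\alpha)}})$ which satisfy all relations in $I$ (Zariski topology). A point $x$ determines the $\Lambda$-module $M_x = \bigoplus_i K^{d_i}$ on which each arrow $\alpha$ acts by $x_\alpha$. A semisimple sequence with dimension vector $\mathbf{d}$ is a sequence $\mathbb{S}=(\mathbb{S}_0,\dots,\mathbb{S}_L)$ of (isomorphism classes of) semisimple $\Lambda$-modules with $\underline{\dim}\,\mathbb{S} := \sum_{l=0}^L\underline{\dim}\,\mathbb{S}_l=\mathbf{d}$. The radical layering of a module $M$ is $\mathbb{S}(M) = (J^lM/J^{l+1}M)_{0\le l\le L}$. $\mathbf{Rep}\,\mathbb{S}$ is the subset of $\mathbf{Rep}_{\mathbf{d}}(\Lambda)$ consisting of the points $x$ with $\mathbb{S}(M_x)=\mathbb{S}$ (a locally closed subvariety). *)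

theory Defs
  imports
    "HOL-Analysis.Abstract_Topology"
    "HOL-Algebra.Ideal_Product"
    "HOL-Algebra.QuotRing"
    "HOL-Computational_Algebra.Polynomial"
    "Graph_Theory.Arc_Walk"
    "Jordan_Normal_Form.VS_Connect"
begin

hide_const (open) Multiset.mult Polynomial.smult Modules.module

section \<open>Left modules over a not necessarily commutative ring\<close>

text \<open>
  The library locale \<open>module\<close> requires a commutative ring of scalars, so only its record type is
  reused here; the \<open>mult\<close> and \<open>one\<close> fields of a module record carry no information.
\<close>

locale left_module = R?: ring R + M?: abelian_group M
  for R :: "('r, 'p) ring_scheme" (structure) and M :: "('r, 'm, 'q) module_scheme" (structure) +
  assumes smult_closed: "\<lbrakk>a \<in> carrier R; x \<in> carrier M\<rbrakk> \<Longrightarrow> a \<odot>\<^bsub>M\<^esub> x \<in> carrier M"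
    and smult_l_distr: "\<lbrakk>a \<in> carrier R; b \<in> carrier R; x \<in> carrier M\<rbrakk>
      \<Longrightarrow> (a \<oplus>\<^bsub>R\<^esub> b) \<odot>\<^bsub>M\<^esub> x = a \<odot>\<^bsub>M\<^esub> x \<oplus>\<^bsub>M\<^esub> b \<odot>\<^bsub>M\<^esub> x"
    and smult_r_distr: "\<lbrakk>a \<in> carrier R; x \<in> carrier M; y \<in> carrier M\<rbrakk>
      \<Longrightarrow> a \<odot>\<^bsub>M\<^esub> (x \<oplus>\<^bsub>M\<^esub> y) = a \<odot>\<^bsub>M\<^esub> x \<oplus>\<^bsub>M\<^esub> a \<odot>\<^bsub>M\<^esub> y"
    and smult_assoc1: "\<lbrakk>a \<in> carrier R; b \<in> carrier R; x \<in> carrier M\<rbrakk>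
      \<Longrightarrow> (a \<otimes>\<^bsub>R\<^esub> b) \<odot>\<^bsub>M\<^esub> x = a \<odot>\<^bsub>M\<^esub> (b \<odot>\<^bsub>M\<^esub> x)"
    and smult_one: "x \<in> carrier M \<Longrightarrow> \<one>\<^bsub>R\<^esub> \<odot>\<^bsub>M\<^esub> x = x"

text \<open>
  \<open>Module.submodule\<close> is the version of HOL-Algebra; unlike the one of the same name in
  \<open>LinearCombinations\<close> it does not presuppose a commutative ring of scalars.
\<close>

definition modules_isomorphic ::
    "('r, 'p) ring_scheme \<Rightarrow> ('r, 'm, 'q) module_scheme \<Rightarrow> ('r, 'n, 's) module_scheme \<Rightarrow> bool" where
  "modules_isomorphic R M N \<longleftrightarrow> (\<exists>f \<in> module_hom R M N. bij_betw f (carrier M) (carrier N))"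

definition quotient_module ::
    "('r, 'm, 'q) module_scheme \<Rightarrow> 'm set \<Rightarrow> ('r, 'm set) module" where
  "quotient_module M N =
    \<lparr>carrier = a_rcosets\<^bsub>M\<^esub> N, mult = undefined, one = undefined,
     zero = N, add = set_add M, smult = (\<lambda>a C. \<Union>m\<in>C. N +>\<^bsub>M\<^esub> (a \<odot>\<^bsub>M\<^esub> m))\<rparr>"

definition simple_module :: "('r, 'p) ring_scheme \<Rightarrow> ('r, 'm, 'q) module_scheme \<Rightarrow> bool" where
  "simple_module R M \<longleftrightarrow> left_module R M \<and> carrier M \<noteq> {\<zero>\<^bsub>M\<^esub>} \<and>
    (\<forall>N. Module.submodule N R M \<longrightarrow> N = {\<zero>\<^bsub>M\<^esub>} \<or> N = carrier M)"

text \<open>A module is semisimple if it is the sum of its simple submodules, i.e. if no proper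
  submodule contains all of them.\<close>

definition semisimple_module :: "('r, 'p) ring_scheme \<Rightarrow> ('r, 'm, 'q) module_scheme \<Rightarrow> bool" where
  "semisimple_module R M \<longleftrightarrow> left_module R M \<and>
    (\<forall>N. Module.submodule N R M \<and>
         (\<forall>S. Module.submodule S R M \<and> simple_module R (M\<lparr>carrier := S\<rparr>) \<longrightarrow> S \<subseteq> N)
       \<longrightarrow> N = carrier M)"


section \<open>Jacobson radical, radical layers and Loewy length\<close>

definition left_ideal :: "'r set \<Rightarrow> ('r, 'p) ring_scheme \<Rightarrow> bool" where
  "left_ideal I R \<longleftrightarrow> additive_subgroup I R \<and> (\<forall>a \<in> carrier R. \<forall>x \<in> I. a \<otimes>\<^bsub>R\<^esub> x \<in> I)"

definition maximal_left_ideal :: "'r set \<Rightarrow> ('r, 'p) ring_scheme \<Rightarrow> bool" where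
  "maximal_left_ideal I R \<longleftrightarrow> left_ideal I R \<and> I \<noteq> carrier R \<and>
    (\<forall>I'. left_ideal I' R \<and> I \<subseteq> I' \<longrightarrow> I' = I \<or> I' = carrier R)"

definition jacobson_radical :: "('r, 'p) ring_scheme \<Rightarrow> 'r set" where
  "jacobson_radical R = carrier R \<inter> \<Inter>{I. maximal_left_ideal I R}"

primrec ideal_power :: "('r, 'p) ring_scheme \<Rightarrow> 'r set \<Rightarrow> nat \<Rightarrow> 'r set" where
  "ideal_power R I 0 = carrier R"
| "ideal_power R I (Suc m) = ideal_prod R I (ideal_power R I m)"

definition loewy_length :: "('r, 'p) ring_scheme \<Rightarrow> nat" where
  "loewy_length R = (LEAST m. ideal_power R (jacobson_radical R) m = {\<zero>\<^bsub>R\<^esub>})"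

inductive_set ideal_smult :: "'r set \<Rightarrow> ('r, 'm, 'q) module_scheme \<Rightarrow> 'm set"
  for I :: "'r set" and M :: "('r, 'm, 'q) module_scheme" where
  smult: "\<lbrakk>a \<in> I; m \<in> carrier M\<rbrakk> \<Longrightarrow> a \<odot>\<^bsub>M\<^esub> m \<in> ideal_smult I M"
| add: "\<lbrakk>m \<in> ideal_smult I M; m' \<in> ideal_smult I M\<rbrakk> \<Longrightarrow> m \<oplus>\<^bsub>M\<^esub> m' \<in> ideal_smult I M"

definition radical_power ::
    "('r, 'p) ring_scheme \<Rightarrow> ('r, 'm, 'q) module_scheme \<Rightarrow> nat \<Rightarrow> 'm set" where
  "radical_power R M l = ideal_smult (ideal_power R (jacobson_radical R) l) M"

definition radical_layer ::
    "('r, 'p) ring_scheme \<Rightarrow> ('r, 'm, 'q) module_scheme \<Rightarrow> nat \<Rightarrow> ('r, 'm set) module" where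
  "radical_layer R M l =
    quotient_module (M\<lparr>carrier := radical_power R M l\<rparr>) (radical_power R M (Suc l))"

definition governed_filtration ::
    "('r, 'p) ring_scheme \<Rightarrow> nat \<Rightarrow> (nat \<Rightarrow> ('r, 's, 't) module_scheme) \<Rightarrow>
     ('r, 'm, 'q) module_scheme \<Rightarrow> (nat \<Rightarrow> 'm set) \<Rightarrow> bool" where
  "governed_filtration R L \<S> M F \<longleftrightarrow>
    F 0 = carrier M \<and> F (Suc L) = {\<zero>\<^bsub>M\<^esub>} \<and>
    (\<forall>l \<le> Suc L. Module.submodule (F l) R M) \<and>
    (\<forall>l \<le> L. F (Suc l) \<subseteq> F l \<and>
       semisimple_module R (quotient_module (M\<lparr>carrier := F l\<rparr>) (F (Suc l))) \<and>
       modules_isomorphic R (quotient_module (M\<lparr>carrier := F l\<rparr>) (F (Suc l))) (\<S> l))"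


section \<open>Path algebras\<close>

text \<open>
  A quiver is a finite directed graph, loops and multiple arrows allowed (\<open>fin_digraph\<close>).  A path is
  a pair of its starting vertex and the list of its arrows, in the order in which they are
  traversed; \<open>(u, [])\<close> is the path of length \<open>0\<close> at \<open>u\<close>.
\<close>

type_synonym ('v, 'a) qpath = "'v \<times> 'a list"

definition qpaths :: "('v, 'a) pre_digraph \<Rightarrow> ('v, 'a) qpath set" where
  "qpaths Q = {(u, p). \<exists>w. pre_digraph.awalk Q u p w}"

definition qend :: "('v, 'a) pre_digraph \<Rightarrow> ('v, 'a) qpath \<Rightarrow> 'v" where
  "qend Q q = last (pre_digraph.awalk_verts Q (fst q) (snd q))"

definition path_elem :: "('v, 'a) qpath \<Rightarrow> ('v, 'a) qpath \<Rightarrow> 'k::field" where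
  "path_elem q = (\<lambda>q'. if q' = q then 1 else 0)"

text \<open>
  Elements are finitely supported coefficient functions on paths.  The product \<open>q p\<close> of two paths
  is \<open>p\<close> followed by \<open>q\<close>, as it has to be for representations to correspond to left modules.
\<close>

definition path_algebra :: "('v, 'a) pre_digraph \<Rightarrow> (('v, 'a) qpath \<Rightarrow> 'k::field) ring" where
  "path_algebra Q =
    \<lparr>carrier = {f. finite {q. f q \<noteq> 0} \<and> {q. f q \<noteq> 0} \<subseteq> qpaths Q},
     mult = (\<lambda>f g (u, r). \<Sum>k\<le>length r. f (qend Q (u, take k r), drop k r) * g (u, take k r)),
     one = (\<lambda>(u, p). if u \<in> verts Q \<and> p = [] then 1 else 0),
     zero = (\<lambda>_. 0),
     add = (\<lambda>f g q. f q + g q)\<rparr>"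

definition arrow_ideal :: "('v, 'a) pre_digraph \<Rightarrow> (('v, 'a) qpath \<Rightarrow> 'k::field) set" where
  "arrow_ideal Q = Idl\<^bsub>path_algebra Q\<^esub> {path_elem (tail Q \<alpha>, [\<alpha>]) | \<alpha>. \<alpha> \<in> arcs Q}"

definition admissible_ideal ::
    "('v, 'a) pre_digraph \<Rightarrow> (('v, 'a) qpath \<Rightarrow> 'k::field) set \<Rightarrow> bool" where
  "admissible_ideal Q I \<longleftrightarrow> ideal I (path_algebra Q) \<and>
    I \<subseteq> ideal_power (path_algebra Q) (arrow_ideal Q) 2 \<and>
    (\<exists>m \<ge> 2. ideal_power (path_algebra Q) (arrow_ideal Q) m \<subseteq> I)"

definition paths_ideal ::
    "('v, 'a) pre_digraph \<Rightarrow> nat \<Rightarrow> (('v, 'a) qpath \<Rightarrow> 'k::field) set" where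
  "paths_ideal Q m = Idl\<^bsub>path_algebra Q\<^esub> {path_elem q | q. q \<in> qpaths Q \<and> length (snd q) = m}"

abbreviation quiver_algebra ::
    "('v, 'a) pre_digraph \<Rightarrow> (('v, 'a) qpath \<Rightarrow> 'k::field) set \<Rightarrow> (('v, 'a) qpath \<Rightarrow> 'k) set ring" where
  "quiver_algebra Q I \<equiv> path_algebra Q Quot I"


section \<open>Dimension vectors and semisimple sequences\<close>

text \<open>A module over \<open>KQ/I\<close> as a vector space: \<open>c \<in> K\<close> acts as the residue class of \<open>c\<cdot>1\<close>.\<close>

definition restrict_scalars ::
    "('v, 'a) pre_digraph \<Rightarrow> (('v, 'a) qpath \<Rightarrow> 'k::field) set \<Rightarrow>
     ((('v, 'a) qpath \<Rightarrow> 'k) set, 'm) module \<Rightarrow> ('k, 'm) module" where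
  "restrict_scalars Q I M =
    \<lparr>carrier = carrier M, mult = undefined, one = undefined, zero = \<zero>\<^bsub>M\<^esub>, add = add M,
     smult = (\<lambda>c m. (I +>\<^bsub>path_algebra Q\<^esub> (\<lambda>q. c * \<one>\<^bsub>path_algebra Q\<^esub> q)) \<odot>\<^bsub>M\<^esub> m)\<rparr>"

text \<open>The entry at \<open>i\<close> is the dimension of \<open>e\<^sub>i M\<close> over \<open>K\<close>.\<close>

definition dim_vector ::
    "('v, 'a) pre_digraph \<Rightarrow> (('v, 'a) qpath \<Rightarrow> 'k::field) set \<Rightarrow>
     ((('v, 'a) qpath \<Rightarrow> 'k) set, 'm) module \<Rightarrow> 'v \<Rightarrow> nat" where
  "dim_vector Q I M i =
    vectorspace.dim class_ring ((restrict_scalars Q I M)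
      \<lparr>carrier := (\<lambda>m. (I +>\<^bsub>path_algebra Q\<^esub> path_elem (i, [])) \<odot>\<^bsub>M\<^esub> m) ` carrier M\<rparr>)"

definition semisimple_sequence ::
    "('v, 'a) pre_digraph \<Rightarrow> (('v, 'a) qpath \<Rightarrow> 'k::field) set \<Rightarrow> nat \<Rightarrow> ('v \<Rightarrow> nat) \<Rightarrow>
     (nat \<Rightarrow> ((('v, 'a) qpath \<Rightarrow> 'k) set, 's) module) \<Rightarrow> bool" where
  "semisimple_sequence Q I L d \<S> \<longleftrightarrow>
    (\<forall>l \<le> L. semisimple_module (quiver_algebra Q I) (\<S> l) \<and>
             vectorspace.fin_dim class_ring (restrict_scalars Q I (\<S> l))) \<and>
    (\<forall>i \<in> verts Q. (\<Sum>l\<le>L. dim_vector Q I (\<S> l) i) = d i)"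


section \<open>Representation varieties\<close>

definition path_map :: "('a \<Rightarrow> 'k::field mat) \<Rightarrow> 'a list \<Rightarrow> 'k vec \<Rightarrow> 'k vec" where
  "path_map x p w = fold (\<lambda>\<alpha> w. x \<alpha> *\<^sub>v w) p w"

text \<open>
  The action of an element of \<open>KQ\<close> on \<open>\<Oplus>\<^sub>i K\<^bsup>d i\<^esup>\<close>: a path from \<open>u\<close> to \<open>i\<close> maps the component at \<open>u\<close>
  to the component at \<open>i\<close> and annihilates all other components.
\<close>

definition rep_action ::
    "('v, 'a) pre_digraph \<Rightarrow> ('v \<Rightarrow> nat) \<Rightarrow> ('a \<Rightarrow> 'k::field mat) \<Rightarrow>
     (('v, 'a) qpath \<Rightarrow> 'k) \<Rightarrow> ('v \<Rightarrow> 'k vec) \<Rightarrow> 'v \<Rightarrow> 'k vec" where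
  "rep_action Q d x f v = (\<lambda>i \<in> verts Q. vec (d i)
     (\<lambda>j. \<Sum>q \<in> {q. f q \<noteq> 0 \<and> qend Q q = i}. f q * path_map x (snd q) (v (fst q)) $ j))"

text \<open>A residue class acts by any of its members; this is well defined for points of the
  representation variety below.\<close>

definition rep_module ::
    "('v, 'a) pre_digraph \<Rightarrow> ('v \<Rightarrow> nat) \<Rightarrow> ('a \<Rightarrow> 'k::field mat) \<Rightarrow>
     ((('v, 'a) qpath \<Rightarrow> 'k) set, 'v \<Rightarrow> 'k vec) module" where
  "rep_module Q d x =
    \<lparr>carrier = (\<Pi>\<^sub>E i \<in> verts Q. carrier_vec (d i)), mult = undefined, one = undefined,
     zero = (\<lambda>i \<in> verts Q. 0\<^sub>v (d i)),
     add = (\<lambda>v w. \<lambda>i \<in> verts Q. v i + w i),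
     smult = (\<lambda>C v. the_elem ((\<lambda>f. rep_action Q d x f v) ` C))\<rparr>"

definition rep_space :: "('v, 'a) pre_digraph \<Rightarrow> ('v \<Rightarrow> nat) \<Rightarrow> ('a \<Rightarrow> 'k::field mat) set" where
  "rep_space Q d = (\<Pi>\<^sub>E \<alpha> \<in> arcs Q. carrier_mat (d (head Q \<alpha>)) (d (tail Q \<alpha>)))"

definition rep_variety ::
    "('v, 'a) pre_digraph \<Rightarrow> (('v, 'a) qpath \<Rightarrow> 'k::field) set \<Rightarrow> ('v \<Rightarrow> nat) \<Rightarrow>
     ('a \<Rightarrow> 'k mat) set" where
  "rep_variety Q I d = {x \<in> rep_space Q d.
     \<forall>\<rho> \<in> I. \<forall>v \<in> (\<Pi>\<^sub>E i \<in> verts Q. carrier_vec (d i)).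
       rep_action Q d x \<rho> v = (\<lambda>i \<in> verts Q. 0\<^sub>v (d i))}"

inductive_set poly_functions :: "('x \<Rightarrow> 'k::field) set \<Rightarrow> ('x \<Rightarrow> 'k) set"
  for coords :: "('x \<Rightarrow> 'k) set" where
  const: "(\<lambda>_. c) \<in> poly_functions coords"
| coord: "f \<in> coords \<Longrightarrow> f \<in> poly_functions coords"
| add: "\<lbrakk>f \<in> poly_functions coords; g \<in> poly_functions coords\<rbrakk>
    \<Longrightarrow> (\<lambda>x. f x + g x) \<in> poly_functions coords"
| mult: "\<lbrakk>f \<in> poly_functions coords; g \<in> poly_functions coords\<rbrakk>
    \<Longrightarrow> (\<lambda>x. f x * g x) \<in> poly_functions coords"

definition zariski_topology :: "('x \<Rightarrow> 'k::field) set \<Rightarrow> 'x set \<Rightarrow> 'x topology" where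
  "zariski_topology coords X =
    topology (\<lambda>U. \<exists>P \<subseteq> poly_functions coords. U = {x \<in> X. \<exists>f \<in> P. f x \<noteq> 0})"

lemma istopology_zariski:
  "istopology (\<lambda>U. \<exists>P \<subseteq> poly_functions coords. U = {x \<in> X. \<exists>f \<in> P. f x \<noteq> (0::'k::field)})"
  (is "istopology ?open")
  unfolding istopology_def
proof (intro conjI allI impI)
  fix S T assume "?open S" "?open T"
  then obtain P P' where P: "P \<subseteq> poly_functions coords" "S = {x \<in> X. \<exists>f \<in> P. f x \<noteq> 0}"
    and P': "P' \<subseteq> poly_functions coords" "T = {x \<in> X. \<exists>f \<in> P'. f x \<noteq> 0}" by auto
  let ?P = "(\<lambda>(f, g) x. f x * g x) ` (P \<times> P')"
  have "?P \<subseteq> poly_functions coords"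
    using P(1) P'(1) by (auto intro!: poly_functions.mult)
  moreover have "S \<inter> T = {x \<in> X. \<exists>f \<in> ?P. f x \<noteq> 0}"
    unfolding P(2) P'(2) by (auto simp: Bex_def)
  ultimately show "?open (S \<inter> T)" by blast
next
  fix \<K> assume "\<forall>K \<in> \<K>. ?open K"
  then obtain P where "\<forall>K \<in> \<K>. P K \<subseteq> poly_functions coords \<and>
      K = {x \<in> X. \<exists>f \<in> P K. f x \<noteq> 0}"
    by (rule bchoice[THEN exE]) blast
  then have P: "\<And>K. K \<in> \<K> \<Longrightarrow> P K \<subseteq> poly_functions coords"
    "\<And>K. K \<in> \<K> \<Longrightarrow> K = {x \<in> X. \<exists>f \<in> P K. f x \<noteq> 0}" by auto
  have "(\<Union>K\<in>\<K>. P K) \<subseteq> poly_functions coords" using P(1) by auto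
  moreover have "\<Union>\<K> = {x \<in> X. \<exists>f \<in> (\<Union>K\<in>\<K>. P K). f x \<noteq> 0}"
  proof (rule Set.set_eqI)
    fix x
    have "x \<in> \<Union>\<K> \<longleftrightarrow> (\<exists>K \<in> \<K>. x \<in> {x \<in> X. \<exists>f \<in> P K. f x \<noteq> 0})"
      using P(2) by blast
    then show "x \<in> \<Union>\<K> \<longleftrightarrow> x \<in> {x \<in> X. \<exists>f \<in> (\<Union>K\<in>\<K>. P K). f x \<noteq> 0}"
      by auto
  qed
  ultimately show "?open (\<Union>\<K>)" by blast
qed

lemma openin_zariski:
  "openin (zariski_topology coords X) U \<longleftrightarrow>
    (\<exists>P \<subseteq> poly_functions coords. U = {x \<in> X. \<exists>f \<in> P. f x \<noteq> (0::'k::field)})"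
  unfolding zariski_topology_def by (simp only: topology_inverse'[OF istopology_zariski])

lemma topspace_zariski:
  "topspace (zariski_topology (coords :: ('x \<Rightarrow> 'k::field) set) X) = X"
proof (rule equalityI)
  show "topspace (zariski_topology coords X) \<subseteq> X"
    unfolding topspace_def openin_zariski by blast
  have "\<exists>P \<subseteq> poly_functions coords. X = {x \<in> X. \<exists>f \<in> P. f x \<noteq> 0}"
    by (rule exI[of _ "{\<lambda>_. 1}"]) (auto intro: poly_functions.const)
  then have "openin (zariski_topology coords X) X"
    by (simp only: openin_zariski)
  then show "X \<subseteq> topspace (zariski_topology coords X)"
    by (rule openin_subset)
qed

lemma closedin_zariski:
  "closedin (zariski_topology coords X) Z \<longleftrightarrow>
    (\<exists>P \<subseteq> poly_functions coords. Z = {x \<in> X. \<forall>f \<in> P. f x = (0::'k::field)})"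
  (is "_ \<longleftrightarrow> (\<exists>P \<subseteq> _. Z = ?Z P)")
proof -
  have eq: "Z \<subseteq> X \<and> X - Z = {x \<in> X. \<exists>f \<in> P. f x \<noteq> 0} \<longleftrightarrow> Z = ?Z P"
    for P
  proof -
    have "{x \<in> X. \<exists>f \<in> P. f x \<noteq> 0} = X - ?Z P" by auto
    then show ?thesis by auto
  qed
  show ?thesis
    unfolding closedin_def topspace_zariski openin_zariski eq[symmetric] by blast
qed

definition rep_topology ::
    "('v, 'a) pre_digraph \<Rightarrow> (('v, 'a) qpath \<Rightarrow> 'k::field) set \<Rightarrow> ('v \<Rightarrow> nat) \<Rightarrow>
     ('a \<Rightarrow> 'k mat) topology" where
  "rep_topology Q I d = zariski_topology
     {(\<lambda>x. x \<alpha> $$ (r, c)) | \<alpha> r c. \<alpha> \<in> arcs Q \<and> r < d (head Q \<alpha>) \<and> c < d (tail Q \<alpha>)}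
     (rep_variety Q I d)"

definition Rep ::
    "('v, 'a) pre_digraph \<Rightarrow> (('v, 'a) qpath \<Rightarrow> 'k::field) set \<Rightarrow> nat \<Rightarrow> ('v \<Rightarrow> nat) \<Rightarrow>
     (nat \<Rightarrow> ((('v, 'a) qpath \<Rightarrow> 'k) set, 's) module) \<Rightarrow> ('a \<Rightarrow> 'k mat) set" where
  "Rep Q I L d \<S> = {x \<in> rep_variety Q I d. \<forall>l \<le> L.
     modules_isomorphic (quiver_algebra Q I)
       (radical_layer (quiver_algebra Q I) (rep_module Q d x) l) (\<S> l)}"

definition Filt ::
    "('v, 'a) pre_digraph \<Rightarrow> (('v, 'a) qpath \<Rightarrow> 'k::field) set \<Rightarrow> nat \<Rightarrow> ('v \<Rightarrow> nat) \<Rightarrow>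
     (nat \<Rightarrow> ((('v, 'a) qpath \<Rightarrow> 'k) set, 's) module) \<Rightarrow> ('a \<Rightarrow> 'k mat) set" where
  "Filt Q I L d \<S> = {x \<in> rep_variety Q I d.
     \<exists>F. governed_filtration (quiver_algebra Q I) L \<S> (rep_module Q d x) F}"

end

theory Submission
  imports Defs "Jordan_Normal_Form.Determinant"
begin

text \<open>
  In suitable bases a filtration governed by \<open>\<S>\<close> is the standard flag,
  so \<open>Filt \<S>\<close> is the saturation under base change of the linear space of representations which map
  each term of the standard flag into the next one.  This space is stable under upper triangular
  matrices.  Closedness is therefore the completeness of a flag variety; it is obtained by adding
  elementary parabolic subgroups one at a time, each step being a union over a projective line,
  where the parameter is eliminated by a resultant.  Since a filtration by powers of the radical is
  governed by the radical layers, \<open>Rep \<S>\<close> is contained in the closed set \<open>Filt \<S>\<close>.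

  In the truncated case every point of that linear space satisfies the relations.  A point of
  \<open>Filt \<S>\<close> and a point of \<open>Rep \<S>\<close>, both moved into the linear space, are joined by a line in it, and
  the nonvanishing of finitely many polynomials, none of them zero on the line, forces the standard
  flag to be the radical filtration of a point of the line.
\<close>

section \<open>Elimination over the projective line\<close>

text \<open>A resultant may vanish identically, so by itself it separates nothing. The elimination
  works because closedness is checked at one point \<open>y\<close> at a time: over an algebraically
  closed field the equations in one chart of the line, specialised at \<open>y\<close>, have no
  common root, hence generate the unit ideal of the principal ideal domain K[t], and a combination
  of them with multipliers that do not depend on the point is a family equal to 1 at
  \<open>y\<close>. Its resultant with an equation that is nonzero at infinity over \<open>y\<close>
  is nonzero at \<open>y\<close>.

  The modules of the sequence enter only through their dimension vectors. A semisimple module is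
  annihilated by the image of the arrow ideal, so it is isomorphic to a representation in which all
  arrows are zero. This turns governed filtrations into adapted bases.

  Irreducibility of the linear space is used only along a line: a nonzero polynomial that keeps the
  flag equal to the radical filtration and one that keeps a given function nonzero have a nonzero
  product, which has a non-root because the field is infinite.\<close>

definition algset :: "('x \<Rightarrow> 'k::field) set \<Rightarrow> 'x set \<Rightarrow> 'x set \<Rightarrow> bool" where
  "algset C X Z \<longleftrightarrow> (\<exists>P \<subseteq> poly_functions C. Z = {x \<in> X. \<forall>f \<in> P. f x = 0})"

text \<open>All polynomial functions vanishing on \<open>Z\<close> together serve as its equations,
  so it is enough to separate each outside point from \<open>Z\<close> by one function. The ambient
  set \<open>X\<close> will be the affine space \<open>rep_space Q d\<close>, where no relations are
  imposed.\<close>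

lemma algsetI:
  assumes "Z \<subseteq> X"
    and "\<And>y. y \<in> X \<Longrightarrow> y \<notin> Z \<Longrightarrow> \<exists>f \<in> poly_functions C. f y \<noteq> 0 \<and> (\<forall>x \<in> Z. f x = 0)"
  shows "algset C X Z"
  unfolding algset_def
proof (intro exI conjI)
  let ?P = "{f \<in> poly_functions C. \<forall>x \<in> Z. f x = 0}"
  show "?P \<subseteq> poly_functions C" by blast
  show "Z = {x \<in> X. \<forall>f \<in> ?P. f x = 0}" using assms by blast
qed

lemma algset_separate:
  assumes "algset C X Z" "y \<in> X" "y \<notin> Z"
  obtains f where "f \<in> poly_functions C" "f y \<noteq> 0" "\<And>x. x \<in> Z \<Longrightarrow> f x = 0"
  using assms unfolding algset_def by blast

lemma poly_functions_sum:
  assumes "\<And>i. i \<in> A \<Longrightarrow> f i \<in> poly_functions C"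
  shows "(\<lambda>x. \<Sum>i\<in>A. f i x) \<in> poly_functions C"
  using assms
proof (induction A rule: infinite_finite_induct)
  case (insert i A)
  then show ?case using poly_functions.add[of "f i" C "\<lambda>x. \<Sum>i\<in>A. f i x"] by simp
qed (simp_all add: poly_functions.const)

lemma poly_functions_prod:
  assumes "\<And>i. i \<in> A \<Longrightarrow> f i \<in> poly_functions C"
  shows "(\<lambda>x. \<Prod>i\<in>A. f i x) \<in> poly_functions C"
  using assms
proof (induction A rule: infinite_finite_induct)
  case (insert i A)
  then show ?case using poly_functions.mult[of "f i" C "\<lambda>x. \<Prod>i\<in>A. f i x"] by simp
qed (simp_all add: poly_functions.const)

lemma poly_functions_det:
  assumes "\<And>x. M x \<in> carrier_mat n n"
    and "\<And>i j. i < n \<Longrightarrow> j < n \<Longrightarrow> (\<lambda>x. M x $$ (i, j)) \<in> poly_functions C"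
  shows "(\<lambda>x. det (M x)) \<in> poly_functions C"
proof -
  have "(\<lambda>x. \<Sum>p\<in>{p. p permutes {0..<n}}. signof p * (\<Prod>i = 0..<n. M x $$ (i, p i))) \<in> poly_functions C"
  proof (intro poly_functions_sum poly_functions.mult poly_functions_prod poly_functions.const)
    fix p i assume "p \<in> {p. p permutes {0..<n}}" "i \<in> {0..<n}"
    then show "(\<lambda>x. M x $$ (i, p i)) \<in> poly_functions C"
      using assms(2) permutes_in_image[of p "{0..<n}" i] by auto
  qed
  then show ?thesis by (simp add: det_def'[OF assms(1)])
qed

text \<open>Polynomials in one more variable over the ring of polynomial functions. The degree bound
  is uniform in the point, so that one size of Sylvester matrix serves all points.\<close>

definition poly_families :: "('x \<Rightarrow> 'k::field) set \<Rightarrow> ('x \<Rightarrow> 'k poly) set" where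
  "poly_families C = {F. (\<forall>j. (\<lambda>x. coeff (F x) j) \<in> poly_functions C) \<and> (\<exists>n. \<forall>x. degree (F x) \<le> n)}"

lemma poly_families_const: "(\<lambda>_. p) \<in> poly_families C"
  unfolding poly_families_def by (auto intro: poly_functions.const)

lemma poly_families_lift:
  assumes "f \<in> poly_functions C"
  shows "(\<lambda>x. [:f x:]) \<in> poly_families C"
proof -
  have "(\<lambda>x. coeff [:f x:] j) \<in> poly_functions C" for j
    by (cases j) (simp_all add: assms poly_functions.const)
  then show ?thesis unfolding poly_families_def by auto
qed

lemma poly_families_add:
  assumes "F \<in> poly_families C" "G \<in> poly_families C"
  shows "(\<lambda>x. F x + G x) \<in> poly_families C"
proof -
  obtain n m where "\<forall>x. degree (F x) \<le> n" "\<forall>x. degree (G x) \<le> m"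
    using assms unfolding poly_families_def by auto
  then have "\<forall>x. degree (F x + G x) \<le> max n m" by (meson degree_add_le max.coboundedI1 max.coboundedI2)
  then show ?thesis using assms unfolding poly_families_def by (auto intro: poly_functions.add)
qed

lemma poly_families_mult:
  assumes "F \<in> poly_families C" "G \<in> poly_families C"
  shows "(\<lambda>x. F x * G x) \<in> poly_families C"
proof -
  obtain n m where nm: "\<And>x. degree (F x) \<le> n" "\<And>x. degree (G x) \<le> m"
    using assms unfolding poly_families_def by auto
  have "\<forall>x. degree (F x * G x) \<le> n + m"
    using nm by (meson add_mono degree_mult_le order_trans)
  moreover have "\<forall>j. (\<lambda>x. coeff (F x * G x) j) \<in> poly_functions C"
    unfolding coeff_mult using assms unfolding poly_families_def
    by (auto intro!: poly_functions_sum poly_functions.mult)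
  ultimately show ?thesis unfolding poly_families_def by blast
qed

lemma poly_families_sum:
  assumes "\<And>i. i \<in> A \<Longrightarrow> F i \<in> poly_families C"
  shows "(\<lambda>x. \<Sum>i\<in>A. F i x) \<in> poly_families C"
  using assms
proof (induction A rule: infinite_finite_induct)
  case (insert i A)
  then show ?case using poly_families_add[of "F i" C "\<lambda>x. \<Sum>i\<in>A. F i x"] by simp
qed (simp_all add: poly_families_const)

text \<open>A family of self-maps of \<open>X\<close> that is polynomial jointly in the parameter
  and the point. The pullback formula is restricted to \<open>X\<close> because for representations
  it is derived only for matrices of the right sizes.\<close>

definition poly_curve :: "('x \<Rightarrow> 'k::field) set \<Rightarrow> 'x set \<Rightarrow> ('k \<Rightarrow> 'x \<Rightarrow> 'x) \<Rightarrow> bool" where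
  "poly_curve C X u \<longleftrightarrow> (\<forall>t. \<forall>x \<in> X. u t x \<in> X) \<and>
     (\<forall>f \<in> C. \<exists>F \<in> poly_families C. \<forall>x \<in> X. \<forall>t. f (u t x) = poly (F x) t)"

lemma poly_curve_pullback:
  assumes "poly_curve C X u" "f \<in> poly_functions C"
  shows "\<exists>F \<in> poly_families C. \<forall>x \<in> X. \<forall>t. f (u t x) = poly (F x) t"
  using assms(2)
proof induction
  case (const c)
  show ?case by (rule bexI[of _ "\<lambda>_. [:c:]"]) (auto intro: poly_families_const)
next
  case (coord f)
  then show ?case using assms(1) unfolding poly_curve_def by blast
next
  case (add f g)
  then obtain F G where "F \<in> poly_families C" "G \<in> poly_families C"
    "\<forall>x \<in> X. \<forall>t. f (u t x) = poly (F x) t" "\<forall>x \<in> X. \<forall>t. g (u t x) = poly (G x) t" by blast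
  then show ?case by (intro bexI[of _ "\<lambda>x. F x + G x"]) (auto intro: poly_families_add)
next
  case (mult f g)
  then obtain F G where "F \<in> poly_families C" "G \<in> poly_families C"
    "\<forall>x \<in> X. \<forall>t. f (u t x) = poly (F x) t" "\<forall>x \<in> X. \<forall>t. g (u t x) = poly (G x) t" by blast
  then show ?case by (intro bexI[of _ "\<lambda>x. F x * G x"]) (auto intro: poly_families_mult)
qed

text \<open>The Sylvester matrix of formal degrees \<open>m\<close> and \<open>n\<close>, rows in ascending powers.\<close>

definition syl :: "nat \<Rightarrow> nat \<Rightarrow> (nat \<Rightarrow> 'k::field) \<Rightarrow> (nat \<Rightarrow> 'k) \<Rightarrow> 'k mat" where
  "syl m n a b = mat (m + n) (m + n) (\<lambda>(i, j).
     if i < n then (if i \<le> j then a (j - i) else 0)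
     else (if i - n \<le> j then b (j - (i - n)) else 0))"

lemma syl_carrier: "syl m n a b \<in> carrier_mat (m + n) (m + n)"
  by (simp add: syl_def)

text \<open>A row of the Sylvester matrix paired with the powers of \<open>t\<close>: the shift by
  \<open>i\<close> pulls out a factor \<open>t ^ i\<close> and leaves the value of the polynomial at
  \<open>t\<close>.\<close>

lemma shifted_sum:
  fixes a :: "nat \<Rightarrow> 'k::field"
  assumes "\<And>k. k > m \<Longrightarrow> a k = 0" "i + m < N"
  shows "(\<Sum>j<N. (if i \<le> j then a (j - i) else 0) * t ^ j) = t ^ i * (\<Sum>k\<le>m. a k * t ^ k)"
proof -
  have "(\<Sum>j<N. (if i \<le> j then a (j - i) else 0) * t ^ j)
      = (\<Sum>j\<in>{i..i+m}. a (j - i) * t ^ j)"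
    using assms by (intro sum.mono_neutral_cong_right) auto
  also have "\<dots> = (\<Sum>k\<in>{..m}. a k * t ^ (k + i))"
    by (rule sum.reindex_bij_witness[of _ "\<lambda>k. k + i" "\<lambda>j. j - i"]) auto
  finally show ?thesis by (simp add: sum_distrib_left power_add mult_ac)
qed

text \<open>At a common root the vector of the powers of \<open>t\<close> lies in the kernel. Its
  entry at index 0 is 1 even for \<open>t = 0\<close>; the assumption \<open>m + n > 0\<close> makes
  sure that this entry exists.\<close>

lemma det_syl_eq_0:
  assumes "\<And>k. k > m \<Longrightarrow> a k = 0" "\<And>k. k > n \<Longrightarrow> b k = 0" "m + n > 0"
    and "(\<Sum>k\<le>m. a k * t ^ k) = 0" "(\<Sum>k\<le>n. b k * t ^ k) = 0"
  shows "det (syl m n a b) = 0"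
proof -
  let ?v = "vec (m + n) (\<lambda>j. t ^ j)"
  have "syl m n a b *\<^sub>v ?v = 0\<^sub>v (m + n)"
  proof (rule eq_vecI)
    fix i assume "i < dim_vec (0\<^sub>v (m + n) :: 'a vec)"
    then have i: "i < m + n" by simp
    have "(syl m n a b *\<^sub>v ?v) $ i = (\<Sum>j<m+n. syl m n a b $$ (i, j) * t ^ j)"
      using i by (auto simp: scalar_prod_def syl_def atLeast0LessThan intro!: sum.cong)
    also have "\<dots> = (\<Sum>j<m+n. (if i < n then (if i \<le> j then a (j - i) else 0)
        else (if i - n \<le> j then b (j - (i - n)) else 0)) * t ^ j)"
      using i by (intro sum.cong) (simp_all add: syl_def)
    also have "\<dots> = 0"
    proof (cases "i < n")
      case True
      then have "(\<Sum>j<m+n. (if i \<le> j then a (j - i) else 0) * t ^ j) = 0"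
        using shifted_sum[of m a i "m + n" t] assms by simp
      with True show ?thesis by simp
    next
      case False
      then have "(\<Sum>j<m+n. (if i - n \<le> j then b (j - (i - n)) else 0) * t ^ j) = 0"
        using shifted_sum[of n b "i - n" "m + n" t] assms i by simp
      with False show ?thesis by simp
    qed
    finally show "(syl m n a b *\<^sub>v ?v) $ i = 0\<^sub>v (m + n) $ i" using i by simp
  qed (simp add: syl_def)
  moreover have "?v \<noteq> 0\<^sub>v (m + n)"
    using assms(3) by (metis index_vec index_zero_vec(1) power_0 zero_neq_one)
  ultimately show ?thesis
    using det_0_iff_vec_prod_zero[OF syl_carrier, of m n a b] vec_carrier by blast
qed

text \<open>The first \<open>n\<close> rows have a single 1, on the diagonal, and the rows of
  \<open>b\<close> reach exactly up to the diagonal, where they carry the top coefficient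
  \<open>b n\<close>. The matrix is lower triangular with determinant the \<open>m\<close>-th power
  of \<open>b n\<close>, although the first polynomial has formal degree \<open>m\<close> and true
  degree 0.\<close>

lemma det_syl_unit:
  assumes "\<And>k. a k = (if k = 0 then 1 else 0)" "\<And>k. k > n \<Longrightarrow> b k = 0" "b n \<noteq> 0"
  shows "det (syl m n a b) \<noteq> 0"
proof -
  have "det (syl m n a b) = prod_list (diag_mat (syl m n a b))"
    using assms by (intro det_lower_triangular[OF _ syl_carrier]) (auto simp: syl_def)
  moreover have "0 \<notin> set (diag_mat (syl m n a b))"
    using assms by (auto simp: diag_mat_def syl_def)
  ultimately show ?thesis by (simp add: prod_list_zero_iff)
qed

lemma poly_altdef_le:
  fixes p :: "'k::field poly"
  shows "degree p \<le> n \<Longrightarrow> poly p t = (\<Sum>k\<le>n. coeff p k * t ^ k)"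
  unfolding poly_altdef by (rule sum.mono_neutral_left) (auto simp: coeff_eq_0)

text \<open>The families that vanish at \<open>t\<close> whenever \<open>u t x\<close> lies in
  \<open>Z\<close> are closed under adding polynomial multiples, so their values at \<open>y\<close>
  form an ideal of the principal ideal domain K[t]. A generator has no root, because for each
  \<open>t\<close> some equation of \<open>Z\<close> is nonzero at \<open>u t y\<close>; over an
  algebraically closed field it is a constant and can be scaled to 1.\<close>

lemma bezout_family:
  fixes Z :: "'x set" and C :: "('x \<Rightarrow> 'k::alg_closed_field) set"
  assumes Z: "algset C X Z" and u: "poly_curve C X u" and y: "y \<in> X" and no: "\<And>t. u t y \<notin> Z"
  obtains F where "F \<in> poly_families C" "F y = 1"
    "\<And>x t. x \<in> X \<Longrightarrow> u t x \<in> Z \<Longrightarrow> poly (F x) t = 0"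
proof -
  define H where "H = {F \<in> poly_families C. \<forall>x \<in> X. \<forall>t. u t x \<in> Z \<longrightarrow> poly (F x) t = 0}"
  have sep: "\<exists>F \<in> H. poly (F y) t \<noteq> 0" for t
  proof -
    have "u t y \<in> X" using u y unfolding poly_curve_def by blast
    then obtain f where f: "f \<in> poly_functions C" "f (u t y) \<noteq> 0" "\<And>x. x \<in> Z \<Longrightarrow> f x = 0"
      using algset_separate[OF Z _ no] by metis
    obtain F where F: "F \<in> poly_families C" "\<forall>x \<in> X. \<forall>t. f (u t x) = poly (F x) t"
      using poly_curve_pullback[OF u f(1)] by blast
    then have "F \<in> H" unfolding H_def using f(3) by simp metis
    then show ?thesis using F f(2) y by auto
  qed
  have H_add: "(\<lambda>x. F x + p * G x) \<in> H" if "F \<in> H" "G \<in> H" for F G p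
    using that unfolding H_def
    by (auto intro!: poly_families_add poly_families_mult poly_families_const)
  define N where "N = {F \<in> H. F y \<noteq> 0}"
  have "N \<noteq> {}" using sep[of 0] unfolding N_def by auto
  \<comment> \<open>A member of least degree at \<open>y\<close> generates the ideal of values at
    \<open>y\<close>, by division with remainder.\<close>
  then obtain F where F: "F \<in> N" and min: "\<And>G. G \<in> N \<Longrightarrow> degree (F y) \<le> degree (G y)"
    using ex_has_least_nat[of "\<lambda>F. F \<in> N" _ "\<lambda>F. degree (F y)"] by auto
  have dvd: "F y dvd G y" if "G \<in> H" for G
  proof (rule ccontr)
    assume "\<not> F y dvd G y"
    then have nz: "G y mod F y \<noteq> 0" by (simp add: dvd_eq_mod_eq_0)
    \<comment> \<open>The quotient is computed at \<open>y\<close> only and then used as a constant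
      multiplier at every point, so \<open>?R\<close> is again a family in \<open>H\<close>.\<close>
    let ?R = "\<lambda>x. G x + (- (G y div F y)) * F x"
    have R: "?R y = G y mod F y" by (simp add: minus_div_mult_eq_mod[symmetric])
    have "?R \<in> H" using F that H_add[of G F "- (G y div F y)"] unfolding N_def by blast
    then have "?R \<in> N" using R nz unfolding N_def by simp
    then have "degree (F y) \<le> degree (G y mod F y)" using min R by fastforce
    moreover have "degree (G y mod F y) < degree (F y)"
      using F nz degree_mod_less_degree[of "F y" "G y"] \<open>\<not> F y dvd G y\<close> unfolding N_def by auto
    ultimately show False by simp
  qed
  have "degree (F y) = 0"
  proof (rule ccontr)
    assume "degree (F y) \<noteq> 0"
    then obtain t where t: "poly (F y) t = 0" using alg_closed_imp_poly_has_root by blast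
    obtain G where "G \<in> H" "poly (G y) t \<noteq> 0" using sep by blast
    then show False using dvd[of G] t by (auto elim!: dvdE)
  qed
  then obtain c where c: "F y = [:c:]" using degree_0_id by metis
  have "c \<noteq> 0" using F c unfolding N_def by auto
  show thesis
  proof
    show "(\<lambda>x. [:inverse c:] * F x) \<in> poly_families C"
      using F unfolding N_def H_def by (intro poly_families_mult poly_families_const) auto
    show "[:inverse c:] * F y = 1" using c \<open>c \<noteq> 0\<close> by (simp add: one_pCons)
    show "poly ([:inverse c:] * F x) t = 0" if "x \<in> X" "u t x \<in> Z" for x t
      using F that unfolding N_def H_def by auto
  qed
qed

text \<open>The two curves are the standard charts of a family parametrised by the projective line;
  the resultant of a polynomial for each chart eliminates the parameter, and the two extra
  factors of the separating function take care of the points \<open>0\<close> and \<open>\<infinity>\<close>.\<close>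

lemma algset_projective_line:
  fixes Z :: "'x set" and C :: "('x \<Rightarrow> 'k::alg_closed_field) set"
  assumes Z: "algset C X Z" and u: "poly_curve C X u" and w: "poly_curve C X w"
    and glue: "\<And>x t. x \<in> X \<Longrightarrow> t \<noteq> 0 \<Longrightarrow> u t x \<in> Z \<longleftrightarrow> w (1 / t) x \<in> Z"
  shows "algset C X {x \<in> X. (\<exists>t. u t x \<in> Z) \<or> w 0 x \<in> Z}"
proof (rule algsetI)
  fix y assume y: "y \<in> X" "y \<notin> {x \<in> X. (\<exists>t. u t x \<in> Z) \<or> w 0 x \<in> Z}"
  then have no: "\<And>t. u t y \<notin> Z" "w 0 y \<notin> Z" by auto
  obtain F where F: "F \<in> poly_families C" "F y = 1"
    "\<And>x t. x \<in> X \<Longrightarrow> u t x \<in> Z \<Longrightarrow> poly (F x) t = 0"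
    using bezout_family[OF Z u y(1) no(1)] by blast
  have "w 0 y \<in> X" using w y unfolding poly_curve_def by blast
  then obtain f where f: "f \<in> poly_functions C" "f (w 0 y) \<noteq> 0" "\<And>x. x \<in> Z \<Longrightarrow> f x = 0"
    using algset_separate[OF Z _ no(2)] by metis
  obtain G where G: "G \<in> poly_families C" "\<And>x t. x \<in> X \<Longrightarrow> f (w t x) = poly (G x) t"
    using poly_curve_pullback[OF w f(1)] by blast
  obtain m0 n where m0: "\<And>x. degree (F x) \<le> m0" and n: "\<And>x. degree (G x) \<le> n"
    using F(1) G(1) unfolding poly_families_def by auto
  \<comment> \<open>One more than the degree bound: this guarantees \<open>m + n > 0\<close> in
    \<open>det_syl_eq_0\<close>, even when both families are constant.\<close>
  define m where "m = Suc m0"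
  have m: "degree (F x) \<le> m" for x using m0[of x] by (simp add: m_def)
  define a where "a x k = coeff (F x) k" for x k
  \<comment> \<open>The coefficients of \<open>G x\<close> in reverse order, that is
    \<open>t ^ n\<close> times the value of \<open>G x\<close> at \<open>1 / t\<close>. The top
    coefficient \<open>b y n\<close> is the constant term of \<open>G y\<close>, which is
    \<open>f (w 0 y)\<close> and therefore nonzero, as \<open>det_syl_unit\<close> requires.\<close>
  define b where "b x k = (if k \<le> n then coeff (G x) (n - k) else 0)" for x k
  let ?R = "\<lambda>x. coeff (G x) 0 * a x 0 * det (syl m n (a x) (b x))"
  have Fc: "(\<lambda>x. coeff (F x) k) \<in> poly_functions C" for k
    using F(1) unfolding poly_families_def by auto
  have Gc: "(\<lambda>x. coeff (G x) k) \<in> poly_functions C" for k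
    using G(1) unfolding poly_families_def by auto
  have ab: "(\<lambda>x. a x k) \<in> poly_functions C" "(\<lambda>x. b x k) \<in> poly_functions C" for k
    using Fc Gc by (cases "k \<le> n"; simp add: a_def b_def poly_functions.const)+
  have "(\<lambda>x. syl m n (a x) (b x) $$ (i, j)) \<in> poly_functions C" if "i < m + n" "j < m + n" for i j
    using that ab
    by (cases "i < n"; cases "i \<le> j"; cases "i - n \<le> j"; simp add: syl_def poly_functions.const)
  then have "(\<lambda>x. det (syl m n (a x) (b x))) \<in> poly_functions C"
    by (rule poly_functions_det[OF syl_carrier])
  then have Rpoly: "?R \<in> poly_functions C"
    by (intro poly_functions.mult Gc ab)
  have Ry: "?R y \<noteq> 0"
  proof -
    have G0: "coeff (G y) 0 \<noteq> 0" using f(2) G(2)[OF y(1), of 0] by (simp add: poly_0_coeff_0)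
    moreover have "det (syl m n (a y) (b y)) \<noteq> 0"
      using G0 F(2) by (intro det_syl_unit) (auto simp: a_def b_def)
    ultimately show ?thesis using F(2) by (simp add: a_def)
  qed
  have "?R x = 0" if x: "x \<in> X" "(\<exists>t. u t x \<in> Z) \<or> w 0 x \<in> Z" for x
  proof -
    consider "w 0 x \<in> Z" | "u 0 x \<in> Z" | t where "u t x \<in> Z" "t \<noteq> 0" using x(2) by metis
    then show ?thesis
    proof cases
      case 1
      then have "coeff (G x) 0 = 0" using f(3) G(2)[OF x(1), of 0] by (simp add: poly_0_coeff_0)
      then show ?thesis by simp
    next
      case 2
      then have "a x 0 = 0" using F(3)[OF x(1), of 0] by (simp add: poly_0_coeff_0 a_def)
      then show ?thesis by simp
    next
      case 3
      have "(\<Sum>k\<le>m. a x k * t ^ k) = 0"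
        using F(3)[OF x(1) 3(1)] poly_altdef_le[OF m] by (simp add: a_def)
      moreover have "(\<Sum>k\<le>n. b x k * t ^ k) = 0"
      proof -
        have "w (1 / t) x \<in> Z" using glue[OF x(1) 3(2)] 3(1) by simp
        then have "poly (G x) (1 / t) = 0" using f(3) G(2)[OF x(1)] by metis
        then have "0 = t ^ n * (\<Sum>k\<le>n. coeff (G x) k * (1 / t) ^ k)"
          using poly_altdef_le[OF n] by simp
        also have "\<dots> = (\<Sum>k\<le>n. coeff (G x) k * t ^ (n - k))"
          using 3(2) by (auto simp: sum_distrib_left power_diff power_one_over field_simps intro!: sum.cong)
        also have "\<dots> = (\<Sum>k\<le>n. b x k * t ^ k)"
          by (rule sum.reindex_bij_witness[of _ "\<lambda>k. n - k" "\<lambda>k. n - k"]) (auto simp: b_def)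
        finally show ?thesis by simp
      qed
      moreover have "a x k = 0" if "k > m" for k
        using that m[of x] by (simp add: a_def coeff_eq_0)
      moreover have "b x k = 0" if "k > n" for k using that by (simp add: b_def)
      moreover have "m + n > 0" by (simp add: m_def)
      ultimately have "det (syl m n (a x) (b x)) = 0" by (intro det_syl_eq_0[of m "a x" n "b x" t])
      then show ?thesis by simp
    qed
  qed
  then show "\<exists>f\<in>poly_functions C. f y \<noteq> 0 \<and> (\<forall>x\<in>{x \<in> X. (\<exists>t. u t x \<in> Z) \<or> w 0 x \<in> Z}. f x = 0)"
    using Rpoly Ry by (intro bexI[of _ ?R]) auto
qed auto

section \<open>Base change\<close>

text \<open>The copy of the 2 by 2 matrices inside the \<open>n\<close> by \<open>n\<close> matrices
  that belongs to the \<open>k\<close>-th simple root; its invertible members, together with the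
  upper triangular matrices, generate an elementary parabolic subgroup.\<close>

definition blk :: "nat \<Rightarrow> nat \<Rightarrow> 'k \<Rightarrow> 'k \<Rightarrow> 'k \<Rightarrow> 'k \<Rightarrow> 'k::comm_ring_1 mat" where
  "blk n k p q r s = mat n n (\<lambda>(a, b).
     if a = k \<and> b = k then p else if a = k \<and> b = Suc k then q
     else if a = Suc k \<and> b = k then r else if a = Suc k \<and> b = Suc k then s
     else if a = b then 1 else 0)"

lemma blk_carrier [simp]: "blk n k p q r s \<in> carrier_mat n n"
  by (simp add: blk_def)

lemma mat_mult_index_sum:
  assumes "A \<in> carrier_mat m n" "B \<in> carrier_mat n l" "a < m" "b < l"
  shows "(A * B) $$ (a, b) = (\<Sum>c<n. A $$ (a, c) * B $$ (c, b))"
proof -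
  have "(A * B) $$ (a, b) = (\<Sum>c\<in>{0..<n}. row A a $ c * col B b $ c)"
    using assms by (simp add: scalar_prod_def)
  also have "\<dots> = (\<Sum>c<n. A $$ (a, c) * B $$ (c, b))"
    using assms by (intro sum.cong) auto
  finally show ?thesis .
qed

lemma mult_blk_index:
  assumes A: "A \<in> carrier_mat m n" and k: "Suc k < n" and ab: "a < m" "b < n"
  shows "(A * blk n k p q r s) $$ (a, b) =
    (if b = k then A $$ (a, k) * p + A $$ (a, Suc k) * r
     else if b = Suc k then A $$ (a, k) * q + A $$ (a, Suc k) * s else A $$ (a, b))"
proof -
  have "(A * blk n k p q r s) $$ (a, b) = (\<Sum>c<n. A $$ (a, c) * blk n k p q r s $$ (c, b))"
    by (rule mat_mult_index_sum[OF A _ ab]) simp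
  also have "\<dots> = (\<Sum>c<n. (if c = k then (if b = k then A $$ (a, c) * p
        else if b = Suc k then A $$ (a, c) * q else 0) else 0) +
      (if c = Suc k then (if b = k then A $$ (a, c) * r
        else if b = Suc k then A $$ (a, c) * s else 0) else 0) +
      (if c = b then (if b = k \<or> b = Suc k then 0 else A $$ (a, c)) else 0))"
    using ab k by (intro sum.cong) (auto simp: blk_def)
  also have "\<dots> = (if b = k then A $$ (a, k) * p + A $$ (a, Suc k) * r
     else if b = Suc k then A $$ (a, k) * q + A $$ (a, Suc k) * s else A $$ (a, b))"
    unfolding sum.distrib using ab k by simp
  finally show ?thesis .
qed

lemma blk_mult:
  assumes "Suc k < n"
  shows "blk n k p q r s * blk n k p' q' r' s'
    = blk n k (p * p' + q * r') (p * q' + q * s') (r * p' + s * r') (r * q' + s * s')"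
proof (rule eq_matI)
  fix a b assume "a < dim_row (blk n k (p * p' + q * r') (p * q' + q * s') (r * p' + s * r') (r * q' + s * s'))"
    "b < dim_col (blk n k (p * p' + q * r') (p * q' + q * s') (r * p' + s * r') (r * q' + s * s'))"
  then have "a < n" "b < n" by (auto simp: blk_def)
  then show "(blk n k p q r s * blk n k p' q' r' s') $$ (a, b) =
      blk n k (p * p' + q * r') (p * q' + q * s') (r * p' + s * r') (r * q' + s * s') $$ (a, b)"
    using assms by (subst mult_blk_index[of _ n]) (auto simp: blk_def)
qed (auto simp: blk_def)

lemma blk_one: "blk n k 1 0 0 1 = 1\<^sub>m n"
proof (rule eq_matI)
  fix a b assume "a < dim_row (1\<^sub>m n :: 'a mat)" "b < dim_col (1\<^sub>m n :: 'a mat)"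
  then have ab: "a < n" "b < n" by simp_all
  show "blk n k 1 0 0 1 $$ (a, b) = (1\<^sub>m n :: 'a mat) $$ (a, b)"
  proof (cases "a = b")
    case True
    then show ?thesis using ab unfolding blk_def by simp
  next
    case False
    then have "\<not> (a = k \<and> b = k)" "\<not> (a = Suc k \<and> b = Suc k)" by blast+
    then show ?thesis using ab False unfolding blk_def by (simp only: index_mat index_one_mat prod.case if_False if_cancel)
  qed
qed (simp_all add: blk_def)

lemma map_mat_blk:
  assumes "f 0 = 0" "f 1 = 1"
  shows "map_mat f (blk n k p q r s) = blk n k (f p) (f q) (f r) (f s)"
proof (rule eq_matI)
  fix a b assume "a < dim_row (blk n k (f p) (f q) (f r) (f s))" "b < dim_col (blk n k (f p) (f q) (f r) (f s))"
  then have "a < n" "b < n" by (simp_all add: blk_def)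
  then show "map_mat f (blk n k p q r s) $$ (a, b) = blk n k (f p) (f q) (f r) (f s) $$ (a, b)"
    using assms by (simp add: blk_def)
qed (simp_all add: blk_def)

abbreviation rep_coords :: "('v, 'a) pre_digraph \<Rightarrow> ('v \<Rightarrow> nat) \<Rightarrow> (('a \<Rightarrow> 'k::field mat) \<Rightarrow> 'k) set" where
  "rep_coords Q d \<equiv>
     {(\<lambda>x. x \<alpha> $$ (r, c)) | \<alpha> r c. \<alpha> \<in> arcs Q \<and> r < d (head Q \<alpha>) \<and> c < d (tail Q \<alpha>)}"

section \<open>The base change group and its action on representations\<close>

locale quiver_dim = fin_digraph Q for Q :: "('v, 'a) pre_digraph" +
  fixes d :: "'v \<Rightarrow> nat"
begin

text \<open>Each group element is stored together with its inverse: inversion is then a swap, and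
  along the families used below both components are visibly polynomial in the parameter. Values
  outside the vertices are left free.\<close>

definition GL :: "(('v \<Rightarrow> 'k::field mat) \<times> ('v \<Rightarrow> 'k mat)) set" where
  "GL = {(g, g'). \<forall>i \<in> verts Q. g i \<in> carrier_mat (d i) (d i) \<and> g' i \<in> carrier_mat (d i) (d i) \<and>
     g i * g' i = 1\<^sub>m (d i) \<and> g' i * g i = 1\<^sub>m (d i)}"

definition act :: "('v \<Rightarrow> 'k::field mat) \<Rightarrow> ('v \<Rightarrow> 'k mat) \<Rightarrow> ('a \<Rightarrow> 'k mat) \<Rightarrow> 'a \<Rightarrow> 'k mat" where
  "act g g' x = (\<lambda>\<alpha> \<in> arcs Q. g (head Q \<alpha>) * x \<alpha> * g' (tail Q \<alpha>))"

lemma GL_D: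
  assumes "(g, g') \<in> GL" "i \<in> verts Q"
  shows "g i \<in> carrier_mat (d i) (d i)" "g' i \<in> carrier_mat (d i) (d i)"
    "g i * g' i = 1\<^sub>m (d i)" "g' i * g i = 1\<^sub>m (d i)"
  using assms unfolding GL_def by auto

lemma GL_sym: "(g, g') \<in> GL \<Longrightarrow> (g', g) \<in> GL"
  unfolding GL_def by auto

lemma GL_one: "(\<lambda>i. 1\<^sub>m (d i), \<lambda>i. 1\<^sub>m (d i)) \<in> GL"
  unfolding GL_def by auto

lemma GL_mult:
  assumes "(g, g') \<in> GL" "(h, h') \<in> GL"
  shows "(\<lambda>i. g i * h i, \<lambda>i. h' i * g' i) \<in> GL"
proof -
  { fix i assume i: "i \<in> verts Q"
    note G = GL_D[OF assms(1) i] note H = GL_D[OF assms(2) i]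
    have "(g i * h i) * (h' i * g' i) = g i * ((h i * h' i) * g' i)"
      using G(1,2) H(1,2) by (simp add: assoc_mult_mat[of _ "d i" "d i" _ "d i" _ "d i"])
    then have 1: "(g i * h i) * (h' i * g' i) = 1\<^sub>m (d i)" using G H by simp
    have "(h' i * g' i) * (g i * h i) = h' i * ((g' i * g i) * h i)"
      using G(1,2) H(1,2) by (simp add: assoc_mult_mat[of _ "d i" "d i" _ "d i" _ "d i"])
    then have "(h' i * g' i) * (g i * h i) = 1\<^sub>m (d i)" using G H by simp
    note 1 this mult_carrier_mat[OF G(1) H(1)] mult_carrier_mat[OF H(2) G(2)] }
  then show ?thesis unfolding GL_def by simp
qed

lemma rep_space_carrier:
  "x \<in> rep_space Q d \<Longrightarrow> \<alpha> \<in> arcs Q \<Longrightarrow> x \<alpha> \<in> carrier_mat (d (head Q \<alpha>)) (d (tail Q \<alpha>))"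
  unfolding rep_space_def by auto

lemma act_closed:
  assumes "x \<in> rep_space Q d"
    and "\<And>i. i \<in> verts Q \<Longrightarrow> g i \<in> carrier_mat (d i) (d i) \<and> g' i \<in> carrier_mat (d i) (d i)"
  shows "act g g' x \<in> rep_space Q d"
proof -
  have "g (head Q \<alpha>) * x \<alpha> * g' (tail Q \<alpha>) \<in> carrier_mat (d (head Q \<alpha>)) (d (tail Q \<alpha>))"
    if "\<alpha> \<in> arcs Q" for \<alpha>
  proof (rule mult_carrier_mat[OF mult_carrier_mat])
    show "x \<alpha> \<in> carrier_mat (d (head Q \<alpha>)) (d (tail Q \<alpha>))"
      using rep_space_carrier[OF assms(1) that] .
    show "g (head Q \<alpha>) \<in> carrier_mat (d (head Q \<alpha>)) (d (head Q \<alpha>))"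
      "g' (tail Q \<alpha>) \<in> carrier_mat (d (tail Q \<alpha>)) (d (tail Q \<alpha>))"
      using assms(2) that by auto
  qed
  then show ?thesis unfolding rep_space_def act_def by (intro PiE_I) auto
qed

lemma GL_act_closed: "(g, g') \<in> GL \<Longrightarrow> x \<in> rep_space Q d \<Longrightarrow> act g g' x \<in> rep_space Q d"
  using act_closed GL_D by metis

lemma act_act:
  assumes x: "x \<in> rep_space Q d" and gh: "(g, g') \<in> GL" "(h, h') \<in> GL"
  shows "act g g' (act h h' x) = act (\<lambda>i. g i * h i) (\<lambda>i. h' i * g' i) x"
proof
  fix \<alpha> show "act g g' (act h h' x) \<alpha> = act (\<lambda>i. g i * h i) (\<lambda>i. h' i * g' i) x \<alpha>"
  proof (cases "\<alpha> \<in> arcs Q")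
    case True
    let ?i = "head Q \<alpha>" and ?j = "tail Q \<alpha>"
    have ij: "?i \<in> verts Q" "?j \<in> verts Q" using True by auto
    note c = GL_D(1,2)[OF gh(1) ij(1)] GL_D(1,2)[OF gh(2) ij(1)]
      GL_D(1,2)[OF gh(1) ij(2)] GL_D(1,2)[OF gh(2) ij(2)] rep_space_carrier[OF x True]
    have "g ?i * (h ?i * x \<alpha> * h' ?j) * g' ?j = (g ?i * h ?i * x \<alpha>) * (h' ?j * g' ?j)"
      using c by (simp add: assoc_mult_mat[of _ "d ?i" "d ?i" _ "d ?i" _ "d ?j"]
          assoc_mult_mat[of _ "d ?i" "d ?i" _ "d ?j" _ "d ?j"]
          assoc_mult_mat[of _ "d ?i" "d ?j" _ "d ?j" _ "d ?j"])
    then show ?thesis using True by (simp add: act_def)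
  qed (simp add: act_def)
qed

lemma act_one: "x \<in> rep_space Q d \<Longrightarrow> act (\<lambda>i. 1\<^sub>m (d i)) (\<lambda>i. 1\<^sub>m (d i)) x = x"
proof
  fix \<alpha> assume x: "x \<in> rep_space Q d"
  show "act (\<lambda>i. 1\<^sub>m (d i)) (\<lambda>i. 1\<^sub>m (d i)) x \<alpha> = x \<alpha>"
    using x rep_space_carrier[OF x, of \<alpha>] unfolding rep_space_def act_def
    by (cases "\<alpha> \<in> arcs Q") (auto simp: PiE_def extensional_def)
qed

lemma act_cong:
  assumes "\<And>i. i \<in> verts Q \<Longrightarrow> g i = h i" "\<And>i. i \<in> verts Q \<Longrightarrow> g' i = h' i"
  shows "act g g' x = act h h' x"
proof -
  have "g (head Q \<alpha>) * x \<alpha> * g' (tail Q \<alpha>) = h (head Q \<alpha>) * x \<alpha> * h' (tail Q \<alpha>)"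
    if "\<alpha> \<in> arcs Q" for \<alpha>
    using assms(1)[of "head Q \<alpha>"] assms(2)[of "tail Q \<alpha>"] that by simp
  then show ?thesis unfolding act_def by (rule restrict_ext)
qed

lemma act_inverse:
  assumes "x \<in> rep_space Q d" "(g, g') \<in> GL"
  shows "act g' g (act g g' x) = x"
proof -
  have "act g' g (act g g' x) = act (\<lambda>i. g' i * g i) (\<lambda>i. g' i * g i) x"
    by (rule act_act[OF assms(1) GL_sym[OF assms(2)] assms(2)])
  also have "\<dots> = act (\<lambda>i. 1\<^sub>m (d i)) (\<lambda>i. 1\<^sub>m (d i)) x"
    by (rule act_cong) (rule GL_D(4)[OF assms(2)], assumption)+
  finally show ?thesis using act_one[OF assms(1)] by simp
qed

text \<open>Each entry of \<open>g x g'\<close> is a sum of terms linear in one coordinate of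
  \<open>x\<close>, the coefficient being the product of one entry of each of the two matrix
  polynomials.\<close>

lemma act_poly_curve:
  fixes G G' :: "'v \<Rightarrow> 'k::field poly mat"
  assumes G: "\<And>i. i \<in> verts Q \<Longrightarrow> G i \<in> carrier_mat (d i) (d i)"
    "\<And>i. i \<in> verts Q \<Longrightarrow> G' i \<in> carrier_mat (d i) (d i)"
  shows "poly_curve (rep_coords Q d) (rep_space Q d)
    (\<lambda>t. act (\<lambda>i. map_mat (\<lambda>p. poly p t) (G i)) (\<lambda>i. map_mat (\<lambda>p. poly p t) (G' i)))"
  unfolding poly_curve_def
proof (intro conjI allI ballI)
  fix t :: 'k and x :: "'a \<Rightarrow> 'k mat" assume x: "x \<in> rep_space Q d"
  show "act (\<lambda>i. map_mat (\<lambda>p. poly p t) (G i)) (\<lambda>i. map_mat (\<lambda>p. poly p t) (G' i)) x \<in> rep_space Q d"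
    using G by (intro act_closed[OF x]) auto
next
  fix f :: "('a \<Rightarrow> 'k mat) \<Rightarrow> 'k" assume "f \<in> rep_coords Q d"
  then obtain \<alpha> r c where f: "f = (\<lambda>x. x \<alpha> $$ (r, c))" and \<alpha>: "\<alpha> \<in> arcs Q"
    and rc: "r < d (head Q \<alpha>)" "c < d (tail Q \<alpha>)" by auto
  let ?i = "head Q \<alpha>" and ?j = "tail Q \<alpha>"
  have ij: "?i \<in> verts Q" "?j \<in> verts Q" using \<alpha> by auto
  let ?F = "\<lambda>x. \<Sum>b<d ?j. (\<Sum>a<d ?i. G ?i $$ (r, a) * [:x \<alpha> $$ (a, b):]) * G' ?j $$ (b, c)"
  have "?F \<in> poly_families (rep_coords Q d)"
    using \<alpha> by (intro poly_families_sum poly_families_mult poly_families_const poly_families_lift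
        poly_functions.coord) auto
  moreover have "f (act (\<lambda>i. map_mat (\<lambda>p. poly p t) (G i)) (\<lambda>i. map_mat (\<lambda>p. poly p t) (G' i)) x)
      = poly (?F x) t" if x: "x \<in> rep_space Q d" for x t
  proof -
    note c = G(1)[OF ij(1)] G(2)[OF ij(2)] rep_space_carrier[OF x \<alpha>]
    let ?A = "map_mat (\<lambda>p. poly p t) (G ?i)" and ?B = "map_mat (\<lambda>p. poly p t) (G' ?j)"
    have "(?A * x \<alpha> * ?B) $$ (r, c) = (\<Sum>b<d ?j. (?A * x \<alpha>) $$ (r, b) * ?B $$ (b, c))"
      using c rc by (intro mat_mult_index_sum) auto
    also have "\<dots> = (\<Sum>b<d ?j. (\<Sum>a<d ?i. ?A $$ (r, a) * x \<alpha> $$ (a, b)) * ?B $$ (b, c))"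
      using c rc by (intro sum.cong refl arg_cong2[where f = "(*)"] mat_mult_index_sum) auto
    also have "\<dots> = poly (?F x) t"
      using c rc by (simp add: poly_sum mult_ac)
    finally show ?thesis using \<alpha> by (simp add: f act_def)
  qed
  ultimately show "\<exists>F\<in>poly_families (rep_coords Q d). \<forall>x\<in>rep_space Q d. \<forall>t.
      f (act (\<lambda>i. map_mat (\<lambda>p. poly p t) (G i)) (\<lambda>i. map_mat (\<lambda>p. poly p t) (G' i)) x) = poly (F x) t"
    by (intro bexI[of _ ?F] ballI allI)
qed

definition elem :: "'v \<Rightarrow> 'k::comm_ring_1 mat \<Rightarrow> 'v \<Rightarrow> 'k mat" where
  "elem i B = (\<lambda>j. if j = i then B else 1\<^sub>m (d j))"

lemma elem_GL:
  assumes "B \<in> carrier_mat (d i) (d i)" "B' \<in> carrier_mat (d i) (d i)"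
    "B * B' = 1\<^sub>m (d i)" "B' * B = 1\<^sub>m (d i)"
  shows "(elem i B, elem i B') \<in> GL"
  using assms unfolding GL_def elem_def by auto

lemma elem_mult:
  assumes "B \<in> carrier_mat (d i) (d i)" "B' \<in> carrier_mat (d i) (d i)"
  shows "(\<lambda>j. elem i B j * elem i B' j) = elem i (B * B')"
  using assms unfolding elem_def by auto

lemma blk_poly_curve:
  fixes p q r s p' q' r' s' :: "'k::field poly"
  shows "poly_curve (rep_coords Q d) (rep_space Q d)
    (\<lambda>t. act (elem i (blk (d i) k (poly p t) (poly q t) (poly r t) (poly s t)))
             (elem i (blk (d i) k (poly p' t) (poly q' t) (poly r' t) (poly s' t))))"
proof -
  have "(\<lambda>j. map_mat (\<lambda>p. poly p t) (elem i (blk (d i) k p q r s) j))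
      = elem i (blk (d i) k (poly p t) (poly q t) (poly r t) (poly s t))" for p q r s :: "'k poly" and t
    by (rule ext) (auto simp: elem_def map_mat_blk intro!: eq_matI)
  then show ?thesis
    using act_poly_curve[of "elem i (blk (d i) k p q r s)" "elem i (blk (d i) k p' q' r' s')"]
    by (simp add: elem_def)
qed

section \<open>Saturations under matrices with prescribed zeros\<close>

definition vanish :: "('v \<times> nat \<times> nat) set \<Rightarrow> ('v \<Rightarrow> 'k::field mat) \<Rightarrow> bool" where
  "vanish D g \<longleftrightarrow> (\<forall>(i, a, b) \<in> D. g i $$ (a, b) = 0)"

text \<open>With \<open>D\<close> empty this is the saturation of \<open>Z\<close> under the whole
  group, with \<open>D = lower\<close> the saturation under the upper triangular subgroup. The sets
  \<open>D\<close> in between are the stages of the passage from one to the other.\<close>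

definition sat :: "('v \<times> nat \<times> nat) set \<Rightarrow> ('a \<Rightarrow> 'k::field mat) set \<Rightarrow> ('a \<Rightarrow> 'k mat) set" where
  "sat D Z = {x \<in> rep_space Q d. \<exists>(g, g') \<in> GL. vanish D g \<and> act g g' x \<in> Z}"

lemma vanishD: "vanish D g \<Longrightarrow> (i, a, b) \<in> D \<Longrightarrow> g i $$ (a, b) = 0"
  unfolding vanish_def by blast

text \<open>If \<open>g\<close> moves \<open>x\<close> into \<open>Z\<close>, then \<open>g\<close>
  times the inverse of \<open>h\<close> moves \<open>h x\<close> into \<open>Z\<close>; only the
  prescribed zeros of that product remain to be checked.\<close>

lemma sat_shift:
  assumes "(g, g') \<in> GL" "act g g' x \<in> Z" "(h, h') \<in> GL" "x \<in> rep_space Q d"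
    "vanish D (\<lambda>i. g i * h' i)"
  shows "act h h' x \<in> sat D Z"
proof -
  have "act (\<lambda>i. g i * h' i) (\<lambda>i. h i * g' i) (act h h' x) = act g g' (act h' h (act h h' x))"
    by (rule act_act[symmetric]) (use assms GL_sym GL_act_closed in blast)+
  then have "act (\<lambda>i. g i * h' i) (\<lambda>i. h i * g' i) (act h h' x) \<in> Z"
    using act_inverse[OF assms(4,3)] assms(2) by simp
  then show ?thesis unfolding sat_def
    using assms(5) GL_mult[OF assms(1) GL_sym[OF assms(3)]] GL_act_closed[OF assms(3,4)] by blast
qed

text \<open>The companion of \<open>sat_shift\<close>: if \<open>g\<close> moves \<open>h x\<close>
  into \<open>Z\<close>, then the product of \<open>g\<close> and \<open>h\<close> moves
  \<open>x\<close> into \<open>Z\<close>.\<close>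

lemma sat_transfer:
  assumes "act h h' x \<in> sat D Z" "(h, h') \<in> GL" "x \<in> rep_space Q d"
    "\<And>g g'. (g, g') \<in> GL \<Longrightarrow> vanish D g \<Longrightarrow> vanish D' (\<lambda>i. g i * h i)"
  shows "x \<in> sat D' Z"
proof -
  obtain g g' where g: "(g, g') \<in> GL" "vanish D g" "act g g' (act h h' x) \<in> Z"
    using assms(1) unfolding sat_def by auto
  then show ?thesis unfolding sat_def
    using act_act[OF assms(3) g(1) assms(2)] GL_mult[OF g(1) assms(2)] assms(3,4) by force
qed

definition lower :: "('v \<times> nat \<times> nat) set" where
  "lower = {(i, a, b). i \<in> verts Q \<and> b < a \<and> a < d i}"

text \<open>One step of Gaussian elimination by column operations on \<open>g\<close>: the entry at \<open>(m, k)\<close> is killed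
  by a matrix acting on columns \<open>k\<close> and \<open>k + 1\<close>, which is determined up to upper triangular
  matrices by a point of the projective line.\<close>

lemma sat_step:
  fixes Z :: "('a \<Rightarrow> 'k::alg_closed_field mat) set"
  assumes D: "D \<subseteq> lower" "\<And>j a b b'. (j, a, b) \<in> D \<Longrightarrow> b' < b \<Longrightarrow> (j, a, b') \<in> D"
    and mk: "i \<in> verts Q" "k < m" "m < d i" "\<And>b. b < k \<Longrightarrow> (i, m, b) \<in> D"
    and Dk: "\<And>a. (i, a, k) \<in> D \<Longrightarrow> (i, a, Suc k) \<in> D"
    and closed: "algset (rep_coords Q d) (rep_space Q d) (sat (insert (i, m, k) D) Z)"
  shows "algset (rep_coords Q d) (rep_space Q d) (sat D Z)"
proof -
  let ?D' = "insert (i, m, k) D"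
  let ?B = "blk (d i) k :: 'k \<Rightarrow> _"
  \<comment> \<open>The lower unipotent chart; \<open>?w\<close> is the chart around the point at
    infinity. The block of \<open>?w (1 / t)\<close> is the block of \<open>?u t\<close> multiplied
    from the left by the upper triangular block with rows \<open>(- t, 1)\<close> and
    \<open>(0, 1 / t)\<close>, and this is the gluing on the overlap.\<close>
  let ?u = "\<lambda>t. act (elem i (?B 1 0 t 1)) (elem i (?B 1 0 (- t) 1))"
  let ?w = "\<lambda>t. act (elem i (?B 0 1 1 t)) (elem i (?B (- t) 1 1 0))"
  have k: "Suc k < d i" using mk by simp
  have uGL: "(elem i (?B 1 0 t 1), elem i (?B 1 0 (- t) 1)) \<in> GL" for t
    by (rule elem_GL) (simp_all add: blk_mult[OF k] blk_one)
  have wGL: "(elem i (?B 0 1 1 t), elem i (?B (- t) 1 1 0)) \<in> GL" for t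
    by (rule elem_GL) (simp_all add: blk_mult[OF k] blk_one)
  have ucurve: "poly_curve (rep_coords Q d) (rep_space Q d) ?u"
    using blk_poly_curve[of i k 1 0 "[:0,1:]" 1 1 0 "[:0,-1:]" 1] by simp
  have wcurve: "poly_curve (rep_coords Q d) (rep_space Q d) ?w"
    using blk_poly_curve[of i k 0 1 1 "[:0,1:]" "[:0,-1:]" 1 1 0] by simp
  have prod_i: "(g i * elem i (?B p q r s) i) $$ (a, b) =
      (if b = k then g i $$ (a, k) * p + g i $$ (a, Suc k) * r
       else if b = Suc k then g i $$ (a, k) * q + g i $$ (a, Suc k) * s else g i $$ (a, b))"
    if "(g, g') \<in> GL" "a < d i" "b < d i" for g g' :: "'v \<Rightarrow> 'k mat" and a b p q r s
    unfolding elem_def using mult_blk_index[OF GL_D(1)[OF that(1) mk(1)] k that(2,3)] by simp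
  have prod_j: "g j * elem i (?B p q r s) j = g j"
    if "(g, g') \<in> GL" "j \<in> verts Q" "j \<noteq> i" for g g' :: "'v \<Rightarrow> 'k mat" and j p q r s
    unfolding elem_def using GL_D(1)[OF that(1,2)] that(3) by simp
  \<comment> \<open>Right multiplication by a block at \<open>i\<close> touches only the columns
    \<open>k\<close> and \<open>Suc k\<close> of \<open>g i\<close>, so only the entries of
    \<open>E\<close> in these two columns need an argument.\<close>
  have vanishI: "vanish E (\<lambda>j. g j * elem i (?B p q r s) j)"
    if g: "(g, g') \<in> GL" and E: "E \<subseteq> lower" and v: "\<And>j a b. j \<noteq> i \<Longrightarrow> (j, a, b) \<in> E \<Longrightarrow> g j $$ (a, b) = 0"
      and vi: "\<And>a b. (i, a, b) \<in> E \<Longrightarrow> b \<noteq> k \<Longrightarrow> b \<noteq> Suc k \<Longrightarrow> g i $$ (a, b) = 0"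
      and k1: "\<And>a. (i, a, k) \<in> E \<Longrightarrow> g i $$ (a, k) * p + g i $$ (a, Suc k) * r = 0"
      and k2: "\<And>a. (i, a, Suc k) \<in> E \<Longrightarrow> g i $$ (a, k) * q + g i $$ (a, Suc k) * s = 0"
    for g g' :: "'v \<Rightarrow> 'k mat" and E p q r s
    unfolding vanish_def
  proof (clarify)
    fix j a b assume e: "(j, a, b) \<in> E"
    then have l: "j \<in> verts Q" "b < a" "a < d j" using E unfolding lower_def by auto
    show "(g j * elem i (?B p q r s) j) $$ (a, b) = 0"
    proof (cases "j = i")
      case True
      then show ?thesis using prod_i[OF g, of a b] l e vi k1 k2 by auto
    next
      case False
      then show ?thesis using prod_j[OF g l(1)] v e by simp
    qed
  qed
  have D': "?D' \<subseteq> lower" using D(1) mk unfolding lower_def by auto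
  have D'l: "(j, a, b) \<in> ?D' \<Longrightarrow> b' < b \<Longrightarrow> (j, a, b') \<in> ?D'" for j a b b'
    using D(2) mk(4) by auto
  \<comment> \<open>An upper triangular block scales column \<open>k\<close> and adds a multiple of
    it to a multiple of column \<open>Suc k\<close>; the zeros survive because \<open>?D'\<close>
    contains with an entry all entries to its left in the same row.\<close>
  have up: "vanish ?D' (\<lambda>j. g j * elem i (?B p q 0 s) j)" if "(g, g') \<in> GL" "vanish ?D' g" for g g' :: "'v \<Rightarrow> 'k mat" and p q s
    using vanishD[OF that(2)] D'l[of i _ "Suc k" k]
    by (intro vanishI[OF that(1) D']) simp_all
  have glue1: "?w (1 / t) x \<in> sat ?D' Z" if x: "x \<in> rep_space Q d" and t: "t \<noteq> 0" and h: "?u t x \<in> sat ?D' Z" for x t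
  proof -
    have bGL: "(elem i (?B (- t) 1 0 (1 / t)), elem i (?B (- 1 / t) 1 0 t)) \<in> GL"
      using t by (intro elem_GL) (simp_all add: blk_mult[OF k] blk_one)
    have "?u t x = act (elem i (?B (- 1 / t) 1 0 t)) (elem i (?B (- t) 1 0 (1 / t))) (?w (1 / t) x)"
      using t by (subst act_act[OF x GL_sym[OF bGL] wGL]) (simp add: elem_mult blk_mult[OF k])
    with h have "act (elem i (?B (- 1 / t) 1 0 t)) (elem i (?B (- t) 1 0 (1 / t))) (?w (1 / t) x) \<in> sat ?D' Z"
      by (simp only:)
    then show ?thesis by (rule sat_transfer[OF _ GL_sym[OF bGL] GL_act_closed[OF wGL x] up])
  qed
  have glue2: "?u t x \<in> sat ?D' Z" if x: "x \<in> rep_space Q d" and t: "t \<noteq> 0" and h: "?w (1 / t) x \<in> sat ?D' Z" for x t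
  proof -
    have bGL: "(elem i (?B (- t) 1 0 (1 / t)), elem i (?B (- 1 / t) 1 0 t)) \<in> GL"
      using t by (intro elem_GL) (simp_all add: blk_mult[OF k] blk_one)
    have "?w (1 / t) x = act (elem i (?B (- t) 1 0 (1 / t))) (elem i (?B (- 1 / t) 1 0 t)) (?u t x)"
      using t by (subst act_act[OF x bGL uGL]) (simp add: elem_mult blk_mult[OF k])
    with h have "act (elem i (?B (- t) 1 0 (1 / t))) (elem i (?B (- 1 / t) 1 0 t)) (?u t x) \<in> sat ?D' Z"
      by (simp only:)
    then show ?thesis by (rule sat_transfer[OF _ bGL GL_act_closed[OF uGL x] up])
  qed
  have "algset (rep_coords Q d) (rep_space Q d)
      {x \<in> rep_space Q d. (\<exists>t. ?u t x \<in> sat ?D' Z) \<or> ?w 0 x \<in> sat ?D' Z}"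
    by (rule algset_projective_line[OF closed ucurve wcurve]) (use glue1 glue2 in blast)
  moreover have "{x \<in> rep_space Q d. (\<exists>t. ?u t x \<in> sat ?D' Z) \<or> ?w 0 x \<in> sat ?D' Z} = sat D Z" (is "?L = _")
  proof (intro equalityI subsetI)
    fix x assume "x \<in> ?L"
    then have x: "x \<in> rep_space Q d" and "(\<exists>t. ?u t x \<in> sat ?D' Z) \<or> ?w 0 x \<in> sat ?D' Z" by auto
    then consider t where "?u t x \<in> sat ?D' Z" | "?w 0 x \<in> sat ?D' Z" by blast
    then show "x \<in> sat D Z"
    proof cases
      case 1
      show ?thesis
      proof (rule sat_transfer[OF 1 uGL x])
        fix g g' :: "'v \<Rightarrow> 'k mat" assume g: "(g, g') \<in> GL" "vanish ?D' g"
        \<comment> \<open>Here column \<open>k\<close> receives \<open>t\<close> times column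
          \<open>Suc k\<close>, so a zero in column \<open>k\<close> needs one beside it in column
          \<open>Suc k\<close>; this is the hypothesis \<open>Dk\<close>.\<close>
        show "vanish D (\<lambda>j. g j * elem i (?B 1 0 t 1) j)"
          using vanishD[OF g(2)] Dk by (intro vanishI[OF g(1) D(1)]) simp_all
      qed
    next
      case 2
      show ?thesis
      proof (rule sat_transfer[OF 2 wGL x])
        fix g g' :: "'v \<Rightarrow> 'k mat" assume g: "(g, g') \<in> GL" "vanish ?D' g"
        show "vanish D (\<lambda>j. g j * elem i (?B 0 1 1 0) j)"
          using vanishD[OF g(2)] Dk D(2)[of i _ "Suc k" k] by (intro vanishI[OF g(1) D(1)]) simp_all
      qed
    qed
  next
    fix x assume "x \<in> sat D Z"
    then obtain g g' where x: "x \<in> rep_space Q d" and g: "(g, g') \<in> GL" "vanish D g" "act g g' x \<in> Z"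
      unfolding sat_def by auto
    show "x \<in> ?L"
    \<comment> \<open>The entry at \<open>(m, k)\<close> of the product has to vanish. If the entry
      of \<open>g\<close> to its right is zero, swapping the two columns achieves this, which is the
      point at infinity; otherwise subtracting a multiple of column \<open>Suc k\<close>
      does.\<close>
    proof (cases "g i $$ (m, Suc k) = 0")
      case True
      \<comment> \<open>The entry \<open>- 0\<close> is kept so that the block matches the inverse
        that occurs in \<open>?w\<close> at parameter 0.\<close>
      have "vanish ?D' (\<lambda>j. g j * elem i (?B (- 0) 1 1 0) j)"
        using vanishD[OF g(2)] Dk D(2)[of i _ "Suc k" k] True
        by (intro vanishI[OF g(1) D']) auto
      then have "?w 0 x \<in> sat ?D' Z" by (rule sat_shift[OF g(1,3) wGL x])
      then show ?thesis using x by blast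
    next
      case False
      define t where "t = g i $$ (m, k) / g i $$ (m, Suc k)"
      have "vanish ?D' (\<lambda>j. g j * elem i (?B 1 0 (- t) 1) j)"
        using vanishD[OF g(2)] Dk False
        by (intro vanishI[OF g(1) D']) (auto simp: t_def)
      then have "?u t x \<in> sat ?D' Z" by (rule sat_shift[OF g(1,3) uGL x])
      then show ?thesis using x by blast
    qed
  qed
  ultimately show ?thesis by simp
qed

text \<open>Within a row the conditions are dropped from right to left, and
  \<open>sat_vertex\<close> drops the rows from the top down. This order keeps both shapes required
  by \<open>sat_step\<close>: prescribed zeros fill a row from the left, and a row below
  \<open>m\<close> is prescribed up to its diagonal, hence at column \<open>Suc k\<close> whenever
  at column \<open>k\<close>, since \<open>k < m\<close>.\<close>

lemma sat_row:
  fixes Z :: "('a \<Rightarrow> 'k::alg_closed_field mat) set"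
  assumes S: "i \<in> verts Q" "i \<notin> S" "S \<subseteq> verts Q" and m: "m < d i" and k: "k \<le> m"
    and closed: "algset (rep_coords Q d) (rep_space Q d)
      (sat ({p \<in> lower. fst p \<in> S} \<union> {p \<in> lower. fst p = i \<and> m \<le> fst (snd p)}) Z)"
  shows "algset (rep_coords Q d) (rep_space Q d)
    (sat ({p \<in> lower. fst p \<in> S} \<union> {p \<in> lower. fst p = i \<and> (m < fst (snd p) \<or> fst (snd p) = m \<and> snd (snd p) < k)}) Z)"
  using k
proof (induction "m - k" arbitrary: k)
  case 0
  then have "{p \<in> lower. fst p = i \<and> (m < fst (snd p) \<or> fst (snd p) = m \<and> snd (snd p) < k)} = {p \<in> lower. fst p = i \<and> m \<le> fst (snd p)}"
    unfolding lower_def by auto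
  then show ?case using closed by simp
next
  case (Suc n)
  let ?D = "\<lambda>k. {p \<in> lower. fst p \<in> S} \<union> {p \<in> lower. fst p = i \<and> (m < fst (snd p) \<or> fst (snd p) = m \<and> snd (snd p) < k)}"
  have k: "k < m" using Suc by linarith
  have "algset (rep_coords Q d) (rep_space Q d) (sat (?D (Suc k)) Z)"
    using Suc k by (intro Suc.hyps(1)) auto
  moreover have "?D (Suc k) = insert (i, m, k) (?D k)"
    using k S m unfolding lower_def by auto
  ultimately have closed': "algset (rep_coords Q d) (rep_space Q d) (sat (insert (i, m, k) (?D k)) Z)"
    by (simp only:)
  have im: "(i, m, b) \<in> lower" if "b < k" for b using that k S m by (simp add: lower_def)
  show ?case
  proof (rule sat_step[OF _ _ S(1) k m _ _ closed'])
    show "?D k \<subseteq> lower" by blast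
    show "(j, a, b') \<in> ?D k" if "(j, a, b) \<in> ?D k" "b' < b" for j a b b'
      using that by (auto simp: lower_def)
    show "(i, m, b) \<in> ?D k" if "b < k" for b using that im by simp
    show "(i, a, Suc k) \<in> ?D k" if "(i, a, k) \<in> ?D k" for a
      using that S k by (auto simp: lower_def)
  qed
qed

lemma sat_vertex:
  fixes Z :: "('a \<Rightarrow> 'k::alg_closed_field mat) set"
  assumes S: "i \<in> verts Q" "i \<notin> S" "S \<subseteq> verts Q" and m: "m \<le> d i"
    and closed: "algset (rep_coords Q d) (rep_space Q d) (sat {p \<in> lower. fst p \<in> insert i S} Z)"
  shows "algset (rep_coords Q d) (rep_space Q d)
    (sat ({p \<in> lower. fst p \<in> S} \<union> {p \<in> lower. fst p = i \<and> m \<le> fst (snd p)}) Z)"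
  using m
proof (induction m)
  case 0
  have "{p \<in> lower. fst p \<in> S} \<union> {p \<in> lower. fst p = i \<and> 0 \<le> fst (snd p)} = {p \<in> lower. fst p \<in> insert i S}"
    by auto
  then show ?case using closed by (simp only:)
next
  case (Suc m)
  have "algset (rep_coords Q d) (rep_space Q d)
    (sat ({p \<in> lower. fst p \<in> S} \<union> {p \<in> lower. fst p = i \<and> (m < fst (snd p) \<or> fst (snd p) = m \<and> snd (snd p) < 0)}) Z)"
    using Suc by (intro sat_row[OF S]) auto
  then show ?case by (simp add: Suc_le_eq)
qed

lemma sat_all:
  fixes Z :: "('a \<Rightarrow> 'k::alg_closed_field mat) set"
  assumes "algset (rep_coords Q d) (rep_space Q d) (sat lower Z)"
  shows "algset (rep_coords Q d) (rep_space Q d) (sat {} Z)"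
proof -
  have *: "S \<subseteq> verts Q \<Longrightarrow> algset (rep_coords Q d) (rep_space Q d) (sat {p \<in> lower. fst p \<in> S} Z) \<Longrightarrow>
      algset (rep_coords Q d) (rep_space Q d) (sat {} Z)" if "finite S" for S
    using that
  proof (induction S rule: finite_induct)
    case empty
    then show ?case by simp
  next
    case (insert i S)
    have "algset (rep_coords Q d) (rep_space Q d)
      (sat ({p \<in> lower. fst p \<in> S} \<union> {p \<in> lower. fst p = i \<and> d i \<le> fst (snd p)}) Z)"
      using insert by (intro sat_vertex) auto
    moreover have "{p \<in> lower. fst p \<in> S} \<union> {p \<in> lower. fst p = i \<and> d i \<le> fst (snd p)} = {p \<in> lower. fst p \<in> S}"
      unfolding lower_def by auto
    ultimately have "algset (rep_coords Q d) (rep_space Q d) (sat {p \<in> lower. fst p \<in> S} Z)"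
      by (simp only:)
    then show ?case using insert by auto
  qed
  have "{p \<in> lower. fst p \<in> verts Q} = lower" unfolding lower_def by auto
  then show ?thesis using *[OF finite_verts subset_refl] assms by (simp only:)
qed

section \<open>Upper triangular matrices and the standard flag\<close>

lemma upper_triangular_inverse:
  fixes g g' :: "'k::field mat"
  assumes c: "g \<in> carrier_mat n n" "g' \<in> carrier_mat n n" and inv: "g' * g = 1\<^sub>m n"
    and upper: "\<And>a b. b < a \<Longrightarrow> a < n \<Longrightarrow> g $$ (a, b) = 0" and ab: "b < a" "a < n"
  shows "g' $$ (a, b) = 0"
proof -
  have ut: "upper_triangular g" using upper c by (auto simp: upper_triangular_def)
  have "det g' * det g = 1" using det_mult[OF c(2,1)] inv by simp
  then have "prod_list (diag_mat g) \<noteq> 0" using det_upper_triangular[OF ut c(1)]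
    by (metis mult_zero_right zero_neq_one)
  then have diag: "g $$ (b, b) \<noteq> 0" if "b < n" for b
    using that c(1) unfolding prod_list_zero_iff by (force simp: diag_mat_def)
  \<comment> \<open>In the entry at \<open>(a, b)\<close> of the identity matrix \<open>g' g\<close>
    only the term with \<open>k = b\<close> survives, by induction on the column and since
    \<open>g\<close> is upper triangular. The diagonal entry of \<open>g\<close> is nonzero because
    the product of all of them is the determinant.\<close>
  show ?thesis using ab
  proof (induction b rule: less_induct)
    case (less b)
    have "0 = (g' * g) $$ (a, b)" using less c by (simp add: inv)
    also have "\<dots> = (\<Sum>k<n. g' $$ (a, k) * g $$ (k, b))"
      using less by (intro mat_mult_index_sum[OF c(2,1)]) auto
    also have "\<dots> = (\<Sum>k<n. if k = b then g' $$ (a, b) * g $$ (b, b) else 0)"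
    proof (intro sum.cong refl)
      fix k assume "k \<in> {..<n}"
      then show "g' $$ (a, k) * g $$ (k, b) = (if k = b then g' $$ (a, b) * g $$ (b, b) else 0)"
        using less upper[of b k] by (cases "k < b"; cases "k = b") auto
    qed
    also have "\<dots> = g' $$ (a, b) * g $$ (b, b)" using less by simp
    finally show ?case using diag[of b] less by auto
  qed
qed

text \<open>Representations for which the standard flag with dimensions \<open>f l i\<close> has the property that all
  arrows map its \<open>l\<close>-th term into the next one.\<close>

definition std :: "(nat \<Rightarrow> 'v \<Rightarrow> nat) \<Rightarrow> ('a \<Rightarrow> 'k::field mat) set" where
  "std f = {x \<in> rep_space Q d. \<forall>\<alpha> \<in> arcs Q. \<forall>l r c. r < d (head Q \<alpha>) \<longrightarrow> c < d (tail Q \<alpha>) \<longrightarrow>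
     c < f l (tail Q \<alpha>) \<longrightarrow> f (Suc l) (head Q \<alpha>) \<le> r \<longrightarrow> x \<alpha> $$ (r, c) = 0}"

lemma std_algset: "algset (rep_coords Q d) (rep_space Q d) (std f :: ('a \<Rightarrow> 'k::field mat) set)"
  unfolding algset_def
proof (intro exI conjI)
  let ?P = "{(\<lambda>x. x \<alpha> $$ (r, c)) | \<alpha> l r c. \<alpha> \<in> arcs Q \<and> r < d (head Q \<alpha>) \<and> c < d (tail Q \<alpha>) \<and>
     c < f l (tail Q \<alpha>) \<and> f (Suc l) (head Q \<alpha>) \<le> r} :: (('a \<Rightarrow> 'k mat) \<Rightarrow> 'k) set"
  show "?P \<subseteq> poly_functions (rep_coords Q d)" by (auto intro!: poly_functions.coord)
  show "std f = {x \<in> rep_space Q d. \<forall>f \<in> ?P. f x = 0}"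
  proof (intro equalityI subsetI)
    fix x :: "'a \<Rightarrow> 'k mat" assume x: "x \<in> {x \<in> rep_space Q d. \<forall>f \<in> ?P. f x = 0}"
    show "x \<in> std f"
      unfolding std_def
    proof (intro CollectI conjI ballI allI impI)
      fix \<alpha> l r c assume "\<alpha> \<in> arcs Q" "r < d (head Q \<alpha>)" "c < d (tail Q \<alpha>)"
        "c < f l (tail Q \<alpha>)" "f (Suc l) (head Q \<alpha>) \<le> r"
      then have "(\<lambda>x. x \<alpha> $$ (r, c)) \<in> ?P" by blast
      moreover have "\<forall>f \<in> ?P. f x = 0" using x by (rule CollectE) (elim conjE)
      ultimately show "x \<alpha> $$ (r, c) = 0" by (rule bspec[rotated])
    qed (use x in blast)
  qed (auto simp: std_def)
qed

text \<open>Upper triangular matrices preserve the span of every initial segment of the unit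
  vectors. In the entry at \<open>(r, c)\<close> of the product only terms with
  \<open>r \<le> a\<close> and \<open>b \<le> c\<close> survive, and for those the condition
  defining \<open>std f\<close> applies to \<open>x \<alpha> $$ (a, b)\<close>.\<close>

lemma std_upper:
  assumes g: "(g, g') \<in> GL" "vanish lower g" and x: "x \<in> std f"
  shows "act g g' x \<in> std f"
proof -
  have xr: "x \<in> rep_space Q d" using x unfolding std_def by auto
  have up: "h i $$ (a, b) = 0" if "h \<in> {g, g'}" "i \<in> verts Q" "b < a" "a < d i" for h i a b
  proof -
    have 1: "g i $$ (a, b) = 0" if "b < a" "a < d i" for a b
      using that \<open>i \<in> verts Q\<close> by (intro vanishD[OF g(2)]) (simp add: lower_def)
    have "g' i $$ (a, b) = 0"
      by (rule upper_triangular_inverse[OF GL_D(1,2,4)[OF g(1) that(2)] 1 that(3,4)])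
    moreover have "g i $$ (a, b) = 0" by (rule 1[OF that(3,4)])
    ultimately show ?thesis using that by auto
  qed
  have "(g (head Q \<alpha>) * x \<alpha> * g' (tail Q \<alpha>)) $$ (r, c) = 0"
    if \<alpha>: "\<alpha> \<in> arcs Q" and rc: "r < d (head Q \<alpha>)" "c < d (tail Q \<alpha>)"
      "c < f l (tail Q \<alpha>)" "f (Suc l) (head Q \<alpha>) \<le> r" for \<alpha> l r c
  proof -
    let ?i = "head Q \<alpha>" and ?j = "tail Q \<alpha>"
    have ij: "?i \<in> verts Q" "?j \<in> verts Q" using \<alpha> by auto
    note cc = GL_D(1)[OF g(1) ij(1)] GL_D(2)[OF g(1) ij(2)] rep_space_carrier[OF xr \<alpha>]
    have "(g ?i * x \<alpha> * g' ?j) $$ (r, c) = (\<Sum>b<d ?j. (g ?i * x \<alpha>) $$ (r, b) * g' ?j $$ (b, c))"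
      using cc rc by (intro mat_mult_index_sum) auto
    also have "\<dots> = (\<Sum>b<d ?j. (\<Sum>a<d ?i. g ?i $$ (r, a) * x \<alpha> $$ (a, b)) * g' ?j $$ (b, c))"
      using cc rc by (intro sum.cong refl arg_cong2[where f = "(*)"] mat_mult_index_sum) auto
    also have "\<dots> = 0"
    proof (intro sum.neutral ballI)
      fix b assume b: "b \<in> {..<d ?j}"
      show "(\<Sum>a<d ?i. g ?i $$ (r, a) * x \<alpha> $$ (a, b)) * g' ?j $$ (b, c) = 0"
      proof (cases "c < b")
        case True
        then show ?thesis using up[of g' ?j c b] ij b by auto
      next
        case False
        have "g ?i $$ (r, a) * x \<alpha> $$ (a, b) = 0" if "a < d ?i" for a
        proof (cases "a < r")
          case True
          then show ?thesis using up[of g ?i a r] ij rc by auto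
        next
          case F: False
          have "b < f l ?j" "f (Suc l) ?i \<le> a" using False F rc by auto
          then have "x \<alpha> $$ (a, b) = 0" using x \<alpha> that b unfolding std_def by blast
          then show ?thesis by simp
        qed
        then have "(\<Sum>a<d ?i. g ?i $$ (r, a) * x \<alpha> $$ (a, b)) = 0"
          by (intro sum.neutral) simp
        then show ?thesis by simp
      qed
    qed
    finally show ?thesis .
  qed
  then show ?thesis using GL_act_closed[OF g(1) xr] unfolding std_def by (simp add: act_def)
qed

text \<open>If an upper triangular \<open>g\<close> moves \<open>x\<close> into
  \<open>std f\<close>, then \<open>x\<close> is recovered by the inverse of \<open>g\<close>, which
  is upper triangular again, and so \<open>x\<close> lies in \<open>std f\<close> itself. Thus
  \<open>sat lower (std f)\<close> is the closed set \<open>std f\<close>, from which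
  \<open>sat_all\<close> reaches the full saturation.\<close>

theorem algset_orbit_std:
  "algset (rep_coords Q d) (rep_space Q d)
    {x \<in> rep_space Q d. \<exists>(g, g') \<in> GL. act g g' x \<in> (std f :: ('a \<Rightarrow> 'k::alg_closed_field mat) set)}"
proof -
  have "sat lower (std f) = (std f :: ('a \<Rightarrow> 'k mat) set)"
  proof (intro equalityI subsetI)
    fix x :: "'a \<Rightarrow> 'k mat" assume "x \<in> sat lower (std f)"
    then obtain g g' where x: "x \<in> rep_space Q d" and g: "(g, g') \<in> GL" "vanish lower g" "act g g' x \<in> std f"
      unfolding sat_def by auto
    have "vanish lower g'"
      unfolding vanish_def
    proof clarify
      fix i a b assume l: "(i, a, b) \<in> lower"
      then have i: "i \<in> verts Q" "b < a" "a < d i" unfolding lower_def by auto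
      show "g' i $$ (a, b) = 0"
        by (rule upper_triangular_inverse[OF GL_D(1,2,4)[OF g(1) i(1)] _ i(2,3)])
          (rule vanishD[OF g(2)], simp add: lower_def i)
    qed
    then have "act g' g (act g g' x) \<in> std f" using std_upper[OF GL_sym[OF g(1)]] g(3) by blast
    then show "x \<in> std f" using act_inverse[OF x g(1)] by simp
  next
    fix x :: "'a \<Rightarrow> 'k mat" assume x: "x \<in> std f"
    then have xr: "x \<in> rep_space Q d" unfolding std_def by auto
    have "vanish lower (\<lambda>i. 1\<^sub>m (d i) :: 'k mat)" unfolding vanish_def lower_def by auto
    then show "x \<in> sat lower (std f)"
      unfolding sat_def using xr GL_one act_one[OF xr] x by force
  qed
  then have "algset (rep_coords Q d) (rep_space Q d) (sat lower (std f :: ('a \<Rightarrow> 'k mat) set))"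
    using std_algset by simp
  then have "algset (rep_coords Q d) (rep_space Q d) (sat {} (std f :: ('a \<Rightarrow> 'k mat) set))"
    by (rule sat_all)
  then show ?thesis unfolding sat_def vanish_def by simp
qed

end

section \<open>Path algebras and their quotients\<close>

text \<open>Negatives come for free as multiples by the negative of the unit.\<close>

lemma (in ring) left_idealI:
  assumes "N \<subseteq> carrier R" "\<zero> \<in> N" "\<And>x y. x \<in> N \<Longrightarrow> y \<in> N \<Longrightarrow> x \<oplus> y \<in> N"
    "\<And>a x. a \<in> carrier R \<Longrightarrow> x \<in> N \<Longrightarrow> a \<otimes> x \<in> N"
  shows "left_ideal N R"
proof -
  have "\<ominus> x \<in> N" if "x \<in> N" for x
    using assms(4)[of "\<ominus> \<one>" x] that assms(1) l_minus[of \<one> x] by auto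
  then have "subgroup N (add_monoid R)"
    using assms by (intro add.subgroupI) (auto simp: a_inv_def)
  then show ?thesis unfolding left_ideal_def using assms(4) by (auto intro: additive_subgroupI)
qed

context fin_digraph
begin

lemma qend_conv: "qend G (u, p) = awlast u p"
  by (simp add: qend_def)

lemma qend_Nil [simp]: "qend G (u, []) = u"
  by (simp add: qend_conv)

lemma qpaths_iff: "(u, p) \<in> qpaths G \<longleftrightarrow> awalk u p (awlast u p)"
  by (auto simp: qpaths_def)

lemma qpaths_Nil [simp]: "(u, []) \<in> qpaths G \<longleftrightarrow> u \<in> verts G"
  by (simp add: qpaths_iff awalk_Nil_iff)

lemma qend_verts: "q \<in> qpaths G \<Longrightarrow> qend G q \<in> verts G"
  by (cases q) (auto simp: qpaths_iff qend_conv dest: awalk_last_in_verts)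

lemma fst_verts: "q \<in> qpaths G \<Longrightarrow> fst q \<in> verts G"
  by (cases q) (auto simp: qpaths_iff awalk_def)

lemma qend_append: "qend G (u, p @ r) = qend G (qend G (u, p), r)"
  by (simp add: qend_conv awlast_append)

lemma qpaths_append: "(u, p @ r) \<in> qpaths G \<longleftrightarrow> (u, p) \<in> qpaths G \<and> (qend G (u, p), r) \<in> qpaths G"
  by (simp add: qpaths_iff qend_conv awlast_append)

lemma qpaths_arrow [simp]: "(u, [\<alpha>]) \<in> qpaths G \<longleftrightarrow> \<alpha> \<in> arcs G \<and> u = tail G \<alpha>"
  by (auto simp: qpaths_iff awalk_def)

lemma qend_arrow [simp]: "qend G (u, [\<alpha>]) = head G \<alpha>"
  by (simp add: qend_conv)

end

locale quiver_ideal = fin_digraph Q for Q :: "('v, 'a) pre_digraph" +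
  fixes I :: "(('v, 'a) qpath \<Rightarrow> 'k::field) set"
  assumes admissible: "admissible_ideal Q I"
begin

abbreviation KQ :: "(('v, 'a) qpath \<Rightarrow> 'k) ring" where "KQ \<equiv> path_algebra Q"
abbreviation Lam :: "(('v, 'a) qpath \<Rightarrow> 'k) set ring" where "Lam \<equiv> quiver_algebra Q I"

sublocale KQ: ideal I KQ
  using admissible unfolding admissible_ideal_def by blast

sublocale Lam: ring Lam
  by (rule KQ.quotient_is_ring)

definition cls :: "(('v, 'a) qpath \<Rightarrow> 'k) \<Rightarrow> (('v, 'a) qpath \<Rightarrow> 'k) set" where
  "cls f = I +>\<^bsub>KQ\<^esub> f"

lemma carrier_Lam: "carrier Lam = cls ` carrier KQ"
  unfolding FactRing_def A_RCOSETS_def' cls_def by auto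

lemma cls_closed [simp]: "f \<in> carrier KQ \<Longrightarrow> cls f \<in> carrier Lam"
  by (simp add: carrier_Lam)

lemma cls_mult: "f \<in> carrier KQ \<Longrightarrow> g \<in> carrier KQ \<Longrightarrow> cls f \<otimes>\<^bsub>Lam\<^esub> cls g = cls (f \<otimes>\<^bsub>KQ\<^esub> g)"
  unfolding cls_def FactRing_def by (simp add: KQ.rcoset_mult_add)

lemma cls_add: "f \<in> carrier KQ \<Longrightarrow> g \<in> carrier KQ \<Longrightarrow> cls f \<oplus>\<^bsub>Lam\<^esub> cls g = cls (f \<oplus>\<^bsub>KQ\<^esub> g)"
  unfolding cls_def FactRing_def by (simp add: KQ.a_rcos_sum)

lemma cls_one: "cls \<one>\<^bsub>KQ\<^esub> = \<one>\<^bsub>Lam\<^esub>"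
  unfolding cls_def FactRing_def by simp

lemma zero_Lam: "\<zero>\<^bsub>Lam\<^esub> = I"
  unfolding FactRing_def by simp

lemma cls_ideal: "f \<in> I \<Longrightarrow> cls f = \<zero>\<^bsub>Lam\<^esub>"
  unfolding cls_def zero_Lam by (simp add: KQ.a_rcos_const)

lemma carrier_KQ: "f \<in> carrier KQ \<longleftrightarrow> finite {q. f q \<noteq> 0} \<and> {q. f q \<noteq> 0} \<subseteq> qpaths Q"
  by (simp add: path_algebra_def)

lemma add_KQ: "f \<oplus>\<^bsub>KQ\<^esub> g = (\<lambda>q. f q + g q)"
  by (simp add: path_algebra_def)

lemma zero_KQ: "\<zero>\<^bsub>KQ\<^esub> = (\<lambda>_. 0)"
  by (simp add: path_algebra_def)

lemma one_KQ: "\<one>\<^bsub>KQ\<^esub> = (\<lambda>(u, p). if u \<in> verts Q \<and> p = [] then 1 else 0)"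
  by (simp add: path_algebra_def)

lemma mult_KQ: "(f \<otimes>\<^bsub>KQ\<^esub> g) (u, r) = (\<Sum>k\<le>length r. f (qend Q (u, take k r), drop k r) * g (u, take k r))"
  by (simp add: path_algebra_def)

lemma mult_KQ_Nil: "(f \<otimes>\<^bsub>KQ\<^esub> g) (u, []) = f (u, []) * g (u, [])"
  by (simp add: mult_KQ)

lemma smult_KQ_closed: "f \<in> carrier KQ \<Longrightarrow> (\<lambda>q. c * f q) \<in> carrier KQ"
  unfolding carrier_KQ by (auto intro: finite_subset)

lemma path_elem_closed [simp]: "q \<in> qpaths Q \<Longrightarrow> path_elem q \<in> carrier KQ"
  unfolding carrier_KQ path_elem_def by auto

lemma a_inv_KQ: "f \<in> carrier KQ \<Longrightarrow> \<ominus>\<^bsub>KQ\<^esub> f = (\<lambda>q. - f q)"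
  by (rule KQ.minus_equality)
    (use smult_KQ_closed[of f "-1"] in \<open>auto simp: add_KQ zero_KQ\<close>)

definition scal :: "'k \<Rightarrow> ('v, 'a) qpath \<Rightarrow> 'k" where
  "scal c = (\<lambda>q. c * \<one>\<^bsub>KQ\<^esub> q)"

lemma scal_closed [simp]: "scal c \<in> carrier KQ"
  unfolding scal_def by (rule smult_KQ_closed) simp

lemma scal_mult:
  assumes "f \<in> carrier KQ"
  shows "scal c \<otimes>\<^bsub>KQ\<^esub> f = (\<lambda>q. c * f q)"
proof
  fix q :: "('v, 'a) qpath"
  obtain u r where q: "q = (u, r)" by fastforce
  have "(scal c \<otimes>\<^bsub>KQ\<^esub> f) (u, r) = (\<Sum>k\<le>length r. if k = length r then c * f (u, r) else 0)"
    unfolding mult_KQ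
  proof (intro sum.cong refl)
    fix k assume k: "k \<in> {..length r}"
    show "scal c (qend Q (u, take k r), drop k r) * f (u, take k r) = (if k = length r then c * f (u, r) else 0)"
    proof (cases "k = length r")
      case True
      show ?thesis
      proof (cases "f (u, r) = 0")
        case False
        then have "(u, r) \<in> qpaths Q" using assms unfolding carrier_KQ by auto
        then show ?thesis using True qend_verts by (simp add: scal_def one_KQ)
      qed (use True in simp)
    next
      case False
      then show ?thesis using k by (simp add: scal_def one_KQ)
    qed
  qed
  then show "(scal c \<otimes>\<^bsub>KQ\<^esub> f) q = c * f q" by (simp add: q)
qed

text \<open>Of all the places at which a path can be cut, only the one after
  \<open>length (snd p)\<close> arrows can contribute to the product.\<close>

lemma path_elem_mult:
  assumes "q \<in> qpaths Q" "p \<in> qpaths Q"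
  shows "path_elem q \<otimes>\<^bsub>KQ\<^esub> path_elem p =
    (if qend Q p = fst q then path_elem (fst p, snd p @ snd q) else \<zero>\<^bsub>KQ\<^esub>)"
proof
  fix x :: "('v, 'a) qpath"
  obtain u r where x: "x = (u, r)" by fastforce
  let ?t = "\<lambda>k. path_elem q (qend Q (u, take k r), drop k r) * path_elem p (u, take k r) :: 'k"
  have "(path_elem q \<otimes>\<^bsub>KQ\<^esub> path_elem p) (u, r) = (\<Sum>k\<le>length r. if k = length (snd p) then ?t k else 0)"
    unfolding mult_KQ by (intro sum.cong refl) (auto simp: path_elem_def)
  also have "\<dots> = (if length (snd p) \<le> length r then ?t (length (snd p)) else 0)" by simp
  also have "\<dots> = (if qend Q p = fst q then path_elem (fst p, snd p @ snd q) else \<zero>\<^bsub>KQ\<^esub>) (u, r)"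
  proof (cases "u = fst p \<and> take (length (snd p)) r = snd p")
    case True
    then obtain s where r: "r = snd p @ s" by (metis append_take_drop_id)
    have "(qend Q p, s) = q \<longleftrightarrow> qend Q p = fst q \<and> snd q = s" by auto
    then show ?thesis using True r by (auto simp: path_elem_def zero_KQ)
  next
    case False
    then show ?thesis by (cases p) (auto simp: path_elem_def zero_KQ)
  qed
  finally show "(path_elem q \<otimes>\<^bsub>KQ\<^esub> path_elem p) x =
      (if qend Q p = fst q then path_elem (fst p, snd p @ snd q) else \<zero>\<^bsub>KQ\<^esub>) x" by (simp add: x)
qed

text \<open>The span of the paths of length at least \<open>k\<close>, in place of the
  \<open>k\<close>-th power of the arrow ideal: membership is a condition on the support, which is
  easier to handle than a generated ideal.\<close>

definition len_ge :: "nat \<Rightarrow> (('v, 'a) qpath \<Rightarrow> 'k) set" where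
  "len_ge k = {f \<in> carrier KQ. \<forall>q. length (snd q) < k \<longrightarrow> f q = 0}"

lemma len_ge_carrier: "f \<in> len_ge k \<Longrightarrow> f \<in> carrier KQ"
  unfolding len_ge_def by blast

lemma len_ge_0: "len_ge 0 = carrier KQ"
  unfolding len_ge_def by simp

lemma len_ge_1: "f \<in> len_ge 1 \<longleftrightarrow> f \<in> carrier KQ \<and> (\<forall>u. f (u, []) = 0)"
  unfolding len_ge_def by auto

lemma len_ge_Suc_0: "f \<in> len_ge (Suc 0) \<longleftrightarrow> f \<in> carrier KQ \<and> (\<forall>u. f (u, []) = 0)"
  using len_ge_1 by simp

lemma len_ge_zero: "\<zero>\<^bsub>KQ\<^esub> \<in> len_ge k"
  unfolding len_ge_def using KQ.zero_closed by (auto simp: zero_KQ)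

lemma len_ge_add:
  assumes "f \<in> len_ge k" "g \<in> len_ge k"
  shows "f \<oplus>\<^bsub>KQ\<^esub> g \<in> len_ge k"
proof -
  have "f \<oplus>\<^bsub>KQ\<^esub> g \<in> carrier KQ" using assms len_ge_carrier by blast
  then show ?thesis using assms unfolding len_ge_def by (simp add: add_KQ)
qed

lemma len_ge_smult: "f \<in> len_ge k \<Longrightarrow> (\<lambda>q. c * f q) \<in> len_ge k"
  unfolding len_ge_def using smult_KQ_closed by auto

text \<open>If a path of length below \<open>j + k\<close> is cut in two, the first piece is shorter
  than \<open>k\<close> or the second is shorter than \<open>j\<close>.\<close>

lemma len_ge_mult:
  assumes "f \<in> len_ge j" "g \<in> len_ge k"
  shows "f \<otimes>\<^bsub>KQ\<^esub> g \<in> len_ge (j + k)"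
proof -
  have "(f \<otimes>\<^bsub>KQ\<^esub> g) (u, r) = 0" if "length r < j + k" for u r
    unfolding mult_KQ
  proof (intro sum.neutral ballI)
    fix i assume i: "i \<in> {..length r}"
    show "f (qend Q (u, take i r), drop i r) * g (u, take i r) = 0"
    proof (cases "i < k")
      case True
      then show ?thesis using assms(2) unfolding len_ge_def by simp
    next
      case False
      then have "length (drop i r) < j" using that i by auto
      then show ?thesis using assms(1) unfolding len_ge_def by simp
    qed
  qed
  moreover have "f \<otimes>\<^bsub>KQ\<^esub> g \<in> carrier KQ" using assms len_ge_carrier by blast
  ultimately show ?thesis unfolding len_ge_def by auto
qed

text \<open>One path of the support is split off at a time. This reduces every additive statement
  about elements of the path algebra to scalar multiples of single paths.\<close>

lemma len_ge_induct [consumes 1, case_names zero add]: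
  assumes "f \<in> len_ge k" and zero: "P \<zero>\<^bsub>KQ\<^esub>"
    and step: "\<And>c q f. q \<in> qpaths Q \<Longrightarrow> k \<le> length (snd q) \<Longrightarrow> f \<in> len_ge k \<Longrightarrow> P f \<Longrightarrow>
      P ((\<lambda>q'. c * path_elem q q') \<oplus>\<^bsub>KQ\<^esub> f)"
  shows "P f"
proof -
  have "finite S \<Longrightarrow> f \<in> len_ge k \<Longrightarrow> {q. f q \<noteq> 0} \<subseteq> S \<Longrightarrow> P f" for S f
  proof (induction S arbitrary: f rule: finite_induct)
    case empty
    then have "f = \<zero>\<^bsub>KQ\<^esub>" by (auto simp: zero_KQ)
    then show ?case using zero by simp
  next
    case (insert q S)
    show ?case
    proof (cases "f q = 0")
      case True
      then show ?thesis using insert by (intro insert.IH) auto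
    next
      case False
      let ?g = "f(q := 0)"
      have "{x. ?g x \<noteq> 0} \<subseteq> {x. f x \<noteq> 0}" by auto
      then have g: "?g \<in> len_ge k"
        using insert.prems(1) unfolding len_ge_def carrier_KQ by (auto intro: finite_subset)
      have "{x. ?g x \<noteq> 0} \<subseteq> S" using insert.prems(2) by auto
      then have "P ?g" by (rule insert.IH[OF g])
      moreover have "q \<in> qpaths Q"
        using False insert.prems(1) unfolding len_ge_def carrier_KQ by auto
      moreover have "k \<le> length (snd q)"
        using False insert.prems(1) unfolding len_ge_def by (cases q) (auto simp: not_less[symmetric])
      ultimately have "P ((\<lambda>q'. f q * path_elem q q') \<oplus>\<^bsub>KQ\<^esub> ?g)" using g by (intro step)
      moreover have "(\<lambda>q'. f q * path_elem q q') \<oplus>\<^bsub>KQ\<^esub> ?g = f"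
        by (auto simp: add_KQ path_elem_def)
      ultimately show ?thesis by simp
    qed
  qed
  moreover have "finite {q. f q \<noteq> 0}" using assms(1) unfolding len_ge_def carrier_KQ by blast
  ultimately show ?thesis using assms(1) by blast
qed

section \<open>Consequences of admissibility\<close>

lemma arrow_subset: "{path_elem (tail Q \<alpha>, [\<alpha>]) | \<alpha>. \<alpha> \<in> arcs Q} \<subseteq> carrier KQ"
  by (auto intro: path_elem_closed)

lemma len_ge_ideal: "ideal (len_ge k) KQ"
proof (rule idealI)
  show "ring KQ" ..
  show "subgroup (len_ge k) (add_monoid KQ)"
  proof (rule KQ.add.subgroupI)
    show "len_ge k \<subseteq> carrier KQ" using len_ge_carrier by blast
    show "len_ge k \<noteq> {}" using len_ge_zero by blast
    show "\<ominus>\<^bsub>KQ\<^esub> a \<in> len_ge k" if "a \<in> len_ge k" for a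
      using len_ge_smult[OF that, of "-1"] a_inv_KQ[OF len_ge_carrier[OF that]] by simp
  qed (rule len_ge_add)
  show "x \<otimes>\<^bsub>KQ\<^esub> a \<in> len_ge k" if "a \<in> len_ge k" "x \<in> carrier KQ" for a x
    using len_ge_mult[of x 0 a k] that by (simp add: len_ge_0)
  show "a \<otimes>\<^bsub>KQ\<^esub> x \<in> len_ge k" if "a \<in> len_ge k" "x \<in> carrier KQ" for a x
    using len_ge_mult[of a k x 0] that by (simp add: len_ge_0)
qed

lemma arrow_ideal_len_ge: "arrow_ideal Q \<subseteq> len_ge 1"
  unfolding arrow_ideal_def
proof (rule KQ.genideal_minimal[OF len_ge_ideal])
  show "{path_elem (tail Q \<alpha>, [\<alpha>]) | \<alpha>. \<alpha> \<in> arcs Q} \<subseteq> len_ge 1"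
    using arrow_subset by (auto simp: len_ge_Suc_0) (simp add: path_elem_def)
qed

text \<open>In a product whose left factor lies in the arrow ideal every path has positive length.
  It follows that the coefficients at trivial paths are constant on residue classes, which is
  \<open>cls_eq_Nil\<close>.\<close>

lemma I_len_ge: "I \<subseteq> len_ge 1"
proof -
  have "ideal_prod KQ (arrow_ideal Q) X \<subseteq> len_ge 1" if X: "X \<subseteq> carrier KQ" for X
  proof
    fix a assume "a \<in> ideal_prod KQ (arrow_ideal Q) X"
    then show "a \<in> len_ge 1"
    proof induction
      case (prod i j)
      then show ?case using len_ge_mult[of i 1 j 0] arrow_ideal_len_ge X by (auto simp: len_ge_0)
    next
      case (sum s1 s2)
      then show ?case by (intro len_ge_add)
    qed
  qed
  from this[of "ideal_power KQ (arrow_ideal Q) 1"] this[of "carrier KQ"]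
  have "ideal_power KQ (arrow_ideal Q) 2 \<subseteq> len_ge 1"
    using len_ge_carrier by (auto simp: numeral_2_eq_2)
  then show ?thesis using admissible unfolding admissible_ideal_def by blast
qed

text \<open>The last arrow is split off; in the product it is the left factor, which fits the
  recursion of \<open>ideal_power\<close>. The recursion stops after \<open>m\<close> arrows, so a
  path longer than \<open>m\<close> leaves a remainder in the zeroth power, which is
  everything.\<close>

lemma long_paths:
  assumes "q \<in> qpaths Q" "m \<le> length (snd q)"
  shows "path_elem q \<in> ideal_power KQ (arrow_ideal Q) m"
  using assms
proof (induction m arbitrary: q)
  case 0
  then show ?case by simp
next
  case (Suc m)
  obtain u p where q: "q = (u, p)" by fastforce
  then obtain p' \<alpha> where p: "p = p' @ [\<alpha>]" using Suc.prems by (cases p rule: rev_cases) auto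
  have p': "(u, p') \<in> qpaths Q" "\<alpha> \<in> arcs Q" "qend Q (u, p') = tail Q \<alpha>"
    using Suc.prems(1) unfolding q p qpaths_append by auto
  have "path_elem (tail Q \<alpha>, [\<alpha>]) \<otimes>\<^bsub>KQ\<^esub> path_elem (u, p') \<in> ideal_power KQ (arrow_ideal Q) (Suc m)"
    unfolding ideal_power.simps
  proof (rule ideal_prod.prod)
    show "path_elem (tail Q \<alpha>, [\<alpha>]) \<in> (arrow_ideal Q :: (('v, 'a) qpath \<Rightarrow> 'k) set)"
      unfolding arrow_ideal_def
      by (rule subsetD[OF KQ.genideal_self[OF arrow_subset]]) (use p'(2) in blast)
    show "path_elem (u, p') \<in> ideal_power KQ (arrow_ideal Q) m"
      using Suc p' by (intro Suc.IH) (auto simp: q p)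
  qed
  then show ?case using p' by (subst (asm) path_elem_mult) (auto simp: q p)
qed

text \<open>Nilpotency of the radical in the form in which it is used: a claim about
  \<open>len_ge k\<close> is clear at \<open>k = m\<close>, where all classes are zero, and is then
  pulled down from \<open>Suc k\<close> to \<open>k\<close>.\<close>

lemma long_in_I: "\<exists>m. len_ge m \<subseteq> I"
proof -
  obtain m where m: "ideal_power KQ (arrow_ideal Q) m \<subseteq> I"
    using admissible unfolding admissible_ideal_def by blast
  have "f \<in> I" if "f \<in> len_ge m" for f
    using that
  proof (induction rule: len_ge_induct)
    case zero
    then show ?case by simp
  next
    case (add c q f)
    have "path_elem q \<in> I" using long_paths add.hyps m by blast
    then have "scal c \<otimes>\<^bsub>KQ\<^esub> path_elem q \<in> I" by (rule KQ.I_l_closed) simp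
    then have "(\<lambda>q'. c * path_elem q q') \<in> I" using add.hyps(1) by (simp add: scal_mult)
    then show ?case using add.IH by simp
  qed
  then show ?thesis by blast
qed

section \<open>The Jacobson radical of the quotient algebra\<close>

lemma cls_eq_Nil:
  assumes "cls f = cls g" "f \<in> carrier KQ" "g \<in> carrier KQ"
  shows "f (u, []) = g (u, [])"
proof -
  have "f \<in> cls g" using KQ.a_rcos_self[OF assms(2)] assms(1) unfolding cls_def by simp
  then obtain h where "h \<in> I" "f = h \<oplus>\<^bsub>KQ\<^esub> g" unfolding cls_def a_r_coset_def' by auto
  moreover from this have "h \<in> len_ge 1" using I_len_ge by blast
  ultimately show ?thesis unfolding len_ge_1 by (simp add: add_KQ)
qed

text \<open>For every vertex \<open>u\<close> the classes with coefficient 0 at the trivial path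
  \<open>(u, [])\<close> form a maximal left ideal, of codimension one. An element of all these
  ideals has no coefficient at a trivial path.\<close>

lemma jacobson_subset: "jacobson_radical Lam \<subseteq> cls ` len_ge 1"
proof
  fix x assume x: "x \<in> jacobson_radical Lam"
  then obtain f where f: "f \<in> carrier KQ" "x = cls f"
    unfolding jacobson_radical_def carrier_Lam by auto
  have "f (u, []) = 0" for u
  proof (cases "u \<in> verts Q")
    case False
    then show ?thesis using f(1) unfolding carrier_KQ by (metis (mono_tags) mem_Collect_eq qpaths_Nil subsetD)
  next
    case True
    let ?M = "cls ` {g \<in> carrier KQ. g (u, []) = 0}"
    have mem: "g (u, []) = 0" if g: "cls g \<in> ?M" "g \<in> carrier KQ" for g
    proof -
      obtain g' where "cls g = cls g'" "g' \<in> carrier KQ" "g' (u, []) = 0" using g(1) by blast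
      then show ?thesis using cls_eq_Nil[of g g' u] g(2) by simp
    qed
    have li: "left_ideal ?M Lam"
    proof (rule Lam.left_idealI)
      show "?M \<subseteq> carrier Lam" by auto
      show "\<zero>\<^bsub>Lam\<^esub> \<in> ?M" using cls_ideal[of "\<zero>\<^bsub>KQ\<^esub>"]
        by (intro image_eqI[of _ _ "\<zero>\<^bsub>KQ\<^esub>"]) (auto simp: zero_KQ[symmetric], simp add: zero_KQ)
      fix x y assume "x \<in> ?M" "y \<in> ?M"
      then obtain g h where "x = cls g" "y = cls h" "g \<in> carrier KQ" "h \<in> carrier KQ"
        "g (u, []) = 0" "h (u, []) = 0" by auto
      then show "x \<oplus>\<^bsub>Lam\<^esub> y \<in> ?M"
        by (intro image_eqI[of _ _ "g \<oplus>\<^bsub>KQ\<^esub> h"]) (auto simp: cls_add, simp add: add_KQ)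
    next
      fix a x assume "a \<in> carrier Lam" "x \<in> ?M"
      then obtain g h where "a = cls g" "x = cls h" "g \<in> carrier KQ" "h \<in> carrier KQ"
        "h (u, []) = 0" unfolding carrier_Lam by auto
      then show "a \<otimes>\<^bsub>Lam\<^esub> x \<in> ?M"
        by (intro image_eqI[of _ _ "g \<otimes>\<^bsub>KQ\<^esub> h"]) (auto simp: cls_mult mult_KQ_Nil)
    qed
    have "maximal_left_ideal ?M Lam"
      unfolding maximal_left_ideal_def
    proof (intro conjI allI impI li)
      have "\<one>\<^bsub>KQ\<^esub> (u, []) = (1 :: 'k)" using True by (simp add: one_KQ)
      then have "cls \<one>\<^bsub>KQ\<^esub> \<notin> ?M" using mem[of "\<one>\<^bsub>KQ\<^esub>"] by auto
      moreover have "cls \<one>\<^bsub>KQ\<^esub> \<in> carrier Lam" by simp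
      ultimately show "?M \<noteq> carrier Lam" by metis
    next
      fix N assume N: "left_ideal N Lam \<and> ?M \<subseteq> N"
      have Nsub: "N \<subseteq> carrier Lam" using N unfolding left_ideal_def
        by (auto dest: additive_subgroup.a_subset)
      show "N = ?M \<or> N = carrier Lam"
      proof (rule disjCI)
        assume "N \<noteq> carrier Lam"
        show "N = ?M"
        proof (rule ccontr)
          assume "N \<noteq> ?M"
          then obtain y where "y \<in> N" "y \<notin> ?M" using N by blast
          then obtain g where g: "g \<in> carrier KQ" "cls g \<in> N" "g (u, []) \<noteq> 0"
            using Nsub unfolding carrier_Lam by blast
          have "cls h \<in> N" if h: "h \<in> carrier KQ" for h
          proof -
            \<comment> \<open>Chosen so that \<open>h - c g\<close> has coefficient 0 at
              \<open>(u, [])\<close> and hence lies in \<open>?M\<close>, while \<open>c g\<close>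
              lies in \<open>N\<close>.\<close>
            define c where "c = h (u, []) / g (u, [])"
            let ?r = "\<lambda>q. h q + - c * g q"
            have cg: "(\<lambda>q. c * g q) \<in> carrier KQ" "(\<lambda>q. - c * g q) \<in> carrier KQ"
              using smult_KQ_closed[OF g(1)] by blast+
            have r: "?r \<in> carrier KQ"
              using KQ.a_closed[OF h cg(2)] by (simp add: add_KQ)
            have "cls ?r \<in> ?M" using r g(3) by (intro imageI) (simp add: c_def)
            then have 1: "cls ?r \<in> N" using N by blast
            have "cls (scal c) \<otimes>\<^bsub>Lam\<^esub> cls g \<in> N" using N g unfolding left_ideal_def by simp
            then have 2: "cls (\<lambda>q. c * g q) \<in> N" using g by (simp add: cls_mult scal_mult)
            have "cls ?r \<oplus>\<^bsub>Lam\<^esub> cls (\<lambda>q. c * g q) = cls h"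
              using cls_add[OF r cg(1)] by (simp add: add_KQ)
            moreover have "cls ?r \<oplus>\<^bsub>Lam\<^esub> cls (\<lambda>q. c * g q) \<in> N"
              using N 1 2 unfolding left_ideal_def by (auto intro: additive_subgroup.a_closed)
            ultimately show ?thesis by simp
          qed
          then have "carrier Lam \<subseteq> N" unfolding carrier_Lam by blast
          then show False using Nsub \<open>N \<noteq> carrier Lam\<close> by blast
        qed
      qed
    qed
    then have "cls f \<in> ?M" using x f(2) unfolding jacobson_radical_def by blast
    then show ?thesis using mem f(1) by blast
  qed
  then have "f \<in> len_ge 1" using f(1) unfolding len_ge_1 by simp
  then show "x \<in> cls ` len_ge 1" using f(2) by blast
qed

text \<open>If a maximal left ideal \<open>\<MM>\<close> misses \<open>cls f\<close>, then together
  with the classes of \<open>len_ge 1\<close> it generates everything, so it contains some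
  \<open>1 + a\<close> with \<open>a\<close> in \<open>len_ge 1\<close>. Then
  \<open>b = b (1 + a) - b a\<close> shows that \<open>b\<close> belongs to \<open>\<MM>\<close> as
  soon as all longer elements do, and descending from the nilpotency bound puts the whole algebra,
  and so \<open>cls f\<close>, into \<open>\<MM>\<close>.\<close>

lemma subset_jacobson: "cls ` len_ge 1 \<subseteq> jacobson_radical Lam"
proof -
  have "cls f \<in> \<MM>" if \<MM>: "maximal_left_ideal \<MM> Lam" and f: "f \<in> len_ge 1" for \<MM> f
  proof (rule ccontr)
    assume nf: "cls f \<notin> \<MM>"
    have li: "left_ideal \<MM> Lam" using \<MM> unfolding maximal_left_ideal_def by blast
    have sub: "\<MM> \<subseteq> carrier Lam" and M0: "\<zero>\<^bsub>Lam\<^esub> \<in> \<MM>"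
      and Madd: "\<And>x y. x \<in> \<MM> \<Longrightarrow> y \<in> \<MM> \<Longrightarrow> x \<oplus>\<^bsub>Lam\<^esub> y \<in> \<MM>"
      and Mmult: "\<And>a x. a \<in> carrier Lam \<Longrightarrow> x \<in> \<MM> \<Longrightarrow> a \<otimes>\<^bsub>Lam\<^esub> x \<in> \<MM>"
      using li unfolding left_ideal_def
      by (auto dest: additive_subgroup.a_subset additive_subgroup.zero_closed
          intro: additive_subgroup.a_closed)
    \<comment> \<open>The sum of \<open>\<MM>\<close> and the image of \<open>len_ge 1\<close>; the
      sign is absorbed since \<open>len_ge 1\<close> is closed under negation.\<close>
    let ?N = "{x \<in> carrier Lam. \<exists>a \<in> len_ge 1. x \<oplus>\<^bsub>Lam\<^esub> cls a \<in> \<MM>}"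
    have l1: "left_ideal ?N Lam"
    proof (rule Lam.left_idealI)
      have "\<zero>\<^bsub>Lam\<^esub> \<oplus>\<^bsub>Lam\<^esub> cls \<zero>\<^bsub>KQ\<^esub> \<in> \<MM>"
        using M0 cls_ideal[of "\<zero>\<^bsub>KQ\<^esub>"] by simp
      then show "\<zero>\<^bsub>Lam\<^esub> \<in> ?N" using len_ge_zero by blast
      fix x y assume "x \<in> ?N" "y \<in> ?N"
      then obtain a b where xy: "x \<in> carrier Lam" "y \<in> carrier Lam" "a \<in> len_ge 1" "b \<in> len_ge 1"
        "x \<oplus>\<^bsub>Lam\<^esub> cls a \<in> \<MM>" "y \<oplus>\<^bsub>Lam\<^esub> cls b \<in> \<MM>" by blast
      have c: "cls a \<in> carrier Lam" "cls b \<in> carrier Lam" using xy len_ge_carrier by auto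
      have "(x \<oplus>\<^bsub>Lam\<^esub> y) \<oplus>\<^bsub>Lam\<^esub> cls (a \<oplus>\<^bsub>KQ\<^esub> b) = (x \<oplus>\<^bsub>Lam\<^esub> cls a) \<oplus>\<^bsub>Lam\<^esub> (y \<oplus>\<^bsub>Lam\<^esub> cls b)"
        using xy c len_ge_carrier by (simp add: cls_add[symmetric] Lam.a_ac)
      then have "(x \<oplus>\<^bsub>Lam\<^esub> y) \<oplus>\<^bsub>Lam\<^esub> cls (a \<oplus>\<^bsub>KQ\<^esub> b) \<in> \<MM>" using Madd xy by simp
      then show "x \<oplus>\<^bsub>Lam\<^esub> y \<in> ?N" using xy len_ge_add by blast
    next
      fix l x assume l: "l \<in> carrier Lam" "x \<in> ?N"
      then obtain g a where g: "g \<in> carrier KQ" "l = cls g" and x: "x \<in> carrier Lam" "a \<in> len_ge 1"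
        "x \<oplus>\<^bsub>Lam\<^esub> cls a \<in> \<MM>" unfolding carrier_Lam by blast
      have "l \<otimes>\<^bsub>Lam\<^esub> x \<oplus>\<^bsub>Lam\<^esub> cls (g \<otimes>\<^bsub>KQ\<^esub> a) = l \<otimes>\<^bsub>Lam\<^esub> (x \<oplus>\<^bsub>Lam\<^esub> cls a)"
        using g x len_ge_carrier[OF x(2)] by (simp add: cls_mult[symmetric] Lam.r_distr)
      then have "l \<otimes>\<^bsub>Lam\<^esub> x \<oplus>\<^bsub>Lam\<^esub> cls (g \<otimes>\<^bsub>KQ\<^esub> a) \<in> \<MM>" using Mmult l x by simp
      moreover have "g \<otimes>\<^bsub>KQ\<^esub> a \<in> len_ge 1" using len_ge_mult[of g 0 a 1] g x by (simp add: len_ge_0)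
      ultimately show "l \<otimes>\<^bsub>Lam\<^esub> x \<in> ?N" using l x by blast
    qed blast
    have l2: "\<MM> \<subseteq> ?N"
    proof
      fix x assume x: "x \<in> \<MM>"
      have "x \<oplus>\<^bsub>Lam\<^esub> cls \<zero>\<^bsub>KQ\<^esub> = x" using x sub cls_ideal[of "\<zero>\<^bsub>KQ\<^esub>"] by auto
      then have "x \<oplus>\<^bsub>Lam\<^esub> cls \<zero>\<^bsub>KQ\<^esub> \<in> \<MM>" using x by simp
      then show "x \<in> ?N" using x sub len_ge_zero[of 1] by blast
    qed
    have l3: "cls f \<in> ?N"
    proof -
      have "\<ominus>\<^bsub>KQ\<^esub> f \<in> len_ge 1"
        using len_ge_smult[OF f, of "-1"] a_inv_KQ[OF len_ge_carrier[OF f]] by simp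
      moreover have "cls f \<oplus>\<^bsub>Lam\<^esub> cls (\<ominus>\<^bsub>KQ\<^esub> f) = \<zero>\<^bsub>Lam\<^esub>"
        using len_ge_carrier[OF f] cls_ideal[of "\<zero>\<^bsub>KQ\<^esub>"] by (simp add: cls_add KQ.r_neg)
      then have "cls f \<oplus>\<^bsub>Lam\<^esub> cls (\<ominus>\<^bsub>KQ\<^esub> f) \<in> \<MM>" using M0 by simp
      moreover have "cls f \<in> carrier Lam" using len_ge_carrier[OF f] by simp
      ultimately show ?thesis by blast
    qed
    have max: "N = \<MM> \<or> N = carrier Lam" if "left_ideal N Lam" "\<MM> \<subseteq> N" for N
      using \<MM> that unfolding maximal_left_ideal_def by blast
    have "?N = carrier Lam"
    proof (rule disjE[OF max[OF l1 l2]])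
      assume e: "?N = \<MM>"
      have "cls f \<in> \<MM>" using l3 unfolding e .
      then show ?thesis using nf by (rule notE[rotated])
    qed
    then have "\<one>\<^bsub>Lam\<^esub> \<in> ?N" by simp
    then obtain a where a: "a \<in> len_ge 1" "\<one>\<^bsub>Lam\<^esub> \<oplus>\<^bsub>Lam\<^esub> cls a \<in> \<MM>" by blast
    have step: "cls b \<in> \<MM>" if IH: "cls ` len_ge (Suc k) \<subseteq> \<MM>" and b: "b \<in> len_ge k" for b k
    proof -
      have bc: "b \<in> carrier KQ" "a \<in> carrier KQ" using b a len_ge_carrier by blast+
      have "\<ominus>\<^bsub>KQ\<^esub> (b \<otimes>\<^bsub>KQ\<^esub> a) = b \<otimes>\<^bsub>KQ\<^esub> (\<ominus>\<^bsub>KQ\<^esub> a)" using bc by (simp add: KQ.r_minus)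
      moreover have "\<ominus>\<^bsub>KQ\<^esub> a \<in> len_ge 1"
        using len_ge_smult[OF a(1), of "-1"] a_inv_KQ[OF bc(2)] by simp
      ultimately have "\<ominus>\<^bsub>KQ\<^esub> (b \<otimes>\<^bsub>KQ\<^esub> a) \<in> len_ge (Suc k)" using len_ge_mult[OF b, of "\<ominus>\<^bsub>KQ\<^esub> a" 1] by simp
      then have 1: "cls (\<ominus>\<^bsub>KQ\<^esub> (b \<otimes>\<^bsub>KQ\<^esub> a)) \<in> \<MM>" using IH by blast
      have 2: "cls b \<otimes>\<^bsub>Lam\<^esub> (\<one>\<^bsub>Lam\<^esub> \<oplus>\<^bsub>Lam\<^esub> cls a) \<in> \<MM>" using Mmult a bc by simp
      have "b \<otimes>\<^bsub>KQ\<^esub> (\<one>\<^bsub>KQ\<^esub> \<oplus>\<^bsub>KQ\<^esub> a) \<oplus>\<^bsub>KQ\<^esub> \<ominus>\<^bsub>KQ\<^esub> (b \<otimes>\<^bsub>KQ\<^esub> a) = b"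
        using bc by (simp add: KQ.r_distr KQ.a_assoc KQ.r_neg)
      then have "cls b = cls b \<otimes>\<^bsub>Lam\<^esub> (\<one>\<^bsub>Lam\<^esub> \<oplus>\<^bsub>Lam\<^esub> cls a) \<oplus>\<^bsub>Lam\<^esub> cls (\<ominus>\<^bsub>KQ\<^esub> (b \<otimes>\<^bsub>KQ\<^esub> a))"
        using bc by (simp add: cls_one[symmetric] cls_add cls_mult)
      then show ?thesis using Madd[OF 2 1] by simp
    qed
    obtain m where m: "len_ge m \<subseteq> I" using long_in_I by blast
    have base: "cls ` len_ge m \<subseteq> \<MM>"
    proof
      fix y assume "y \<in> cls ` len_ge m"
      then obtain g where "g \<in> len_ge m" "y = cls g" by blast
      then show "y \<in> \<MM>" using M0 cls_ideal[of g] m by auto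
    qed
    have "cls ` len_ge 0 \<subseteq> \<MM>"
      by (rule inc_induct[where P = "\<lambda>k. cls ` len_ge k \<subseteq> \<MM>", OF le0 base]) (use step in blast)
    then show False using nf f len_ge_carrier unfolding len_ge_0 by blast
  qed
  then show ?thesis unfolding jacobson_radical_def using len_ge_carrier by auto
qed

lemma jacobson_eq: "jacobson_radical Lam = cls ` len_ge 1"
  using jacobson_subset subset_jacobson by blast

lemma jacobson_power_subset: "ideal_power Lam (jacobson_radical Lam) k \<subseteq> cls ` len_ge k"
proof (induction k)
  case 0
  then show ?case by (simp add: len_ge_0 carrier_Lam)
next
  case (Suc k)
  show ?case
  proof
    fix a assume "a \<in> ideal_power Lam (jacobson_radical Lam) (Suc k)"
    then have "a \<in> ideal_prod Lam (jacobson_radical Lam) (ideal_power Lam (jacobson_radical Lam) k)" by simp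
    then show "a \<in> cls ` len_ge (Suc k)"
    proof induction
      case (prod i j)
      have "i \<in> cls ` len_ge 1" "j \<in> cls ` len_ge k"
        using prod(1)[unfolded jacobson_eq] subsetD[OF Suc prod(2)] by this
      then obtain f g where fg: "f \<in> len_ge 1" "g \<in> len_ge k" "i = cls f" "j = cls g"
        by blast
      then show ?case using len_ge_mult[OF fg(1,2)] len_ge_carrier
        by (intro image_eqI[of _ _ "f \<otimes>\<^bsub>KQ\<^esub> g"]) (auto simp: cls_mult)
    next
      case (sum s1 s2)
      then obtain f g where fg: "f \<in> len_ge (Suc k)" "g \<in> len_ge (Suc k)" "s1 = cls f" "s2 = cls g" by blast
      then show ?case using len_ge_add[OF fg(1,2)] len_ge_carrier
        by (intro image_eqI[of _ _ "f \<oplus>\<^bsub>KQ\<^esub> g"]) (auto simp: cls_add)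
    qed
  qed
qed

text \<open>\<open>loewy_length\<close> is a least number, so some power of the radical has to be
  shown to vanish first; the exponent from \<open>long_in_I\<close> does.\<close>

lemma jacobson_power_loewy: "ideal_power Lam (jacobson_radical Lam) (loewy_length Lam) = {\<zero>\<^bsub>Lam\<^esub>}"
proof -
  obtain m where m: "len_ge m \<subseteq> I" using long_in_I by blast
  have "ideal_power Lam (jacobson_radical Lam) m \<subseteq> {\<zero>\<^bsub>Lam\<^esub>}"
    using jacobson_power_subset[of m] m cls_ideal by blast
  moreover have "\<zero>\<^bsub>Lam\<^esub> \<in> ideal_power Lam (jacobson_radical Lam) k" for k
  proof (induction k)
    case (Suc k)
    have "\<zero>\<^bsub>Lam\<^esub> \<in> jacobson_radical Lam"
      unfolding jacobson_eq using len_ge_zero cls_ideal[of "\<zero>\<^bsub>KQ\<^esub>"] by force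
    then have "\<zero>\<^bsub>Lam\<^esub> \<otimes>\<^bsub>Lam\<^esub> \<zero>\<^bsub>Lam\<^esub> \<in> ideal_power Lam (jacobson_radical Lam) (Suc k)"
      unfolding ideal_power.simps using Suc by (intro ideal_prod.prod)
    then show ?case by simp
  qed simp
  ultimately have "ideal_power Lam (jacobson_radical Lam) m = {\<zero>\<^bsub>Lam\<^esub>}" by blast
  then show ?thesis unfolding loewy_length_def by (rule LeastI)
qed

text \<open>A product of ideals consists of sums of products, with no closure under scalars built
  in; the scalar is absorbed by the left factor, which lies in the radical.\<close>

lemma jacobson_power_left: 
  assumes "a \<in> carrier Lam" "b \<in> ideal_power Lam (jacobson_radical Lam) k"
  shows "a \<otimes>\<^bsub>Lam\<^esub> b \<in> ideal_power Lam (jacobson_radical Lam) k"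
proof (cases k)
  case 0
  then show ?thesis using assms by simp
next
  case (Suc k')
  let ?J = "ideal_power Lam (jacobson_radical Lam)"
  have sub: "?J k \<subseteq> carrier Lam" for k using jacobson_power_subset[of k] len_ge_carrier by auto
  have "b \<in> ideal_prod Lam (jacobson_radical Lam) (?J k')" using assms(2) Suc by simp
  then have "a \<otimes>\<^bsub>Lam\<^esub> b \<in> ideal_prod Lam (jacobson_radical Lam) (?J k') \<and> b \<in> carrier Lam"
  proof induction
    case (prod i j)
    obtain f g where f: "f \<in> len_ge 1" "i = cls f" and g: "g \<in> carrier KQ" "a = cls g"
      using prod(1) assms(1) unfolding jacobson_eq carrier_Lam by blast
    have j: "j \<in> carrier Lam" using prod(2) sub by blast
    have i: "i \<in> carrier Lam" using f len_ge_carrier by simp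
    have "a \<otimes>\<^bsub>Lam\<^esub> i \<in> jacobson_radical Lam"
      unfolding jacobson_eq using f g len_ge_mult[of g 0 f 1] len_ge_carrier[OF f(1)]
      by (intro image_eqI[of _ _ "g \<otimes>\<^bsub>KQ\<^esub> f"]) (auto simp: cls_mult len_ge_0)
    then have "(a \<otimes>\<^bsub>Lam\<^esub> i) \<otimes>\<^bsub>Lam\<^esub> j \<in> ideal_prod Lam (jacobson_radical Lam) (?J k')"
      using prod(2) by (rule ideal_prod.prod)
    then show ?case using i j assms(1) by (simp add: Lam.m_assoc)
  next
    case (sum s1 s2)
    then show ?case using assms(1) by (auto simp: Lam.r_distr intro: ideal_prod.sum)
  qed
  then show ?thesis using Suc by simp
qed

end

section \<open>Left modules\<close>

context left_module
begin

lemma smult_r_null: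
  assumes a: "a \<in> carrier R"
  shows "a \<odot>\<^bsub>M\<^esub> \<zero>\<^bsub>M\<^esub> = \<zero>\<^bsub>M\<^esub>"
proof -
  have c: "a \<odot>\<^bsub>M\<^esub> \<zero>\<^bsub>M\<^esub> \<in> carrier M" using a by (rule smult_closed) simp
  have "a \<odot>\<^bsub>M\<^esub> \<zero>\<^bsub>M\<^esub> \<oplus>\<^bsub>M\<^esub> a \<odot>\<^bsub>M\<^esub> \<zero>\<^bsub>M\<^esub> = a \<odot>\<^bsub>M\<^esub> (\<zero>\<^bsub>M\<^esub> \<oplus>\<^bsub>M\<^esub> \<zero>\<^bsub>M\<^esub>)"
    by (rule smult_r_distr[symmetric, OF a]) simp_all
  also have "\<dots> = a \<odot>\<^bsub>M\<^esub> \<zero>\<^bsub>M\<^esub>" by simp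
  finally show ?thesis using M.add.l_cancel_one[OF c c] by blast
qed

lemma smult_l_null:
  assumes x: "x \<in> carrier M"
  shows "\<zero>\<^bsub>R\<^esub> \<odot>\<^bsub>M\<^esub> x = \<zero>\<^bsub>M\<^esub>"
proof -
  have c: "\<zero>\<^bsub>R\<^esub> \<odot>\<^bsub>M\<^esub> x \<in> carrier M" by (rule smult_closed[OF _ x]) simp
  have "\<zero>\<^bsub>R\<^esub> \<odot>\<^bsub>M\<^esub> x \<oplus>\<^bsub>M\<^esub> \<zero>\<^bsub>R\<^esub> \<odot>\<^bsub>M\<^esub> x = (\<zero>\<^bsub>R\<^esub> \<oplus>\<^bsub>R\<^esub> \<zero>\<^bsub>R\<^esub>) \<odot>\<^bsub>M\<^esub> x"
    by (rule smult_l_distr[symmetric, OF _ _ x]) simp_all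
  also have "\<dots> = \<zero>\<^bsub>R\<^esub> \<odot>\<^bsub>M\<^esub> x" by simp
  finally show ?thesis using M.add.l_cancel_one[OF c c] by blast
qed

lemma minus_one_smult:
  assumes x: "x \<in> carrier M"
  shows "(\<ominus>\<^bsub>R\<^esub> \<one>\<^bsub>R\<^esub>) \<odot>\<^bsub>M\<^esub> x = \<ominus>\<^bsub>M\<^esub> x"
proof -
  have "(\<ominus>\<^bsub>R\<^esub> \<one>\<^bsub>R\<^esub>) \<odot>\<^bsub>M\<^esub> x \<oplus>\<^bsub>M\<^esub> x = (\<ominus>\<^bsub>R\<^esub> \<one>\<^bsub>R\<^esub> \<oplus>\<^bsub>R\<^esub> \<one>\<^bsub>R\<^esub>) \<odot>\<^bsub>M\<^esub> x"
    using x by (simp add: smult_l_distr smult_one)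
  also have "\<dots> = \<zero>\<^bsub>M\<^esub>" using x by (simp add: R.l_neg smult_l_null)
  finally show ?thesis
    using x smult_closed[of "\<ominus>\<^bsub>R\<^esub> \<one>\<^bsub>R\<^esub>" x] by (simp add: M.minus_equality)
qed

lemma minus_eq_zero_iff:
  assumes "x \<in> carrier M" "y \<in> carrier M"
  shows "x \<ominus>\<^bsub>M\<^esub> y = \<zero>\<^bsub>M\<^esub> \<longleftrightarrow> x = y"
proof
  assume e: "x \<ominus>\<^bsub>M\<^esub> y = \<zero>\<^bsub>M\<^esub>"
  have "x = (x \<ominus>\<^bsub>M\<^esub> y) \<oplus>\<^bsub>M\<^esub> y" using assms by (simp add: a_minus_def M.a_assoc M.l_neg)
  then show "x = y" using assms e by simp
next
  assume "x = y"
  then show "x \<ominus>\<^bsub>M\<^esub> y = \<zero>\<^bsub>M\<^esub>" using assms by (simp add: a_minus_def M.r_neg)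
qed

lemma minus_zero_right: "x \<in> carrier M \<Longrightarrow> x \<ominus>\<^bsub>M\<^esub> \<zero>\<^bsub>M\<^esub> = x"
  using M.minus_equality[of "\<zero>\<^bsub>M\<^esub>" "\<zero>\<^bsub>M\<^esub>"] by (simp add: a_minus_def)

lemma submoduleI:
  assumes "N \<subseteq> carrier M" "\<zero>\<^bsub>M\<^esub> \<in> N" "\<And>x y. x \<in> N \<Longrightarrow> y \<in> N \<Longrightarrow> x \<oplus>\<^bsub>M\<^esub> y \<in> N"
    "\<And>a x. a \<in> carrier R \<Longrightarrow> x \<in> N \<Longrightarrow> a \<odot>\<^bsub>M\<^esub> x \<in> N"
  shows "Module.submodule N R M"
proof -
  have "\<ominus>\<^bsub>M\<^esub> x \<in> N" if "x \<in> N" for x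
    using assms(4)[of "\<ominus>\<^bsub>R\<^esub> \<one>\<^bsub>R\<^esub>" x] that assms(1) minus_one_smult[of x] by auto
  then have "subgroup N (add_monoid M)"
    using assms by (intro M.add.subgroupI) auto
  then show ?thesis unfolding Module.submodule_def submodule_axioms_def using assms(4) by blast
qed

end

lemma submoduleD:
  assumes "Module.submodule N R M"
  shows "N \<subseteq> carrier M" "\<zero>\<^bsub>M\<^esub> \<in> N" "\<And>x y. x \<in> N \<Longrightarrow> y \<in> N \<Longrightarrow> x \<oplus>\<^bsub>M\<^esub> y \<in> N"
    "\<And>a x. a \<in> carrier R \<Longrightarrow> x \<in> N \<Longrightarrow> a \<odot>\<^bsub>M\<^esub> x \<in> N"
proof -
  interpret Module.submodule N R M by fact
  show "N \<subseteq> carrier M" using subset by simp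
  show "\<zero>\<^bsub>M\<^esub> \<in> N" using one_closed by simp
  show "x \<oplus>\<^bsub>M\<^esub> y \<in> N" if "x \<in> N" "y \<in> N" for x y using m_closed[OF that] by simp
  show "a \<odot>\<^bsub>M\<^esub> x \<in> N" if "a \<in> carrier R" "x \<in> N" for a x using smult_closed[OF that] .
qed

text \<open>The module axioms are equations, so they may be checked after an injective map into a
  known module; the one existence statement, about additive inverses, is met by the scalar
  \<open>- 1\<close>. Submodules use the identity as \<open>f\<close>, quotients the map induced on
  cosets.\<close>

lemma left_module_injective:
  assumes P: "left_module R P" and f: "f \<in> carrier X \<rightarrow> carrier P" "inj_on f (carrier X)"
    and zero: "\<zero>\<^bsub>X\<^esub> \<in> carrier X" "f \<zero>\<^bsub>X\<^esub> = \<zero>\<^bsub>P\<^esub>"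
    and add: "\<And>x y. x \<in> carrier X \<Longrightarrow> y \<in> carrier X \<Longrightarrow> x \<oplus>\<^bsub>X\<^esub> y \<in> carrier X"
      "\<And>x y. x \<in> carrier X \<Longrightarrow> y \<in> carrier X \<Longrightarrow> f (x \<oplus>\<^bsub>X\<^esub> y) = f x \<oplus>\<^bsub>P\<^esub> f y"
    and smult: "\<And>a x. a \<in> carrier R \<Longrightarrow> x \<in> carrier X \<Longrightarrow> a \<odot>\<^bsub>X\<^esub> x \<in> carrier X"
      "\<And>a x. a \<in> carrier R \<Longrightarrow> x \<in> carrier X \<Longrightarrow> f (a \<odot>\<^bsub>X\<^esub> x) = a \<odot>\<^bsub>P\<^esub> f x"
  shows "left_module R X"
proof -
  interpret P: left_module R P by (rule P)
  have fc: "f x \<in> carrier P" if "x \<in> carrier X" for x using f(1) that by auto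
  have eq: "x = y" if "x \<in> carrier X" "y \<in> carrier X" "f x = f y" for x y
    using f(2) that by (simp add: inj_on_def)
  have "abelian_group X"
  proof (rule abelian_groupI)
    fix x y z assume xyz: "x \<in> carrier X" "y \<in> carrier X" "z \<in> carrier X"
    show "x \<oplus>\<^bsub>X\<^esub> y \<oplus>\<^bsub>X\<^esub> z = x \<oplus>\<^bsub>X\<^esub> (y \<oplus>\<^bsub>X\<^esub> z)"
      by (rule eq) (use xyz in \<open>simp_all add: add fc P.M.a_assoc\<close>)
  next
    fix x y assume xy: "x \<in> carrier X" "y \<in> carrier X"
    show "x \<oplus>\<^bsub>X\<^esub> y = y \<oplus>\<^bsub>X\<^esub> x"
      by (rule eq) (use xy in \<open>simp_all add: add fc P.M.a_comm\<close>)
  next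
    fix x assume x: "x \<in> carrier X"
    show "\<zero>\<^bsub>X\<^esub> \<oplus>\<^bsub>X\<^esub> x = x"
      by (rule eq) (use x in \<open>simp_all add: add zero fc\<close>)
    have c: "(\<ominus>\<^bsub>R\<^esub> \<one>\<^bsub>R\<^esub>) \<odot>\<^bsub>X\<^esub> x \<in> carrier X" using x by (simp add: smult)
    have "(\<ominus>\<^bsub>R\<^esub> \<one>\<^bsub>R\<^esub>) \<odot>\<^bsub>X\<^esub> x \<oplus>\<^bsub>X\<^esub> x = \<zero>\<^bsub>X\<^esub>"
      by (rule eq) (use x c in \<open>simp_all add: add zero smult fc P.minus_one_smult P.M.l_neg\<close>)
    then show "\<exists>y\<in>carrier X. y \<oplus>\<^bsub>X\<^esub> x = \<zero>\<^bsub>X\<^esub>" using c by blast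
  qed (simp_all add: add zero)
  moreover have "left_module_axioms R X"
  proof
    fix a b x assume abx: "a \<in> carrier R" "b \<in> carrier R" "x \<in> carrier X"
    show "(a \<oplus>\<^bsub>R\<^esub> b) \<odot>\<^bsub>X\<^esub> x = a \<odot>\<^bsub>X\<^esub> x \<oplus>\<^bsub>X\<^esub> b \<odot>\<^bsub>X\<^esub> x"
      by (rule eq) (use abx in \<open>simp_all add: add smult fc P.smult_l_distr\<close>)
    show "(a \<otimes>\<^bsub>R\<^esub> b) \<odot>\<^bsub>X\<^esub> x = a \<odot>\<^bsub>X\<^esub> (b \<odot>\<^bsub>X\<^esub> x)"
      by (rule eq) (use abx in \<open>simp_all add: smult fc P.smult_assoc1\<close>)
  next
    fix a x y assume axy: "a \<in> carrier R" "x \<in> carrier X" "y \<in> carrier X"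
    show "a \<odot>\<^bsub>X\<^esub> (x \<oplus>\<^bsub>X\<^esub> y) = a \<odot>\<^bsub>X\<^esub> x \<oplus>\<^bsub>X\<^esub> a \<odot>\<^bsub>X\<^esub> y"
      by (rule eq) (use axy in \<open>simp_all add: add smult fc P.smult_r_distr\<close>)
  next
    fix x assume x: "x \<in> carrier X"
    show "\<one>\<^bsub>R\<^esub> \<odot>\<^bsub>X\<^esub> x = x"
      by (rule eq) (use x in \<open>simp_all add: smult fc P.smult_one\<close>)
  qed (simp add: smult)
  ultimately show ?thesis by (intro left_module.intro P.R.ring_axioms)
qed

lemma left_module_submodule:
  assumes "left_module R M" "Module.submodule N R M"
  shows "left_module R (M\<lparr>carrier := N\<rparr>)"
  by (rule left_module_injective[OF assms(1), of "\<lambda>x. x"]) (use submoduleD[OF assms(2)] in auto)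

lemma submodule_restrict_iff:
  assumes M: "left_module R M" and N: "Module.submodule N R M"
  shows "Module.submodule U R (M\<lparr>carrier := N\<rparr>) \<longleftrightarrow> Module.submodule U R M \<and> U \<subseteq> N"
proof
  assume U: "Module.submodule U R (M\<lparr>carrier := N\<rparr>)"
  show "Module.submodule U R M \<and> U \<subseteq> N"
    using submoduleD[OF U] submoduleD(1)[OF N]
    by (auto intro!: left_module.submoduleI[OF M])
next
  assume U: "Module.submodule U R M \<and> U \<subseteq> N"
  then show "Module.submodule U R (M\<lparr>carrier := N\<rparr>)"
    using submoduleD[of U R M]
    by (intro left_module.submoduleI[OF left_module_submodule[OF M N]]) auto
qed

lemma module_hom_zero:
  assumes "left_module R M" "left_module R N" "f \<in> module_hom R M N"
  shows "f \<zero>\<^bsub>M\<^esub> = \<zero>\<^bsub>N\<^esub>"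
proof -
  interpret M: left_module R M by fact
  interpret N: left_module R N by fact
  have "f (\<zero>\<^bsub>R\<^esub> \<odot>\<^bsub>M\<^esub> \<zero>\<^bsub>M\<^esub>) = \<zero>\<^bsub>R\<^esub> \<odot>\<^bsub>N\<^esub> f \<zero>\<^bsub>M\<^esub>"
    using assms(3) by (intro module_hom_smult) auto
  moreover have "f \<zero>\<^bsub>M\<^esub> \<in> carrier N" using module_hom_closed[OF assms(3)] by auto
  ultimately show ?thesis by (simp add: M.smult_l_null N.smult_l_null)
qed

lemma module_homI:
  assumes "\<And>x. x \<in> carrier M \<Longrightarrow> f x \<in> carrier N"
    "\<And>x y. x \<in> carrier M \<Longrightarrow> y \<in> carrier M \<Longrightarrow> f (x \<oplus>\<^bsub>M\<^esub> y) = f x \<oplus>\<^bsub>N\<^esub> f y"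
    "\<And>a x. a \<in> carrier R \<Longrightarrow> x \<in> carrier M \<Longrightarrow> f (a \<odot>\<^bsub>M\<^esub> x) = a \<odot>\<^bsub>N\<^esub> f x"
  shows "f \<in> module_hom R M N"
  unfolding module_hom_def using assms by auto

lemma module_hom_in: "f \<in> module_hom R M N \<Longrightarrow> x \<in> carrier M \<Longrightarrow> f x \<in> carrier N"
  using module_hom_closed by blast

lemma submodule_image:
  assumes M: "left_module R M" and N: "left_module R N" and f: "f \<in> module_hom R M N"
    and U: "Module.submodule U R M"
  shows "Module.submodule (f ` U) R N"
proof -
  note u = submoduleD[OF U]
  show ?thesis
  proof (rule left_module.submoduleI[OF N])
    show "f ` U \<subseteq> carrier N" using u(1) module_hom_in[OF f] by auto
    show "\<zero>\<^bsub>N\<^esub> \<in> f ` U" using module_hom_zero[OF M N f] u(2) by (metis imageI)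
    show "x \<oplus>\<^bsub>N\<^esub> y \<in> f ` U" if xy: "x \<in> f ` U" "y \<in> f ` U" for x y
    proof -
      obtain x' y' where "x' \<in> U" "y' \<in> U" "x = f x'" "y = f y'" using xy by blast
      then show ?thesis using u(1,3) by (auto intro!: image_eqI[of _ _ "x' \<oplus>\<^bsub>M\<^esub> y'"] module_hom_add[OF f, symmetric])
    qed
    show "a \<odot>\<^bsub>N\<^esub> x \<in> f ` U" if ax: "a \<in> carrier R" "x \<in> f ` U" for a x
    proof -
      obtain x' where "x' \<in> U" "x = f x'" using ax(2) by blast
      then show ?thesis using u(1,4) ax(1) by (auto intro!: image_eqI[of _ _ "a \<odot>\<^bsub>M\<^esub> x'"] module_hom_smult[OF f, symmetric])
    qed
  qed
qed

lemma submodule_vimage: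
  assumes M: "left_module R M" and N: "left_module R N" and f: "f \<in> module_hom R M N"
    and U: "Module.submodule U R N"
  shows "Module.submodule {x \<in> carrier M. f x \<in> U} R M"
proof -
  interpret M: left_module R M by (rule M)
  note u = submoduleD[OF U]
  show ?thesis
    by (rule M.submoduleI) (use u module_hom_zero[OF M N f] in
        \<open>auto simp: module_hom_add[OF f] module_hom_smult[OF f] M.smult_closed\<close>)
qed

lemma modules_isomorphicE:
  assumes "modules_isomorphic R M N"
  obtains f where "f \<in> module_hom R M N" "bij_betw f (carrier M) (carrier N)"
  using assms unfolding modules_isomorphic_def by blast

lemma modules_isomorphic_sym:
  assumes "left_module R M" "modules_isomorphic R M N"
  shows "modules_isomorphic R N M"
proof -
  interpret M: left_module R M by fact
  obtain f where f: "f \<in> module_hom R M N" "bij_betw f (carrier M) (carrier N)"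
    using assms(2) by (rule modules_isomorphicE)
  let ?g = "inv_into (carrier M) f"
  have g: "bij_betw ?g (carrier N) (carrier M)" using bij_betw_inv_into[OF f(2)] .
  have gc: "?g x \<in> carrier M" "f (?g x) = x" if "x \<in> carrier N" for x
    using that g bij_betwE f(2) by (auto simp: bij_betw_inv_into_right)
  have gf: "?g (f x) = x" if "x \<in> carrier M" for x
    using that f(2) by (simp add: bij_betw_inv_into_left)
  have "?g \<in> module_hom R N M"
  proof (rule module_homI)
    show "?g x \<in> carrier M" if "x \<in> carrier N" for x using gc that by simp
    show "?g (x \<oplus>\<^bsub>N\<^esub> y) = ?g x \<oplus>\<^bsub>M\<^esub> ?g y" if "x \<in> carrier N" "y \<in> carrier N" for x y
      using gf[of "?g x \<oplus>\<^bsub>M\<^esub> ?g y"] gc[OF that(1)] gc[OF that(2)] by (simp add: module_hom_add[OF f(1)])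
    show "?g (a \<odot>\<^bsub>N\<^esub> x) = a \<odot>\<^bsub>M\<^esub> ?g x" if "a \<in> carrier R" "x \<in> carrier N" for a x
      using gf[of "a \<odot>\<^bsub>M\<^esub> ?g x"] gc[OF that(2)] that(1)
      by (simp add: module_hom_smult[OF f(1)] M.smult_closed)
  qed
  then show ?thesis unfolding modules_isomorphic_def using g by blast
qed

lemma module_hom_comp:
  assumes "f \<in> module_hom R M N" "g \<in> module_hom R N P"
  shows "(\<lambda>x. g (f x)) \<in> module_hom R M P"
  by (rule module_homI)
    (use module_hom_in[OF assms(1)] module_hom_in[OF assms(2)] in
      \<open>simp_all add: module_hom_add[OF assms(1)] module_hom_add[OF assms(2)]
        module_hom_smult[OF assms(1)] module_hom_smult[OF assms(2)]\<close>)

text \<open>Simple submodules of \<open>P\<close> pull back along the isomorphism to simple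
  submodules of \<open>X\<close>. If \<open>N\<close> contains all simple submodules of
  \<open>X\<close>, its image therefore contains all those of \<open>P\<close> and is
  everything.\<close>

lemma semisimple_isomorphic:
  assumes X: "left_module R X" and iso: "modules_isomorphic R X P" and P: "semisimple_module R P"
  shows "semisimple_module R X"
proof -
  have Pm: "left_module R P" using P unfolding semisimple_module_def by blast
  obtain f where f: "f \<in> module_hom R X P" "bij_betw f (carrier X) (carrier P)"
    using iso by (rule modules_isomorphicE)
  have inj: "inj_on f (carrier X)" and surj: "f ` carrier X = carrier P"
    using f(2) by (auto simp: bij_betw_def)
  have f0: "f \<zero>\<^bsub>X\<^esub> = \<zero>\<^bsub>P\<^esub>" by (rule module_hom_zero[OF X Pm f(1)])
  have X0: "\<zero>\<^bsub>X\<^esub> \<in> carrier X" using X by (simp add: left_module_def abelian_group.axioms abelian_monoid.zero_closed)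
  have "N = carrier X" if N: "Module.submodule N R X"
    and all: "\<And>S. Module.submodule S R X \<Longrightarrow> simple_module R (X\<lparr>carrier := S\<rparr>) \<Longrightarrow> S \<subseteq> N" for N
  proof -
    have fN: "Module.submodule (f ` N) R P" by (rule submodule_image[OF X Pm f(1) N])
    have "S \<subseteq> f ` N" if S: "Module.submodule S R P" "simple_module R (P\<lparr>carrier := S\<rparr>)" for S
    proof -
      let ?T = "{x \<in> carrier X. f x \<in> S}"
      have T: "Module.submodule ?T R X" by (rule submodule_vimage[OF X Pm f(1) S(1)])
      have fT: "f ` ?T = S" using surj submoduleD(1)[OF S(1)] by auto
      have "simple_module R (X\<lparr>carrier := ?T\<rparr>)"
        unfolding simple_module_def
      proof (intro conjI allI impI)
        show "left_module R (X\<lparr>carrier := ?T\<rparr>)" by (rule left_module_submodule[OF X T])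
        have "S \<noteq> {\<zero>\<^bsub>P\<^esub>}" using S(2) unfolding simple_module_def by simp
        then show "carrier (X\<lparr>carrier := ?T\<rparr>) \<noteq> {\<zero>\<^bsub>X\<lparr>carrier := ?T\<rparr>\<^esub>}"
          using fT f0 by auto
        fix U assume "Module.submodule U R (X\<lparr>carrier := ?T\<rparr>)"
        then have U: "Module.submodule U R X" "U \<subseteq> ?T" using submodule_restrict_iff[OF X T] by auto
        have "Module.submodule (f ` U) R P" by (rule submodule_image[OF X Pm f(1) U(1)])
        moreover have "f ` U \<subseteq> S" using U(2) by auto
        ultimately have "Module.submodule (f ` U) R (P\<lparr>carrier := S\<rparr>)"
          using submodule_restrict_iff[OF Pm S(1)] by blast
        then have "f ` U = {\<zero>\<^bsub>P\<^esub>} \<or> f ` U = S" using S(2) unfolding simple_module_def by simp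
        then have "f ` U = f ` {\<zero>\<^bsub>X\<^esub>} \<or> f ` U = f ` ?T" using f0 fT by auto
        then show "U = {\<zero>\<^bsub>X\<lparr>carrier := ?T\<rparr>\<^esub>} \<or> U = carrier (X\<lparr>carrier := ?T\<rparr>)"
          using inj_on_image_eq_iff[OF inj, of U "{\<zero>\<^bsub>X\<^esub>}"] inj_on_image_eq_iff[OF inj, of U ?T]
            U(2) X0 by auto
      qed
      then have "?T \<subseteq> N" using all T by blast
      then show ?thesis using fT by blast
    qed
    then have "f ` N = carrier P" using P fN unfolding semisimple_module_def by blast
    then have "f ` N = f ` carrier X" using surj by simp
    then show ?thesis using inj_on_image_eq_iff[OF inj] submoduleD(1)[OF N] by blast
  qed
  then show ?thesis unfolding semisimple_module_def using X by blast
qed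

subsection \<open>Quotient modules\<close>

locale submodule_pair = left_module +
  fixes N assumes sub: "Module.submodule N R M"
begin

lemma abelian_subgroup_N: "abelian_subgroup N M"
proof (rule abelian_subgroupI3)
  show "additive_subgroup N M" using sub unfolding Module.submodule_def by (simp add: additive_subgroupI)
  show "abelian_group M" ..
qed

lemma coset_eq_iff:
  assumes "v \<in> carrier M" "w \<in> carrier M"
  shows "N +>\<^bsub>M\<^esub> v = N +>\<^bsub>M\<^esub> w \<longleftrightarrow> v \<ominus>\<^bsub>M\<^esub> w \<in> N"
proof -
  interpret N: abelian_subgroup N M by (rule abelian_subgroup_N)
  have "v \<in> N +>\<^bsub>M\<^esub> w \<longleftrightarrow> v \<ominus>\<^bsub>M\<^esub> w \<in> N"
    using N.a_rcos_module[OF assms(2,1)] by (simp add: a_minus_def)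
  moreover have "v \<in> N +>\<^bsub>M\<^esub> w \<longleftrightarrow> N +>\<^bsub>M\<^esub> v = N +>\<^bsub>M\<^esub> w"
    using M.a_repr_independence[OF _ assms(2) N.a_subgroup] N.a_rcos_self[OF assms(1)] by blast
  ultimately show ?thesis by simp
qed

lemma quotient_carrier: "carrier (quotient_module M N) = (\<lambda>v. N +>\<^bsub>M\<^esub> v) ` carrier M"
  unfolding quotient_module_def A_RCOSETS_def' by auto

lemma quotient_zero: "\<zero>\<^bsub>quotient_module M N\<^esub> = N +>\<^bsub>M\<^esub> \<zero>\<^bsub>M\<^esub>"
proof -
  interpret N: abelian_subgroup N M by (rule abelian_subgroup_N)
  show ?thesis unfolding quotient_module_def using N.a_rcos_const[OF submoduleD(2)[OF sub]] by simp
qed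

lemma quotient_add:
  assumes "v \<in> carrier M" "w \<in> carrier M"
  shows "(N +>\<^bsub>M\<^esub> v) \<oplus>\<^bsub>quotient_module M N\<^esub> (N +>\<^bsub>M\<^esub> w) = N +>\<^bsub>M\<^esub> (v \<oplus>\<^bsub>M\<^esub> w)"
proof -
  interpret N: abelian_subgroup N M by (rule abelian_subgroup_N)
  show ?thesis unfolding quotient_module_def using N.a_rcos_sum[OF assms] by simp
qed

text \<open>The union that defines scalar multiplication on cosets runs over equal cosets, because
  \<open>a\<close> maps \<open>N\<close> into itself, and over a nonempty index set, as
  \<open>v\<close> lies in its own coset.\<close>

lemma quotient_smult:
  assumes a: "a \<in> carrier R" and v: "v \<in> carrier M"
  shows "a \<odot>\<^bsub>quotient_module M N\<^esub> (N +>\<^bsub>M\<^esub> v) = N +>\<^bsub>M\<^esub> (a \<odot>\<^bsub>M\<^esub> v)"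
proof -
  interpret N: abelian_subgroup N M by (rule abelian_subgroup_N)
  have self: "v \<in> N +>\<^bsub>M\<^esub> v" by (rule N.a_rcos_self[OF v])
  have "N +>\<^bsub>M\<^esub> (a \<odot>\<^bsub>M\<^esub> m) = N +>\<^bsub>M\<^esub> (a \<odot>\<^bsub>M\<^esub> v)" if "m \<in> N +>\<^bsub>M\<^esub> v" for m
  proof -
    obtain n where n: "n \<in> N" "m = n \<oplus>\<^bsub>M\<^esub> v" using \<open>m \<in> N +>\<^bsub>M\<^esub> v\<close> unfolding a_r_coset_def' by auto
    have nc: "n \<in> carrier M" using n submoduleD(1)[OF sub] by blast
    have "a \<odot>\<^bsub>M\<^esub> m = a \<odot>\<^bsub>M\<^esub> n \<oplus>\<^bsub>M\<^esub> a \<odot>\<^bsub>M\<^esub> v" using n nc a v by (simp add: smult_r_distr)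
    then have "a \<odot>\<^bsub>M\<^esub> m \<ominus>\<^bsub>M\<^esub> a \<odot>\<^bsub>M\<^esub> v = a \<odot>\<^bsub>M\<^esub> n"
      using smult_closed[OF a v] smult_closed[OF a nc]
      by (simp add: a_minus_def M.a_assoc M.r_neg)
    then have "a \<odot>\<^bsub>M\<^esub> m \<ominus>\<^bsub>M\<^esub> a \<odot>\<^bsub>M\<^esub> v \<in> N" using submoduleD(4)[OF sub a n(1)] by simp
    then show ?thesis using n nc a v by (subst coset_eq_iff) (auto intro: smult_closed)
  qed
  then have "(\<Union>m\<in>N +>\<^bsub>M\<^esub> v. N +>\<^bsub>M\<^esub> (a \<odot>\<^bsub>M\<^esub> m)) = (\<Union>m\<in>N +>\<^bsub>M\<^esub> v. N +>\<^bsub>M\<^esub> (a \<odot>\<^bsub>M\<^esub> v))"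
    by (rule SUP_cong[OF refl])
  also have "\<dots> = N +>\<^bsub>M\<^esub> (a \<odot>\<^bsub>M\<^esub> v)"
    using self UN_constant[of "N +>\<^bsub>M\<^esub> (a \<odot>\<^bsub>M\<^esub> v)" "N +>\<^bsub>M\<^esub> v"] by (cases "N +>\<^bsub>M\<^esub> v = {}") simp_all
  finally show ?thesis unfolding quotient_module_def by simp
qed

text \<open>The homomorphism theorem. It also provides the module axioms of the quotient, which are
  pulled back from \<open>P\<close> along the injective map induced by
  \<open>\<psi>\<close>.\<close>

lemma quotient_iso:
  assumes P: "left_module R P" and \<psi>: "\<psi> \<in> module_hom R M P" and surj: "\<psi> ` carrier M = carrier P"
    and ker: "\<And>v. v \<in> carrier M \<Longrightarrow> \<psi> v = \<zero>\<^bsub>P\<^esub> \<longleftrightarrow> v \<in> N"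
  shows "left_module R (quotient_module M N)" "modules_isomorphic R (quotient_module M N) P"
proof -
  interpret P: left_module R P by (rule P)
  note \<psi>c = module_hom_in[OF \<psi>]
  have \<psi>eq: "\<psi> v = \<psi> w \<longleftrightarrow> N +>\<^bsub>M\<^esub> v = N +>\<^bsub>M\<^esub> w" if vw: "v \<in> carrier M" "w \<in> carrier M" for v w
  proof -
    have "\<psi> (v \<ominus>\<^bsub>M\<^esub> w) = \<psi> v \<oplus>\<^bsub>P\<^esub> \<psi> ((\<ominus>\<^bsub>R\<^esub> \<one>\<^bsub>R\<^esub>) \<odot>\<^bsub>M\<^esub> w)"
      using vw by (simp add: a_minus_def minus_one_smult module_hom_add[OF \<psi>])
    also have "\<dots> = \<psi> v \<ominus>\<^bsub>P\<^esub> \<psi> w"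
      using vw \<psi>c by (simp only: module_hom_smult[OF \<psi>] R.a_inv_closed R.one_closed P.minus_one_smult a_minus_def)
    finally have "\<psi> (v \<ominus>\<^bsub>M\<^esub> w) = \<zero>\<^bsub>P\<^esub> \<longleftrightarrow> \<psi> v = \<psi> w"
      using vw \<psi>c P.minus_eq_zero_iff by simp
    then show ?thesis using ker[of "v \<ominus>\<^bsub>M\<^esub> w"] coset_eq_iff[OF vw] vw by simp
  qed
  define f where "f C = \<psi> (SOME v. v \<in> carrier M \<and> C = N +>\<^bsub>M\<^esub> v)" for C
  have f: "f (N +>\<^bsub>M\<^esub> v) = \<psi> v" if v: "v \<in> carrier M" for v
  proof -
    have "(SOME w. w \<in> carrier M \<and> N +>\<^bsub>M\<^esub> v = N +>\<^bsub>M\<^esub> w) \<in> carrier M \<and>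
        N +>\<^bsub>M\<^esub> v = N +>\<^bsub>M\<^esub> (SOME w. w \<in> carrier M \<and> N +>\<^bsub>M\<^esub> v = N +>\<^bsub>M\<^esub> w)"
      by (rule someI[of _ v]) (use v in simp)
    then show ?thesis unfolding f_def using \<psi>eq v by metis
  qed
  let ?X = "quotient_module M N"
  have inj: "inj_on f (carrier ?X)"
    unfolding quotient_carrier by (rule inj_onI) (auto simp: f \<psi>eq)
  have hom: "f \<in> module_hom R ?X P"
    by (rule module_homI)
      (auto simp: quotient_carrier quotient_add quotient_smult f \<psi>c module_hom_add[OF \<psi>]
        module_hom_smult[OF \<psi>] smult_closed)
  show "left_module R ?X"
  proof (rule left_module_injective[OF P _ inj])
    show "\<zero>\<^bsub>?X\<^esub> \<in> carrier ?X" unfolding quotient_zero quotient_carrier by simp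
    show "f \<zero>\<^bsub>?X\<^esub> = \<zero>\<^bsub>P\<^esub>" unfolding quotient_zero
      using f[OF M.zero_closed] ker[OF M.zero_closed] submoduleD(2)[OF sub] by simp
    show "f \<in> carrier ?X \<rightarrow> carrier P" by (rule module_hom_closed[OF hom])
    show "f (x \<oplus>\<^bsub>?X\<^esub> y) = f x \<oplus>\<^bsub>P\<^esub> f y" if "x \<in> carrier ?X" "y \<in> carrier ?X" for x y
      by (rule module_hom_add[OF hom that])
    show "f (a \<odot>\<^bsub>?X\<^esub> x) = a \<odot>\<^bsub>P\<^esub> f x" if "a \<in> carrier R" "x \<in> carrier ?X" for a x
      by (rule module_hom_smult[OF hom that])
    show "x \<oplus>\<^bsub>?X\<^esub> y \<in> carrier ?X" if "x \<in> carrier ?X" "y \<in> carrier ?X" for x y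
      using that unfolding quotient_carrier by (auto simp: quotient_add)
    show "a \<odot>\<^bsub>?X\<^esub> x \<in> carrier ?X" if "a \<in> carrier R" "x \<in> carrier ?X" for a x
      using that unfolding quotient_carrier by (auto simp: quotient_smult smult_closed)
  qed
  have "f ` carrier ?X = \<psi> ` carrier M" unfolding quotient_carrier image_image by (simp add: f)
  then show "modules_isomorphic R ?X P"
    unfolding modules_isomorphic_def bij_betw_def using hom inj surj by auto
qed

lemma quotient_iso_hom:
  assumes P: "left_module R P" and iso: "modules_isomorphic R (quotient_module M N) P"
  obtains \<psi> where "\<psi> \<in> module_hom R M P" "\<psi> ` carrier M = carrier P"
    "\<And>v. v \<in> carrier M \<Longrightarrow> \<psi> v = \<zero>\<^bsub>P\<^esub> \<longleftrightarrow> v \<in> N"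
proof -
  interpret P: left_module R P by (rule P)
  interpret N: abelian_subgroup N M by (rule abelian_subgroup_N)
  let ?X = "quotient_module M N"
  obtain f where f: "f \<in> module_hom R ?X P" "bij_betw f (carrier ?X) (carrier P)"
    using iso by (rule modules_isomorphicE)
  let ?\<psi> = "\<lambda>v. f (N +>\<^bsub>M\<^esub> v)"
  have c: "N +>\<^bsub>M\<^esub> v \<in> carrier ?X" if "v \<in> carrier M" for v using that unfolding quotient_carrier by blast
  have hom: "?\<psi> \<in> module_hom R M P"
  proof (rule module_homI)
    show "?\<psi> x \<in> carrier P" if "x \<in> carrier M" for x using module_hom_in[OF f(1) c[OF that]] .
    show "?\<psi> (x \<oplus>\<^bsub>M\<^esub> y) = ?\<psi> x \<oplus>\<^bsub>P\<^esub> ?\<psi> y" if "x \<in> carrier M" "y \<in> carrier M" for x y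
      using that quotient_add[OF that] module_hom_add[OF f(1) c c] by metis
    show "?\<psi> (a \<odot>\<^bsub>M\<^esub> x) = a \<odot>\<^bsub>P\<^esub> ?\<psi> x" if "a \<in> carrier R" "x \<in> carrier M" for a x
      using that quotient_smult[OF that] module_hom_smult[OF f(1) _ c] by metis
  qed
  have inj: "inj_on f (carrier ?X)" and surj: "f ` carrier ?X = carrier P"
    using f(2) by (auto simp: bij_betw_def)
  have 0: "?\<psi> \<zero>\<^bsub>M\<^esub> = \<zero>\<^bsub>P\<^esub>"
    by (rule module_hom_zero[OF _ P hom]) (rule left_module_axioms)
  show thesis
  proof (rule that[OF hom])
    show "?\<psi> ` carrier M = carrier P" using surj unfolding quotient_carrier image_image .
    fix v assume v: "v \<in> carrier M"
    have "?\<psi> v = \<zero>\<^bsub>P\<^esub> \<longleftrightarrow> N +>\<^bsub>M\<^esub> v = N +>\<^bsub>M\<^esub> \<zero>\<^bsub>M\<^esub>"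
      using 0 inj_on_eq_iff[OF inj c[OF v] c[OF M.zero_closed]] by simp
    also have "\<dots> \<longleftrightarrow> v \<in> N" using coset_eq_iff[OF v M.zero_closed] minus_zero_right[OF v] by simp
    finally show "?\<psi> v = \<zero>\<^bsub>P\<^esub> \<longleftrightarrow> v \<in> N" .
  qed
qed

end

lemma submodule_pair_restrict:
  assumes "left_module R M" "Module.submodule F R M" "Module.submodule F' R M" "F' \<subseteq> F"
  shows "submodule_pair R (M\<lparr>carrier := F\<rparr>) F'"
  using left_module_submodule[OF assms(1,2)] submodule_restrict_iff[OF assms(1,2)] assms(3,4)
  unfolding submodule_pair_def submodule_pair_axioms_def by blast

text \<open>The condition that \<open>F/F'\<close> is isomorphic to \<open>P\<close>, expressed without quotients.\<close>

definition layer_hom ::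
  "('r, 'p) ring_scheme \<Rightarrow> ('r, 'm, 'q) module_scheme \<Rightarrow> 'm set \<Rightarrow> 'm set \<Rightarrow> ('r, 'n, 's) module_scheme \<Rightarrow> ('m \<Rightarrow> 'n) \<Rightarrow> bool" where
  "layer_hom R M F F' P \<psi> \<longleftrightarrow> \<psi> \<in> module_hom R (M\<lparr>carrier := F\<rparr>) P \<and> \<psi> ` F = carrier P \<and>
     (\<forall>v \<in> F. \<psi> v = \<zero>\<^bsub>P\<^esub> \<longleftrightarrow> v \<in> F')"

lemma layer_hom_iso:
  assumes "left_module R M" "Module.submodule F R M" "Module.submodule F' R M" "F' \<subseteq> F"
    and P: "left_module R P"
  shows "modules_isomorphic R (quotient_module (M\<lparr>carrier := F\<rparr>) F') P \<longleftrightarrow> (\<exists>\<psi>. layer_hom R M F F' P \<psi>)"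
proof -
  interpret S: submodule_pair R "M\<lparr>carrier := F\<rparr>" F' by (rule submodule_pair_restrict[OF assms(1-4)])
  show ?thesis
  proof
    assume "modules_isomorphic R (quotient_module (M\<lparr>carrier := F\<rparr>) F') P"
    then obtain \<psi> where "\<psi> \<in> module_hom R (M\<lparr>carrier := F\<rparr>) P" "\<psi> ` carrier (M\<lparr>carrier := F\<rparr>) = carrier P"
      "\<And>v. v \<in> carrier (M\<lparr>carrier := F\<rparr>) \<Longrightarrow> \<psi> v = \<zero>\<^bsub>P\<^esub> \<longleftrightarrow> v \<in> F'"
      by (rule S.quotient_iso_hom[OF P]) blast
    then have "layer_hom R M F F' P \<psi>" unfolding layer_hom_def by simp
    then show "\<exists>\<psi>. layer_hom R M F F' P \<psi>" by blast
  next
    assume "\<exists>\<psi>. layer_hom R M F F' P \<psi>"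
    then obtain \<psi> where "layer_hom R M F F' P \<psi>" by blast
    then show "modules_isomorphic R (quotient_module (M\<lparr>carrier := F\<rparr>) F') P"
      by (intro S.quotient_iso(2)[OF P, of \<psi>]) (simp_all add: layer_hom_def)
  qed
qed

lemma layer_hom_left_module:
  assumes "left_module R M" "Module.submodule F R M" "Module.submodule F' R M" "F' \<subseteq> F"
    and P: "left_module R P" and \<psi>: "layer_hom R M F F' P \<psi>"
  shows "left_module R (quotient_module (M\<lparr>carrier := F\<rparr>) F')"
proof -
  interpret S: submodule_pair R "M\<lparr>carrier := F\<rparr>" F' by (rule submodule_pair_restrict[OF assms(1-4)])
  show ?thesis
    by (rule S.quotient_iso(1)[OF P, of \<psi>]) (use \<psi> in \<open>auto simp: layer_hom_def\<close>)
qed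

text \<open>Semisimplicity of a layer is inherited from \<open>\<S> l\<close> along the isomorphism,
  by \<open>semisimple_isomorphic\<close>, so a surjection with the right kernel carries all the
  information about a layer.\<close>

lemma governed_filtration_iff:
  assumes M: "left_module R M" and \<S>: "\<And>l. l \<le> L \<Longrightarrow> semisimple_module R (\<S> l)"
  shows "governed_filtration R L \<S> M F \<longleftrightarrow>
    F 0 = carrier M \<and> F (Suc L) = {\<zero>\<^bsub>M\<^esub>} \<and> (\<forall>l \<le> Suc L. Module.submodule (F l) R M) \<and>
    (\<forall>l \<le> L. F (Suc l) \<subseteq> F l \<and> (\<exists>\<psi>. layer_hom R M (F l) (F (Suc l)) (\<S> l) \<psi>))"
proof -
  have \<S>m: "left_module R (\<S> l)" if "l \<le> L" for l using \<S>[OF that] unfolding semisimple_module_def by blast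
  have "semisimple_module R (quotient_module (M\<lparr>carrier := F l\<rparr>) (F (Suc l))) \<and>
       modules_isomorphic R (quotient_module (M\<lparr>carrier := F l\<rparr>) (F (Suc l))) (\<S> l) \<longleftrightarrow>
       (\<exists>\<psi>. layer_hom R M (F l) (F (Suc l)) (\<S> l) \<psi>)"
    if l: "l \<le> L" and sub: "\<forall>l \<le> Suc L. Module.submodule (F l) R M" "F (Suc l) \<subseteq> F l" for l
  proof -
    have s: "Module.submodule (F l) R M" "Module.submodule (F (Suc l)) R M" using l sub(1) by auto
    note iso = layer_hom_iso[OF M s sub(2) \<S>m[OF l]]
    show ?thesis
      using iso layer_hom_left_module[OF M s sub(2) \<S>m[OF l]] semisimple_isomorphic[OF _ _ \<S>[OF l]] by blast
  qed
  then show ?thesis unfolding governed_filtration_def by blast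
qed

section \<open>Modules over a quotient of a path algebra\<close>

context quiver_ideal
begin

text \<open>The elements annihilated by all of \<open>len_ge 1\<close> form a submodule
  \<open>Ker\<close>. A simple submodule \<open>S\<close> lies in it or meets it in zero. In the
  second case induction downwards from the nilpotency bound shows that \<open>len_ge k\<close> kills
  \<open>S\<close>: if longer elements kill \<open>S\<close>, then \<open>cls f\<close> maps
  \<open>S\<close> into \<open>Ker\<close>. At \<open>k = 0\<close> the unit kills \<open>S\<close>,
  so \<open>S\<close> would be zero.\<close>

lemma semisimple_killed:
  assumes M: "semisimple_module Lam M" and f: "f \<in> len_ge 1" and v: "v \<in> carrier M"
  shows "cls f \<odot>\<^bsub>M\<^esub> v = \<zero>\<^bsub>M\<^esub>"
proof -
  have Mm: "left_module Lam M" using M unfolding semisimple_module_def by blast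
  interpret M: left_module Lam M by (rule Mm)
  define Ker where "Ker = {v \<in> carrier M. \<forall>f \<in> len_ge 1. cls f \<odot>\<^bsub>M\<^esub> v = \<zero>\<^bsub>M\<^esub>}"
  have mult: "cls f \<odot>\<^bsub>M\<^esub> (cls g \<odot>\<^bsub>M\<^esub> v) = cls (f \<otimes>\<^bsub>KQ\<^esub> g) \<odot>\<^bsub>M\<^esub> v"
    if "f \<in> carrier KQ" "g \<in> carrier KQ" "v \<in> carrier M" for f g v
    using that by (simp add: M.smult_assoc1[symmetric] cls_mult)
  have Ker: "Module.submodule Ker Lam M"
  proof (rule M.submoduleI)
    show "Ker \<subseteq> carrier M" unfolding Ker_def by blast
    show "\<zero>\<^bsub>M\<^esub> \<in> Ker" unfolding Ker_def using len_ge_carrier by (auto simp: M.smult_r_null)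
    show "x \<oplus>\<^bsub>M\<^esub> y \<in> Ker" if "x \<in> Ker" "y \<in> Ker" for x y
      using that unfolding Ker_def using len_ge_carrier by (auto simp: M.smult_r_distr)
    show "a \<odot>\<^bsub>M\<^esub> x \<in> Ker" if a: "a \<in> carrier Lam" "x \<in> Ker" for a x
    proof -
      obtain g where g: "g \<in> carrier KQ" "a = cls g" using a(1) unfolding carrier_Lam by blast
      have "f \<otimes>\<^bsub>KQ\<^esub> g \<in> len_ge 1" if "f \<in> len_ge 1" for f
        using len_ge_mult[of f 1 g 0] that g by (simp add: len_ge_0)
      then show ?thesis using a g unfolding Ker_def
        using mult len_ge_carrier by (auto simp: M.smult_closed)
    qed
  qed
  have "S \<subseteq> Ker" if S: "Module.submodule S Lam M" "simple_module Lam (M\<lparr>carrier := S\<rparr>)" for S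
  proof -
    note s = submoduleD[OF S(1)]
    have "Module.submodule (Ker \<inter> S) Lam M"
      by (rule M.submoduleI) (use s submoduleD[OF Ker] in auto)
    then have "Module.submodule (Ker \<inter> S) Lam (M\<lparr>carrier := S\<rparr>)"
      using submodule_restrict_iff[OF Mm S(1)] by blast
    then consider "Ker \<inter> S = {\<zero>\<^bsub>M\<^esub>}" | "Ker \<inter> S = S" using S(2) unfolding simple_module_def by auto
    then show ?thesis
    proof cases
      case 1
      obtain m where m: "len_ge m \<subseteq> I" using long_in_I by blast
      have base: "\<forall>f \<in> len_ge m. \<forall>v \<in> S. cls f \<odot>\<^bsub>M\<^esub> v = \<zero>\<^bsub>M\<^esub>"
      proof (intro ballI)
        fix f v assume "f \<in> len_ge m" "v \<in> S"
        then have "f \<in> I" "v \<in> carrier M" using m s(1) by blast+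
        from cls_ideal[OF this(1)] this(2)
        show "cls f \<odot>\<^bsub>M\<^esub> v = \<zero>\<^bsub>M\<^esub>" by (simp add: M.smult_l_null)
      qed
      have step: "\<forall>f \<in> len_ge k. \<forall>v \<in> S. cls f \<odot>\<^bsub>M\<^esub> v = \<zero>\<^bsub>M\<^esub>"
        if IH: "\<forall>f \<in> len_ge (Suc k). \<forall>v \<in> S. cls f \<odot>\<^bsub>M\<^esub> v = \<zero>\<^bsub>M\<^esub>" for k
      proof (intro ballI)
        fix f v assume f: "f \<in> len_ge k" and v: "v \<in> S"
        have fv: "cls f \<odot>\<^bsub>M\<^esub> v \<in> S" using s(4) v len_ge_carrier[OF f] by simp
        have "cls g \<odot>\<^bsub>M\<^esub> (cls f \<odot>\<^bsub>M\<^esub> v) = \<zero>\<^bsub>M\<^esub>" if g: "g \<in> len_ge 1" for g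
          using mult[OF len_ge_carrier[OF g] len_ge_carrier[OF f]] len_ge_mult[OF g f] IH v s(1) by auto
        then have "cls f \<odot>\<^bsub>M\<^esub> v \<in> Ker" unfolding Ker_def using fv s(1) by auto
        then show "cls f \<odot>\<^bsub>M\<^esub> v = \<zero>\<^bsub>M\<^esub>" using fv 1 by blast
      qed
      have "\<forall>f \<in> len_ge 0. \<forall>v \<in> S. cls f \<odot>\<^bsub>M\<^esub> v = \<zero>\<^bsub>M\<^esub>"
        by (rule inc_induct[where P = "\<lambda>k. \<forall>f \<in> len_ge k. \<forall>v \<in> S. cls f \<odot>\<^bsub>M\<^esub> v = \<zero>\<^bsub>M\<^esub>", OF le0 base])
          (rule step)
      then have one: "cls \<one>\<^bsub>KQ\<^esub> \<odot>\<^bsub>M\<^esub> v = \<zero>\<^bsub>M\<^esub>" if "v \<in> S" for v using that by (simp add: len_ge_0)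
      have "v = \<zero>\<^bsub>M\<^esub>" if "v \<in> S" for v
      proof -
        have "v \<in> carrier M" using that s(1) by blast
        then show ?thesis using one[OF that] by (simp add: cls_one M.smult_one)
      qed
      then have "S \<subseteq> {\<zero>\<^bsub>M\<^esub>}" by blast
      then have "S = {\<zero>\<^bsub>M\<^esub>}" using s(2) by blast
      then show ?thesis using S(2) unfolding simple_module_def by simp
    qed blast
  qed
  then have "Ker = carrier M" using M Ker unfolding semisimple_module_def by blast
  then have "v \<in> Ker" using v by simp
  then show ?thesis using f unfolding Ker_def by blast
qed

section \<open>The radical filtration of a module\<close>

lemma radical_power_0:
  assumes "left_module Lam M"
  shows "radical_power Lam M 0 = carrier M"
proof -
  interpret M: left_module Lam M by fact
  show ?thesis
  proof (intro equalityI subsetI)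
    fix v assume "v \<in> radical_power Lam M 0"
    then have "v \<in> ideal_smult (carrier Lam) M" by (simp add: radical_power_def)
    then show "v \<in> carrier M" by induction (auto intro: M.smult_closed)
  next
    fix v assume v: "v \<in> carrier M"
    have "\<one>\<^bsub>Lam\<^esub> \<odot>\<^bsub>M\<^esub> v \<in> radical_power Lam M 0"
      unfolding radical_power_def by (rule ideal_smult.smult) (use v in auto)
    then show "v \<in> radical_power Lam M 0" using v by (simp add: M.smult_one)
  qed
qed

lemma ideal_power_zero: "\<zero>\<^bsub>Lam\<^esub> \<in> ideal_power Lam (jacobson_radical Lam) k"
proof (induction k)
  case (Suc k)
  have "cls \<zero>\<^bsub>KQ\<^esub> \<in> jacobson_radical Lam" unfolding jacobson_eq using len_ge_zero by blast
  then have "cls \<zero>\<^bsub>KQ\<^esub> \<otimes>\<^bsub>Lam\<^esub> \<zero>\<^bsub>Lam\<^esub> \<in> ideal_power Lam (jacobson_radical Lam) (Suc k)"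
    unfolding ideal_power.simps using Suc by (intro ideal_prod.prod)
  then show ?case by simp
qed simp

lemma ideal_power_carrier: "ideal_power Lam (jacobson_radical Lam) k \<subseteq> carrier Lam"
  using jacobson_power_subset[of k] len_ge_carrier by auto

lemma radical_power_submodule:
  assumes "left_module Lam M"
  shows "Module.submodule (radical_power Lam M l) Lam M"
proof -
  interpret M: left_module Lam M by fact
  let ?J = "ideal_power Lam (jacobson_radical Lam) l"
  have sub: "v \<in> carrier M" if "v \<in> ideal_smult ?J M" for v
    using that by induction (use ideal_power_carrier in \<open>auto intro: M.smult_closed\<close>)
  show ?thesis
    unfolding radical_power_def
  proof (rule M.submoduleI)
    show "ideal_smult ?J M \<subseteq> carrier M" using sub by blast
    have "\<zero>\<^bsub>Lam\<^esub> \<odot>\<^bsub>M\<^esub> \<zero>\<^bsub>M\<^esub> \<in> ideal_smult ?J M"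
      by (rule ideal_smult.smult[OF ideal_power_zero]) simp
    then show "\<zero>\<^bsub>M\<^esub> \<in> ideal_smult ?J M" by (simp add: M.smult_l_null)
    show "a \<odot>\<^bsub>M\<^esub> x \<in> ideal_smult ?J M" if a: "a \<in> carrier Lam" and x: "x \<in> ideal_smult ?J M" for a x
      using x
    proof induction
      case (smult b m)
      have "(a \<otimes>\<^bsub>Lam\<^esub> b) \<odot>\<^bsub>M\<^esub> m \<in> ideal_smult ?J M"
        using jacobson_power_left[OF a smult(1)] smult(2) by (rule ideal_smult.smult)
      moreover have "b \<in> carrier Lam" using smult(1) ideal_power_carrier by blast
      ultimately show ?case using a smult by (simp add: M.smult_assoc1)
    next
      case (add m m')
      then show ?case using a sub by (auto simp: M.smult_r_distr intro: ideal_smult.add)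
    qed
  qed (rule ideal_smult.add)
qed

lemma radical_power_step:
  assumes "left_module Lam M" and f: "f \<in> len_ge 1" and v: "v \<in> radical_power Lam M l"
  shows "cls f \<odot>\<^bsub>M\<^esub> v \<in> radical_power Lam M (Suc l)"
proof -
  interpret M: left_module Lam M by fact
  let ?J = "ideal_power Lam (jacobson_radical Lam)"
  have fc: "cls f \<in> carrier Lam" using len_ge_carrier[OF f] by simp
  have sub: "radical_power Lam M l \<subseteq> carrier M" by (rule submoduleD(1)[OF radical_power_submodule[OF assms(1)]])
  show ?thesis
    using v sub unfolding radical_power_def
  proof induction
    case (smult b m)
    have "cls f \<otimes>\<^bsub>Lam\<^esub> b \<in> ?J (Suc l)"
      unfolding ideal_power.simps
      by (rule ideal_prod.prod[OF _ smult(1)]) (use f in \<open>simp only: jacobson_eq imageI\<close>)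
    then have "(cls f \<otimes>\<^bsub>Lam\<^esub> b) \<odot>\<^bsub>M\<^esub> m \<in> ideal_smult (?J (Suc l)) M"
      using smult(2) by (rule ideal_smult.smult)
    moreover have "b \<in> carrier Lam" using smult(1) ideal_power_carrier by blast
    ultimately show ?case using fc smult by (simp add: M.smult_assoc1 del: ideal_power.simps)
  next
    case (add m m')
    have "m \<in> carrier M" "m' \<in> carrier M" using add sub unfolding radical_power_def by auto
    then show ?case using add fc ideal_smult.add[of "cls f \<odot>\<^bsub>M\<^esub> m" "?J (Suc l)" M "cls f \<odot>\<^bsub>M\<^esub> m'"]
      by (simp add: M.smult_r_distr del: ideal_power.simps)
  qed
qed

text \<open>With \<open>radical_power_step\<close> this describes the next radical power as the
  additive group generated by the elements of \<open>len_ge 1\<close> applied to the current one; a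
  product \<open>i j\<close> in the power of the radical acts as \<open>i\<close> after
  \<open>j\<close>.\<close>

lemma radical_power_Suc_subset:
  assumes M: "left_module Lam M"
    and U: "\<And>x y. x \<in> U \<Longrightarrow> y \<in> U \<Longrightarrow> x \<oplus>\<^bsub>M\<^esub> y \<in> U"
      "\<And>f v. f \<in> len_ge 1 \<Longrightarrow> v \<in> radical_power Lam M l \<Longrightarrow> cls f \<odot>\<^bsub>M\<^esub> v \<in> U"
  shows "radical_power Lam M (Suc l) \<subseteq> U"
proof
  interpret M: left_module Lam M by fact
  let ?J = "ideal_power Lam (jacobson_radical Lam)"
  fix v assume "v \<in> radical_power Lam M (Suc l)"
  then have "v \<in> ideal_smult (?J (Suc l)) M" unfolding radical_power_def .
  then show "v \<in> U"
  proof induction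
    case (smult a m)
    have "a \<in> ideal_prod Lam (jacobson_radical Lam) (?J l)"
      using smult(1) unfolding ideal_power.simps .
    then have "a \<odot>\<^bsub>M\<^esub> m \<in> U \<and> a \<in> carrier Lam"
    proof induction
      case (prod i j)
      obtain f where f: "f \<in> len_ge 1" "i = cls f" using prod(1)[unfolded jacobson_eq] by (rule imageE)
      have j: "j \<in> carrier Lam" using prod(2) ideal_power_carrier by blast
      have "j \<odot>\<^bsub>M\<^esub> m \<in> radical_power Lam M l"
        unfolding radical_power_def by (rule ideal_smult.smult[OF prod(2) smult(2)])
      then have "cls f \<odot>\<^bsub>M\<^esub> (j \<odot>\<^bsub>M\<^esub> m) \<in> U" by (rule U(2)[OF f(1)])
      then show ?case using f j smult(2) len_ge_carrier[OF f(1)] by (simp add: M.smult_assoc1)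
    next
      case (sum s1 s2)
      then show ?case using smult(2) U(1) by (simp add: M.smult_l_distr)
    qed
    then show ?case ..
  qed (rule U(1))
qed

lemma radical_power_decreasing:
  assumes M: "left_module Lam M"
  shows "radical_power Lam M (Suc l) \<subseteq> radical_power Lam M l"
proof (rule radical_power_Suc_subset[OF M])
  note s = submoduleD[OF radical_power_submodule[OF M, of l]]
  show "cls f \<odot>\<^bsub>M\<^esub> v \<in> radical_power Lam M l" if "f \<in> len_ge 1" "v \<in> radical_power Lam M l" for f v
    using s(4)[OF cls_closed[OF len_ge_carrier[OF that(1)]] that(2)] .
qed (rule submoduleD(3)[OF radical_power_submodule[OF M]])

lemma radical_power_loewy:
  assumes "left_module Lam M"
  shows "radical_power Lam M (loewy_length Lam) = {\<zero>\<^bsub>M\<^esub>}"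
proof -
  interpret M: left_module Lam M by fact
  have "v = \<zero>\<^bsub>M\<^esub>" if "v \<in> ideal_smult {\<zero>\<^bsub>Lam\<^esub>} M" for v
    using that by induction (auto simp: M.smult_l_null)
  then have "radical_power Lam M (loewy_length Lam) \<subseteq> {\<zero>\<^bsub>M\<^esub>}"
    unfolding radical_power_def jacobson_power_loewy by blast
  then show ?thesis using submoduleD(2)[OF radical_power_submodule[OF assms]] by blast
qed

end

section \<open>Representations as modules\<close>

definition vsub :: "nat \<Rightarrow> 'k::field vec set \<Rightarrow> bool" where
  "vsub n U \<longleftrightarrow> U \<subseteq> carrier_vec n \<and> 0\<^sub>v n \<in> U \<and> (\<forall>v \<in> U. \<forall>w \<in> U. v + w \<in> U) \<and> (\<forall>c. \<forall>v \<in> U. c \<cdot>\<^sub>v v \<in> U)"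

lemma vsubD:
  assumes "vsub n U"
  shows "U \<subseteq> carrier_vec n" "0\<^sub>v n \<in> U" "\<And>v w. v \<in> U \<Longrightarrow> w \<in> U \<Longrightarrow> v + w \<in> U"
    "\<And>c v. v \<in> U \<Longrightarrow> c \<cdot>\<^sub>v v \<in> U"
  using assms unfolding vsub_def by auto

locale quiver_rep = quiver_ideal Q I + quiver_dim Q d
  for Q :: "('v, 'a) pre_digraph" and I :: "(('v, 'a) qpath \<Rightarrow> 'k::field) set" and d :: "'v \<Rightarrow> nat"
begin

definition V :: "('v \<Rightarrow> 'k vec) set" where
  "V = (\<Pi>\<^sub>E i \<in> verts Q. carrier_vec (d i))"

definition embed :: "'v \<Rightarrow> 'k vec \<Rightarrow> 'v \<Rightarrow> 'k vec" where
  "embed i w = (\<lambda>j \<in> verts Q. if j = i then w else 0\<^sub>v (d j))"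

definition plus_V :: "('v \<Rightarrow> 'k vec) \<Rightarrow> ('v \<Rightarrow> 'k vec) \<Rightarrow> 'v \<Rightarrow> 'k vec" (infixl "+\<^sub>V" 65) where
  "v +\<^sub>V w = (\<lambda>i \<in> verts Q. v i + w i)"

definition zero_V :: "'v \<Rightarrow> 'k vec" where
  "zero_V = (\<lambda>i \<in> verts Q. 0\<^sub>v (d i))"

lemma plus_V_at [simp]: "i \<in> verts Q \<Longrightarrow> (v +\<^sub>V w) i = v i + w i"
  by (simp add: plus_V_def)

lemma zero_V_at [simp]: "i \<in> verts Q \<Longrightarrow> zero_V i = 0\<^sub>v (d i)"
  by (simp add: zero_V_def)

lemma embed_at [simp]: "i \<in> verts Q \<Longrightarrow> embed i w i = w"
  by (simp add: embed_def)

lemma embed_at_neq [simp]: "j \<in> verts Q \<Longrightarrow> j \<noteq> i \<Longrightarrow> embed i w j = 0\<^sub>v (d j)"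
  by (simp add: embed_def)

lemma V_ext:
  assumes "v \<in> V" "w \<in> V" "\<And>i. i \<in> verts Q \<Longrightarrow> v i = w i"
  shows "v = w"
  using assms unfolding V_def by (metis PiE_ext)

lemma V_carrier [simp]: "v \<in> V \<Longrightarrow> i \<in> verts Q \<Longrightarrow> v i \<in> carrier_vec (d i)"
  unfolding V_def by auto

lemma V_I: "(\<And>i. i \<in> verts Q \<Longrightarrow> f i \<in> carrier_vec (d i)) \<Longrightarrow> (\<lambda>i \<in> verts Q. f i) \<in> V"
  unfolding V_def by auto

lemma plus_V_closed [simp]: "v \<in> V \<Longrightarrow> w \<in> V \<Longrightarrow> v +\<^sub>V w \<in> V"
  unfolding plus_V_def by (rule V_I) simp

lemma zero_V_closed [simp]: "zero_V \<in> V"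
  unfolding zero_V_def by (rule V_I) simp

lemma embed_closed [simp]: "w \<in> carrier_vec (d i) \<Longrightarrow> embed i w \<in> V"
  unfolding embed_def by (rule V_I) simp

section \<open>Path maps and the action of the path algebra\<close>

lemma path_map_Nil [simp]: "path_map x [] w = w"
  by (simp add: path_map_def)

lemma path_map_Cons [simp]: "path_map x (\<alpha> # p) w = path_map x p (x \<alpha> *\<^sub>v w)"
  by (simp add: path_map_def)

lemma path_map_append: "path_map x (p @ r) w = path_map x r (path_map x p w)"
  by (simp add: path_map_def)

lemma qpaths_Cons: "(u, \<alpha> # p) \<in> qpaths Q \<longleftrightarrow> \<alpha> \<in> arcs Q \<and> u = tail Q \<alpha> \<and> (head Q \<alpha>, p) \<in> qpaths Q"
  using qpaths_append[of u "[\<alpha>]" p] by auto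

lemma qend_Cons: "qend Q (u, \<alpha> # p) = qend Q (head Q \<alpha>, p)"
  using qend_append[of u "[\<alpha>]" p] by simp

lemma smult_zero: "c \<cdot>\<^sub>v 0\<^sub>v n = (0\<^sub>v n :: 'k vec)"
  by (rule eq_vecI) simp_all

lemma V_restrict: "v \<in> V \<Longrightarrow> (\<lambda>i \<in> verts Q. v i) = v"
  unfolding V_def by (rule PiE_restrict)

lemma arrow_carrier:
  "x \<in> rep_space Q d \<Longrightarrow> (u, \<alpha> # p) \<in> qpaths Q \<Longrightarrow> (head Q \<alpha>, p) \<in> qpaths Q \<and> x \<alpha> \<in> carrier_mat (d (head Q \<alpha>)) (d u)"
  using rep_space_carrier[of x \<alpha>] unfolding qpaths_Cons by auto

lemma path_map_closed:
  assumes x: "x \<in> rep_space Q d" and p: "(u, p) \<in> qpaths Q" and w: "w \<in> carrier_vec (d u)"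
  shows "path_map x p w \<in> carrier_vec (d (qend Q (u, p)))"
  using p w
proof (induction p arbitrary: u w)
  case (Cons \<alpha> p)
  have a: "(head Q \<alpha>, p) \<in> qpaths Q" "x \<alpha> \<in> carrier_mat (d (head Q \<alpha>)) (d u)"
    using arrow_carrier[OF x Cons.prems(1)] by auto
  show ?case using Cons.IH[OF a(1) mult_mat_vec_carrier[OF a(2) Cons.prems(2)]] by (simp add: qend_Cons)
qed simp

lemma path_map_add:
  assumes x: "x \<in> rep_space Q d" and p: "(u, p) \<in> qpaths Q"
    and w: "w \<in> carrier_vec (d u)" "w' \<in> carrier_vec (d u)"
  shows "path_map x p (w + w') = path_map x p w + path_map x p w'"
  using p w
proof (induction p arbitrary: u w w')
  case (Cons \<alpha> p)
  have a: "(head Q \<alpha>, p) \<in> qpaths Q" "x \<alpha> \<in> carrier_mat (d (head Q \<alpha>)) (d u)"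
    using arrow_carrier[OF x Cons.prems(1)] by auto
  show ?case
    using Cons.IH[OF a(1) mult_mat_vec_carrier[OF a(2) Cons.prems(2)] mult_mat_vec_carrier[OF a(2) Cons.prems(3)]]
      mult_add_distrib_mat_vec[OF a(2) Cons.prems(2,3)] by simp
qed simp

lemma path_map_smult:
  assumes x: "x \<in> rep_space Q d" and p: "(u, p) \<in> qpaths Q" and w: "w \<in> carrier_vec (d u)"
  shows "path_map x p (c \<cdot>\<^sub>v w) = c \<cdot>\<^sub>v path_map x p w"
  using p w
proof (induction p arbitrary: u w)
  case (Cons \<alpha> p)
  have a: "(head Q \<alpha>, p) \<in> qpaths Q" "x \<alpha> \<in> carrier_mat (d (head Q \<alpha>)) (d u)"
    using arrow_carrier[OF x Cons.prems(1)] by auto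
  show ?case
    using Cons.IH[OF a(1) mult_mat_vec_carrier[OF a(2) Cons.prems(2)]] mult_mat_vec[OF a(2) Cons.prems(2)] by simp
qed simp

lemma path_map_zero:
  assumes x: "x \<in> rep_space Q d" and p: "(u, p) \<in> qpaths Q"
  shows "path_map x p (0\<^sub>v (d u)) = 0\<^sub>v (d (qend Q (u, p)))"
  using p
proof (induction p arbitrary: u)
  case (Cons \<alpha> p)
  have "x \<alpha> *\<^sub>v 0\<^sub>v (d u) = 0\<^sub>v (d (head Q \<alpha>))" using arrow_carrier[OF x Cons.prems] by auto
  then show ?case using arrow_carrier[OF x Cons.prems] Cons.IH by (simp add: qend_Cons)
qed simp

lemma rep_action_closed [simp]: "rep_action Q d x f v \<in> V"
  unfolding rep_action_def by (rule V_I) simp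

text \<open>The support of a sum can be smaller than the union of the supports, so additivity is
  computed over a common finite set \<open>T\<close> on which some coefficients may be zero.\<close>

lemma rep_action_index:
  assumes "i \<in> verts Q" "j < d i" "finite T" "{q. f q \<noteq> 0} \<subseteq> T"
  shows "rep_action Q d x f v i $ j = (\<Sum>q \<in> {q \<in> T. qend Q q = i}. f q * path_map x (snd q) (v (fst q)) $ j)"
proof -
  have "(\<Sum>q \<in> {q. f q \<noteq> 0 \<and> qend Q q = i}. f q * path_map x (snd q) (v (fst q)) $ j)
      = (\<Sum>q \<in> {q \<in> T. qend Q q = i}. f q * path_map x (snd q) (v (fst q)) $ j)"
    using assms(3,4) by (intro sum.mono_neutral_left) auto
  then show ?thesis using assms(1,2) by (simp add: rep_action_def)
qed

lemma rep_action_dim: "i \<in> verts Q \<Longrightarrow> dim_vec (rep_action Q d x f v i) = d i"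
  unfolding rep_action_def by simp

lemma rep_action_add_left:
  assumes "f \<in> carrier KQ" "g \<in> carrier KQ"
  shows "rep_action Q d x (f \<oplus>\<^bsub>KQ\<^esub> g) v = rep_action Q d x f v +\<^sub>V rep_action Q d x g v"
proof (rule V_ext)
  fix i assume i: "i \<in> verts Q"
  let ?T = "{q. f q \<noteq> 0} \<union> {q. g q \<noteq> 0}"
  have T: "finite ?T" using assms unfolding carrier_KQ by simp
  show "rep_action Q d x (f \<oplus>\<^bsub>KQ\<^esub> g) v i = (rep_action Q d x f v +\<^sub>V rep_action Q d x g v) i"
  proof (rule eq_vecI)
    fix j assume "j < dim_vec ((rep_action Q d x f v +\<^sub>V rep_action Q d x g v) i)"
    then have j: "j < d i" using i by (simp add: rep_action_dim)
    have "rep_action Q d x (f \<oplus>\<^bsub>KQ\<^esub> g) v i $ j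
        = (\<Sum>q \<in> {q \<in> ?T. qend Q q = i}. (f \<oplus>\<^bsub>KQ\<^esub> g) q * path_map x (snd q) (v (fst q)) $ j)"
      by (rule rep_action_index[OF i j T]) (auto simp: add_KQ)
    also have "\<dots> = rep_action Q d x f v i $ j + rep_action Q d x g v i $ j"
      by (subst (1 2) rep_action_index[OF i j T]) (auto simp: add_KQ sum.distrib distrib_right)
    finally show "rep_action Q d x (f \<oplus>\<^bsub>KQ\<^esub> g) v i $ j = (rep_action Q d x f v +\<^sub>V rep_action Q d x g v) i $ j"
      using i j by (simp add: rep_action_dim)
  qed (use i in \<open>simp add: rep_action_dim\<close>)
qed simp_all

lemma rep_action_zero: "rep_action Q d x \<zero>\<^bsub>KQ\<^esub> v = zero_V"
proof (rule V_ext)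
  show "rep_action Q d x \<zero>\<^bsub>KQ\<^esub> v i = zero_V i" if "i \<in> verts Q" for i
    using that by (intro eq_vecI) (simp_all add: rep_action_def zero_KQ)
qed simp_all

lemma rep_action_single:
  assumes x: "x \<in> rep_space Q d" and q: "q \<in> qpaths Q" and v: "v \<in> V"
  shows "rep_action Q d x (\<lambda>q'. c * path_elem q q') v = embed (qend Q q) (c \<cdot>\<^sub>v path_map x (snd q) (v (fst q)))"
proof -
  have w: "path_map x (snd q) (v (fst q)) \<in> carrier_vec (d (qend Q q))"
    using path_map_closed[OF x, of "fst q" "snd q" "v (fst q)"] q v fst_verts[OF q] by simp
  show ?thesis
  proof (rule V_ext)
    fix i assume i: "i \<in> verts Q"
    show "rep_action Q d x (\<lambda>q'. c * path_elem q q') v i = embed (qend Q q) (c \<cdot>\<^sub>v path_map x (snd q) (v (fst q))) i"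
    proof (rule eq_vecI)
      show "dim_vec (rep_action Q d x (\<lambda>q'. c * path_elem q q') v i) = dim_vec (embed (qend Q q) (c \<cdot>\<^sub>v path_map x (snd q) (v (fst q))) i)"
        using i w by (auto simp: rep_action_dim embed_def)
      fix j assume "j < dim_vec (embed (qend Q q) (c \<cdot>\<^sub>v path_map x (snd q) (v (fst q))) i)"
      then have j: "j < d i" using i w by (auto simp: embed_def split: if_splits)
      have "rep_action Q d x (\<lambda>q'. c * path_elem q q') v i $ j
          = (\<Sum>q' \<in> {q' \<in> {q}. qend Q q' = i}. c * path_elem q q' * path_map x (snd q') (v (fst q')) $ j)"
        by (rule rep_action_index[OF i j]) (auto simp: path_elem_def)
      also have "\<dots> = embed (qend Q q) (c \<cdot>\<^sub>v path_map x (snd q) (v (fst q))) i $ j"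
      proof (cases "qend Q q = i")
        case True
        then have "{q' \<in> {q}. qend Q q' = i} = {q}" by auto
        then show ?thesis using True i j w by (simp add: embed_def path_elem_def)
      next
        case False
        then have "{q' \<in> {q}. qend Q q' = i} = {}" by auto
        then show ?thesis using False i j by (auto simp: embed_def simp del: Collect_empty_eq)
      qed
      finally show "rep_action Q d x (\<lambda>q'. c * path_elem q q') v i $ j = embed (qend Q q) (c \<cdot>\<^sub>v path_map x (snd q) (v (fst q))) i $ j" .
    qed
  qed (use w in simp_all)
qed

lemma single_closed: "q \<in> qpaths Q \<Longrightarrow> (\<lambda>q'. c * path_elem q q') \<in> carrier KQ"
  by (rule smult_KQ_closed) simp

lemma embed_add:
  assumes "w \<in> carrier_vec (d i)" "w' \<in> carrier_vec (d i)"
  shows "embed i (w + w') = embed i w +\<^sub>V embed i w'"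
proof (rule V_ext)
  show "embed i (w + w') j = (embed i w +\<^sub>V embed i w') j" if "j \<in> verts Q" for j
    using that by (cases "j = i") simp_all
qed (use assms in simp_all)

lemma embed_zero: "embed i (0\<^sub>v (d i)) = zero_V"
proof (rule V_ext)
  show "embed i (0\<^sub>v (d i)) j = zero_V j" if "j \<in> verts Q" for j
    using that by (cases "j = i") simp_all
qed simp_all

lemma zero_V_left: "v \<in> V \<Longrightarrow> zero_V +\<^sub>V v = v"
  by (rule V_ext) simp_all

lemma plus_V_assoc: "u \<in> V \<Longrightarrow> v \<in> V \<Longrightarrow> w \<in> V \<Longrightarrow> u +\<^sub>V v +\<^sub>V w = u +\<^sub>V (v +\<^sub>V w)"
  by (rule V_ext) (simp_all add: assoc_add_vec[OF V_carrier V_carrier V_carrier])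

lemma plus_V_comm: "v \<in> V \<Longrightarrow> w \<in> V \<Longrightarrow> v +\<^sub>V w = w +\<^sub>V v"
  by (rule V_ext) (simp_all add: comm_add_vec[OF V_carrier V_carrier])

lemma plus_V_4:
  assumes "a \<in> V" "b \<in> V" "c \<in> V" "e \<in> V"
  shows "(a +\<^sub>V b) +\<^sub>V (c +\<^sub>V e) = (a +\<^sub>V c) +\<^sub>V (b +\<^sub>V e)"
proof -
  have "(a +\<^sub>V b) +\<^sub>V (c +\<^sub>V e) = a +\<^sub>V ((b +\<^sub>V c) +\<^sub>V e)"
    using assms by (simp add: plus_V_assoc)
  also have "\<dots> = a +\<^sub>V ((c +\<^sub>V b) +\<^sub>V e)" using assms plus_V_comm[of b c] by simp
  finally show ?thesis using assms by (simp add: plus_V_assoc)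
qed

lemma rep_action_add_right:
  assumes x: "x \<in> rep_space Q d" and f: "f \<in> carrier KQ" and v: "v \<in> V" "w \<in> V"
  shows "rep_action Q d x f (v +\<^sub>V w) = rep_action Q d x f v +\<^sub>V rep_action Q d x f w"
proof -
  have "f \<in> len_ge 0" using f by (simp add: len_ge_0)
  then show ?thesis
  proof (induction rule: len_ge_induct)
    case zero
    then show ?case by (simp only: rep_action_zero zero_V_left zero_V_closed)
  next
    case (add c q f)
    let ?s = "\<lambda>q'. c * path_elem q q'"
    note c = single_closed[OF add.hyps(1)] len_ge_carrier[OF add.hyps(3)]
    have u: "fst q \<in> verts Q" by (rule fst_verts[OF add.hyps(1)])
    have pc: "path_map x (snd q) (z (fst q)) \<in> carrier_vec (d (qend Q q))" if "z \<in> V" for z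
      using path_map_closed[OF x, of "fst q" "snd q" "z (fst q)"] add.hyps(1) u that by simp
    have "path_map x (snd q) ((v +\<^sub>V w) (fst q)) = path_map x (snd q) (v (fst q)) + path_map x (snd q) (w (fst q))"
      using path_map_add[OF x, of "fst q" "snd q"] add.hyps(1) u v by simp
    then have "rep_action Q d x ?s (v +\<^sub>V w) = rep_action Q d x ?s v +\<^sub>V rep_action Q d x ?s w"
      using v pc by (simp add: rep_action_single[OF x add.hyps(1)] smult_add_distrib_vec[OF pc pc] embed_add)
    then show ?case
      by (simp only: rep_action_add_left[OF c] add.IH) (rule plus_V_4, simp_all)
  qed
qed

lemma single_mult:
  "(\<lambda>q'. c * path_elem q q') \<otimes>\<^bsub>KQ\<^esub> (\<lambda>p'. e * path_elem p p') = (\<lambda>r. (c * e) * (path_elem q \<otimes>\<^bsub>KQ\<^esub> path_elem p) r)"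
proof
  fix r :: "('v, 'a) qpath"
  show "((\<lambda>q'. c * path_elem q q') \<otimes>\<^bsub>KQ\<^esub> (\<lambda>p'. e * path_elem p p')) r = (c * e) * (path_elem q \<otimes>\<^bsub>KQ\<^esub> path_elem p) r"
    by (cases r) (simp add: mult_KQ sum_distrib_left mult_ac)
qed

lemma rep_action_mult_single:
  assumes x: "x \<in> rep_space Q d" and v: "v \<in> V" and q: "q \<in> qpaths Q" "p \<in> qpaths Q"
  shows "rep_action Q d x ((\<lambda>q'. c * path_elem q q') \<otimes>\<^bsub>KQ\<^esub> (\<lambda>p'. e * path_elem p p')) v
    = rep_action Q d x (\<lambda>q'. c * path_elem q q') (rep_action Q d x (\<lambda>p'. e * path_elem p p') v)"
proof -
  obtain u a where p': "p = (u, a)" by fastforce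
  obtain y b where q': "q = (y, b)" by fastforce
  have u: "u \<in> verts Q" and y: "y \<in> verts Q" using fst_verts q unfolding p' q' by auto
  have pc: "path_map x a (v u) \<in> carrier_vec (d (qend Q p))"
    using path_map_closed[OF x _ V_carrier[OF v u]] q(2) unfolding p' by simp
  have R: "rep_action Q d x (\<lambda>q'. c * path_elem q q') (rep_action Q d x (\<lambda>p'. e * path_elem p p') v)
     = embed (qend Q q) (c \<cdot>\<^sub>v path_map x b (embed (qend Q p) (e \<cdot>\<^sub>v path_map x a (v u)) y))"
    using pc by (subst rep_action_single[OF x q(2) v], subst rep_action_single[OF x q(1)]) (simp_all add: p' q')
  show ?thesis
  proof (cases "qend Q p = y")
    case True
    then have pq: "(u, a @ b) \<in> qpaths Q" "qend Q (u, a @ b) = qend Q q"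
      using q unfolding p' q' by (simp_all add: qpaths_append qend_append)
    have pc': "path_map x a (v u) \<in> carrier_vec (d y)" using pc True by simp
    have "path_map x b (e \<cdot>\<^sub>v path_map x a (v u)) = e \<cdot>\<^sub>v path_map x b (path_map x a (v u))"
      using path_map_smult[OF x _ pc'] q(1) unfolding q' by simp
    moreover have "rep_action Q d x ((\<lambda>q'. c * path_elem q q') \<otimes>\<^bsub>KQ\<^esub> (\<lambda>p'. e * path_elem p p')) v
        = rep_action Q d x (\<lambda>r. (c * e) * path_elem (u, a @ b) r) v"
      using True unfolding single_mult path_elem_mult[OF q] by (simp add: p' q')
    ultimately show ?thesis unfolding R using True y pq
      by (simp add: rep_action_single[OF x pq(1) v] embed_at path_map_append smult_smult_assoc)
  next
    case False
    then have "(\<lambda>q'. c * path_elem q q') \<otimes>\<^bsub>KQ\<^esub> (\<lambda>p'. e * path_elem p p') = \<zero>\<^bsub>KQ\<^esub>"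
      unfolding single_mult path_elem_mult[OF q] by (simp add: p' q' zero_KQ)
    moreover have "path_map x b (0\<^sub>v (d y)) = 0\<^sub>v (d (qend Q q))"
      using path_map_zero[OF x] q(1) unfolding q' by simp
    ultimately show ?thesis unfolding R using False y
      by (simp add: rep_action_zero embed_zero smult_zero)
  qed
qed

text \<open>Bilinearity reduces the claim to two paths: \<open>g\<close> is decomposed first, with a
  single path on the left, and then \<open>f\<close>. The product of two paths is zero if the end of
  the first is not the start of the second, and then the second path meets a zero component of
  \<open>embed\<close>.\<close>

lemma rep_action_mult:
  assumes x: "x \<in> rep_space Q d" and f: "f \<in> carrier KQ" and g: "g \<in> carrier KQ" and v: "v \<in> V"
  shows "rep_action Q d x (f \<otimes>\<^bsub>KQ\<^esub> g) v = rep_action Q d x f (rep_action Q d x g v)"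
proof -
  have single: "rep_action Q d x ((\<lambda>q'. c * path_elem q q') \<otimes>\<^bsub>KQ\<^esub> g) v
      = rep_action Q d x (\<lambda>q'. c * path_elem q q') (rep_action Q d x g v)" if q: "q \<in> qpaths Q" for c q
  proof -
    let ?s = "\<lambda>q'. c * path_elem q q'"
    note s = single_closed[OF q]
    have "g \<in> len_ge 0" using g by (simp add: len_ge_0)
    then show ?thesis
    proof (induction rule: len_ge_induct)
      case zero
      have "path_map x (snd q) (0\<^sub>v (d (fst q))) = 0\<^sub>v (d (qend Q q))"
        using path_map_zero[OF x, of "fst q" "snd q"] q by simp
      then have "rep_action Q d x ?s zero_V = zero_V"
        using fst_verts[OF q] by (simp add: rep_action_single[OF x q] embed_zero smult_zero)
      then show ?case using KQ.r_null[OF s] by (simp only: rep_action_zero)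
    next
      case (add e p g)
      note c = single_closed[OF add.hyps(1)] len_ge_carrier[OF add.hyps(3)]
      show ?case
        using rep_action_mult_single[OF x v q add.hyps(1)] add.IH
        by (simp only: KQ.r_distr[OF c s] rep_action_add_left[OF c] rep_action_add_left[OF KQ.m_closed[OF s c(1)] KQ.m_closed[OF s c(2)]]
            rep_action_add_right[OF x s rep_action_closed rep_action_closed])
    qed
  qed
  have "f \<in> len_ge 0" using f by (simp add: len_ge_0)
  then show ?thesis
  proof (induction rule: len_ge_induct)
    case zero
    show ?case using KQ.l_null[OF g] by (simp only: rep_action_zero)
  next
    case (add c q f)
    note c = single_closed[OF add.hyps(1)] len_ge_carrier[OF add.hyps(3)]
    show ?case
      using single[OF add.hyps(1)] add.IH
      by (simp only: KQ.l_distr[OF c g] rep_action_add_left[OF c] rep_action_add_left[OF KQ.m_closed[OF c(1) g] KQ.m_closed[OF c(2) g]])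
  qed
qed

lemma rep_action_vertices:
  assumes f: "f \<in> carrier KQ" "\<And>u p. p \<noteq> [] \<Longrightarrow> f (u, p) = 0" and v: "v \<in> V"
  shows "rep_action Q d x f v = (\<lambda>i \<in> verts Q. f (i, []) \<cdot>\<^sub>v v i)"
proof (rule V_ext)
  fix i assume i: "i \<in> verts Q"
  let ?T = "(\<lambda>u. (u, [] :: 'a list)) ` verts Q"
  have sub: "{q. f q \<noteq> 0} \<subseteq> ?T"
  proof
    fix q assume q: "q \<in> {q. f q \<noteq> 0}"
    obtain u p where up: "q = (u, p)" by fastforce
    have "p = []" using q f(2) unfolding up by blast
    moreover have "(u, p) \<in> qpaths Q" using q f(1) unfolding carrier_KQ up by blast
    ultimately show "q \<in> ?T" unfolding up by auto
  qed
  show "rep_action Q d x f v i = (\<lambda>i \<in> verts Q. f (i, []) \<cdot>\<^sub>v v i) i"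
  proof (rule eq_vecI)
    show "dim_vec (rep_action Q d x f v i) = dim_vec ((\<lambda>i \<in> verts Q. f (i, []) \<cdot>\<^sub>v v i) i)"
      using i carrier_vecD[OF V_carrier[OF v i]] by (simp add: rep_action_dim)
    fix j assume "j < dim_vec ((\<lambda>i \<in> verts Q. f (i, []) \<cdot>\<^sub>v v i) i)"
    then have j: "j < d i" using i carrier_vecD[OF V_carrier[OF v i]] by simp
    have "rep_action Q d x f v i $ j = (\<Sum>q \<in> {q \<in> ?T. qend Q q = i}. f q * path_map x (snd q) (v (fst q)) $ j)"
      by (rule rep_action_index[OF i j _ sub]) simp
    also have "{q \<in> ?T. qend Q q = i} = {(i, [])}" using i by auto
    finally show "rep_action Q d x f v i $ j = (\<lambda>i \<in> verts Q. f (i, []) \<cdot>\<^sub>v v i) i $ j"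
      using i j carrier_vecD[OF V_carrier[OF v i]] by simp
  qed
next
  show "(\<lambda>i \<in> verts Q. f (i, []) \<cdot>\<^sub>v v i) \<in> V" using v by (intro V_I) simp
qed simp

lemma rep_action_scal:
  assumes v: "v \<in> V"
  shows "rep_action Q d x (scal c) v = (\<lambda>i \<in> verts Q. c \<cdot>\<^sub>v v i)"
proof -
  have "rep_action Q d x (scal c) v = (\<lambda>i \<in> verts Q. scal c (i, []) \<cdot>\<^sub>v v i)"
    by (rule rep_action_vertices[OF scal_closed _ v]) (simp add: scal_def one_KQ)
  also have "\<dots> = (\<lambda>i \<in> verts Q. c \<cdot>\<^sub>v v i)"
    by (rule restrict_ext) (simp add: scal_def one_KQ)
  finally show ?thesis .
qed

text \<open>Separates the trivial paths from the others. On the layers of the flags considered below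
  only the first summand acts, since the second one maps into the next term.\<close>

lemma rep_action_split:
  assumes f: "f \<in> carrier KQ" and v: "v \<in> V"
  obtains g where "g \<in> len_ge 1" "rep_action Q d x f v = (\<lambda>i \<in> verts Q. f (i, []) \<cdot>\<^sub>v v i) +\<^sub>V rep_action Q d x g v"
proof -
  let ?h = "\<lambda>(u, p). if p = [] then f (u, p) else 0" and ?g = "\<lambda>(u, p). if p = [] then 0 else f (u, p)"
  have h: "?h \<in> carrier KQ"
  proof -
    have "{q. ?h q \<noteq> 0} \<subseteq> {q. f q \<noteq> 0}" by (auto split: if_splits)
    then show ?thesis using f unfolding carrier_KQ by (meson finite_subset order_trans)
  qed
  have g: "?g \<in> carrier KQ"
  proof -
    have "{q. ?g q \<noteq> 0} \<subseteq> {q. f q \<noteq> 0}" by (auto split: if_splits)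
    then show ?thesis using f unfolding carrier_KQ by (meson finite_subset order_trans)
  qed
  have "f = ?h \<oplus>\<^bsub>KQ\<^esub> ?g" unfolding add_KQ by auto
  then have "rep_action Q d x f v = rep_action Q d x ?h v +\<^sub>V rep_action Q d x ?g v"
    using rep_action_add_left[OF h g] by metis
  also have "rep_action Q d x ?h v = (\<lambda>i \<in> verts Q. f (i, []) \<cdot>\<^sub>v v i)"
    by (subst rep_action_vertices[OF h _ v]) auto
  finally have eq: "rep_action Q d x f v = (\<lambda>i \<in> verts Q. f (i, []) \<cdot>\<^sub>v v i) +\<^sub>V rep_action Q d x ?g v" .
  have "?g \<in> len_ge 1" using g unfolding len_ge_1 by simp
  then show ?thesis using eq by (rule that)
qed

lemma scal_one: "scal 1 = \<one>\<^bsub>KQ\<^esub>"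
  by (simp add: scal_def)

lemma rep_action_one: "v \<in> V \<Longrightarrow> rep_action Q d x \<one>\<^bsub>KQ\<^esub> v = v"
  unfolding scal_one[symmetric] using V_restrict[of v] by (simp add: rep_action_scal)

lemma rep_action_vertex:
  assumes "x \<in> rep_space Q d" "i \<in> verts Q" "v \<in> V"
  shows "rep_action Q d x (path_elem (i, [])) v = embed i (v i)"
  using rep_action_single[OF assms(1) _ assms(3), of "(i, [])" 1] assms(2,3) by simp

lemma rep_action_arrow:
  assumes "x \<in> rep_space Q d" "\<alpha> \<in> arcs Q" "v \<in> V"
  shows "rep_action Q d x (path_elem (tail Q \<alpha>, [\<alpha>])) v = embed (head Q \<alpha>) (x \<alpha> *\<^sub>v v (tail Q \<alpha>))"
  using rep_action_single[OF assms(1) _ assms(3), of "(tail Q \<alpha>, [\<alpha>])" 1] assms(2,3)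
    rep_space_carrier[OF assms(1,2)] by simp

section \<open>Points of the variety as modules\<close>

lemma rep_carrier: "carrier (rep_module Q d x) = V"
  by (simp add: rep_module_def V_def)

lemma rep_zero: "\<zero>\<^bsub>rep_module Q d x\<^esub> = zero_V"
  by (simp add: rep_module_def zero_V_def)

lemma rep_add: "v \<oplus>\<^bsub>rep_module Q d x\<^esub> w = v +\<^sub>V w"
  by (simp add: rep_module_def plus_V_def)

lemma variety_space: "x \<in> rep_variety Q I d \<Longrightarrow> x \<in> rep_space Q d"
  unfolding rep_variety_def by blast

lemma variety_kills: "x \<in> rep_variety Q I d \<Longrightarrow> h \<in> I \<Longrightarrow> v \<in> V \<Longrightarrow> rep_action Q d x h v = zero_V"
  unfolding rep_variety_def V_def zero_V_def by blast

text \<open>\<open>the_elem\<close> is legitimate because all members of a residue class act alike: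
  they differ by elements of \<open>I\<close>, which act by zero at a point of the variety.\<close>

lemma rep_smult:
  assumes x: "x \<in> rep_variety Q I d" and f: "f \<in> carrier KQ" and v: "v \<in> V"
  shows "cls f \<odot>\<^bsub>rep_module Q d x\<^esub> v = rep_action Q d x f v"
proof -
  have "rep_action Q d x g v = rep_action Q d x f v" if "g \<in> cls f" for g
  proof -
    obtain h where h: "h \<in> I" "g = h \<oplus>\<^bsub>KQ\<^esub> f" using \<open>g \<in> cls f\<close> unfolding cls_def a_r_coset_def' by auto
    have "h \<in> carrier KQ" using h(1) KQ.a_subset by blast
    then have "rep_action Q d x g v = zero_V +\<^sub>V rep_action Q d x f v"
      unfolding h(2) using rep_action_add_left[OF _ f] variety_kills[OF x h(1) v] by (simp only:)
    then show ?thesis using zero_V_left[OF rep_action_closed] by (simp only:)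
  qed
  moreover have "f \<in> cls f" unfolding cls_def by (rule KQ.a_rcos_self[OF f])
  ultimately have "(\<lambda>g. rep_action Q d x g v) ` cls f = {rep_action Q d x f v}" by blast
  then show ?thesis by (simp add: rep_module_def)
qed

lemma rep_left_module:
  assumes x: "x \<in> rep_variety Q I d"
  shows "left_module Lam (rep_module Q d x)"
proof -
  note xs = variety_space[OF x]
  have "abelian_group (rep_module Q d x)"
  proof (rule abelian_groupI, unfold rep_carrier rep_zero rep_add)
    fix v assume v: "v \<in> V"
    let ?w = "\<lambda>i \<in> verts Q. - v i"
    have "?w \<in> V" using v by (intro V_I) simp
    moreover have "?w +\<^sub>V v = zero_V" unfolding plus_V_def zero_V_def using v by (intro restrict_ext) simp
    ultimately show "\<exists>w\<in>V. w +\<^sub>V v = zero_V" by blast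
  qed (fact plus_V_closed zero_V_closed plus_V_assoc plus_V_comm zero_V_left)+
  moreover have "left_module_axioms Lam (rep_module Q d x)"
  proof (unfold left_module_axioms_def, unfold rep_carrier rep_add, intro conjI allI impI)
    fix a v assume a: "a \<in> carrier Lam" and v: "v \<in> V"
    obtain f where f: "f \<in> carrier KQ" "a = cls f" using a unfolding carrier_Lam by blast
    show "a \<odot>\<^bsub>rep_module Q d x\<^esub> v \<in> V" unfolding f(2) rep_smult[OF x f(1) v] by simp
  next
    fix a b v assume a: "a \<in> carrier Lam" "b \<in> carrier Lam" and v: "v \<in> V"
    obtain f where f: "f \<in> carrier KQ" "a = cls f" using a unfolding carrier_Lam by blast
    obtain g where g: "g \<in> carrier KQ" "b = cls g" using a unfolding carrier_Lam by blast
    show "(a \<oplus>\<^bsub>Lam\<^esub> b) \<odot>\<^bsub>rep_module Q d x\<^esub> v = a \<odot>\<^bsub>rep_module Q d x\<^esub> v +\<^sub>V b \<odot>\<^bsub>rep_module Q d x\<^esub> v"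
      unfolding f(2) g(2) cls_add[OF f(1) g(1)] rep_smult[OF x KQ.a_closed[OF f(1) g(1)] v]
        rep_smult[OF x f(1) v] rep_smult[OF x g(1) v] by (rule rep_action_add_left[OF f(1) g(1)])
    show "(a \<otimes>\<^bsub>Lam\<^esub> b) \<odot>\<^bsub>rep_module Q d x\<^esub> v = a \<odot>\<^bsub>rep_module Q d x\<^esub> (b \<odot>\<^bsub>rep_module Q d x\<^esub> v)"
      unfolding f(2) g(2) cls_mult[OF f(1) g(1)] rep_smult[OF x KQ.m_closed[OF f(1) g(1)] v]
        rep_smult[OF x g(1) v] rep_smult[OF x f(1) rep_action_closed] by (rule rep_action_mult[OF xs f(1) g(1) v])
  next
    fix a v w assume a: "a \<in> carrier Lam" and v: "v \<in> V" "w \<in> V"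
    obtain f where f: "f \<in> carrier KQ" "a = cls f" using a unfolding carrier_Lam by blast
    show "a \<odot>\<^bsub>rep_module Q d x\<^esub> (v +\<^sub>V w) = a \<odot>\<^bsub>rep_module Q d x\<^esub> v +\<^sub>V a \<odot>\<^bsub>rep_module Q d x\<^esub> w"
      unfolding f(2) rep_smult[OF x f(1) v(1)] rep_smult[OF x f(1) v(2)] rep_smult[OF x f(1) plus_V_closed[OF v]]
      by (rule rep_action_add_right[OF xs f(1) v])
  next
    fix v assume v: "v \<in> V"
    show "\<one>\<^bsub>Lam\<^esub> \<odot>\<^bsub>rep_module Q d x\<^esub> v = v"
      unfolding cls_one[symmetric] rep_smult[OF x KQ.one_closed v] by (rule rep_action_one[OF v])
  qed
  ultimately show ?thesis by (intro left_module.intro Lam.ring_axioms)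
qed

subsection \<open>Graded subspaces\<close>

definition graded :: "('v \<Rightarrow> 'k vec set) \<Rightarrow> ('v \<Rightarrow> 'k vec) set" where
  "graded W = {v \<in> V. \<forall>i \<in> verts Q. v i \<in> W i}"

lemma graded_add:
  assumes "\<And>i. i \<in> verts Q \<Longrightarrow> vsub (d i) (W i)"
    "v \<in> graded W" "w \<in> graded W"
  shows "v +\<^sub>V w \<in> graded W"
  using assms(2,3) vsubD(3)[OF assms(1)] unfolding graded_def by simp

lemma graded_zero:
  assumes "\<And>i. i \<in> verts Q \<Longrightarrow> vsub (d i) (W i)"
  shows "zero_V \<in> graded W"
  using vsubD(2)[OF assms] unfolding graded_def by simp

lemma graded_embed:
  assumes "\<And>i. i \<in> verts Q \<Longrightarrow> vsub (d i) (W i)" "i \<in> verts Q" "w \<in> W i"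
  shows "embed i w \<in> graded W"
proof -
  have "w \<in> carrier_vec (d i)" using vsubD(1)[OF assms(1)[OF assms(2)]] assms(3) by blast
  moreover have "embed i w j \<in> W j" if "j \<in> verts Q" for j
    using that assms(2,3) vsubD(2)[OF assms(1)[OF that]] by (cases "j = i") simp_all
  ultimately show ?thesis unfolding graded_def by simp
qed

lemma path_map_stable:
  assumes "(u, p) \<in> qpaths Q" "w \<in> W u"
    and stab: "\<And>\<alpha> w. \<alpha> \<in> arcs Q \<Longrightarrow> w \<in> W (tail Q \<alpha>) \<Longrightarrow> x \<alpha> *\<^sub>v w \<in> W (head Q \<alpha>)"
  shows "path_map x p w \<in> W (qend Q (u, p))"
  using assms(1,2)
  by (induction p arbitrary: u w) (auto simp: qpaths_Cons qend_Cons stab)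

lemma rep_action_stable:
  assumes x: "x \<in> rep_space Q d" and W: "\<And>i. i \<in> verts Q \<Longrightarrow> vsub (d i) (W i)"
    and stab: "\<And>\<alpha> w. \<alpha> \<in> arcs Q \<Longrightarrow> w \<in> W (tail Q \<alpha>) \<Longrightarrow> x \<alpha> *\<^sub>v w \<in> W (head Q \<alpha>)"
    and f: "f \<in> carrier KQ" and v: "v \<in> graded W"
  shows "rep_action Q d x f v \<in> graded W"
proof -
  have vV: "v \<in> V" using v unfolding graded_def by blast
  have "f \<in> len_ge 0" using f by (simp add: len_ge_0)
  then show ?thesis
  proof (induction rule: len_ge_induct)
    case zero
    show ?case unfolding rep_action_zero by (rule graded_zero[OF W])
  next
    case (add c q f)
    have "v (fst q) \<in> W (fst q)" using v fst_verts[OF add.hyps(1)] unfolding graded_def by blast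
    then have "path_map x (snd q) (v (fst q)) \<in> W (qend Q q)"
      using path_map_stable[of "fst q" "snd q" "v (fst q)" W x, OF _ _ stab] add.hyps(1) by simp
    then have "embed (qend Q q) (c \<cdot>\<^sub>v path_map x (snd q) (v (fst q))) \<in> graded W"
      using qend_verts[OF add.hyps(1)] by (intro graded_embed W vsubD(4)[OF W])
    then show ?case
      unfolding rep_action_add_left[OF single_closed[OF add.hyps(1)] len_ge_carrier[OF add.hyps(3)]]
        rep_action_single[OF x add.hyps(1) vV] using add.IH by (intro graded_add[of W] W)
  qed
qed

text \<open>A path of positive length has a last arrow. Everything before it stays inside
  \<open>W\<close>, and the last arrow maps \<open>W\<close> into \<open>W'\<close>.\<close>

lemma rep_action_lower:
  assumes x: "x \<in> rep_space Q d" and W': "\<And>i. i \<in> verts Q \<Longrightarrow> vsub (d i) (W' i)"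
    and stab: "\<And>\<alpha> w. \<alpha> \<in> arcs Q \<Longrightarrow> w \<in> W (tail Q \<alpha>) \<Longrightarrow> x \<alpha> *\<^sub>v w \<in> W (head Q \<alpha>)"
    and lower: "\<And>\<alpha> w. \<alpha> \<in> arcs Q \<Longrightarrow> w \<in> W (tail Q \<alpha>) \<Longrightarrow> x \<alpha> *\<^sub>v w \<in> W' (head Q \<alpha>)"
    and f: "f \<in> len_ge 1" and v: "v \<in> graded W"
  shows "rep_action Q d x f v \<in> graded W'"
proof -
  have vV: "v \<in> V" using v unfolding graded_def by blast
  show ?thesis
    using f
  proof (induction rule: len_ge_induct)
    case zero
    show ?case unfolding rep_action_zero by (rule graded_zero[OF W'])
  next
    case (add c q f)
    obtain u p where q: "q = (u, p)" by fastforce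
    have "v u \<in> W u" using v fst_verts[OF add.hyps(1)] unfolding graded_def q by auto
    obtain p' \<alpha> where p: "p = p' @ [\<alpha>]" using add.hyps(2) unfolding q by (cases p rule: rev_cases) auto
    have p': "(u, p') \<in> qpaths Q" "\<alpha> \<in> arcs Q" "qend Q (u, p') = tail Q \<alpha>"
      using add.hyps(1) unfolding q p qpaths_append by auto
    have "path_map x p' (v u) \<in> W (tail Q \<alpha>)"
      using path_map_stable[OF p'(1) \<open>v u \<in> W u\<close> stab] p'(3) by simp
    then have "x \<alpha> *\<^sub>v path_map x p' (v u) \<in> W' (head Q \<alpha>)" by (rule lower[OF p'(2)])
    then have "path_map x (snd q) (v (fst q)) \<in> W' (qend Q q)"
      by (simp add: q p path_map_append qend_append)
    then have "embed (qend Q q) (c \<cdot>\<^sub>v path_map x (snd q) (v (fst q))) \<in> graded W'"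
      using qend_verts[OF add.hyps(1)] by (intro graded_embed W' vsubD(4)[OF W'])
    then show ?case
      unfolding rep_action_add_left[OF single_closed[OF add.hyps(1)] len_ge_carrier[OF add.hyps(3)]]
        rep_action_single[OF x add.hyps(1) vV] using add.IH by (intro graded_add[of W'] W')
  qed
qed

text \<open>\<open>v\<close> is the sum of its components; the sum is built up over a growing set of
  vertices, with zero components elsewhere.\<close>

lemma embed_sum_mem:
  assumes N: "zero_V \<in> N" "\<And>v w. v \<in> N \<Longrightarrow> w \<in> N \<Longrightarrow> v +\<^sub>V w \<in> N"
    and v: "v \<in> V" "\<And>i. i \<in> verts Q \<Longrightarrow> embed i (v i) \<in> N"
  shows "v \<in> N"
proof -
  have "A \<subseteq> verts Q \<Longrightarrow> (\<lambda>i \<in> verts Q. if i \<in> A then v i else 0\<^sub>v (d i)) \<in> N" if "finite A" for A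
    using that
  proof (induction A rule: finite_induct)
    case empty
    then show ?case using N(1) unfolding zero_V_def by (simp only: empty_iff if_False)
  next
    case (insert j A)
    have "(\<lambda>i \<in> verts Q. if i \<in> insert j A then v i else 0\<^sub>v (d i))
        = embed j (v j) +\<^sub>V (\<lambda>i \<in> verts Q. if i \<in> A then v i else 0\<^sub>v (d i))"
      unfolding plus_V_def using insert v(1) by (intro restrict_ext) (auto simp: embed_def)
    moreover have "embed j (v j) \<in> N" using v(2) insert.prems by blast
    moreover have "(\<lambda>i \<in> verts Q. if i \<in> A then v i else 0\<^sub>v (d i)) \<in> N"
      using insert.IH insert.prems by blast
    ultimately show ?case using N(2) by (simp only:)
  qed
  from this[OF finite_verts subset_refl] have "(\<lambda>i \<in> verts Q. v i) \<in> N" by (simp cong: restrict_cong)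
  then show ?thesis using V_restrict[OF v(1)] by (simp only:)
qed

lemma graded_submodule:
  assumes x: "x \<in> rep_variety Q I d" and W: "\<And>i. i \<in> verts Q \<Longrightarrow> vsub (d i) (W i)"
    and stab: "\<And>\<alpha> w. \<alpha> \<in> arcs Q \<Longrightarrow> w \<in> W (tail Q \<alpha>) \<Longrightarrow> x \<alpha> *\<^sub>v w \<in> W (head Q \<alpha>)"
  shows "Module.submodule (graded W) Lam (rep_module Q d x)"
proof (rule left_module.submoduleI[OF rep_left_module[OF x]], unfold rep_carrier rep_zero rep_add)
  show sub: "graded W \<subseteq> V" unfolding graded_def by blast
  fix a v assume a: "a \<in> carrier Lam" and v: "v \<in> graded W"
  obtain f where f: "f \<in> carrier KQ" "a = cls f" using a unfolding carrier_Lam by blast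
  show "a \<odot>\<^bsub>rep_module Q d x\<^esub> v \<in> graded W"
    unfolding f(2) rep_smult[OF x f(1) subsetD[OF sub v]]
    by (rule rep_action_stable[OF variety_space[OF x] W stab f(1) v])
qed (rule graded_zero[OF W] graded_add[of W], simp_all add: W)+

end

section \<open>Semisimple modules as zero representations\<close>

lemma coordinates_exist:
  fixes V :: "('k::field, 'c, 'd) module_scheme"
  assumes VS: "vectorspace class_ring V" and fd: "vectorspace.fin_dim class_ring V"
  obtains \<phi> where "bij_betw \<phi> (carrier_vec (vectorspace.dim class_ring V)) (carrier V)"
    "\<And>c c'. c \<in> carrier_vec (vectorspace.dim class_ring V) \<Longrightarrow> c' \<in> carrier_vec (vectorspace.dim class_ring V) \<Longrightarrow> \<phi> (c + c') = \<phi> c \<oplus>\<^bsub>V\<^esub> \<phi> c'"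
    "\<And>a c. c \<in> carrier_vec (vectorspace.dim class_ring V) \<Longrightarrow> \<phi> (a \<cdot>\<^sub>v c) = a \<odot>\<^bsub>V\<^esub> \<phi> c"
proof -
  interpret vectorspace class_ring V by (rule VS)
  obtain B where B: "finite B" "basis B" using finite_basis_exists[OF fd] by blast
  define n where "n = dim"
  have n: "card B = n" using dim_basis[OF B] by (simp add: n_def)
  have BV: "B \<subseteq> carrier V" using B(2) unfolding basis_def by blast
  obtain e where e: "bij_betw e {0..<n} B" using ex_bij_betw_nat_finite[OF B(1)] n by blast
  define pos where "pos = inv_into {0..<n} e"
  have pos: "pos b < n" "e (pos b) = b" if "b \<in> B" for b
    using bij_betw_inv_into_right[OF e that] bij_betwE[OF bij_betw_inv_into[OF e]] that by (auto simp: pos_def)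
  have pos_e: "pos (e j) = j" if "j < n" for j
    using bij_betw_inv_into_left[OF e] that by (simp add: pos_def)
  have eB: "e j \<in> B" if "j < n" for j using bij_betwE[OF e] that by auto
  have inK: "a \<in> B \<rightarrow> carrier (class_ring :: 'k ring)" for a by simp
  define \<phi> where "\<phi> c = lincomb (\<lambda>b. c $ pos b) B" for c
  \<comment> \<open>Uniqueness of coordinates is obtained for functions that are undefined outside
    \<open>B\<close>, hence the passage to restrictions in \<open>restr\<close>.\<close>
  have unique: "\<exists>!a. a \<in> B \<rightarrow>\<^sub>E carrier class_ring \<and> lincomb a B = v" if "v \<in> carrier V" for v
    using basis_criterion[OF B(1) BV] B(2) that by blast
  have restr: "lincomb (restrict a B) B = lincomb a B" for a
    by (rule lincomb_cong[OF refl BV _ inK]) simp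
  have \<phi>c: "\<phi> c \<in> carrier V" for c unfolding \<phi>_def by (rule lincomb_closed[OF BV inK])
  have "inj_on \<phi> (carrier_vec n)"
  proof (rule inj_onI)
    fix c c' assume c: "c \<in> carrier_vec n" "c' \<in> carrier_vec n" "\<phi> c = \<phi> c'"
    have "restrict (\<lambda>b. c $ pos b) B \<in> B \<rightarrow>\<^sub>E carrier class_ring \<and> lincomb (restrict (\<lambda>b. c $ pos b) B) B = \<phi> c"
      "restrict (\<lambda>b. c' $ pos b) B \<in> B \<rightarrow>\<^sub>E carrier class_ring \<and> lincomb (restrict (\<lambda>b. c' $ pos b) B) B = \<phi> c"
      using restr c(3) unfolding \<phi>_def by simp_all
    then have "restrict (\<lambda>b. c $ pos b) B = restrict (\<lambda>b. c' $ pos b) B"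
      using unique[OF \<phi>c[of c]] by (elim ex1E) metis
    then have "c $ pos b = c' $ pos b" if "b \<in> B" for b using that by (metis restrict_apply')
    then have "c $ j = c' $ j" if "j < n" for j using that eB[OF that] pos_e[OF that] by metis
    then show "c = c'" using c by (intro eq_vecI) auto
  qed
  moreover have "\<phi> ` carrier_vec n = carrier V"
  proof (intro equalityI subsetI)
    fix v assume "v \<in> carrier V"
    then obtain a where a: "lincomb a B = v" using unique by blast
    have "\<phi> (vec n (\<lambda>j. a (e j))) = v"
      unfolding \<phi>_def a[symmetric] by (rule lincomb_cong[OF refl BV _ inK]) (simp add: pos)
    then show "v \<in> \<phi> ` carrier_vec n" by (metis imageI vec_carrier)
  qed (use \<phi>c in auto)
  ultimately have bij: "bij_betw \<phi> (carrier_vec dim) (carrier V)" unfolding bij_betw_def n_def by blast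
  show thesis
  proof (rule that[OF bij])
    fix c c' :: "'k vec" assume c: "c \<in> carrier_vec dim" "c' \<in> carrier_vec dim"
    have "\<phi> (c + c') = lincomb (\<lambda>b. c $ pos b \<oplus>\<^bsub>class_ring\<^esub> c' $ pos b) B"
      unfolding \<phi>_def using c pos(1) by (intro lincomb_cong[OF refl BV _ inK]) (simp add: n_def)
    then show "\<phi> (c + c') = \<phi> c \<oplus>\<^bsub>V\<^esub> \<phi> c'"
      unfolding \<phi>_def using lincomb_sum[OF B(1) BV inK inK] by simp
  next
    fix a and c :: "'k vec" assume c: "c \<in> carrier_vec dim"
    have "\<phi> (a \<cdot>\<^sub>v c) = lincomb (\<lambda>b. a \<otimes>\<^bsub>class_ring\<^esub> c $ pos b) B"
      unfolding \<phi>_def using c pos(1) by (intro lincomb_cong[OF refl BV _ inK]) (simp add: n_def)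
    then show "\<phi> (a \<cdot>\<^sub>v c) = a \<odot>\<^bsub>V\<^esub> \<phi> c"
      unfolding \<phi>_def using lincomb_smult[OF BV inK, of a] by simp
  qed
qed

context quiver_ideal
begin

text \<open>The normal form of a semisimple module with dimension vector \<open>m\<close>.\<close>

definition zero_rep :: "('v \<Rightarrow> nat) \<Rightarrow> 'a \<Rightarrow> 'k mat" where
  "zero_rep m = (\<lambda>\<alpha> \<in> arcs Q. 0\<^sub>m (m (head Q \<alpha>)) (m (tail Q \<alpha>)))"

lemma quiver_rep: "quiver_rep Q I"
  by unfold_locales

lemma zero_rep_space: "zero_rep m \<in> rep_space Q m"
  unfolding zero_rep_def rep_space_def by auto

lemma zero_rep_kills:
  assumes f: "f \<in> len_ge 1" and v: "v \<in> quiver_rep.V Q m"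
  shows "rep_action Q m (zero_rep m) f v = quiver_rep.zero_V Q m"
proof -
  interpret Z: quiver_rep Q I m by unfold_locales
  have "rep_action Q m (zero_rep m) f v \<in> Z.graded (\<lambda>i. {0\<^sub>v (m i)})"
  proof (rule Z.rep_action_lower[OF zero_rep_space _ _ _ f, of _ "\<lambda>i. carrier_vec (m i)"])
    show "vsub (m i) {0\<^sub>v (m i) :: 'k vec}" for i unfolding vsub_def by (auto simp: Z.smult_zero)
    show "zero_rep m \<alpha> *\<^sub>v w \<in> carrier_vec (m (head Q \<alpha>))" if "\<alpha> \<in> arcs Q" "w \<in> carrier_vec (m (tail Q \<alpha>))" for \<alpha> w
      using mult_mat_vec_carrier[OF Z.rep_space_carrier[OF zero_rep_space that(1)] that(2)] .
    show "zero_rep m \<alpha> *\<^sub>v w \<in> {0\<^sub>v (m (head Q \<alpha>))}" if "\<alpha> \<in> arcs Q" "w \<in> carrier_vec (m (tail Q \<alpha>))" for \<alpha> w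
      using that by (auto simp: zero_rep_def)
    show "v \<in> Z.graded (\<lambda>i. carrier_vec (m i))" using v unfolding Z.graded_def by simp
  qed
  then show ?thesis unfolding Z.graded_def by (intro Z.V_ext) auto
qed

lemma zero_rep_variety: "zero_rep m \<in> rep_variety Q I m"
proof -
  interpret Z: quiver_rep Q I m by unfold_locales
  show ?thesis
    unfolding rep_variety_def using zero_rep_space zero_rep_kills I_len_ge
    by (auto simp: Z.V_def[symmetric] Z.zero_V_def[symmetric])
qed

lemma zero_rep_action:
  assumes f: "f \<in> carrier KQ" and v: "v \<in> quiver_rep.V Q m"
  shows "rep_action Q m (zero_rep m) f v = (\<lambda>i \<in> verts Q. f (i, []) \<cdot>\<^sub>v v i)"
proof -
  interpret Z: quiver_rep Q I m by unfold_locales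
  obtain g where g: "g \<in> len_ge 1"
    "rep_action Q m (zero_rep m) f v = Z.plus_V (\<lambda>i \<in> verts Q. f (i, []) \<cdot>\<^sub>v v i) (rep_action Q m (zero_rep m) g v)"
    by (rule Z.rep_action_split[OF f v])
  have c: "(\<lambda>i \<in> verts Q. f (i, []) \<cdot>\<^sub>v v i) \<in> Z.V" using v by (intro Z.V_I) simp
  show ?thesis unfolding g(2) zero_rep_kills[OF g(1) v]
    using Z.plus_V_comm[OF c Z.zero_V_closed] Z.zero_V_left[OF c] by simp
qed

text \<open>Stated for subsets \<open>U\<close> closed under scalars, so that it applies both to the
  whole of \<open>S\<close> and to its components at the vertices.\<close>

lemma scalar_vectorspace:
  assumes S: "left_module Lam S" and U: "U \<subseteq> carrier S" "\<zero>\<^bsub>S\<^esub> \<in> U"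
    "\<And>s t. s \<in> U \<Longrightarrow> t \<in> U \<Longrightarrow> s \<oplus>\<^bsub>S\<^esub> t \<in> U" "\<And>c s. s \<in> U \<Longrightarrow> cls (scal c) \<odot>\<^bsub>S\<^esub> s \<in> U"
  shows "vectorspace class_ring (restrict_scalars Q I S\<lparr>carrier := U\<rparr>)"
proof -
  interpret S: left_module Lam S by (rule S)
  have op: "c \<odot>\<^bsub>restrict_scalars Q I S\<^esub> s = cls (scal c) \<odot>\<^bsub>S\<^esub> s" for c s
    by (simp add: restrict_scalars_def cls_def scal_def)
  have simps: "\<zero>\<^bsub>restrict_scalars Q I S\<^esub> = \<zero>\<^bsub>S\<^esub>" "add (restrict_scalars Q I S) = add S"
    by (simp_all add: restrict_scalars_def)
  have sc: "cls (scal c) \<in> carrier Lam" for c by simp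
  have Uc: "s \<in> carrier S" if "s \<in> U" for s using U(1) that by blast
  have scal_mult': "scal (a * b) = scal a \<otimes>\<^bsub>KQ\<^esub> scal b" for a b
    unfolding scal_mult[OF scal_closed] by (simp add: scal_def mult.assoc)
  have scal_add': "scal (a + b) = scal a \<oplus>\<^bsub>KQ\<^esub> scal b" for a b
    by (auto simp: scal_def add_KQ distrib_right)
  have one: "scal 1 = \<one>\<^bsub>KQ\<^esub>" by (simp add: scal_def)
  show ?thesis
  proof (rule vs_criteria[OF class_field], simp_all add: op simps)
    show "\<forall>v\<in>U. \<exists>w\<in>U. v \<oplus>\<^bsub>S\<^esub> w = \<zero>\<^bsub>S\<^esub>"
    proof
      fix v assume v: "v \<in> U"
      have "v \<oplus>\<^bsub>S\<^esub> cls (scal (-1)) \<odot>\<^bsub>S\<^esub> v = cls (scal 1) \<odot>\<^bsub>S\<^esub> v \<oplus>\<^bsub>S\<^esub> cls (scal (-1)) \<odot>\<^bsub>S\<^esub> v"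
        using Uc[OF v] by (simp add: one cls_one S.smult_one)
      also have "\<dots> = cls (scal (1 + -1)) \<odot>\<^bsub>S\<^esub> v"
        using Uc[OF v] by (simp only: S.smult_l_distr[OF sc sc, symmetric] cls_add scal_closed scal_add')
      also have "scal (1 + -1) = \<zero>\<^bsub>KQ\<^esub>" by (simp add: scal_def zero_KQ)
      finally have "v \<oplus>\<^bsub>S\<^esub> cls (scal (-1)) \<odot>\<^bsub>S\<^esub> v = \<zero>\<^bsub>S\<^esub>"
        using Uc[OF v] cls_ideal[of "\<zero>\<^bsub>KQ\<^esub>"] by (simp add: S.smult_l_null)
      then show "\<exists>w\<in>U. v \<oplus>\<^bsub>S\<^esub> w = \<zero>\<^bsub>S\<^esub>" using U(4)[OF v] by blast
    qed
    show "\<forall>v w. v \<in> U \<and> w \<in> U \<longrightarrow> v \<oplus>\<^bsub>S\<^esub> w = w \<oplus>\<^bsub>S\<^esub> v" using Uc S.M.a_comm by blast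
    show "\<forall>v w x. v \<in> U \<and> w \<in> U \<and> x \<in> U \<longrightarrow> v \<oplus>\<^bsub>S\<^esub> w \<oplus>\<^bsub>S\<^esub> x = v \<oplus>\<^bsub>S\<^esub> (w \<oplus>\<^bsub>S\<^esub> x)" using Uc S.M.a_assoc by blast
    show "\<forall>v\<in>U. v \<oplus>\<^bsub>S\<^esub> \<zero>\<^bsub>S\<^esub> = v" using Uc by simp
    show "\<forall>a b v. v \<in> U \<longrightarrow> cls (scal (a * b)) \<odot>\<^bsub>S\<^esub> v = cls (scal a) \<odot>\<^bsub>S\<^esub> (cls (scal b) \<odot>\<^bsub>S\<^esub> v)"
      using Uc by (simp add: scal_mult' cls_mult[symmetric] S.smult_assoc1)
    show "\<forall>v\<in>U. cls (scal 1) \<odot>\<^bsub>S\<^esub> v = v" using Uc by (simp add: one cls_one S.smult_one)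
    show "\<forall>a b v. v \<in> U \<longrightarrow> cls (scal (a + b)) \<odot>\<^bsub>S\<^esub> v = cls (scal a) \<odot>\<^bsub>S\<^esub> v \<oplus>\<^bsub>S\<^esub> cls (scal b) \<odot>\<^bsub>S\<^esub> v"
      using Uc by (simp add: scal_add' cls_add[symmetric] S.smult_l_distr)
    show "\<forall>a v w. v \<in> U \<and> w \<in> U \<longrightarrow> cls (scal a) \<odot>\<^bsub>S\<^esub> (v \<oplus>\<^bsub>S\<^esub> w) = cls (scal a) \<odot>\<^bsub>S\<^esub> v \<oplus>\<^bsub>S\<^esub> cls (scal a) \<odot>\<^bsub>S\<^esub> w"
      using Uc by (simp add: S.smult_r_distr)
  qed (use U in auto)
qed

text \<open>The difference of \<open>f\<close> and \<open>g\<close> lies in \<open>len_ge 1\<close>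
  and acts by zero: on such a module an element acts through its coefficients at the trivial
  paths.\<close>

lemma killed_cong:
  assumes S: "left_module Lam S" and killed: "\<And>f s. f \<in> len_ge 1 \<Longrightarrow> s \<in> carrier S \<Longrightarrow> cls f \<odot>\<^bsub>S\<^esub> s = \<zero>\<^bsub>S\<^esub>"
    and fg: "f \<in> carrier KQ" "g \<in> carrier KQ" "\<And>u. f (u, []) = g (u, [])" and s: "s \<in> carrier S"
  shows "cls f \<odot>\<^bsub>S\<^esub> s = cls g \<odot>\<^bsub>S\<^esub> s"
proof -
  interpret S: left_module Lam S by (rule S)
  let ?h = "\<lambda>q. f q + - 1 * g q"
  have h: "?h \<in> carrier KQ" using KQ.a_closed[OF fg(1) smult_KQ_closed[OF fg(2), of "- 1"]] by (simp add: add_KQ)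
  then have h1: "?h \<in> len_ge 1" unfolding len_ge_1 using fg(3) by simp
  have "cls ?h \<oplus>\<^bsub>Lam\<^esub> cls g = cls f"
    unfolding cls_add[OF h fg(2)] by (simp add: add_KQ)
  then have "cls f \<odot>\<^bsub>S\<^esub> s = cls ?h \<odot>\<^bsub>S\<^esub> s \<oplus>\<^bsub>S\<^esub> cls g \<odot>\<^bsub>S\<^esub> s"
    using S.smult_l_distr[OF cls_closed[OF h] cls_closed[OF fg(2)] s] by (simp only:)
  also have "\<dots> = cls g \<odot>\<^bsub>S\<^esub> s" using killed[OF h1 s] fg s S.smult_closed[of "cls g" s] by simp
  finally show ?thesis .
qed

text \<open>Since paths of positive length act by zero, the trivial paths act as orthogonal
  idempotents \<open>E i\<close> with sum 1, and \<open>S\<close> is the direct sum of the spaces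
  \<open>U i\<close> on which \<open>f\<close> acts by the scalar \<open>f (i, [])\<close>. Bases of
  the \<open>U i\<close>, whose dimensions make up the dimension vector, give the isomorphism
  \<open>\<Psi>\<close>.\<close>

lemma killed_iso_zero_rep:
  assumes S: "left_module Lam S" and killed: "\<And>f s. f \<in> len_ge 1 \<Longrightarrow> s \<in> carrier S \<Longrightarrow> cls f \<odot>\<^bsub>S\<^esub> s = \<zero>\<^bsub>S\<^esub>"
    and fd: "vectorspace.fin_dim class_ring (restrict_scalars Q I S)"
  shows "modules_isomorphic Lam S (rep_module Q (dim_vector Q I S) (zero_rep (dim_vector Q I S)))"
proof -
  interpret S: left_module Lam S by (rule S)
  define m where "m = dim_vector Q I S"
  interpret Z: quiver_rep Q I m by unfold_locales
  let ?RS = "restrict_scalars Q I S"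
  have op: "c \<odot>\<^bsub>?RS\<^esub> s = cls (scal c) \<odot>\<^bsub>S\<^esub> s" for c s
    by (simp add: restrict_scalars_def cls_def scal_def)
  have RSadd: "add ?RS = add S" and RSc: "carrier ?RS = carrier S" by (simp_all add: restrict_scalars_def)
  define E where "E i s = cls (path_elem (i, [])) \<odot>\<^bsub>S\<^esub> s" for i s
  have ec: "path_elem (i, []) \<in> carrier KQ" if "i \<in> verts Q" for i using that by simp
  have Ec: "E i s \<in> carrier S" if "i \<in> verts Q" "s \<in> carrier S" for i s
    unfolding E_def using that ec by (simp add: S.smult_closed)
  have Eadd: "E i (s \<oplus>\<^bsub>S\<^esub> t) = E i s \<oplus>\<^bsub>S\<^esub> E i t" if "i \<in> verts Q" "s \<in> carrier S" "t \<in> carrier S" for i s t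
    unfolding E_def using that ec by (simp add: S.smult_r_distr)
  have mult: "cls f \<odot>\<^bsub>S\<^esub> (cls g \<odot>\<^bsub>S\<^esub> s) = cls (f \<otimes>\<^bsub>KQ\<^esub> g) \<odot>\<^bsub>S\<^esub> s"
    if "f \<in> carrier KQ" "g \<in> carrier KQ" "s \<in> carrier S" for f g s
    using that by (simp add: S.smult_assoc1[symmetric] cls_mult)
  have cong: "cls f \<odot>\<^bsub>S\<^esub> s = cls g \<odot>\<^bsub>S\<^esub> s"
    if "f \<in> carrier KQ" "g \<in> carrier KQ" "\<And>u. f (u, []) = g (u, [])" "s \<in> carrier S" for f g s
    by (rule killed_cong[OF S killed]) (rule that | assumption)+
  \<comment> \<open>Multiplying by the trivial path at \<open>i\<close> leaves only the coefficient
    of \<open>f\<close> at \<open>i\<close>, up to paths of positive length, which act as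
    zero.\<close>
  have Ef: "E i (cls f \<odot>\<^bsub>S\<^esub> s) = cls (scal (f (i, []))) \<odot>\<^bsub>S\<^esub> E i s"
    if "i \<in> verts Q" "f \<in> carrier KQ" "s \<in> carrier S" for i f s
    unfolding E_def mult[OF ec[OF that(1)] that(2,3)] mult[OF scal_closed ec[OF that(1)] that(3)]
    by (rule cong[OF KQ.m_closed[OF ec[OF that(1)] that(2)] KQ.m_closed[OF scal_closed ec[OF that(1)]] _ that(3)])
      (use that(1) in \<open>simp add: mult_KQ_Nil path_elem_def scal_def one_KQ\<close>)
  have EE: "E i (E j s) = (if i = j then E j s else \<zero>\<^bsub>S\<^esub>)" if "i \<in> verts Q" "j \<in> verts Q" "s \<in> carrier S" for i j s
  proof -
    have "E i (E j s) = cls (if i = j then path_elem (j, []) else \<zero>\<^bsub>KQ\<^esub>) \<odot>\<^bsub>S\<^esub> s"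
      unfolding E_def mult[OF ec[OF that(1)] ec[OF that(2)] that(3)]
    proof (rule cong[OF KQ.m_closed[OF ec[OF that(1)] ec[OF that(2)]] _ _ that(3)])
      show "(if i = j then path_elem (j, []) else \<zero>\<^bsub>KQ\<^esub>) \<in> carrier KQ" using that by simp
      show "(path_elem (i, []) \<otimes>\<^bsub>KQ\<^esub> path_elem (j, [])) (u, []) = (if i = j then path_elem (j, []) else \<zero>\<^bsub>KQ\<^esub>) (u, [])" for u
        by (simp add: mult_KQ_Nil path_elem_def zero_KQ)
    qed
    then show ?thesis using that(3) cls_ideal[of "\<zero>\<^bsub>KQ\<^esub>"] by (auto simp: E_def S.smult_l_null)
  qed
  have E0: "E i \<zero>\<^bsub>S\<^esub> = \<zero>\<^bsub>S\<^esub>" if "i \<in> verts Q" for i unfolding E_def using that ec by (simp add: S.smult_r_null)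
  have Esc: "cls (scal c) \<odot>\<^bsub>S\<^esub> E i s = E i (cls (scal c) \<odot>\<^bsub>S\<^esub> s)" if "i \<in> verts Q" "s \<in> carrier S" for c i s
    using Ef[OF that(1) scal_closed that(2), of c] that by (simp add: scal_def one_KQ)
  define U where "U i = E i ` carrier S" for i
  have Uprops: "U i \<subseteq> carrier S" "\<zero>\<^bsub>S\<^esub> \<in> U i" "\<And>s t. s \<in> U i \<Longrightarrow> t \<in> U i \<Longrightarrow> s \<oplus>\<^bsub>S\<^esub> t \<in> U i"
    "\<And>c s. s \<in> U i \<Longrightarrow> cls (scal c) \<odot>\<^bsub>S\<^esub> s \<in> U i" if i: "i \<in> verts Q" for i
  proof -
    show "U i \<subseteq> carrier S" unfolding U_def using Ec[OF i] by blast
    show "\<zero>\<^bsub>S\<^esub> \<in> U i" unfolding U_def using E0[OF i] S.M.zero_closed by (metis imageI)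
    show "s \<oplus>\<^bsub>S\<^esub> t \<in> U i" if st: "s \<in> U i" "t \<in> U i" for s t
    proof -
      obtain a b where "a \<in> carrier S" "s = E i a" "b \<in> carrier S" "t = E i b"
        using st unfolding U_def by blast
      then have "s \<oplus>\<^bsub>S\<^esub> t = E i (a \<oplus>\<^bsub>S\<^esub> b)" "a \<oplus>\<^bsub>S\<^esub> b \<in> carrier S" using Eadd[OF i] by simp_all
      then show ?thesis unfolding U_def by (rule image_eqI)
    qed
    show "cls (scal c) \<odot>\<^bsub>S\<^esub> s \<in> U i" if s: "s \<in> U i" for c s
    proof -
      obtain a where a: "a \<in> carrier S" "s = E i a" using s unfolding U_def by blast
      have "cls (scal c) \<odot>\<^bsub>S\<^esub> s = E i (cls (scal c) \<odot>\<^bsub>S\<^esub> a)" unfolding a(2) by (rule Esc[OF i a(1)])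
      then show ?thesis unfolding U_def using S.smult_closed[OF cls_closed[OF scal_closed] a(1)] by (rule image_eqI)
    qed
  qed
  have VS: "vectorspace class_ring (?RS\<lparr>carrier := U i\<rparr>)" if "i \<in> verts Q" for i
    by (rule scalar_vectorspace[OF S Uprops[OF that]])
  have VS0: "vectorspace class_ring ?RS"
  proof -
    have "vectorspace class_ring (?RS\<lparr>carrier := carrier S\<rparr>)"
      by (rule scalar_vectorspace[OF S]) (auto intro: S.smult_closed)
    then show ?thesis by (simp add: restrict_scalars_def)
  qed
  have mi: "m i = vectorspace.dim class_ring (?RS\<lparr>carrier := U i\<rparr>)" for i
    unfolding m_def dim_vector_def U_def E_def cls_def ..
  \<comment> \<open>\<open>U i\<close> inherits finite dimension as the image of \<open>S\<close>
    under the linear map \<open>E i\<close>, as \<open>coordinates_exist\<close> requires.\<close>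
  have fdi: "vectorspace.fin_dim class_ring (?RS\<lparr>carrier := U i\<rparr>)" if i: "i \<in> verts Q" for i
  proof -
    have hom: "E i \<in> module_hom class_ring ?RS (?RS\<lparr>carrier := U i\<rparr>)"
      by (rule module_homI) (use i Eadd Esc in \<open>simp_all add: RSadd RSc op U_def\<close>)
    interpret L: linear_map class_ring ?RS "?RS\<lparr>carrier := U i\<rparr>" "E i"
      using VS0 VS[OF i] hom
      by (simp add: linear_map_def mod_hom_def mod_hom_axioms_def vectorspace_def)
    show ?thesis by (rule L.surj_fin_dim[OF fd]) (simp add: RSc U_def)
  qed
  have "\<exists>\<phi>. bij_betw \<phi> (carrier_vec (m i)) (U i) \<and>
      (\<forall>c \<in> carrier_vec (m i). \<forall>c' \<in> carrier_vec (m i). \<phi> (c + c') = \<phi> c \<oplus>\<^bsub>S\<^esub> \<phi> c') \<and>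
      (\<forall>a. \<forall>c \<in> carrier_vec (m i). \<phi> (a \<cdot>\<^sub>v c) = cls (scal a) \<odot>\<^bsub>S\<^esub> \<phi> c)" if i: "i \<in> verts Q" for i
  proof -
    obtain \<phi> where "bij_betw \<phi> (carrier_vec (vectorspace.dim class_ring (?RS\<lparr>carrier := U i\<rparr>))) (carrier (?RS\<lparr>carrier := U i\<rparr>))"
    "\<And>c c'. c \<in> carrier_vec (vectorspace.dim class_ring (?RS\<lparr>carrier := U i\<rparr>)) \<Longrightarrow> c' \<in> carrier_vec (vectorspace.dim class_ring (?RS\<lparr>carrier := U i\<rparr>)) \<Longrightarrow> \<phi> (c + c') = \<phi> c \<oplus>\<^bsub>?RS\<lparr>carrier := U i\<rparr>\<^esub> \<phi> c'"
    "\<And>a c. c \<in> carrier_vec (vectorspace.dim class_ring (?RS\<lparr>carrier := U i\<rparr>)) \<Longrightarrow> \<phi> (a \<cdot>\<^sub>v c) = a \<odot>\<^bsub>?RS\<lparr>carrier := U i\<rparr>\<^esub> \<phi> c"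
      using coordinates_exist[OF VS[OF i] fdi[OF i]] by blast
    then show ?thesis by (intro exI[of _ \<phi>]) (simp add: mi[symmetric] RSadd op)
  qed
  then obtain \<phi> where \<phi>: "\<And>i. i \<in> verts Q \<Longrightarrow> bij_betw (\<phi> i) (carrier_vec (m i)) (U i)"
    "\<And>i c c'. i \<in> verts Q \<Longrightarrow> c \<in> carrier_vec (m i) \<Longrightarrow> c' \<in> carrier_vec (m i) \<Longrightarrow> \<phi> i (c + c') = \<phi> i c \<oplus>\<^bsub>S\<^esub> \<phi> i c'"
    "\<And>i a c. i \<in> verts Q \<Longrightarrow> c \<in> carrier_vec (m i) \<Longrightarrow> \<phi> i (a \<cdot>\<^sub>v c) = cls (scal a) \<odot>\<^bsub>S\<^esub> \<phi> i c"
    by metis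
  define \<psi> where "\<psi> i = inv_into (carrier_vec (m i)) (\<phi> i)" for i
  have \<psi>c: "\<psi> i s \<in> carrier_vec (m i)" "\<phi> i (\<psi> i s) = s" if "i \<in> verts Q" "s \<in> U i" for i s
    unfolding \<psi>_def using bij_betwE[OF bij_betw_inv_into[OF \<phi>(1)[OF that(1)]]] that(2)
      bij_betw_inv_into_right[OF \<phi>(1)[OF that(1)] that(2)] by auto
  have \<psi>\<phi>: "\<psi> i (\<phi> i c) = c" if "i \<in> verts Q" "c \<in> carrier_vec (m i)" for i c
    unfolding \<psi>_def using bij_betw_inv_into_left[OF \<phi>(1)[OF that(1)] that(2)] .
  have \<psi>add: "\<psi> i (s \<oplus>\<^bsub>S\<^esub> t) = \<psi> i s + \<psi> i t" if i: "i \<in> verts Q" and st: "s \<in> U i" "t \<in> U i" for i s t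
    using \<psi>\<phi>[OF i, of "\<psi> i s + \<psi> i t"] \<phi>(2)[OF i \<psi>c(1)[OF i st(1)] \<psi>c(1)[OF i st(2)]]
      \<psi>c[OF i st(1)] \<psi>c[OF i st(2)] by simp
  have \<psi>smult: "\<psi> i (cls (scal a) \<odot>\<^bsub>S\<^esub> s) = a \<cdot>\<^sub>v \<psi> i s" if i: "i \<in> verts Q" and s: "s \<in> U i" for i a s
    using \<psi>\<phi>[OF i, of "a \<cdot>\<^sub>v \<psi> i s"] \<phi>(3)[OF i \<psi>c(1)[OF i s]] \<psi>c[OF i s] by simp
  have EU: "E i s \<in> U i" if "s \<in> carrier S" for i s unfolding U_def using that by blast
  define \<Psi> where "\<Psi> s = (\<lambda>i \<in> verts Q. \<psi> i (E i s))" for s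
  have \<Psi>V: "\<Psi> s \<in> Z.V" if "s \<in> carrier S" for s
    unfolding \<Psi>_def by (rule Z.V_I) (rule \<psi>c(1)[OF _ EU[OF that]])
  have hom: "\<Psi> \<in> module_hom Lam S (rep_module Q m (zero_rep m))"
  proof (rule module_homI, unfold Z.rep_carrier Z.rep_add)
    show "\<Psi> (s \<oplus>\<^bsub>S\<^esub> t) = Z.plus_V (\<Psi> s) (\<Psi> t)" if "s \<in> carrier S" "t \<in> carrier S" for s t
      unfolding \<Psi>_def Z.plus_V_def using that Eadd EU \<psi>add by (intro restrict_ext) simp
    show "\<Psi> (a \<odot>\<^bsub>S\<^esub> s) = a \<odot>\<^bsub>rep_module Q m (zero_rep m)\<^esub> \<Psi> s" if a: "a \<in> carrier Lam" "s \<in> carrier S" for a s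
    proof -
      obtain f where f: "f \<in> carrier KQ" "a = cls f" using a(1) unfolding carrier_Lam by blast
      show ?thesis
        unfolding f(2) Z.rep_smult[OF zero_rep_variety f(1) \<Psi>V[OF a(2)]] zero_rep_action[OF f(1) \<Psi>V[OF a(2)]]
        unfolding \<Psi>_def using Ef[OF _ f(1) a(2)] \<psi>smult EU[OF a(2)] by (intro restrict_ext) simp
    qed
  qed (rule \<Psi>V)
  have inj: "inj_on \<Psi> (carrier S)"
  proof (rule inj_onI)
    fix s t assume st: "s \<in> carrier S" "t \<in> carrier S" "\<Psi> s = \<Psi> t"
    have E: "E i s = E i t" if "i \<in> verts Q" for i
    proof -
      have "\<psi> i (E i s) = \<psi> i (E i t)" using fun_cong[OF st(3), of i] that unfolding \<Psi>_def by simp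
      then show ?thesis using \<psi>c(2)[OF that EU] st by metis
    qed
    \<comment> \<open>The sum of the trivial paths at the vertices in \<open>A\<close>. For
      \<open>A = verts Q\<close> it is the unit, so an element is determined by its components
      \<open>E i s\<close>.\<close>
    let ?f = "\<lambda>A (u, p). if u \<in> A \<and> p = [] then 1 else (0 :: 'k)"
    have "A \<subseteq> verts Q \<Longrightarrow> ?f A \<in> carrier KQ \<and> cls (?f A) \<odot>\<^bsub>S\<^esub> s = cls (?f A) \<odot>\<^bsub>S\<^esub> t" if "finite A" for A
      using that
    proof (induction A rule: finite_induct)
      case empty
      have "?f {} = \<zero>\<^bsub>KQ\<^esub>" by (auto simp: zero_KQ)
      then show ?case using cls_ideal[of "\<zero>\<^bsub>KQ\<^esub>"] st by (simp only: KQ.zero_closed) (simp add: S.smult_l_null)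
    next
      case (insert j A)
      have j: "j \<in> verts Q" and A: "A \<subseteq> verts Q" using insert.prems by auto
      have e: "?f (insert j A) = path_elem (j, []) \<oplus>\<^bsub>KQ\<^esub> ?f A"
        using insert.hyps by (auto simp: add_KQ path_elem_def)
      have IH: "?f A \<in> carrier KQ" "cls (?f A) \<odot>\<^bsub>S\<^esub> s = cls (?f A) \<odot>\<^bsub>S\<^esub> t"
        using insert.IH[OF A] by auto
      have "cls (?f (insert j A)) \<odot>\<^bsub>S\<^esub> r = E j r \<oplus>\<^bsub>S\<^esub> cls (?f A) \<odot>\<^bsub>S\<^esub> r" if "r \<in> carrier S" for r
        unfolding e cls_add[OF ec[OF j] IH(1), symmetric] E_def
        by (rule S.smult_l_distr[OF cls_closed[OF ec[OF j]] cls_closed[OF IH(1)] that])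
      moreover have "?f (insert j A) \<in> carrier KQ" unfolding e by (rule KQ.a_closed[OF ec[OF j] IH(1)])
      ultimately show ?case using st E[OF j] IH(2) by (simp only:)
    qed
    from this[OF finite_verts subset_refl] have "cls \<one>\<^bsub>KQ\<^esub> \<odot>\<^bsub>S\<^esub> s = cls \<one>\<^bsub>KQ\<^esub> \<odot>\<^bsub>S\<^esub> t"
      by (simp add: one_KQ)
    then show "s = t" using st by (simp add: cls_one S.smult_one)
  qed
  have surj: "\<Psi> ` carrier S = Z.V"
  proof (intro equalityI subsetI)
    fix w assume w: "w \<in> Z.V"
    define t where "t i = \<phi> i (w i)" for i
    have tU: "t i \<in> U i" if "i \<in> verts Q" for i
      unfolding t_def using bij_betwE[OF \<phi>(1)[OF that]] Z.V_carrier[OF w that] by blast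
    have Et: "E i (t j) = (if i = j then t j else \<zero>\<^bsub>S\<^esub>)" if ij: "i \<in> verts Q" "j \<in> verts Q" for i j
    proof -
      obtain s where "s \<in> carrier S" "t j = E j s" using tU[OF ij(2)] unfolding U_def by blast
      then show ?thesis using EE[OF ij] by simp
    qed
    \<comment> \<open>Partial sums of the prescribed components \<open>t j\<close>; orthogonality of
      the idempotents, recorded in \<open>Et\<close>, keeps the components separate.\<close>
    have "A \<subseteq> verts Q \<Longrightarrow> \<exists>s \<in> carrier S. \<forall>i \<in> verts Q. E i s = (if i \<in> A then t i else \<zero>\<^bsub>S\<^esub>)" if "finite A" for A
      using that
    proof (induction A rule: finite_induct)
      case empty
      show ?case using E0 by (intro bexI[of _ "\<zero>\<^bsub>S\<^esub>"]) auto
    next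
      case (insert j A)
      then obtain s where s: "s \<in> carrier S" "\<And>i. i \<in> verts Q \<Longrightarrow> E i s = (if i \<in> A then t i else \<zero>\<^bsub>S\<^esub>)" by auto
      have j: "j \<in> verts Q" using insert.prems by blast
      have tj: "t j \<in> carrier S" using tU[OF j] Uprops(1)[OF j] by blast
      have "E i (s \<oplus>\<^bsub>S\<^esub> t j) = (if i \<in> insert j A then t i else \<zero>\<^bsub>S\<^esub>)" if i: "i \<in> verts Q" for i
      proof -
        have "t i \<in> carrier S" using tU[OF i] Uprops(1)[OF i] by blast
        then show ?thesis using Eadd[OF i s(1) tj] s(2)[OF i] Et[OF i j] insert.hyps by auto
      qed
      then show ?case using s(1) tj by (intro bexI[of _ "s \<oplus>\<^bsub>S\<^esub> t j"]) auto
    qed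
    from this[OF finite_verts subset_refl] obtain s where s: "s \<in> carrier S" "\<And>i. i \<in> verts Q \<Longrightarrow> E i s = t i" by auto
    have "\<Psi> s = w"
      by (rule Z.V_ext[OF \<Psi>V[OF s(1)] w]) (simp add: \<Psi>_def s(2) t_def \<psi>\<phi> Z.V_carrier[OF w])
    then show "w \<in> \<Psi> ` carrier S" using s(1) by blast
  qed (use \<Psi>V in auto)
  show ?thesis
    unfolding modules_isomorphic_def m_def[symmetric]
    using hom inj surj by (intro bexI[of _ \<Psi>]) (auto simp: bij_betw_def Z.rep_carrier)
qed

lemma semisimple_iso_zero_rep:
  assumes "semisimple_module Lam S" "vectorspace.fin_dim class_ring (restrict_scalars Q I S)"
  shows "modules_isomorphic Lam S (rep_module Q (dim_vector Q I S) (zero_rep (dim_vector Q I S)))"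
  using killed_iso_zero_rep[OF _ semisimple_killed[OF assms(1)] assms(2)] assms(1)
  unfolding semisimple_module_def by blast

end

lemma layer_hom_trans:
  assumes P: "left_module R P" and iso: "modules_isomorphic R P P'" and P': "left_module R P'"
    and \<psi>: "layer_hom R M F F' P \<psi>"
  shows "\<exists>\<psi>'. layer_hom R M F F' P' \<psi>'"
proof -
  obtain f where f: "f \<in> module_hom R P P'" "bij_betw f (carrier P) (carrier P')"
    using iso by (rule modules_isomorphicE)
  have hom: "\<psi> \<in> module_hom R (M\<lparr>carrier := F\<rparr>) P" and surj: "\<psi> ` F = carrier P"
    and ker: "\<And>v. v \<in> F \<Longrightarrow> \<psi> v = \<zero>\<^bsub>P\<^esub> \<longleftrightarrow> v \<in> F'" using \<psi> unfolding layer_hom_def by auto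
  have f0: "f \<zero>\<^bsub>P\<^esub> = \<zero>\<^bsub>P'\<^esub>" by (rule module_hom_zero[OF P P' f(1)])
  interpret P: left_module R P by (rule P)
  have "f (\<psi> v) = \<zero>\<^bsub>P'\<^esub> \<longleftrightarrow> v \<in> F'" if "v \<in> F" for v
  proof -
    have "\<psi> v \<in> carrier P" using surj that by blast
    then have "f (\<psi> v) = f \<zero>\<^bsub>P\<^esub> \<longleftrightarrow> \<psi> v = \<zero>\<^bsub>P\<^esub>"
      using f(2) inj_on_eq_iff[of f "carrier P" "\<psi> v" "\<zero>\<^bsub>P\<^esub>"] unfolding bij_betw_def by simp
    then show ?thesis using f0 ker[OF that] by simp
  qed
  moreover have "(\<lambda>v. f (\<psi> v)) ` F = carrier P'"
    using surj f(2) unfolding bij_betw_def by (metis image_image)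
  ultimately have "layer_hom R M F F' P' (\<lambda>v. f (\<psi> v))"
    unfolding layer_hom_def using module_hom_comp[OF hom f(1)] by simp
  then show ?thesis by blast
qed

text \<open>Preimages along the isomorphism; this carries a filtration of
  \<open>rep_module Q d x\<close> to an arbitrary module isomorphic to it.\<close>

lemma governed_filtration_vimage:
  assumes M: "left_module R M" and N: "left_module R N" and iso: "modules_isomorphic R M N"
    and \<S>: "\<And>l. l \<le> L \<Longrightarrow> semisimple_module R (\<S> l)" and F: "governed_filtration R L \<S> N F"
  shows "\<exists>F'. governed_filtration R L \<S> M F'"
proof -
  obtain h where h: "h \<in> module_hom R M N" "bij_betw h (carrier M) (carrier N)"
    using iso by (rule modules_isomorphicE)
  interpret M: left_module R M by (rule M)
  define F' where "F' l = {v \<in> carrier M. h v \<in> F l}" for l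
  have F1: "F 0 = carrier N \<and> F (Suc L) = {\<zero>\<^bsub>N\<^esub>} \<and> (\<forall>l \<le> Suc L. Module.submodule (F l) R N) \<and>
      (\<forall>l \<le> L. F (Suc l) \<subseteq> F l \<and> (\<exists>\<psi>. layer_hom R N (F l) (F (Suc l)) (\<S> l) \<psi>))"
    using F governed_filtration_iff[OF N, of L \<S> F] \<S> by blast
  have h0: "h \<zero>\<^bsub>M\<^esub> = \<zero>\<^bsub>N\<^esub>" by (rule module_hom_zero[OF M N h(1)])
  have inj: "inj_on h (carrier M)" and surj: "h ` carrier M = carrier N" using h(2) by (auto simp: bij_betw_def)
  have "governed_filtration R L \<S> M F'"
  proof (rule iffD2[OF governed_filtration_iff[OF M \<S>]], assumption, intro conjI allI impI)
    show "F' 0 = carrier M" using F1 module_hom_in[OF h(1)] unfolding F'_def by auto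
    show "F' (Suc L) = {\<zero>\<^bsub>M\<^esub>}"
      using F1 h0 inj_on_eq_iff[OF inj _ M.M.zero_closed] unfolding F'_def by auto
    show "Module.submodule (F' l) R M" if "l \<le> Suc L" for l
      unfolding F'_def using F1 that by (intro submodule_vimage[OF M N h(1)]) auto
    fix l assume l: "l \<le> L"
    have sub: "F (Suc l) \<subseteq> F l" using F1 l by blast
    then show "F' (Suc l) \<subseteq> F' l" unfolding F'_def by blast
    obtain \<psi> where \<psi>: "layer_hom R N (F l) (F (Suc l)) (\<S> l) \<psi>" using F1 l by blast
    have Fl: "F l \<subseteq> carrier N" using F1 l submoduleD(1) by (metis le_SucI)
    have im: "h ` F' l = F l" unfolding F'_def using Fl surj by auto
    have hl: "h \<in> module_hom R (M\<lparr>carrier := F' l\<rparr>) (N\<lparr>carrier := F l\<rparr>)"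
      by (rule module_homI) (auto simp: F'_def module_hom_add[OF h(1)] module_hom_smult[OF h(1)])
    have \<psi>hom: "\<psi> \<in> module_hom R (N\<lparr>carrier := F l\<rparr>) (\<S> l)" and \<psi>im: "\<psi> ` F l = carrier (\<S> l)"
      using \<psi> unfolding layer_hom_def by blast+
    note module_hom_comp[OF hl \<psi>hom]
    moreover have "(\<lambda>v. \<psi> (h v)) ` F' l = carrier (\<S> l)"
      unfolding \<psi>im[symmetric] im[symmetric] image_image ..
    moreover have "\<psi> (h v) = \<zero>\<^bsub>\<S> l\<^esub> \<longleftrightarrow> v \<in> F' (Suc l)" if "v \<in> F' l" for v
      using that \<psi> unfolding layer_hom_def F'_def by auto
    ultimately have "layer_hom R M (F' l) (F' (Suc l)) (\<S> l) (\<lambda>v. \<psi> (h v))"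
      unfolding layer_hom_def by blast
    then show "\<exists>\<psi>. layer_hom R M (F' l) (F' (Suc l)) (\<S> l) \<psi>" by blast
  qed
  then show ?thesis by blast
qed

section \<open>Filtrations and flags\<close>

lemma mat_vec_index:
  assumes "A \<in> carrier_mat m n" "v \<in> carrier_vec n" "r < m"
  shows "(A *\<^sub>v v) $ r = (\<Sum>c<n. A $$ (r, c) * v $ c)"
proof -
  have "(A *\<^sub>v v) $ r = (\<Sum>c\<in>{0..<n}. row A r $ c * v $ c)"
    using assms by (simp add: scalar_prod_def)
  also have "\<dots> = (\<Sum>c<n. A $$ (r, c) * v $ c)"
    using assms by (intro sum.cong) auto
  finally show ?thesis .
qed

lemma vsub_sum:
  assumes U: "vsub n U" and fin: "finite K" and u: "\<And>k. k \<in> K \<Longrightarrow> u k \<in> U"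
  shows "vec n (\<lambda>r. \<Sum>k\<in>K. a k * u k $ r) \<in> U"
  using fin u
proof (induction K rule: finite_induct)
  case empty
  have "vec n (\<lambda>r. \<Sum>k\<in>{}. a k * u k $ r) = 0\<^sub>v n" by (rule eq_vecI) simp_all
  then show ?case using vsubD(2)[OF U] by simp
next
  case (insert j K)
  have uj: "u j \<in> U" "u j \<in> carrier_vec n" using insert.prems vsubD(1)[OF U] by auto
  have "vec n (\<lambda>r. \<Sum>k\<in>insert j K. a k * u k $ r) = a j \<cdot>\<^sub>v u j + vec n (\<lambda>r. \<Sum>k\<in>K. a k * u k $ r)"
    using insert.hyps uj(2) by (intro eq_vecI) auto
  then show ?case using vsubD(3)[OF U vsubD(4)[OF U uj(1)]] insert by simp
qed

text \<open>\<open>A v\<close> is a combination of those columns of \<open>A\<close> that correspond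
  to nonzero entries of \<open>v\<close>, so only these have to lie in \<open>U\<close>.\<close>

lemma mult_mat_vec_comb:
  assumes A: "A \<in> carrier_mat m n" and v: "v \<in> carrier_vec n" and U: "vsub m U"
    and col: "\<And>c. c < n \<Longrightarrow> v $ c \<noteq> 0 \<Longrightarrow> col A c \<in> U"
  shows "A *\<^sub>v v \<in> U"
proof -
  have "A *\<^sub>v v = vec m (\<lambda>r. \<Sum>c\<in>{c. c < n \<and> v $ c \<noteq> 0}. v $ c * col A c $ r)"
  proof (rule eq_vecI)
    fix r assume "r < dim_vec (vec m (\<lambda>r. \<Sum>c\<in>{c. c < n \<and> v $ c \<noteq> 0}. v $ c * col A c $ r))"
    then have r: "r < m" by simp
    have "(A *\<^sub>v v) $ r = (\<Sum>c<n. A $$ (r, c) * v $ c)" by (rule mat_vec_index[OF A v r])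
    also have "\<dots> = (\<Sum>c\<in>{c. c < n \<and> v $ c \<noteq> 0}. v $ c * col A c $ r)"
      using A r by (intro sum.mono_neutral_cong_right) auto
    finally show "(A *\<^sub>v v) $ r = vec m (\<lambda>r. \<Sum>c\<in>{c. c < n \<and> v $ c \<noteq> 0}. v $ c * col A c $ r) $ r"
      using r by simp
  qed (use A in simp)
  also have "\<dots> \<in> U" by (rule vsub_sum[OF U]) (auto intro: col)
  finally show ?thesis .
qed

lemma mult_mat_unit_vec:
  fixes A :: "'k::field mat"
  assumes "A \<in> carrier_mat m n" "c < n"
  shows "A *\<^sub>v unit_vec n c = col A c"
proof (rule eq_vecI)
  fix r assume "r < dim_vec (col A c)"
  then show "(A *\<^sub>v unit_vec n c) $ r = col A c $ r" using assms by simp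
qed (use assms in simp)

lemma mat_inverse_vec:
  fixes g :: "'k::field mat"
  assumes "g \<in> carrier_mat n n" "g' \<in> carrier_mat n n" "g * g' = 1\<^sub>m n" "v \<in> carrier_vec n"
  shows "g *\<^sub>v (g' *\<^sub>v v) = v"
proof -
  have "g *\<^sub>v (g' *\<^sub>v v) = (g * g') *\<^sub>v v" by (rule assoc_mult_mat_vec[symmetric, OF assms(1,2,4)])
  then show ?thesis using assms(3,4) by simp
qed

locale quiver_layers = quiver_rep Q I d
  for Q :: "('v, 'a) pre_digraph" and I :: "(('v, 'a) qpath \<Rightarrow> 'k::field) set" and d :: "'v \<Rightarrow> nat" +
  fixes L :: nat and m :: "nat \<Rightarrow> 'v \<Rightarrow> nat"
  assumes sum_m: "\<And>i. i \<in> verts Q \<Longrightarrow> (\<Sum>l\<le>L. m l i) = d i"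
begin

text \<open>The dimension at \<open>i\<close> of the \<open>l\<close>-th term of a filtration with
  layer dimensions \<open>m\<close>. For \<open>l > L\<close> the range of summation is empty and
  the value is 0, which matches the zero term at the end.\<close>

definition fl :: "nat \<Rightarrow> 'v \<Rightarrow> nat" where
  "fl l i = (\<Sum>k\<in>{l..L}. m k i)"

lemma fl_0: "i \<in> verts Q \<Longrightarrow> fl 0 i = d i"
  using sum_m by (simp add: fl_def atMost_atLeast0)

lemma fl_top: "L < l \<Longrightarrow> fl l i = 0"
  by (simp add: fl_def)

lemma fl_step: "l \<le> L \<Longrightarrow> fl l i = fl (Suc l) i + m l i"
proof -
  assume l: "l \<le> L"
  then have "{l..L} = insert l {Suc l..L}" by auto
  then show ?thesis by (simp add: fl_def)
qed

lemma fl_Suc_le: "fl (Suc l) i \<le> fl l i"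
  unfolding fl_def by (rule sum_mono2) auto

lemma fl_antimono: "l \<le> l' \<Longrightarrow> fl l' i \<le> fl l i"
  by (rule lift_Suc_antimono_le[of "\<lambda>l. fl l i"]) (rule fl_Suc_le)

lemma fl_le: "i \<in> verts Q \<Longrightarrow> fl l i \<le> d i"
  using fl_antimono[of 0 l i] fl_0 by simp

definition layer :: "nat \<Rightarrow> ((('v, 'a) qpath \<Rightarrow> 'k) set, 'v \<Rightarrow> 'k vec) module" where
  "layer l = rep_module Q (m l) (zero_rep (m l))"

text \<open>The preimage under \<open>g i\<close> of the span of the first \<open>fl l i\<close>
  unit vectors.\<close>

definition flag :: "('v \<Rightarrow> 'k mat) \<Rightarrow> nat \<Rightarrow> 'v \<Rightarrow> 'k vec set" where
  "flag g l i = {v \<in> carrier_vec (d i). \<forall>r. fl l i \<le> r \<longrightarrow> r < d i \<longrightarrow> (g i *\<^sub>v v) $ r = 0}"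

lemma flag_vsub:
  assumes "(g, g') \<in> GL" "i \<in> verts Q"
  shows "vsub (d i) (flag g l i)"
proof -
  note G = GL_D[OF assms]
  have "g i *\<^sub>v 0\<^sub>v (d i) = 0\<^sub>v (d i)" using G(1) by auto
  then show ?thesis
    unfolding vsub_def flag_def using G(1)
    by (auto simp: mult_add_distrib_mat_vec[OF G(1)] mult_mat_vec[OF G(1)] simp del: index_mult_mat_vec)
qed

lemma flag_decreasing: "flag g (Suc l) i \<subseteq> flag g l i"
  unfolding flag_def using fl_Suc_le[of l i] by auto

lemma flag_supp: "w \<in> flag g l i \<Longrightarrow> c < d i \<Longrightarrow> (g i *\<^sub>v w) $ c \<noteq> 0 \<Longrightarrow> c < fl l i"
  by (rule ccontr) (auto simp: flag_def not_less simp del: index_mult_mat_vec)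

lemma act_mult_vec:
  assumes g: "(g, g') \<in> GL" and x: "x \<in> rep_space Q d" and \<alpha>: "\<alpha> \<in> arcs Q" and w: "w \<in> carrier_vec (d (tail Q \<alpha>))"
  shows "act g g' x \<alpha> *\<^sub>v (g (tail Q \<alpha>) *\<^sub>v w) = g (head Q \<alpha>) *\<^sub>v (x \<alpha> *\<^sub>v w)"
proof -
  have ij: "head Q \<alpha> \<in> verts Q" "tail Q \<alpha> \<in> verts Q" using \<alpha> by auto
  note G = GL_D[OF g ij(1)] and H = GL_D[OF g ij(2)] and xa = rep_space_carrier[OF x \<alpha>]
  have gw: "g (tail Q \<alpha>) *\<^sub>v w \<in> carrier_vec (d (tail Q \<alpha>))" using H(1) w by simp
  have "act g g' x \<alpha> *\<^sub>v (g (tail Q \<alpha>) *\<^sub>v w) = (g (head Q \<alpha>) * x \<alpha>) *\<^sub>v (g' (tail Q \<alpha>) *\<^sub>v (g (tail Q \<alpha>) *\<^sub>v w))"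
    using \<alpha> assoc_mult_mat_vec[OF mult_carrier_mat[OF G(1) xa] H(2) gw] by (simp add: act_def)
  also have "\<dots> = g (head Q \<alpha>) *\<^sub>v (x \<alpha> *\<^sub>v w)"
    unfolding mat_inverse_vec[OF H(2,1,4) w] by (rule assoc_mult_mat_vec[OF G(1) xa w])
  finally show ?thesis .
qed

text \<open>In the coordinates given by \<open>g\<close> the arrow acts by the matrix
  \<open>act g g' x \<alpha>\<close>, and the zero pattern of \<open>std fl\<close> is what moves
  the \<open>l\<close>-th term into the next one.\<close>

lemma flag_arrow:
  assumes g: "(g, g') \<in> GL" and x: "x \<in> rep_space Q d" and std: "act g g' x \<in> std fl"
    and \<alpha>: "\<alpha> \<in> arcs Q" and w: "w \<in> flag g l (tail Q \<alpha>)"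
  shows "x \<alpha> *\<^sub>v w \<in> flag g (Suc l) (head Q \<alpha>)"
proof -
  have ij: "head Q \<alpha> \<in> verts Q" "tail Q \<alpha> \<in> verts Q" using \<alpha> by auto
  note G = GL_D[OF g ij(1)] and H = GL_D[OF g ij(2)] and xa = rep_space_carrier[OF x \<alpha>]
  have wc: "w \<in> carrier_vec (d (tail Q \<alpha>))" using w unfolding flag_def by blast
  have z: "act g g' x \<alpha> \<in> carrier_mat (d (head Q \<alpha>)) (d (tail Q \<alpha>))"
    by (rule rep_space_carrier[OF GL_act_closed[OF g x] \<alpha>])
  have gw: "g (tail Q \<alpha>) *\<^sub>v w \<in> carrier_vec (d (tail Q \<alpha>))" using H(1) wc by simp
  have "(g (head Q \<alpha>) *\<^sub>v (x \<alpha> *\<^sub>v w)) $ r = 0" if r: "fl (Suc l) (head Q \<alpha>) \<le> r" "r < d (head Q \<alpha>)" for r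
  proof -
    have "(g (head Q \<alpha>) *\<^sub>v (x \<alpha> *\<^sub>v w)) $ r = (\<Sum>c<d (tail Q \<alpha>). act g g' x \<alpha> $$ (r, c) * (g (tail Q \<alpha>) *\<^sub>v w) $ c)"
      unfolding act_mult_vec[OF g x \<alpha> wc, symmetric] by (rule mat_vec_index[OF z gw r(2)])
    also have "\<dots> = 0"
    proof (intro sum.neutral ballI)
      fix c assume c: "c \<in> {..<d (tail Q \<alpha>)}"
      show "act g g' x \<alpha> $$ (r, c) * (g (tail Q \<alpha>) *\<^sub>v w) $ c = 0"
      proof (cases "c < fl l (tail Q \<alpha>)")
        case True
        then have "act g g' x \<alpha> $$ (r, c) = 0" using std \<alpha> r c unfolding std_def by blast
        then show ?thesis by simp
      next
        case False
        then show ?thesis using flag_supp[OF w, of c] c by auto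
      qed
    qed
    finally show ?thesis .
  qed
  then show ?thesis unfolding flag_def using xa wc by simp
qed

lemma flag_arrow_stable:
  assumes "(g, g') \<in> GL" "x \<in> rep_space Q d" "act g g' x \<in> std fl" "\<alpha> \<in> arcs Q" "w \<in> flag g l (tail Q \<alpha>)"
  shows "x \<alpha> *\<^sub>v w \<in> flag g l (head Q \<alpha>)"
  using flag_arrow[OF assms] flag_decreasing by blast

lemma graded_flag_0:
  assumes "(g, g') \<in> GL"
  shows "graded (flag g 0) = V"
  unfolding graded_def flag_def using fl_0 by auto

lemma graded_flag_top:
  assumes g: "(g, g') \<in> GL" and l: "L < l"
  shows "graded (flag g l) = {zero_V}"
proof (intro equalityI subsetI)
  fix v assume v: "v \<in> graded (flag g l)"
  then have vV: "v \<in> V" unfolding graded_def by blast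
  have "v i = 0\<^sub>v (d i)" if i: "i \<in> verts Q" for i
  proof -
    note G = GL_D[OF g i]
    have "v i \<in> flag g l i" using v i unfolding graded_def by blast
    then have "g i *\<^sub>v v i = 0\<^sub>v (d i)" using G(1) unfolding flag_def by (intro eq_vecI) (auto simp: fl_top[OF l])
    then have "g' i *\<^sub>v (g i *\<^sub>v v i) = 0\<^sub>v (d i)" using G(2) by auto
    then show ?thesis using mat_inverse_vec[OF G(2,1,4) V_carrier[OF vV i]] by simp
  qed
  then show "v \<in> {zero_V}" using V_ext[OF vV zero_V_closed] by simp
next
  fix v assume "v \<in> {zero_V}"
  then show "v \<in> graded (flag g l)" using graded_zero[of "flag g l"] flag_vsub[OF g] by simp
qed

lemma flag_submodule:
  assumes "(g, g') \<in> GL" "x \<in> rep_variety Q I d" "act g g' x \<in> std fl"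
  shows "Module.submodule (graded (flag g l)) Lam (rep_module Q d x)"
  using flag_arrow_stable[OF assms(1) variety_space[OF assms(2)] assms(3)]
  by (intro graded_submodule[OF assms(2)] flag_vsub[OF assms(1)])

lemma graded_mono: "(\<And>i. i \<in> verts Q \<Longrightarrow> W i \<subseteq> W' i) \<Longrightarrow> graded W \<subseteq> graded W'"
  unfolding graded_def by blast

text \<open>The map onto the layer reads off the coordinates of \<open>g v\<close> from
  \<open>fl (Suc l) i\<close> up to but excluding \<open>fl l i\<close>: on the \<open>l\<close>-th
  term all later coordinates vanish, and the next term is where these vanish too.\<close>

lemma flag_layer_hom:
  assumes g: "(g, g') \<in> GL" and x: "x \<in> rep_variety Q I d" and std: "act g g' x \<in> std fl" and l: "l \<le> L"
  shows "\<exists>\<psi>. layer_hom Lam (rep_module Q d x) (graded (flag g l)) (graded (flag g (Suc l))) (layer l) \<psi>"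
proof -
  interpret Z: quiver_rep Q I "m l" by unfold_locales
  note xs = variety_space[OF x]
  let ?f = "fl (Suc l)"
  define \<psi> where "\<psi> v = (\<lambda>i \<in> verts Q. vec (m l i) (\<lambda>j. (g i *\<^sub>v v i) $ (?f i + j)))" for v
  have lt: "?f i + j < d i" if "i \<in> verts Q" "j < m l i" for i j
    using fl_step[OF l, of i] fl_le[OF that(1), of l] that(2) by simp
  have \<psi>c: "\<psi> v \<in> Z.V" for v unfolding \<psi>_def by (rule Z.V_I) simp
  have \<psi>add: "\<psi> (plus_V v w) = Z.plus_V (\<psi> v) (\<psi> w)" if vw: "v \<in> V" "w \<in> V" for v w
  proof (rule Z.V_ext[OF \<psi>c Z.plus_V_closed[OF \<psi>c \<psi>c]])
    fix i assume i: "i \<in> verts Q"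
    note G = GL_D[OF g i]
    have "g i *\<^sub>v (v i + w i) = g i *\<^sub>v v i + g i *\<^sub>v w i"
      by (rule mult_add_distrib_mat_vec[OF G(1) V_carrier[OF vw(1) i] V_carrier[OF vw(2) i]])
    then have "\<psi> (plus_V v w) i = vec (m l i) (\<lambda>j. (g i *\<^sub>v v i + g i *\<^sub>v w i) $ (?f i + j))"
      using i by (simp add: \<psi>_def)
    also have "\<dots> = \<psi> v i + \<psi> w i"
      using i G(1) lt[OF i] by (intro eq_vecI) (auto simp: \<psi>_def)
    finally show "\<psi> (plus_V v w) i = Z.plus_V (\<psi> v) (\<psi> w) i" using i by simp
  qed
  have ker: "\<psi> v = Z.zero_V \<longleftrightarrow> v \<in> graded (flag g (Suc l))" if v: "v \<in> graded (flag g l)" for v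
  proof
    assume 0: "\<psi> v = Z.zero_V"
    have "v i \<in> flag g (Suc l) i" if i: "i \<in> verts Q" for i
    proof -
      have vi: "v i \<in> flag g l i" using v i unfolding graded_def by blast
      have "(g i *\<^sub>v v i) $ r = 0" if r: "?f i \<le> r" "r < d i" for r
      proof (cases "r < fl l i")
        case True
        then have j: "r - ?f i < m l i" using r fl_step[OF l, of i] by simp
        have "\<psi> v i $ (r - ?f i) = 0" using 0 j i by simp
        then show ?thesis using i j r unfolding \<psi>_def by simp
      next
        case False
        then show ?thesis using vi r unfolding flag_def by auto
      qed
      then show ?thesis using vi unfolding flag_def by simp
    qed
    then show "v \<in> graded (flag g (Suc l))" using v unfolding graded_def by simp
  next
    assume v': "v \<in> graded (flag g (Suc l))"
    show "\<psi> v = Z.zero_V"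
      unfolding \<psi>_def Z.zero_V_def
    proof (rule restrict_ext)
      fix i assume i: "i \<in> verts Q"
      then have "v i \<in> flag g (Suc l) i" using v' unfolding graded_def by blast
      then show "vec (m l i) (\<lambda>j. (g i *\<^sub>v v i) $ (?f i + j)) = 0\<^sub>v (m l i)"
        using lt[OF i] unfolding flag_def by (intro eq_vecI) auto
    qed
  qed
  \<comment> \<open>The paths of positive length in \<open>f\<close> map into the next term, the
    kernel of \<open>\<psi>\<close>, so \<open>f\<close> acts through its coefficients at the
    vertices, as in the zero representation.\<close>
  have \<psi>smult: "\<psi> (rep_action Q d x f v) = (\<lambda>i \<in> verts Q. f (i, []) \<cdot>\<^sub>v \<psi> v i)"
    if f: "f \<in> carrier KQ" and v: "v \<in> graded (flag g l)" for f v
  proof -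
    have vV: "v \<in> V" using v unfolding graded_def by blast
    obtain h where h: "h \<in> len_ge 1" "rep_action Q d x f v = plus_V (\<lambda>i \<in> verts Q. f (i, []) \<cdot>\<^sub>v v i) (rep_action Q d x h v)"
      by (rule rep_action_split[OF f vV])
    have hv: "rep_action Q d x h v \<in> graded (flag g (Suc l))"
      by (rule rep_action_lower[OF xs flag_vsub[OF g] flag_arrow_stable[OF g xs std] flag_arrow[OF g xs std] h(1) v])
    then have "rep_action Q d x h v \<in> graded (flag g l)"
      using graded_mono[of "flag g (Suc l)" "flag g l"] flag_decreasing by blast
    then have \<psi>0: "\<psi> (rep_action Q d x h v) = Z.zero_V" using ker hv by blast
    have c: "(\<lambda>i \<in> verts Q. f (i, []) \<cdot>\<^sub>v v i) \<in> V" using vV by (intro V_I) simp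
    have "\<psi> (rep_action Q d x f v) = Z.plus_V (\<psi> (\<lambda>i \<in> verts Q. f (i, []) \<cdot>\<^sub>v v i)) Z.zero_V"
      unfolding h(2) \<psi>add[OF c rep_action_closed] \<psi>0 ..
    also have "\<dots> = \<psi> (\<lambda>i \<in> verts Q. f (i, []) \<cdot>\<^sub>v v i)"
      using Z.plus_V_comm[OF \<psi>c Z.zero_V_closed] Z.zero_V_left[OF \<psi>c] by simp
    also have "\<dots> = (\<lambda>i \<in> verts Q. f (i, []) \<cdot>\<^sub>v \<psi> v i)"
      unfolding \<psi>_def
    proof (rule restrict_ext)
      fix i assume i: "i \<in> verts Q"
      note G = GL_D[OF g i]
      have "g i *\<^sub>v (f (i, []) \<cdot>\<^sub>v v i) = f (i, []) \<cdot>\<^sub>v (g i *\<^sub>v v i)"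
        by (rule mult_mat_vec[OF G(1) V_carrier[OF vV i]])
      then show "vec (m l i) (\<lambda>j. (g i *\<^sub>v (\<lambda>i\<in>verts Q. f (i, []) \<cdot>\<^sub>v v i) i) $ (?f i + j)) =
          f (i, []) \<cdot>\<^sub>v (\<lambda>i\<in>verts Q. vec (m l i) (\<lambda>j. (g i *\<^sub>v v i) $ (?f i + j))) i"
        using i G(1) lt[OF i] by (intro eq_vecI) auto
    qed
    finally show ?thesis .
  qed
  have sub: "graded (flag g l) \<subseteq> V" unfolding graded_def by blast
  have hom: "\<psi> \<in> module_hom Lam (rep_module Q d x\<lparr>carrier := graded (flag g l)\<rparr>) (layer l)"
  proof (rule module_homI)
    show "\<psi> v \<in> carrier (layer l)" for v using \<psi>c by (simp add: layer_def Z.rep_carrier)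
    show "\<psi> (v \<oplus>\<^bsub>rep_module Q d x\<lparr>carrier := graded (flag g l)\<rparr>\<^esub> w) = \<psi> v \<oplus>\<^bsub>layer l\<^esub> \<psi> w"
      if "v \<in> carrier (rep_module Q d x\<lparr>carrier := graded (flag g l)\<rparr>)" "w \<in> carrier (rep_module Q d x\<lparr>carrier := graded (flag g l)\<rparr>)" for v w
      using that \<psi>add sub by (auto simp: layer_def Z.rep_add rep_add)
    show "\<psi> (a \<odot>\<^bsub>rep_module Q d x\<lparr>carrier := graded (flag g l)\<rparr>\<^esub> v) = a \<odot>\<^bsub>layer l\<^esub> \<psi> v"
      if a: "a \<in> carrier Lam" and v: "v \<in> carrier (rep_module Q d x\<lparr>carrier := graded (flag g l)\<rparr>)" for a v
    proof -
      obtain f where f: "f \<in> carrier KQ" "a = cls f" using a unfolding carrier_Lam by blast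
      have v': "v \<in> graded (flag g l)" "v \<in> V" using v sub by auto
      show ?thesis
        using rep_smult[OF x f(1) v'(2)] \<psi>smult[OF f(1) v'(1)]
          Z.rep_smult[OF zero_rep_variety f(1) \<psi>c] zero_rep_action[OF f(1) \<psi>c]
        by (simp add: f(2) layer_def)
    qed
  qed
  have surj: "\<psi> ` graded (flag g l) = carrier (layer l)"
  proof (intro equalityI subsetI)
    fix c assume "c \<in> carrier (layer l)"
    then have c: "c \<in> Z.V" by (simp add: layer_def Z.rep_carrier)
    \<comment> \<open>The window of coordinates is filled with \<open>c\<close> and the others with
      0; applying \<open>g'\<close> gives a preimage of \<open>c\<close> under
      \<open>\<psi>\<close>.\<close>
    define u where "u i = vec (d i) (\<lambda>r. if ?f i \<le> r \<and> r < fl l i then c i $ (r - ?f i) else 0)" for i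
    let ?v = "\<lambda>i \<in> verts Q. g' i *\<^sub>v u i"
    have uc: "u i \<in> carrier_vec (d i)" for i by (simp add: u_def)
    have gv: "g i *\<^sub>v ?v i = u i" if i: "i \<in> verts Q" for i
      using mat_inverse_vec[OF GL_D(1,2,3)[OF g i] uc] i by simp
    have vV: "?v \<in> V" using GL_D(2)[OF g] uc by (intro V_I mult_mat_vec_carrier[of _ "d i" "d i" for i]) auto
    have "?v \<in> graded (flag g l)"
      unfolding graded_def flag_def using vV gv V_carrier[OF vV] by (auto simp: u_def simp del: restrict_apply')
    moreover have "\<psi> ?v = c"
    proof (rule Z.V_ext[OF \<psi>c c])
      fix i assume i: "i \<in> verts Q"
      have "dim_vec (c i) = m l i" using Z.V_carrier[OF c i] by simp
      then show "\<psi> ?v i = c i"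
        using i gv[OF i] lt[OF i] fl_step[OF l, of i] unfolding \<psi>_def by (intro eq_vecI) (auto simp: u_def)
    qed
    ultimately show "c \<in> \<psi> ` graded (flag g l)" by (metis imageI)
  qed (use \<psi>c in \<open>auto simp: layer_def Z.rep_carrier\<close>)
  have "layer_hom Lam (rep_module Q d x) (graded (flag g l)) (graded (flag g (Suc l))) (layer l) \<psi>"
    unfolding layer_hom_def using hom surj ker by (simp add: layer_def Z.rep_zero)
  then show ?thesis by blast
qed

section \<open>Bases adapted to a filtration\<close>

lemma zero_smult: "v \<in> carrier_vec n \<Longrightarrow> 0 \<cdot>\<^sub>v v = (0\<^sub>v n :: 'k vec)"
  by (rule eq_vecI) auto

lemma layer_left_module: "left_module Lam (layer l)"
proof -
  interpret Z: quiver_rep Q I "m l" by unfold_locales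
  show ?thesis unfolding layer_def by (rule Z.rep_left_module[OF zero_rep_variety])
qed

lemma rep_submodule:
  assumes x: "x \<in> rep_variety Q I d" and F: "Module.submodule F Lam (rep_module Q d x)"
  shows "F \<subseteq> V" "zero_V \<in> F" "\<And>v w. v \<in> F \<Longrightarrow> w \<in> F \<Longrightarrow> v +\<^sub>V w \<in> F"
    "\<And>f v. f \<in> carrier KQ \<Longrightarrow> v \<in> F \<Longrightarrow> rep_action Q d x f v \<in> F"
proof -
  note s = submoduleD[OF F, unfolded rep_carrier rep_zero rep_add]
  show "F \<subseteq> V" "zero_V \<in> F" "\<And>v w. v \<in> F \<Longrightarrow> w \<in> F \<Longrightarrow> v +\<^sub>V w \<in> F" using s by auto
  show "rep_action Q d x f v \<in> F" if f: "f \<in> carrier KQ" and v: "v \<in> F" for f v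
    using s(4)[OF cls_closed[OF f] v] rep_smult[OF x f subsetD[OF s(1) v]] by simp
qed

lemma embed_smult: "w \<in> carrier_vec (d i) \<Longrightarrow> embed i (c \<cdot>\<^sub>v w) = rep_action Q d x (scal c) (embed i w)"
proof (rule V_ext)
  fix j assume w: "w \<in> carrier_vec (d i)" and j: "j \<in> verts Q"
  show "embed i (c \<cdot>\<^sub>v w) j = rep_action Q d x (scal c) (embed i w) j"
    using w j by (cases "j = i") (simp_all add: rep_action_scal smult_zero)
qed simp_all

text \<open>Stability under the trivial paths makes a submodule homogeneous, that is the direct sum
  of its components at the vertices; stability under \<open>scal c\<close> makes the components
  subspaces.\<close>

lemma rep_submodule_embed:
  assumes x: "x \<in> rep_variety Q I d" and F: "Module.submodule F Lam (rep_module Q d x)" and i: "i \<in> verts Q"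
  shows "v \<in> F \<Longrightarrow> embed i (v i) \<in> F" "vsub (d i) {w \<in> carrier_vec (d i). embed i w \<in> F}"
proof -
  note s = rep_submodule[OF x F]
  show "embed i (v i) \<in> F" if v: "v \<in> F" for v
    using s(4)[OF _ v, of "path_elem (i, [])"] rep_action_vertex[OF variety_space[OF x] i subsetD[OF s(1) v]] i by simp
  show "vsub (d i) {w \<in> carrier_vec (d i). embed i w \<in> F}"
    unfolding vsub_def using s(2,3) s(4)[OF scal_closed] by (auto simp: embed_zero embed_add embed_smult[of _ _ _ x])
qed

lemma rep_submodule_arrow:
  assumes x: "x \<in> rep_variety Q I d" and \<alpha>: "\<alpha> \<in> arcs Q" and w: "w \<in> carrier_vec (d (tail Q \<alpha>))"
  shows "rep_action Q d x (path_elem (tail Q \<alpha>, [\<alpha>])) (embed (tail Q \<alpha>) w) = embed (head Q \<alpha>) (x \<alpha> *\<^sub>v w)"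
  using rep_action_arrow[OF variety_space[OF x] \<alpha> embed_closed[OF w]] \<alpha> by simp

lemma layer_homD:
  assumes x: "x \<in> rep_variety Q I d" and F: "Module.submodule F Lam (rep_module Q d x)"
    and \<psi>: "layer_hom Lam (rep_module Q d x) F F' (layer l) \<psi>"
  shows "\<And>v. v \<in> F \<Longrightarrow> \<psi> v \<in> quiver_rep.V Q (m l)"
    "\<And>v w. v \<in> F \<Longrightarrow> w \<in> F \<Longrightarrow> \<psi> (v +\<^sub>V w) = \<psi> v +\<^sub>V \<psi> w"
    "\<And>f v. f \<in> carrier KQ \<Longrightarrow> v \<in> F \<Longrightarrow> \<psi> (rep_action Q d x f v) = (\<lambda>i \<in> verts Q. f (i, []) \<cdot>\<^sub>v \<psi> v i)"
    "\<And>v. v \<in> F \<Longrightarrow> \<psi> v = quiver_rep.zero_V Q (m l) \<longleftrightarrow> v \<in> F'"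
    "\<psi> ` F = quiver_rep.V Q (m l)"
proof -
  interpret Z: quiver_rep Q I "m l" by unfold_locales
  have hom: "\<psi> \<in> module_hom Lam (rep_module Q d x\<lparr>carrier := F\<rparr>) (layer l)"
    and surj: "\<psi> ` F = carrier (layer l)" and ker: "\<And>v. v \<in> F \<Longrightarrow> \<psi> v = \<zero>\<^bsub>layer l\<^esub> \<longleftrightarrow> v \<in> F'"
    using \<psi> unfolding layer_hom_def by auto
  note s = rep_submodule[OF x F]
  show \<psi>c: "\<psi> v \<in> Z.V" if "v \<in> F" for v
    using module_hom_in[OF hom, of v] that by (simp add: layer_def Z.rep_carrier)
  show "\<psi> (plus_V v w) = plus_V (\<psi> v) (\<psi> w)" if "v \<in> F" "w \<in> F" for v w
    using module_hom_add[OF hom, of v w] that by (simp add: layer_def Z.rep_add rep_add)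
  show "\<psi> (rep_action Q d x f v) = (\<lambda>i \<in> verts Q. f (i, []) \<cdot>\<^sub>v \<psi> v i)" if f: "f \<in> carrier KQ" and v: "v \<in> F" for f v
    using module_hom_smult[OF hom, of "cls f" v] f v rep_smult[OF x f subsetD[OF s(1) v]]
      Z.rep_smult[OF zero_rep_variety f \<psi>c[OF v]] zero_rep_action[OF f \<psi>c[OF v]]
    by (simp add: layer_def)
  show "\<psi> v = Z.zero_V \<longleftrightarrow> v \<in> F'" if "v \<in> F" for v using ker[OF that] by (simp add: layer_def Z.rep_zero)
  show "\<psi> ` F = Z.V" using surj by (simp add: layer_def Z.rep_carrier)
qed

text \<open>A preimage of the unit vector placed at \<open>i\<close> need not be concentrated at
  \<open>i\<close>; applying the trivial path at \<open>i\<close> cuts it down to that component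
  without changing its image there.\<close>

lemma layer_hom_lift:
  assumes x: "x \<in> rep_variety Q I d" and F: "Module.submodule F Lam (rep_module Q d x)"
    and \<psi>: "layer_hom Lam (rep_module Q d x) F F' (layer l) \<psi>" and i: "i \<in> verts Q" and j: "j < m l i"
  shows "\<exists>w \<in> carrier_vec (d i). embed i w \<in> F \<and> \<psi> (embed i w) i = unit_vec (m l i) j"
proof -
  interpret Z: quiver_rep Q I "m l" by unfold_locales
  note h = layer_homD[OF x F \<psi>] and s = rep_submodule[OF x F]
  obtain v where v: "v \<in> F" "\<psi> v = Z.embed i (unit_vec (m l i) j)"
    using h(5) Z.embed_closed[of "unit_vec (m l i) j" i] by (metis imageE unit_vec_carrier)
  have e: "path_elem (i, []) \<in> carrier KQ" using i by simp
  have "embed i (v i) = rep_action Q d x (path_elem (i, [])) v"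
    using rep_action_vertex[OF variety_space[OF x] i subsetD[OF s(1) v(1)]] by simp
  then have "\<psi> (embed i (v i)) = (\<lambda>i' \<in> verts Q. (path_elem (i, []) :: ('v, 'a) qpath \<Rightarrow> 'k) (i', []) \<cdot>\<^sub>v \<psi> v i')"
    using h(3)[OF e v(1)] by simp
  then have "\<psi> (embed i (v i)) i = unit_vec (m l i) j" using i v(2) by (simp add: path_elem_def)
  moreover have "v i \<in> carrier_vec (d i)" using s(1) v(1) i by auto
  ultimately show ?thesis using rep_submodule_embed(1)[OF x F i v(1)] by blast
qed

text \<open>Commuting with the trivial path at \<open>i\<close> forces the image of an element
  concentrated at \<open>i\<close> to be concentrated at \<open>i\<close>, so one component decides
  membership in the kernel \<open>F'\<close>.\<close>

lemma layer_hom_kernel: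
  assumes x: "x \<in> rep_variety Q I d" and F: "Module.submodule F Lam (rep_module Q d x)"
    and \<psi>: "layer_hom Lam (rep_module Q d x) F F' (layer l) \<psi>" and i: "i \<in> verts Q"
    and w: "w \<in> carrier_vec (d i)" "embed i w \<in> F" "\<psi> (embed i w) i = 0\<^sub>v (m l i)"
  shows "embed i w \<in> F'"
proof -
  interpret Z: quiver_rep Q I "m l" by unfold_locales
  note h = layer_homD[OF x F \<psi>] and s = rep_submodule[OF x F]
  have e: "path_elem (i, []) \<in> carrier KQ" using i by simp
  have "rep_action Q d x (path_elem (i, [])) (embed i w) = embed i w"
    using rep_action_vertex[OF variety_space[OF x] i embed_closed[OF w(1)]] i by simp
  then have 1: "\<psi> (embed i w) = (\<lambda>i' \<in> verts Q. (path_elem (i, []) :: ('v, 'a) qpath \<Rightarrow> 'k) (i', []) \<cdot>\<^sub>v \<psi> (embed i w) i')"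
    using h(3)[OF e w(2)] by simp
  have "\<psi> (embed i w) = Z.zero_V"
  proof (rule Z.V_ext[OF h(1)[OF w(2)] Z.zero_V_closed])
    fix i' assume i': "i' \<in> verts Q"
    show "\<psi> (embed i w) i' = Z.zero_V i'"
    proof (cases "i' = i")
      case True
      then show ?thesis using w(3) i by simp
    next
      case False
      have "\<psi> (embed i w) i' = 0 \<cdot>\<^sub>v \<psi> (embed i w) i'"
        using fun_cong[OF 1, of i'] i' False by (simp add: path_elem_def)
      also have "\<dots> = 0\<^sub>v (m l i')" using zero_smult[OF Z.V_carrier[OF h(1)[OF w(2)] i']] .
      finally show ?thesis using i' by simp
    qed
  qed
  then show ?thesis using h(4)[OF w(2)] by simp
qed

text \<open>Linearity of \<open>\<psi>\<close>, from additivity and the action of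
  \<open>scal c\<close>; the sums are written by entries in order to match products of a matrix and
  a vector.\<close>

lemma layer_hom_comb:
  assumes x: "x \<in> rep_variety Q I d" and F: "Module.submodule F Lam (rep_module Q d x)"
    and \<psi>: "layer_hom Lam (rep_module Q d x) F F' (layer l) \<psi>" and i: "i \<in> verts Q"
    and K: "finite K" "\<And>k. k \<in> K \<Longrightarrow> u k \<in> carrier_vec (d i)" "\<And>k. k \<in> K \<Longrightarrow> embed i (u k) \<in> F"
  shows "embed i (vec (d i) (\<lambda>r. \<Sum>k\<in>K. a k * u k $ r)) \<in> F \<and>
    \<psi> (embed i (vec (d i) (\<lambda>r. \<Sum>k\<in>K. a k * u k $ r))) i = vec (m l i) (\<lambda>t. \<Sum>k\<in>K. a k * \<psi> (embed i (u k)) i $ t)"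
  using K
proof (induction K rule: finite_induct)
  case empty
  interpret Z: quiver_rep Q I "m l" by unfold_locales
  note h = layer_homD[OF x F \<psi>] and s = rep_submodule[OF x F]
  have 0: "vec (d i) (\<lambda>r. \<Sum>k\<in>{}. a k * u k $ r) = 0\<^sub>v (d i)" by (rule eq_vecI) simp_all
  have "rep_action Q d x \<zero>\<^bsub>KQ\<^esub> zero_V = zero_V" by (rule rep_action_zero)
  then have "\<psi> zero_V = (\<lambda>i' \<in> verts Q. 0 \<cdot>\<^sub>v \<psi> zero_V i')"
    using h(3)[OF KQ.zero_closed s(2)] by (simp add: zero_KQ)
  from fun_cong[OF this, of i] have "\<psi> zero_V i = 0 \<cdot>\<^sub>v \<psi> zero_V i" using i by (simp only: restrict_apply if_True)
  also have "\<dots> = 0\<^sub>v (m l i)" using zero_smult[OF Z.V_carrier[OF h(1)[OF s(2)] i]] .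
  finally have "\<psi> zero_V i = 0\<^sub>v (m l i)" .
  then show ?case unfolding 0 embed_zero using s(2) by (auto intro!: eq_vecI)
next
  case (insert k K)
  interpret Z: quiver_rep Q I "m l" by unfold_locales
  note h = layer_homD[OF x F \<psi>] and s = rep_submodule[OF x F]
  let ?s = "vec (d i) (\<lambda>r. \<Sum>k\<in>K. a k * u k $ r)"
  have uk: "u k \<in> carrier_vec (d i)" "embed i (u k) \<in> F" using insert.prems by auto
  have IH: "embed i ?s \<in> F" "\<psi> (embed i ?s) i = vec (m l i) (\<lambda>t. \<Sum>k\<in>K. a k * \<psi> (embed i (u k)) i $ t)"
    using insert.IH insert.prems by auto
  have sum: "vec (d i) (\<lambda>r. \<Sum>k\<in>insert k K. a k * u k $ r) = a k \<cdot>\<^sub>v u k + ?s"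
    using insert.hyps uk by (intro eq_vecI) auto
  have e: "embed i (vec (d i) (\<lambda>r. \<Sum>k\<in>insert k K. a k * u k $ r)) = plus_V (rep_action Q d x (scal (a k)) (embed i (u k))) (embed i ?s)"
    unfolding sum using uk by (simp add: embed_add embed_smult[of _ _ _ x])
  have r: "rep_action Q d x (scal (a k)) (embed i (u k)) \<in> F" by (rule s(4)[OF scal_closed uk(2)])
  have c: "\<psi> (embed i (u k)) i \<in> carrier_vec (m l i)" by (rule Z.V_carrier[OF h(1)[OF uk(2)] i])
  have "\<psi> (plus_V (rep_action Q d x (scal (a k)) (embed i (u k))) (embed i ?s)) i
      = a k \<cdot>\<^sub>v \<psi> (embed i (u k)) i + vec (m l i) (\<lambda>t. \<Sum>k\<in>K. a k * \<psi> (embed i (u k)) i $ t)"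
    unfolding h(2)[OF r IH(1)] h(3)[OF scal_closed uk(2)] using i IH(2) by (simp add: scal_def one_KQ)
  also have "\<dots> = vec (m l i) (\<lambda>t. \<Sum>k\<in>insert k K. a k * \<psi> (embed i (u k)) i $ t)"
    using insert.hyps c by (intro eq_vecI) auto
  finally show ?case unfolding e using s(3)[OF r IH(1)] by simp
qed

text \<open>At every vertex, lifts of the unit vectors of all layers, the deepest layer first, are
  the columns of a matrix \<open>h i\<close>. They span, by descending the filtration, so
  \<open>h i\<close> is invertible, and its inverse \<open>g i\<close> takes the filtration to the
  standard flag. The arrows act as zero on each layer, which gives the zero pattern of
  \<open>std fl\<close>.\<close>

lemma std_from_filtration:
  assumes x: "x \<in> rep_variety Q I d"
    and F0: "F 0 = V" and FL: "F (Suc L) = {zero_V}"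
    and sub: "\<And>l. l \<le> Suc L \<Longrightarrow> Module.submodule (F l) Lam (rep_module Q d x)"
    and dec: "\<And>l. l \<le> L \<Longrightarrow> F (Suc l) \<subseteq> F l"
    and lay: "\<And>l. l \<le> L \<Longrightarrow> \<exists>\<psi>. layer_hom Lam (rep_module Q d x) (F l) (F (Suc l)) (layer l) \<psi>"
  shows "\<exists>(g, g') \<in> GL. act g g' x \<in> std fl \<and> (\<forall>l \<le> Suc L. F l = graded (flag g l))"
proof -
  note xs = variety_space[OF x]
  obtain \<psi> where \<psi>: "\<And>l. l \<le> L \<Longrightarrow> layer_hom Lam (rep_module Q d x) (F l) (F (Suc l)) (layer l) (\<psi> l)"
    using lay by metis
  have subl: "Module.submodule (F l) Lam (rep_module Q d x)" if "l \<le> L" for l using sub[of l] that by simp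
  have decl: "F l' \<subseteq> F l" if "l \<le> l'" "l' \<le> Suc L" for l l'
    using that
  proof (induction l' rule: dec_induct)
    case (step n)
    then show ?case using dec[of n] by auto
  qed simp
  have "\<forall>l i j. \<exists>w. l \<le> L \<longrightarrow> i \<in> verts Q \<longrightarrow> j < m l i \<longrightarrow>
      w \<in> carrier_vec (d i) \<and> embed i w \<in> F l \<and> \<psi> l (embed i w) i = unit_vec (m l i) j"
    using layer_hom_lift[OF x subl \<psi>] by blast
  then obtain w where w: "\<And>l i j. l \<le> L \<Longrightarrow> i \<in> verts Q \<Longrightarrow> j < m l i \<Longrightarrow>
      w l i j \<in> carrier_vec (d i) \<and> embed i (w l i j) \<in> F l \<and> \<psi> l (embed i (w l i j)) i = unit_vec (m l i) j"
    by metis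
  \<comment> \<open>The layer to which column \<open>c\<close> belongs: layer \<open>l\<close>
    occupies the columns from \<open>fl (Suc l) i\<close> up to but excluding
    \<open>fl l i\<close>.\<close>
  define lev where "lev i c = (LEAST l. fl (Suc l) i \<le> c)" for i c
  have lev_eq: "lev i (fl (Suc l) i + j) = l" if "l \<le> L" "j < m l i" for l i j
    unfolding lev_def
  proof (rule Least_equality)
    fix l' assume l': "fl (Suc l') i \<le> fl (Suc l) i + j"
    show "l \<le> l'"
    proof (rule ccontr)
      assume "\<not> l \<le> l'"
      then have "fl l i \<le> fl (Suc l') i" by (intro fl_antimono) simp
      then show False using l' fl_step[OF that(1), of i] that(2) by simp
    qed
  qed simp
  have lev: "lev i c \<le> L \<and> fl (Suc (lev i c)) i \<le> c \<and> c - fl (Suc (lev i c)) i < m (lev i c) i"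
    if i: "i \<in> verts Q" and c: "c < d i" for i c
  proof -
    have 0: "fl (Suc L) i \<le> c" by (simp add: fl_top)
    have l: "lev i c \<le> L" unfolding lev_def by (rule Least_le[of "\<lambda>l. fl (Suc l) i \<le> c", OF 0])
    have le: "fl (Suc (lev i c)) i \<le> c" unfolding lev_def by (rule LeastI[of "\<lambda>l. fl (Suc l) i \<le> c", OF 0])
    have "c < fl (lev i c) i"
    proof (cases "lev i c")
      case 0
      then show ?thesis using fl_0[OF i] c by simp
    next
      case (Suc k)
      then have "k < (LEAST l. fl (Suc l) i \<le> c)" unfolding lev_def by simp
      then have "\<not> fl (Suc k) i \<le> c" by (rule not_less_Least)
      then show ?thesis using Suc by simp
    qed
    then show ?thesis using l le fl_step[OF l, of i] by simp
  qed
  define h where "h i = mat (d i) (d i) (\<lambda>(r, c). w (lev i c) i (c - fl (Suc (lev i c)) i) $ r)" for i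
  have hc: "h i \<in> carrier_mat (d i) (d i)" for i by (simp add: h_def)
  have hcol: "col (h i) c = w (lev i c) i (c - fl (Suc (lev i c)) i)" if "i \<in> verts Q" "c < d i" for i c
  proof -
    have "w (lev i c) i (c - fl (Suc (lev i c)) i) \<in> carrier_vec (d i)"
      using lev[OF that] w[of "lev i c" i "c - fl (Suc (lev i c)) i"] that by blast
    then show ?thesis using that unfolding h_def by (intro eq_vecI) auto
  qed
  have colF: "embed i (col (h i) c) \<in> F l" if i: "i \<in> verts Q" and c: "c < d i" and cl: "c < fl l i" for i c l
  proof -
    have "l \<le> lev i c"
    proof (rule ccontr)
      assume "\<not> l \<le> lev i c"
      then have "fl l i \<le> fl (Suc (lev i c)) i" by (intro fl_antimono) simp
      then show False using lev[OF i c] cl by simp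
    qed
    then have "F (lev i c) \<subseteq> F l" using lev[OF i c] by (intro decl) auto
    moreover have "embed i (col (h i) c) \<in> F (lev i c)"
      unfolding hcol[OF i c] using lev[OF i c] w i by blast
    ultimately show ?thesis by blast
  qed
  \<comment> \<open>Induction starting from the zero term: subtracting from \<open>v\<close> the
    lifts weighted by the coordinates of its image in the layer leaves an element of the next term,
    to which the induction hypothesis applies.\<close>
  have span: "\<forall>v \<in> carrier_vec (d i). embed i v \<in> F l \<longrightarrow>
      (\<exists>a \<in> carrier_vec (d i). (\<forall>r. fl l i \<le> r \<longrightarrow> r < d i \<longrightarrow> a $ r = 0) \<and> h i *\<^sub>v a = v)"
    if i: "i \<in> verts Q" and l: "l \<le> Suc L" for i l
    using l
  proof (induction rule: inc_induct)
    case base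
    have "v = 0\<^sub>v (d i)" if "embed i v \<in> F (Suc L)" for v
    proof -
      have "embed i v i = zero_V i" using that unfolding FL by (metis singletonD)
      then show ?thesis using i by simp
    qed
    moreover have "h i *\<^sub>v 0\<^sub>v (d i) = 0\<^sub>v (d i)" using hc[of i] by auto
    ultimately show ?case by (metis index_zero_vec(1) zero_carrier_vec)
  next
    case (step l)
    then have l: "l \<le> L" by simp
    note F = subl[OF l]
    have wl: "w l i j \<in> carrier_vec (d i)" "embed i (w l i j) \<in> F l" "\<psi> l (embed i (w l i j)) i = unit_vec (m l i) j"
      if "j < m l i" for j using w[OF l i that] by auto
    show ?case
    proof (intro ballI impI)
      fix v assume v: "v \<in> carrier_vec (d i)" "embed i v \<in> F l"
      interpret Z: quiver_rep Q I "m l" by unfold_locales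
      note hh = layer_homD[OF x F \<psi>[OF l]] and s = rep_submodule[OF x F]
      define c where "c = \<psi> l (embed i v) i"
      have cc: "c \<in> carrier_vec (m l i)" unfolding c_def by (rule Z.V_carrier[OF hh(1)[OF v(2)] i])
      \<comment> \<open>Index 0 stands for \<open>v\<close> itself, with coefficient 1, and index
        \<open>k > 0\<close> for the lift numbered \<open>k - 1\<close>, with minus the coordinate;
        the difference thus becomes a single combination for \<open>layer_hom_comb\<close>.\<close>
      define u where "u = (\<lambda>k. if k = 0 then v else w l i (k - 1))"
      define a0 where "a0 = (\<lambda>k. if k = 0 then 1 else - c $ (k - 1))"
      let ?K = "{..m l i}"
      let ?y = "vec (d i) (\<lambda>r. \<Sum>k\<in>?K. a0 k * u k $ r)"
      have sumK: "(\<Sum>k\<in>?K. f k) = f 0 + (\<Sum>j<m l i. f (Suc j))" for f :: "nat \<Rightarrow> 'k"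
        by (simp add: sum.atMost_shift)
      have uprop: "u k \<in> carrier_vec (d i)" "embed i (u k) \<in> F l" if "k \<in> ?K" for k
        using that v wl(1,2)[of "k - 1"] unfolding u_def by (auto split: if_splits)
      have y: "embed i ?y \<in> F l"
        "\<psi> l (embed i ?y) i = vec (m l i) (\<lambda>t. \<Sum>k\<in>?K. a0 k * \<psi> l (embed i (u k)) i $ t)"
        using layer_hom_comb[OF x F \<psi>[OF l] i finite_atMost uprop] by auto
      have "\<psi> l (embed i ?y) i = 0\<^sub>v (m l i)"
        unfolding y(2)
      proof (rule eq_vecI)
        fix t assume "t < dim_vec (0\<^sub>v (m l i) :: 'k vec)"
        then have t: "t < m l i" by simp
        have "(\<Sum>k\<in>?K. a0 k * \<psi> l (embed i (u k)) i $ t) = c $ t + (\<Sum>j<m l i. - c $ j * \<psi> l (embed i (w l i j)) i $ t)"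
          unfolding sumK by (simp add: a0_def u_def c_def)
        also have "(\<Sum>j<m l i. - c $ j * \<psi> l (embed i (w l i j)) i $ t) = (\<Sum>j<m l i. if j = t then - c $ t else 0)"
          using t by (intro sum.cong refl) (auto simp: wl(3))
        finally show "vec (m l i) (\<lambda>t. \<Sum>k\<in>?K. a0 k * \<psi> l (embed i (u k)) i $ t) $ t = 0\<^sub>v (m l i) $ t"
          using t by simp
      qed simp
      then have "embed i ?y \<in> F (Suc l)" by (intro layer_hom_kernel[OF x F \<psi>[OF l] i _ y(1)]) simp_all
      then obtain a where a: "a \<in> carrier_vec (d i)" "\<And>r. fl (Suc l) i \<le> r \<Longrightarrow> r < d i \<Longrightarrow> a $ r = 0" "h i *\<^sub>v a = ?y"
        using step.IH vec_carrier by blast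
      \<comment> \<open>Puts the subtracted coordinates back, in the columns of layer
        \<open>l\<close>; \<open>a\<close> accounts for the deeper layers.\<close>
      define b where "b = vec (d i) (\<lambda>r. if fl (Suc l) i \<le> r \<and> r < fl l i then c $ (r - fl (Suc l) i) else 0)"
      have bc: "b \<in> carrier_vec (d i)" by (simp add: b_def)
      have "h i *\<^sub>v (a + b) = v"
      proof (rule eq_vecI)
        fix r assume "r < dim_vec v"
        then have r: "r < d i" using v by simp
        have "(h i *\<^sub>v b) $ r = (\<Sum>k<d i. h i $$ (r, k) * b $ k)" by (rule mat_vec_index[OF hc bc r])
        also have "\<dots> = (\<Sum>k\<in>{fl (Suc l) i..<fl l i}. h i $$ (r, k) * c $ (k - fl (Suc l) i))"
          using fl_le[OF i, of l] by (intro sum.mono_neutral_cong_right) (auto simp: b_def)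
        also have "\<dots> = (\<Sum>j<m l i. h i $$ (r, fl (Suc l) i + j) * c $ j)"
          using fl_step[OF l, of i]
          by (intro sum.reindex_bij_witness[of _ "\<lambda>j. fl (Suc l) i + j" "\<lambda>k. k - fl (Suc l) i"]) auto
        also have "\<dots> = (\<Sum>j<m l i. c $ j * w l i j $ r)"
        proof (intro sum.cong refl)
          fix j assume "j \<in> {..<m l i}"
          then have j: "j < m l i" by simp
          then have "fl (Suc l) i + j < d i" using fl_step[OF l, of i] fl_le[OF i, of l] by simp
          then show "h i $$ (r, fl (Suc l) i + j) * c $ j = c $ j * w l i j $ r"
            using r lev_eq[OF l j] by (simp add: h_def mult.commute)
        qed
        finally have hb: "(h i *\<^sub>v b) $ r = (\<Sum>j<m l i. c $ j * w l i j $ r)" .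
        have "(h i *\<^sub>v a) $ r = v $ r + (\<Sum>j<m l i. - c $ j * w l i j $ r)"
          unfolding a(3) using r by (simp add: sumK a0_def u_def)
        then have "(h i *\<^sub>v a) $ r + (h i *\<^sub>v b) $ r = v $ r" unfolding hb by (simp add: sum_negf)
        moreover have "h i *\<^sub>v (a + b) = h i *\<^sub>v a + h i *\<^sub>v b" by (rule mult_add_distrib_mat_vec[OF hc a(1) bc])
        ultimately show "(h i *\<^sub>v (a + b)) $ r = v $ r" using r hc[of i] by (simp del: index_mult_mat_vec)
      qed (use hc[of i] v in simp)
      moreover have "(a + b) $ r = 0" if r: "fl l i \<le> r" "r < d i" for r
      proof -
        have "a $ r = 0" using a(2)[of r] r fl_Suc_le[of l i] by simp
        moreover have "b $ r = 0" using r by (simp add: b_def)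
        ultimately show ?thesis using r a(1) bc by simp
      qed
      ultimately show "\<exists>a \<in> carrier_vec (d i). (\<forall>r. fl l i \<le> r \<longrightarrow> r < d i \<longrightarrow> a $ r = 0) \<and> h i *\<^sub>v a = v"
        using a(1) bc by (intro bexI[of _ "a + b"]) auto
    qed
  qed
  \<comment> \<open>The columns of a right inverse solve \<open>h i a = unit_vec (d i) c\<close>;
    solutions come from \<open>span\<close> at \<open>l = 0\<close>, where \<open>F 0\<close> is
    everything. For a square matrix a right inverse is also a left inverse.\<close>
  have "\<exists>A \<in> carrier_mat (d i) (d i). h i * A = 1\<^sub>m (d i)" if i: "i \<in> verts Q" for i
  proof -
    have "\<exists>a \<in> carrier_vec (d i). h i *\<^sub>v a = unit_vec (d i) c" for c
      using span[OF i, of 0] F0 embed_closed[of "unit_vec (d i) c" i] unit_vec_carrier by blast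
    then obtain a where a: "\<And>c. a c \<in> carrier_vec (d i)" "\<And>c. h i *\<^sub>v a c = unit_vec (d i) c" by metis
    define A where "A = mat (d i) (d i) (\<lambda>(r, c). a c $ r)"
    have A: "A \<in> carrier_mat (d i) (d i)" by (simp add: A_def)
    have colA: "col A c = a c" if "c < d i" for c using a(1)[of c] that unfolding A_def by (intro eq_vecI) auto
    have "h i * A = 1\<^sub>m (d i)"
    proof (rule eq_matI)
      fix r c assume "r < dim_row (1\<^sub>m (d i) :: 'k mat)" "c < dim_col (1\<^sub>m (d i) :: 'k mat)"
      then have rc: "r < d i" "c < d i" by simp_all
      have "(h i * A) $$ (r, c) = (h i *\<^sub>v col A c) $ r" using rc hc[of i] A by simp
      then show "(h i * A) $$ (r, c) = (1\<^sub>m (d i) :: 'k mat) $$ (r, c)" using rc unfolding colA[OF rc(2)] a(2) by simp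
    qed (use hc[of i] A in simp_all)
    then show ?thesis using A by blast
  qed
  then obtain g where g: "\<And>i. i \<in> verts Q \<Longrightarrow> g i \<in> carrier_mat (d i) (d i)" "\<And>i. i \<in> verts Q \<Longrightarrow> h i * g i = 1\<^sub>m (d i)"
    by metis
  have gh: "(g, h) \<in> GL"
    unfolding GL_def using g hc mat_mult_left_right_inverse[OF hc g(1) g(2)] by auto
  have Fflag: "v i \<in> flag g l i" if v: "v \<in> F l" and l: "l \<le> Suc L" and i: "i \<in> verts Q" for v l i
  proof -
    have c: "v i \<in> carrier_vec (d i)" using rep_submodule(1)[OF x sub[OF l]] v i by auto
    obtain a where a: "a \<in> carrier_vec (d i)" "\<And>r. fl l i \<le> r \<Longrightarrow> r < d i \<Longrightarrow> a $ r = 0" "h i *\<^sub>v a = v i"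
      using span[OF i l] c rep_submodule_embed(1)[OF x sub[OF l] i v] by blast
    have "g i *\<^sub>v v i = a" unfolding a(3)[symmetric] by (rule mat_inverse_vec[OF GL_D(1,2,3)[OF gh i] a(1)])
    then show ?thesis unfolding flag_def using a(2) c by (simp del: index_mult_mat_vec)
  qed
  have flagF: "embed i v \<in> F l" if v: "v \<in> flag g l i" and l: "l \<le> Suc L" and i: "i \<in> verts Q" for v l i
  proof -
    have vc: "v \<in> carrier_vec (d i)" using v unfolding flag_def by blast
    have gv: "g i *\<^sub>v v \<in> carrier_vec (d i)" using g(1)[OF i] vc by simp
    have "h i *\<^sub>v (g i *\<^sub>v v) \<in> {w \<in> carrier_vec (d i). embed i w \<in> F l}"
      by (rule mult_mat_vec_comb[OF hc gv rep_submodule_embed(2)[OF x sub[OF l] i]])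
        (use colF[OF i] flag_supp[OF v] hc[of i] in auto)
    then show ?thesis using mat_inverse_vec[OF GL_D(2,1,4)[OF gh i] vc] by simp
  qed
  have Feq: "F l = graded (flag g l)" if l: "l \<le> Suc L" for l
  proof (intro equalityI subsetI)
    fix v assume v: "v \<in> F l"
    then have "v \<in> V" using rep_submodule(1)[OF x sub[OF l]] by blast
    then show "v \<in> graded (flag g l)" unfolding graded_def using Fflag[OF v l] by blast
  next
    fix v assume v: "v \<in> graded (flag g l)"
    note s = rep_submodule[OF x sub[OF l]]
    show "v \<in> F l"
      by (rule embed_sum_mem[OF s(2,3)]) (use v flagF[OF _ l] in \<open>auto simp: graded_def\<close>)
  qed
  have "act g h x \<in> std fl"
    unfolding std_def
  proof (intro CollectI conjI ballI allI impI)
    show "act g h x \<in> rep_space Q d" by (rule GL_act_closed[OF gh xs])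
    fix \<alpha> l r c assume \<alpha>: "\<alpha> \<in> arcs Q" and r: "r < d (head Q \<alpha>)" and c: "c < d (tail Q \<alpha>)"
      "c < fl l (tail Q \<alpha>)" and rf: "fl (Suc l) (head Q \<alpha>) \<le> r"
    \<comment> \<open>\<open>std\<close> quantifies over all \<open>l\<close>; beyond
      \<open>L\<close> the value of \<open>fl l\<close> is 0, so no column index \<open>c\<close>
      lies below it.\<close>
    have l: "l \<le> L"
    proof (rule ccontr)
      assume "\<not> l \<le> L"
      then show False using c(2) fl_top[of l "tail Q \<alpha>"] by simp
    qed
    let ?i = "head Q \<alpha>" and ?j = "tail Q \<alpha>"
    have ij: "?i \<in> verts Q" "?j \<in> verts Q" using \<alpha> by auto
    let ?w = "col (h ?j) c"
    have wc: "?w \<in> carrier_vec (d ?j)" using hc[of ?j] c by auto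
    have wF: "embed ?j ?w \<in> F l" by (rule colF[OF ij(2) c])
    have pe: "path_elem (?j, [\<alpha>]) \<in> carrier KQ" using \<alpha> by simp
    note hh = layer_homD[OF x subl[OF l] \<psi>[OF l]]
    interpret Z: quiver_rep Q I "m l" by unfold_locales
    have aF: "embed ?i (x \<alpha> *\<^sub>v ?w) \<in> F l"
      using rep_submodule(4)[OF x subl[OF l] pe wF] rep_submodule_arrow[OF x \<alpha> wc] by simp
    have xw: "x \<alpha> *\<^sub>v ?w \<in> carrier_vec (d ?i)" using rep_space_carrier[OF xs \<alpha>] wc by simp
    \<comment> \<open>An arrow has coefficient 0 at every trivial path, so the image in the layer
      vanishes and the vector lies in the next term.\<close>
    have "\<psi> l (embed ?i (x \<alpha> *\<^sub>v ?w)) = (\<lambda>i' \<in> verts Q. path_elem (?j, [\<alpha>]) (i', []) \<cdot>\<^sub>v \<psi> l (embed ?j ?w) i')"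
      using hh(3)[OF pe wF] rep_submodule_arrow[OF x \<alpha> wc] by simp
    then have "\<psi> l (embed ?i (x \<alpha> *\<^sub>v ?w)) ?i = 0 \<cdot>\<^sub>v \<psi> l (embed ?j ?w) ?i"
      using ij by (simp add: path_elem_def)
    also have "\<dots> = 0\<^sub>v (m l ?i)" using zero_smult[OF Z.V_carrier[OF hh(1)[OF wF] ij(1)]] .
    finally have "embed ?i (x \<alpha> *\<^sub>v ?w) \<in> F (Suc l)"
      by (intro layer_hom_kernel[OF x subl[OF l] \<psi>[OF l] ij(1) xw aF])
    then have "x \<alpha> *\<^sub>v ?w \<in> flag g (Suc l) ?i" using Fflag[OF _ _ ij(1), of "embed ?i (x \<alpha> *\<^sub>v ?w)" "Suc l"] l ij by simp
    then have 0: "(g ?i *\<^sub>v (x \<alpha> *\<^sub>v ?w)) $ r = 0" using rf r unfolding flag_def by blast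
    note G = GL_D[OF gh ij(1)] and H = GL_D[OF gh ij(2)] and xa = rep_space_carrier[OF xs \<alpha>]
    have "(g ?i * x \<alpha> * h ?j) $$ (r, c) = ((g ?i * x \<alpha>) *\<^sub>v ?w) $ r"
    proof -
      have "(M * h ?j) $$ (r, c) = (M *\<^sub>v ?w) $ r" if "M \<in> carrier_mat (d ?i) (d ?j)" for M
        using r c that hc[of ?j] by simp
      then show ?thesis using mult_carrier_mat[OF G(1) xa] by blast
    qed
    also have "(g ?i * x \<alpha>) *\<^sub>v ?w = g ?i *\<^sub>v (x \<alpha> *\<^sub>v ?w)" by (rule assoc_mult_mat_vec[OF G(1) xa wc])
    finally show "act g h x \<alpha> $$ (r, c) = 0" using 0 \<alpha> by (simp add: act_def)
  qed
  then show ?thesis using gh Feq by blast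
qed

end

section \<open>Radical layerings\<close>

lemma vsub_preimage:
  fixes A :: "'k::field mat"
  assumes A: "A \<in> carrier_mat m n" and Y: "vsub m Y"
  shows "vsub n {u \<in> carrier_vec n. A *\<^sub>v u \<in> Y}"
proof -
  have "A *\<^sub>v 0\<^sub>v n = 0\<^sub>v m" using A by auto
  then show ?thesis
    unfolding vsub_def using vsubD[OF Y]
    by (auto simp: mult_add_distrib_mat_vec[OF A] mult_mat_vec[OF A])
qed

context quiver_layers
begin

lemma flag_embed:
  assumes g: "(g, g') \<in> GL" and i: "i \<in> verts Q" and w: "w \<in> flag g l i"
  shows "embed i w \<in> graded (flag g l)"
  by (rule graded_embed[of "flag g l", OF flag_vsub[OF g] i w])

text \<open>These columns span the component at \<open>i\<close> of what the arrows make out of the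
  \<open>l\<close>-th term of the standard flag.\<close>

definition cols :: "nat \<Rightarrow> 'v \<Rightarrow> ('a \<times> nat) set" where
  "cols l i = {(\<alpha>, c). \<alpha> \<in> arcs Q \<and> head Q \<alpha> = i \<and> c < fl l (tail Q \<alpha>)}"

definition col_comb :: "('a \<Rightarrow> 'k mat) \<Rightarrow> nat \<Rightarrow> 'v \<Rightarrow> ('a \<times> nat \<Rightarrow> 'k) \<Rightarrow> 'k vec" where
  "col_comb z l i \<rho> = vec (d i) (\<lambda>r. \<Sum>k\<in>cols l i. \<rho> k * col (z (fst k)) (snd k) $ r)"

text \<open>For a representation in standard form, fullness says that applying the arrows to the \<open>l\<close>-th
  term of the standard flag yields the whole of the next term.\<close>

definition full :: "('a \<Rightarrow> 'k mat) \<Rightarrow> bool" where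
  "full z \<longleftrightarrow> (\<forall>l \<le> L. \<forall>i \<in> verts Q. \<forall>k < fl (Suc l) i. \<exists>\<rho>. unit_vec (d i) k = col_comb z l i \<rho>)"

lemma finite_cols: "finite (cols l i)"
proof (rule finite_subset)
  show "cols l i \<subseteq> (SIGMA \<alpha>:arcs Q. {..<fl l (tail Q \<alpha>)})" unfolding cols_def by auto
qed simp

lemma cols_bound: "(\<alpha>, c) \<in> cols l i \<Longrightarrow> c < d (tail Q \<alpha>)"
  using fl_le[of "tail Q \<alpha>" l] unfolding cols_def by auto

lemma col_comb_vsub: "vsub (d i) {v. \<exists>\<rho>. v = col_comb z l i \<rho>}"
  unfolding vsub_def
proof (intro conjI ballI allI)
  show "{v. \<exists>\<rho>. v = col_comb z l i \<rho>} \<subseteq> carrier_vec (d i)" by (auto simp: col_comb_def)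
  have "0\<^sub>v (d i) = col_comb z l i (\<lambda>_. 0)" by (intro eq_vecI) (auto simp: col_comb_def)
  then show "0\<^sub>v (d i) \<in> {v. \<exists>\<rho>. v = col_comb z l i \<rho>}" by blast
next
  fix v w assume "v \<in> {v. \<exists>\<rho>. v = col_comb z l i \<rho>}" "w \<in> {v. \<exists>\<rho>. v = col_comb z l i \<rho>}"
  then obtain \<rho> \<sigma> where "v = col_comb z l i \<rho>" "w = col_comb z l i \<sigma>" by auto
  then have "v + w = col_comb z l i (\<lambda>k. \<rho> k + \<sigma> k)"
    by (intro eq_vecI) (auto simp: col_comb_def sum.distrib distrib_right)
  then show "v + w \<in> {v. \<exists>\<rho>. v = col_comb z l i \<rho>}" by blast
next
  fix c v assume "v \<in> {v. \<exists>\<rho>. v = col_comb z l i \<rho>}"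
  then obtain \<rho> where "v = col_comb z l i \<rho>" by auto
  then have "c \<cdot>\<^sub>v v = col_comb z l i (\<lambda>k. c * \<rho> k)"
    by (intro eq_vecI) (auto simp: col_comb_def sum_distrib_left mult.assoc)
  then show "c \<cdot>\<^sub>v v \<in> {v. \<exists>\<rho>. v = col_comb z l i \<rho>}" by blast
qed

lemma col_in_col_comb:
  assumes z: "z \<in> rep_space Q d" and \<alpha>: "\<alpha> \<in> arcs Q" "c < fl l (tail Q \<alpha>)"
  shows "\<exists>\<rho>. col (z \<alpha>) c = col_comb z l (head Q \<alpha>) \<rho>"
proof -
  have "(\<alpha>, c) \<in> cols l (head Q \<alpha>)" using \<alpha> by (simp add: cols_def)
  then have "(\<Sum>k\<in>cols l (head Q \<alpha>). (if k = (\<alpha>, c) then 1 else 0) * col (z (fst k)) (snd k) $ r) = col (z \<alpha>) c $ r" for r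
    by (subst sum.remove[OF finite_cols]) auto
  then have "col (z \<alpha>) c = col_comb z l (head Q \<alpha>) (\<lambda>k. if k = (\<alpha>, c) then 1 else 0)"
    using rep_space_carrier[OF z \<alpha>(1)] by (intro eq_vecI) (simp_all add: col_comb_def)
  then show ?thesis by blast
qed

text \<open>Pulling the span of the columns back by \<open>g\<close> gives subspaces
  \<open>W\<close> into which every arrow maps the \<open>l\<close>-th term. They contain the next
  radical power, which by assumption is the next term of the flag, and in standard coordinates that
  term contains the unit vectors in question.\<close>

lemma full_if_radical_flag:
  assumes x: "x \<in> rep_variety Q I d" and g: "(g, g') \<in> GL" and std: "act g g' x \<in> std fl"
    and rad: "\<And>l. l \<le> Suc L \<Longrightarrow> radical_power Lam (rep_module Q d x) l = graded (flag g l)"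
  shows "full (act g g' x)"
  unfolding full_def
proof (intro allI impI ballI)
  fix l i k assume l: "l \<le> L" and i: "i \<in> verts Q" and k: "k < fl (Suc l) i"
  note xs = variety_space[OF x] and G = GL_D[OF g i] and M = rep_left_module[OF x]
  let ?z = "act g g' x"
  let ?S = "\<lambda>i. {v. \<exists>\<rho>. v = col_comb ?z l i \<rho>}"
  define W where "W i = {w \<in> carrier_vec (d i). g i *\<^sub>v w \<in> ?S i}" for i
  have W: "vsub (d i) (W i)" if "i \<in> verts Q" for i
    unfolding W_def by (rule vsub_preimage[OF GL_D(1)[OF g that] col_comb_vsub])
  have low: "x \<alpha> *\<^sub>v w \<in> W (head Q \<alpha>)" if \<alpha>: "\<alpha> \<in> arcs Q" and w: "w \<in> flag g l (tail Q \<alpha>)" for \<alpha> w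
  proof -
    have wc: "w \<in> carrier_vec (d (tail Q \<alpha>))" using w unfolding flag_def by blast
    have z: "?z \<alpha> \<in> carrier_mat (d (head Q \<alpha>)) (d (tail Q \<alpha>))" by (rule rep_space_carrier[OF GL_act_closed[OF g xs] \<alpha>])
    have gw: "g (tail Q \<alpha>) *\<^sub>v w \<in> carrier_vec (d (tail Q \<alpha>))" using GL_D(1)[OF g, of "tail Q \<alpha>"] \<alpha> wc by simp
    have "?z \<alpha> *\<^sub>v (g (tail Q \<alpha>) *\<^sub>v w) \<in> ?S (head Q \<alpha>)"
    proof (rule mult_mat_vec_comb[OF z gw col_comb_vsub])
      fix c assume "c < d (tail Q \<alpha>)" "(g (tail Q \<alpha>) *\<^sub>v w) $ c \<noteq> 0"
      then have "c < fl l (tail Q \<alpha>)" by (rule flag_supp[OF w])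
      then show "col (?z \<alpha>) c \<in> ?S (head Q \<alpha>)" using col_in_col_comb[OF GL_act_closed[OF g xs] \<alpha>] by blast
    qed
    then show ?thesis
      unfolding W_def act_mult_vec[OF g xs \<alpha> wc] using rep_space_carrier[OF xs \<alpha>] wc by simp
  qed
  have "radical_power Lam (rep_module Q d x) (Suc l) \<subseteq> graded W"
  proof (rule radical_power_Suc_subset[OF M], unfold rep_add)
    show "v +\<^sub>V w \<in> graded W" if "v \<in> graded W" "w \<in> graded W" for v w
      by (rule graded_add[OF W that])
    fix f v assume f: "f \<in> len_ge 1" and "v \<in> radical_power Lam (rep_module Q d x) l"
    then have v: "v \<in> graded (flag g l)" using rad[of l] l by simp
    then have vV: "v \<in> V" unfolding graded_def by blast
    show "cls f \<odot>\<^bsub>rep_module Q d x\<^esub> v \<in> graded W"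
      unfolding rep_smult[OF x len_ge_carrier[OF f] vV]
      by (rule rep_action_lower[OF xs W flag_arrow_stable[OF g xs std] low f v])
  qed
  then have sub: "graded (flag g (Suc l)) \<subseteq> graded W" using rad[of "Suc l"] l by simp
  let ?w = "g' i *\<^sub>v unit_vec (d i) k"
  have gw: "g i *\<^sub>v ?w = unit_vec (d i) k" by (rule mat_inverse_vec[OF G(1,2,3) unit_vec_carrier])
  have "?w \<in> flag g (Suc l) i" using G(2) k by (auto simp: flag_def gw simp del: index_mult_mat_vec)
  then have "embed i ?w \<in> graded W" using flag_embed[OF g i] sub by blast
  then have "?w \<in> W i" using i unfolding graded_def by auto
  then show "\<exists>\<rho>. unit_vec (d i) k = col_comb ?z l i \<rho>" using gw by (auto simp: W_def simp del: index_mult_mat_vec)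
qed

text \<open>Induction on \<open>l\<close>. The next radical power lies in the next term because
  arrows lower the flag; conversely fullness writes each basis vector of the next term as a
  combination of arrows applied to the current term, which is a radical power by the induction
  hypothesis.\<close>

lemma radical_flag_if_full:
  assumes x: "x \<in> rep_variety Q I d" and g: "(g, g') \<in> GL" and std: "act g g' x \<in> std fl"
    and full: "full (act g g' x)" and l: "l \<le> Suc L"
  shows "radical_power Lam (rep_module Q d x) l = graded (flag g l)"
  using l
proof (induction l)
  case 0
  show ?case by (simp add: radical_power_0[OF rep_left_module[OF x]] rep_carrier graded_flag_0[OF g])
next
  case (Suc l)
  then have l: "l \<le> L" and IH: "radical_power Lam (rep_module Q d x) l = graded (flag g l)" by simp_all
  note xs = variety_space[OF x] and M = rep_left_module[OF x]
  let ?z = "act g g' x" and ?R = "radical_power Lam (rep_module Q d x)"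
  note sub = radical_power_submodule[OF M, of "Suc l"]
  show ?case
  proof (rule equalityI)
    show "?R (Suc l) \<subseteq> graded (flag g (Suc l))"
    proof (rule radical_power_Suc_subset[OF M], unfold rep_add)
      show "v +\<^sub>V w \<in> graded (flag g (Suc l))" if "v \<in> graded (flag g (Suc l))" "w \<in> graded (flag g (Suc l))" for v w
        by (rule graded_add[OF flag_vsub[OF g] that])
      fix f v assume f: "f \<in> len_ge 1" and "v \<in> ?R l"
      then have v: "v \<in> graded (flag g l)" using IH by simp
      then have vV: "v \<in> V" unfolding graded_def by blast
      show "cls f \<odot>\<^bsub>rep_module Q d x\<^esub> v \<in> graded (flag g (Suc l))"
        unfolding rep_smult[OF x len_ge_carrier[OF f] vV]
        by (rule rep_action_lower[OF xs flag_vsub[OF g] flag_arrow_stable[OF g xs std] flag_arrow[OF g xs std] f v])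
    qed
    show "graded (flag g (Suc l)) \<subseteq> ?R (Suc l)"
    proof
      fix v assume v: "v \<in> graded (flag g (Suc l))"
      note s = rep_submodule[OF x sub]
      show "v \<in> ?R (Suc l)"
      proof (rule embed_sum_mem[OF s(2,3)])
        show vV: "v \<in> V" using v unfolding graded_def by blast
        fix i assume i: "i \<in> verts Q"
        note G = GL_D[OF g i]
        let ?Y = "{w \<in> carrier_vec (d i). embed i w \<in> ?R (Suc l)}"
        have Y: "vsub (d i) ?Y" by (rule rep_submodule_embed(2)[OF x sub i])
        \<comment> \<open>The columns of \<open>g' i\<close> are the basis adapted to the flag; the
          first \<open>fl (Suc l) i\<close> of them span its next term.\<close>
        have col: "col (g' i) k \<in> ?Y" if k: "k < fl (Suc l) i" for k
        proof -
          let ?U = "{u \<in> carrier_vec (d i). g' i *\<^sub>v u \<in> ?Y}"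
          have U: "vsub (d i) ?U" by (rule vsub_preimage[OF G(2) Y])
          obtain \<rho> where \<rho>: "unit_vec (d i) k = col_comb ?z l i \<rho>" using full l i k unfolding full_def by blast
          have "col_comb ?z l i \<rho> \<in> ?U"
            unfolding col_comb_def
          proof (rule vsub_sum[OF U finite_cols])
            fix p assume p: "p \<in> cols l i"
            obtain \<alpha> c where pc: "p = (\<alpha>, c)" by fastforce
            have \<alpha>: "\<alpha> \<in> arcs Q" "head Q \<alpha> = i" "c < fl l (tail Q \<alpha>)" using p unfolding pc cols_def by auto
            have c: "c < d (tail Q \<alpha>)" using cols_bound p unfolding pc by blast
            have t: "tail Q \<alpha> \<in> verts Q" using \<alpha>(1) by simp
            note H = GL_D[OF g t]
            let ?w = "g' (tail Q \<alpha>) *\<^sub>v unit_vec (d (tail Q \<alpha>)) c"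
            have wc: "?w \<in> carrier_vec (d (tail Q \<alpha>))" using H(2) by simp
            have gw: "g (tail Q \<alpha>) *\<^sub>v ?w = unit_vec (d (tail Q \<alpha>)) c" by (rule mat_inverse_vec[OF H(1,2,3) unit_vec_carrier])
            have "?w \<in> flag g l (tail Q \<alpha>)" using wc \<alpha>(3) by (auto simp: flag_def gw simp del: index_mult_mat_vec)
            then have "embed (tail Q \<alpha>) ?w \<in> ?R l" unfolding IH by (rule flag_embed[OF g t])
            moreover have "path_elem (tail Q \<alpha>, [\<alpha>]) \<in> len_ge 1" using \<alpha>(1) path_elem_closed[of "(tail Q \<alpha>, [\<alpha>])"] unfolding len_ge_1 by (simp add: path_elem_def)
            ultimately have "cls (path_elem (tail Q \<alpha>, [\<alpha>])) \<odot>\<^bsub>rep_module Q d x\<^esub> embed (tail Q \<alpha>) ?w \<in> ?R (Suc l)"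
              by (intro radical_power_step[OF M])
            moreover have "cls (path_elem (tail Q \<alpha>, [\<alpha>])) \<odot>\<^bsub>rep_module Q d x\<^esub> embed (tail Q \<alpha>) ?w = embed (head Q \<alpha>) (x \<alpha> *\<^sub>v ?w)"
              using rep_smult[OF x _ embed_closed[OF wc]] rep_submodule_arrow[OF x \<alpha>(1) wc] \<alpha>(1) by simp
            ultimately have mem: "embed i (x \<alpha> *\<^sub>v ?w) \<in> ?R (Suc l)" using \<alpha>(2) by simp
            have z: "?z \<alpha> \<in> carrier_mat (d (head Q \<alpha>)) (d (tail Q \<alpha>))" by (rule rep_space_carrier[OF GL_act_closed[OF g xs] \<alpha>(1)])
            have "?z \<alpha> *\<^sub>v (g (tail Q \<alpha>) *\<^sub>v ?w) = g (head Q \<alpha>) *\<^sub>v (x \<alpha> *\<^sub>v ?w)" by (rule act_mult_vec[OF g xs \<alpha>(1) wc])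
            then have "col (?z \<alpha>) c = g i *\<^sub>v (x \<alpha> *\<^sub>v ?w)" unfolding gw mult_mat_unit_vec[OF z c] \<alpha>(2) .
            moreover have xw: "x \<alpha> *\<^sub>v ?w \<in> carrier_vec (d i)" using rep_space_carrier[OF xs \<alpha>(1)] wc \<alpha>(2) by simp
            ultimately have "g' i *\<^sub>v col (?z \<alpha>) c = x \<alpha> *\<^sub>v ?w" using mat_inverse_vec[OF G(2,1,4) xw] by simp
            moreover have "col (?z \<alpha>) c \<in> carrier_vec (d i)" using z c \<alpha>(2) by auto
            ultimately show "col (?z (fst p)) (snd p) \<in> ?U" using mem xw unfolding pc by simp
          qed
          then have "g' i *\<^sub>v unit_vec (d i) k \<in> ?Y" unfolding \<rho> by blast
          moreover have "k < d i" using k fl_le[OF i, of "Suc l"] by simp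
          ultimately show ?thesis using mult_mat_unit_vec[OF G(2)] by simp
        qed
        have vi: "v i \<in> flag g (Suc l) i" using v i unfolding graded_def by blast
        have vc: "v i \<in> carrier_vec (d i)" using vi unfolding flag_def by blast
        have gv: "g i *\<^sub>v v i \<in> carrier_vec (d i)" using G(1) vc by simp
        have "g' i *\<^sub>v (g i *\<^sub>v v i) \<in> ?Y"
          by (rule mult_mat_vec_comb[OF G(2) gv Y]) (rule col, rule flag_supp[OF vi])
        then show "embed i (v i) \<in> ?R (Suc l)" unfolding mat_inverse_vec[OF G(2,1,4) vc] by blast
      qed
    qed
  qed
qed

text \<open>Every arrow moves the flag one step down, so a path of length at least
  \<open>L + 1\<close> ends in a term beyond \<open>L\<close>, which is zero. The relations of the
  truncated algebra therefore hold automatically.\<close>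

lemma truncated_variety:
  assumes I: "I = paths_ideal Q (Suc L)" and x: "x \<in> rep_space Q d" and g: "(g, g') \<in> GL"
    and std: "act g g' x \<in> std fl"
  shows "x \<in> rep_variety Q I d"
proof -
  have path: "path_map x p w \<in> flag g (l + length p) (qend Q (u, p))"
    if "(u, p) \<in> qpaths Q" "w \<in> flag g l u" for u p w l
    using that
  proof (induction p arbitrary: u w l)
    case Nil
    then show ?case by (simp add: path_map_def)
  next
    case (Cons \<alpha> p)
    have \<alpha>: "\<alpha> \<in> arcs Q" "u = tail Q \<alpha>" "(head Q \<alpha>, p) \<in> qpaths Q" using Cons.prems(1) by (auto simp: qpaths_Cons)
    have "x \<alpha> *\<^sub>v w \<in> flag g (Suc l) (head Q \<alpha>)" using flag_arrow[OF g x std \<alpha>(1)] Cons.prems(2) \<alpha>(2) by simp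
    then show ?case using Cons.IH[OF \<alpha>(3), of "x \<alpha> *\<^sub>v w" "Suc l"] by (simp add: path_map_def qend_Cons)
  qed
  have I_len: "I \<subseteq> len_ge (Suc L)"
    unfolding I paths_ideal_def
  proof (rule KQ.genideal_minimal[OF len_ge_ideal])
    have "path_elem q \<in> len_ge (Suc L)" if "q \<in> qpaths Q" "length (snd q) = Suc L" for q
      using that path_elem_closed[OF that(1)] unfolding len_ge_def by (auto simp: path_elem_def)
    then show "{path_elem q | q. q \<in> qpaths Q \<and> length (snd q) = Suc L} \<subseteq> len_ge (Suc L)" by blast
  qed
  have "rep_action Q d x f v = zero_V" if f: "f \<in> len_ge (Suc L)" and v: "v \<in> V" for f v
    using f
  proof (induction rule: len_ge_induct)
    case zero
    show ?case by (rule rep_action_zero)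
  next
    case (add c q f)
    obtain u p where q: "q = (u, p)" by fastforce
    have u: "u \<in> verts Q" and e: "qend Q q \<in> verts Q" using fst_verts qend_verts add.hyps(1) unfolding q by auto
    have "v u \<in> flag g 0 u" using V_carrier[OF v u] fl_0[OF u] unfolding flag_def by simp
    then have "path_map x p (v u) \<in> flag g (length p) (qend Q q)" using path[of u p "v u" 0] add.hyps(1) unfolding q by simp
    then have "embed (qend Q q) (path_map x p (v u)) \<in> graded (flag g (length p))" by (rule flag_embed[OF g e])
    moreover have "graded (flag g (length p)) = {zero_V}" using add.hyps(2) unfolding q by (intro graded_flag_top[OF g]) simp
    ultimately have "embed (qend Q q) (path_map x p (v u)) (qend Q q) = zero_V (qend Q q)" by (metis singletonD)
    then have "path_map x p (v u) = 0\<^sub>v (d (qend Q q))" using e by simp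
    then have "embed (qend Q q) (c \<cdot>\<^sub>v path_map x (snd q) (v (fst q))) = zero_V"
      unfolding q by (simp add: smult_zero embed_zero)
    then show ?case
      unfolding rep_action_add_left[OF single_closed[OF add.hyps(1)] len_ge_carrier[OF add.hyps(3)]]
        rep_action_single[OF x add.hyps(1) v] using add.IH by (simp add: zero_V_left)
  qed
  then show ?thesis using x I_len unfolding rep_variety_def V_def zero_V_def by blast
qed

end

section \<open>Degenerations along lines\<close>

text \<open>Over a finite field, 1 plus the product of all \<open>[:- a, 1:]\<close> is a
  nonconstant polynomial without a root.\<close>

lemma alg_closed_infinite: "infinite (UNIV :: 'k::alg_closed_field set)"
proof
  assume fin: "finite (UNIV :: 'k set)"
  let ?p = "\<Prod>a\<in>(UNIV :: 'k set). [:- a, 1:]"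
  have "degree ?p = card (UNIV :: 'k set)" by (subst degree_prod_eq_sum_degree) simp_all
  then have "degree ?p > 0" using fin by (simp add: card_gt_0_iff)
  then have "degree (?p + 1) > 0" by (subst degree_add_eq_left) simp_all
  then obtain t where "poly (?p + 1) t = 0" using alg_closed_imp_poly_has_root by blast
  moreover have "poly ?p t = 0" using fin by (auto simp: poly_prod prod_zero_iff)
  ultimately show False by simp
qed

lemma poly_functions_comp:
  assumes "f \<in> poly_functions C" "\<And>f. f \<in> C \<Longrightarrow> (\<lambda>s. f (\<gamma> s)) \<in> poly_functions D"
  shows "(\<lambda>s. f (\<gamma> s)) \<in> poly_functions D"
  using assms(1)
proof induction
  case (const c)
  show ?case by (rule poly_functions.const)
next
  case (coord f)
  then show ?case by (rule assms(2))
next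
  case (add f g)
  from add.IH show ?case by (rule poly_functions.add)
next
  case (mult f g)
  from mult.IH show ?case by (rule poly_functions.mult)
qed

lemma poly_functions_line:
  assumes "f \<in> poly_functions {\<lambda>s. s}"
  shows "\<exists>p. \<forall>s. f s = poly p s"
  using assms
proof induction
  case (const c)
  show ?case by (rule exI[of _ "[:c:]"]) simp
next
  case (coord f)
  then show ?case by (intro exI[of _ "[:0, 1:]"]) simp
next
  case (add f g)
  then obtain p q where "\<forall>s. f s = poly p s" "\<forall>s. g s = poly q s" by blast
  then show ?case by (intro exI[of _ "p + q"]) simp
next
  case (mult f g)
  then obtain p q where "\<forall>s. f s = poly p s" "\<forall>s. g s = poly q s" by blast
  then show ?case by (intro exI[of _ "p * q"]) simp
qed

context quiver_layers
begin

section \<open>Lines between two representations in standard form\<close>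

definition line :: "('a \<Rightarrow> 'k mat) \<Rightarrow> ('a \<Rightarrow> 'k mat) \<Rightarrow> 'k \<Rightarrow> 'a \<Rightarrow> 'k mat" where
  "line y z s = (\<lambda>\<alpha> \<in> arcs Q. mat (d (head Q \<alpha>)) (d (tail Q \<alpha>))
     (\<lambda>(r, c). (1 - s) * y \<alpha> $$ (r, c) + s * z \<alpha> $$ (r, c)))"

lemma line_space: "line y z s \<in> rep_space Q d"
  unfolding line_def rep_space_def by simp

lemma line_index:
  "\<alpha> \<in> arcs Q \<Longrightarrow> r < d (head Q \<alpha>) \<Longrightarrow> c < d (tail Q \<alpha>) \<Longrightarrow>
    line y z s \<alpha> $$ (r, c) = (1 - s) * y \<alpha> $$ (r, c) + s * z \<alpha> $$ (r, c)"
  by (simp add: line_def)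

lemma line_end:
  assumes "y \<in> rep_space Q d" "z \<in> rep_space Q d"
  shows "line y z 0 = y" "line y z 1 = z"
proof -
  have "line y z 0 \<alpha> = y \<alpha> \<and> line y z 1 \<alpha> = z \<alpha>" for \<alpha>
  proof (cases "\<alpha> \<in> arcs Q")
    case True
    then show ?thesis
      using rep_space_carrier[OF assms(1) True] rep_space_carrier[OF assms(2) True]
      by (auto simp: line_def intro!: eq_matI)
  next
    case False
    then show ?thesis using assms by (auto simp: line_def rep_space_def PiE_def extensional_def)
  qed
  then show "line y z 0 = y" "line y z 1 = z" by auto
qed

lemma line_std: "y \<in> std f \<Longrightarrow> z \<in> std f \<Longrightarrow> line y z s \<in> std f"
  unfolding std_def by (auto simp: line_index line_space)

lemma line_coord:
  assumes "\<alpha> \<in> arcs Q" "r < d (head Q \<alpha>)" "c < d (tail Q \<alpha>)"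
  shows "(\<lambda>s. line y z s \<alpha> $$ (r, c)) \<in> poly_functions {\<lambda>s. s}"
proof -
  have "(\<lambda>s. y \<alpha> $$ (r, c) + s * (z \<alpha> $$ (r, c) - y \<alpha> $$ (r, c))) \<in> poly_functions {\<lambda>s. s}"
    by (intro poly_functions.add poly_functions.mult poly_functions.const poly_functions.coord) simp
  then show ?thesis using assms by (simp add: line_index algebra_simps)
qed

text \<open>The entries of the line are affine in \<open>s\<close> and the action is linear in them,
  so every polynomial function becomes a polynomial in \<open>s\<close>.\<close>

lemma act_line_poly:
  assumes g: "(g, g') \<in> GL" and f: "f \<in> poly_functions (rep_coords Q d)"
  shows "\<exists>p. \<forall>s. f (act g g' (line y z s)) = poly p s"
proof (rule poly_functions_line, rule poly_functions_comp[OF f])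
  fix f :: "('a \<Rightarrow> 'k mat) \<Rightarrow> 'k" assume "f \<in> rep_coords Q d"
  then obtain \<alpha> r c where \<alpha>: "\<alpha> \<in> arcs Q" "r < d (head Q \<alpha>)" "c < d (tail Q \<alpha>)" and f: "f = (\<lambda>x. x \<alpha> $$ (r, c))"
    by blast
  let ?i = "head Q \<alpha>" and ?j = "tail Q \<alpha>"
  have ij: "?i \<in> verts Q" "?j \<in> verts Q" using \<alpha>(1) by auto
  note G = GL_D(1)[OF g ij(1)] and H = GL_D(2)[OF g ij(2)]
  have "f (act g g' (line y z s)) =
      (\<Sum>b<d ?j. (\<Sum>a<d ?i. g ?i $$ (r, a) * line y z s \<alpha> $$ (a, b)) * g' ?j $$ (b, c))" for s
  proof -
    note x = rep_space_carrier[OF line_space[of y z s] \<alpha>(1)]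
    have "f (act g g' (line y z s)) = (g ?i * line y z s \<alpha> * g' ?j) $$ (r, c)"
      unfolding f act_def using \<alpha>(1) by simp
    also have "\<dots> = (\<Sum>b<d ?j. (g ?i * line y z s \<alpha>) $$ (r, b) * g' ?j $$ (b, c))"
      by (rule mat_mult_index_sum[OF mult_carrier_mat[OF G x] H \<alpha>(2,3)])
    also have "\<dots> = (\<Sum>b<d ?j. (\<Sum>a<d ?i. g ?i $$ (r, a) * line y z s \<alpha> $$ (a, b)) * g' ?j $$ (b, c))"
    proof (intro sum.cong refl)
      fix b assume "b \<in> {..<d ?j}"
      then show "(g ?i * line y z s \<alpha>) $$ (r, b) * g' ?j $$ (b, c)
          = (\<Sum>a<d ?i. g ?i $$ (r, a) * line y z s \<alpha> $$ (a, b)) * g' ?j $$ (b, c)"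
        using mat_mult_index_sum[OF G x \<alpha>(2), of b] by simp
    qed
    finally show ?thesis .
  qed
  moreover have "(\<lambda>s. \<Sum>b<d ?j. (\<Sum>a<d ?i. g ?i $$ (r, a) * line y z s \<alpha> $$ (a, b)) * g' ?j $$ (b, c)) \<in> poly_functions {\<lambda>s. s}"
  proof (intro poly_functions_sum poly_functions.mult poly_functions.const)
    fix a b assume "b \<in> {..<d ?j}" "a \<in> {..<d ?i}"
    then show "(\<lambda>s. line y z s \<alpha> $$ (a, b)) \<in> poly_functions {\<lambda>s. s}" by (intro line_coord \<alpha>(1)) simp_all
  qed
  ultimately show "(\<lambda>s. f (act g g' (line y z s))) \<in> poly_functions {\<lambda>s. s}" by presburger
qed

text \<open>The combinations \<open>\<rho>\<close> that witness fullness of \<open>z\<close> are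
  kept fixed along the line. The upper square block \<open>T s\<close> of the resulting vectors has
  polynomial entries and is the identity at \<open>s = 1\<close>, so its determinant is a nonzero
  polynomial; where it does not vanish, the inverse of \<open>T s\<close> turns the combinations
  into unit vectors again.\<close>

lemma line_full_at:
  assumes y: "y \<in> std fl" and z: "z \<in> std fl" "full z" and l: "l \<le> L" and i: "i \<in> verts Q"
  shows "\<exists>q. q \<noteq> 0 \<and> (\<forall>s. poly q s \<noteq> 0 \<longrightarrow>
    (\<forall>k < fl (Suc l) i. \<exists>\<rho>. unit_vec (d i) k = col_comb (line y z s) l i \<rho>))"
proof -
  let ?n = "fl (Suc l) i"
  have n: "?n \<le> d i" by (rule fl_le[OF i])
  obtain \<rho> where \<rho>: "\<And>k. k < ?n \<Longrightarrow> unit_vec (d i) k = col_comb z l i (\<rho> k)"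
    using z(2) l i unfolding full_def by metis
  define e where "e s k r = (\<Sum>p\<in>cols l i. \<rho> k p * line y z s (fst p) $$ (r, snd p))" for s k r
  define T where "T s = mat ?n ?n (\<lambda>(r, k). e s k r)" for s
  have Tc: "T s \<in> carrier_mat ?n ?n" for s by (simp add: T_def)
  have colp: "fst p \<in> arcs Q" "head Q (fst p) = i" "snd p < fl l (tail Q (fst p))" "snd p < d (tail Q (fst p))"
    if "p \<in> cols l i" for p
    using that cols_bound[of "fst p" "snd p" l i] by (auto simp: cols_def)
  have line_col: "col (line y z s (fst p)) (snd p) $ r = line y z s (fst p) $$ (r, snd p)"
    if "p \<in> cols l i" "r < d i" for p s r
    using rep_space_carrier[OF line_space colp(1)[OF that(1)], of y z s] colp[OF that(1)] that(2) by auto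
  have comb: "col_comb (line y z s) l i (\<rho> k) = vec (d i) (\<lambda>r. e s k r)" for s k
    unfolding col_comb_def e_def by (intro eq_vecI) (auto intro!: sum.cong simp: line_col)
  have zs: "y \<in> rep_space Q d" "z \<in> rep_space Q d" using y z unfolding std_def by auto
  have "T 1 = 1\<^sub>m ?n"
  proof (rule eq_matI)
    fix r k assume "r < dim_row (1\<^sub>m ?n :: 'k mat)" "k < dim_col (1\<^sub>m ?n :: 'k mat)"
    then have rk: "r < ?n" "k < ?n" by simp_all
    have "unit_vec (d i) k = vec (d i) (\<lambda>r. e 1 k r)"
      using \<rho>[OF rk(2)] comb[of 1 k] unfolding line_end(2)[OF zs] by (rule trans)
    then have "unit_vec (d i) k $ r = e 1 k r" using rk n by simp
    then show "T 1 $$ (r, k) = (1\<^sub>m ?n :: 'k mat) $$ (r, k)" using rk n unfolding T_def by auto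
  qed (simp_all add: T_def)
  then have det1: "det (T 1) = 1" by simp
  have "(\<lambda>s. det (T s)) \<in> poly_functions {\<lambda>s. s}"
  proof (rule poly_functions_det[OF Tc])
    fix r k assume rk: "r < ?n" "k < ?n"
    have "(\<lambda>s. e s k r) \<in> poly_functions {\<lambda>s. s}"
      unfolding e_def
    proof (intro poly_functions_sum poly_functions.mult poly_functions.const)
      fix p assume p: "p \<in> cols l i"
      show "(\<lambda>s. line y z s (fst p) $$ (r, snd p)) \<in> poly_functions {\<lambda>s. s}"
        using colp[OF p] rk n by (intro line_coord) auto
    qed
    then show "(\<lambda>s. T s $$ (r, k)) \<in> poly_functions {\<lambda>s. s}" using rk unfolding T_def by simp
  qed
  then obtain q where q: "\<And>s. det (T s) = poly q s" using poly_functions_line by blast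
  have "q \<noteq> 0" using det1 q[of 1] by auto
  moreover have "\<exists>\<sigma>. unit_vec (d i) k = col_comb (line y z s) l i \<sigma>" if s: "poly q s \<noteq> 0" and k: "k < ?n" for s k
  proof -
    have "det (T s) \<noteq> 0" using s q by simp
    then obtain B where B: "B \<in> carrier_mat ?n ?n" "T s * B = 1\<^sub>m ?n"
      using det_non_zero_imp_unit[OF Tc] unfolding Units_def ring_mat_def by auto
    let ?U = "{v. \<exists>\<sigma>. v = col_comb (line y z s) l i \<sigma>}"
    have "vec (d i) (\<lambda>r. \<Sum>j\<in>{..<?n}. B $$ (j, k) * col_comb (line y z s) l i (\<rho> j) $ r) \<in> ?U"
      by (rule vsub_sum[OF col_comb_vsub]) auto
    moreover have "vec (d i) (\<lambda>r. \<Sum>j\<in>{..<?n}. B $$ (j, k) * col_comb (line y z s) l i (\<rho> j) $ r) = unit_vec (d i) k"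
    proof (rule eq_vecI)
      fix r assume "r < dim_vec (unit_vec (d i) k :: 'k vec)"
      then have r: "r < d i" by simp
      show "vec (d i) (\<lambda>r. \<Sum>j\<in>{..<?n}. B $$ (j, k) * col_comb (line y z s) l i (\<rho> j) $ r) $ r = unit_vec (d i) k $ r"
      proof (cases "r < ?n")
        case True
        have "(T s * B) $$ (r, k) = (\<Sum>j<?n. T s $$ (r, j) * B $$ (j, k))"
          by (rule mat_mult_index_sum[OF Tc B(1) True k])
        also have "\<dots> = (\<Sum>j<?n. B $$ (j, k) * e s j r)" using True by (simp add: T_def mult.commute)
        finally show ?thesis using r k n True unfolding B(2) comb by simp
      next
        case False
        \<comment> \<open>Below the square block the vectors vanish, because the whole line stays in
          \<open>std fl\<close>; so inverting the block is enough.\<close>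
        have "line y z s (fst p) $$ (r, snd p) = 0" if p: "p \<in> cols l i" for p
          using line_std[OF y z(1), of s] colp[OF p] r False unfolding std_def by auto
        then have "e s j r = 0" for j unfolding e_def by simp
        then show ?thesis using r k False unfolding comb by simp
      qed
    qed simp
    ultimately have "unit_vec (d i) k \<in> ?U" by (simp only:)
    then show ?thesis by blast
  qed
  ultimately show ?thesis by blast
qed

text \<open>The polynomials of \<open>line_full_at\<close> are multiplied over the finitely many
  pairs of a level and a vertex.\<close>

lemma line_full:
  assumes y: "y \<in> std fl" and z: "z \<in> std fl" "full z"
  shows "\<exists>q. q \<noteq> 0 \<and> (\<forall>s. poly q s \<noteq> 0 \<longrightarrow> full (line y z s))"
proof -
  have "\<forall>l i. \<exists>q. l \<le> L \<longrightarrow> i \<in> verts Q \<longrightarrow> q \<noteq> 0 \<and> (\<forall>s. poly q s \<noteq> 0 \<longrightarrow>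
    (\<forall>k < fl (Suc l) i. \<exists>\<rho>. unit_vec (d i) k = col_comb (line y z s) l i \<rho>))"
    using line_full_at[OF y z] by blast
  then obtain q where q: "\<And>l i. l \<le> L \<Longrightarrow> i \<in> verts Q \<Longrightarrow> q l i \<noteq> 0"
    "\<And>l i s k. l \<le> L \<Longrightarrow> i \<in> verts Q \<Longrightarrow> poly (q l i) s \<noteq> 0 \<Longrightarrow> k < fl (Suc l) i \<Longrightarrow>
      \<exists>\<rho>. unit_vec (d i) k = col_comb (line y z s) l i \<rho>"
    by metis
  let ?q = "\<Prod>l\<le>L. \<Prod>i\<in>verts Q. q l i"
  have "?q \<noteq> 0" using q(1) by (simp add: prod_zero_iff)
  moreover have "full (line y z s)" if "poly ?q s \<noteq> 0" for s
    using that q(2) unfolding full_def by (auto simp: poly_prod prod_zero_iff)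
  ultimately show ?thesis by blast
qed

text \<open>The field of this locale is arbitrary, so its infinitude is an explicit assumption; it
  provides a parameter at which the nonzero product of \<open>p\<close> and the polynomial of
  \<open>line_full\<close> does not vanish.\<close>

lemma line_dense:
  fixes p :: "'k poly"
  assumes inf: "infinite (UNIV :: 'k set)" and y: "y \<in> std fl" and z: "z \<in> std fl" "full z" and p: "p \<noteq> 0"
  shows "\<exists>s. poly p s \<noteq> 0 \<and> full (line y z s)"
proof -
  obtain q where q: "q \<noteq> 0" "\<And>s. poly q s \<noteq> 0 \<Longrightarrow> full (line y z s)" using line_full[OF y z] by blast
  have "finite {s. poly (p * q) s = 0}" using p q(1) by (intro poly_roots_finite) simp
  then obtain s where "poly (p * q) s \<noteq> 0" using inf by (metis (mono_tags) UNIV_eq_I mem_Collect_eq)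
  then show ?thesis using q(2) by auto
qed

section \<open>\<open>Filt\<close> and \<open>Rep\<close> as conditions on base changes\<close>

lemma layer_hom_layer_iff:
  assumes S: "semisimple_module Lam S" and iso: "modules_isomorphic Lam S (layer l)"
  shows "(\<exists>\<psi>. layer_hom Lam M F F' S \<psi>) \<longleftrightarrow> (\<exists>\<psi>. layer_hom Lam M F F' (layer l) \<psi>)"
proof -
  have Sm: "left_module Lam S" using S unfolding semisimple_module_def by blast
  have iso': "modules_isomorphic Lam (layer l) S"
    by (rule modules_isomorphic_sym[OF Sm iso])
  show ?thesis
    using layer_hom_trans[OF Sm iso layer_left_module] layer_hom_trans[OF layer_left_module iso' Sm] by blast
qed

context
  fixes \<S> :: "nat \<Rightarrow> ((('v, 'a) qpath \<Rightarrow> 'k) set, 's) module"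
  assumes semisimple: "\<And>l. l \<le> L \<Longrightarrow> semisimple_module Lam (\<S> l)"
    and iso_layer: "\<And>l. l \<le> L \<Longrightarrow> modules_isomorphic Lam (\<S> l) (layer l)"
begin

text \<open>The two directions are \<open>std_from_filtration\<close> and
  \<open>flag_layer_hom\<close>; the modules \<open>\<S> l\<close> are exchanged for the zero
  representations \<open>layer l\<close> by \<open>layer_hom_layer_iff\<close>.\<close>

lemma Filt_eq: "Filt Q I L d \<S> = {x \<in> rep_variety Q I d. \<exists>(g, g') \<in> GL. act g g' x \<in> std fl}"
proof -
  have "(\<exists>F. governed_filtration Lam L \<S> (rep_module Q d x) F) \<longleftrightarrow> (\<exists>(g, g') \<in> GL. act g g' x \<in> std fl)"
    if x: "x \<in> rep_variety Q I d" for x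
  proof -
    have gov: "governed_filtration Lam L \<S> (rep_module Q d x) F \<longleftrightarrow>
        F 0 = V \<and> F (Suc L) = {zero_V} \<and> (\<forall>l \<le> Suc L. Module.submodule (F l) Lam (rep_module Q d x)) \<and>
        (\<forall>l \<le> L. F (Suc l) \<subseteq> F l \<and> (\<exists>\<psi>. layer_hom Lam (rep_module Q d x) (F l) (F (Suc l)) (\<S> l) \<psi>))" for F
      unfolding rep_carrier[of x, symmetric] rep_zero[of x, symmetric]
      by (rule governed_filtration_iff[OF rep_left_module[OF x]]) (rule semisimple)
    show ?thesis
    proof
      assume "\<exists>F. governed_filtration Lam L \<S> (rep_module Q d x) F"
      then obtain F where F: "governed_filtration Lam L \<S> (rep_module Q d x) F" by blast
      note F = F[unfolded gov]
      have "\<exists>(g, g') \<in> GL. act g g' x \<in> std fl \<and> (\<forall>l \<le> Suc L. F l = graded (flag g l))"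
      proof (rule std_from_filtration[OF x])
        fix l assume l: "l \<le> L"
        show "\<exists>\<psi>. layer_hom Lam (rep_module Q d x) (F l) (F (Suc l)) (layer l) \<psi>"
          using F l layer_hom_layer_iff[OF semisimple[OF l] iso_layer[OF l]] by blast
      qed (use F in auto)
      then show "\<exists>(g, g') \<in> GL. act g g' x \<in> std fl" by blast
    next
      assume "\<exists>(g, g') \<in> GL. act g g' x \<in> std fl"
      then obtain g g' where g: "(g, g') \<in> GL" and std: "act g g' x \<in> std fl" by blast
      have "governed_filtration Lam L \<S> (rep_module Q d x) (\<lambda>l. graded (flag g l))"
        unfolding gov
      proof (intro conjI allI impI)
        fix l assume l: "l \<le> L"
        show "graded (flag g (Suc l)) \<subseteq> graded (flag g l)" by (intro graded_mono flag_decreasing)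
        show "\<exists>\<psi>. layer_hom Lam (rep_module Q d x) (graded (flag g l)) (graded (flag g (Suc l))) (\<S> l) \<psi>"
          unfolding layer_hom_layer_iff[OF semisimple[OF l] iso_layer[OF l]] by (rule flag_layer_hom[OF g x std l])
      qed (use graded_flag_0[OF g] graded_flag_top[OF g] flag_submodule[OF g x std] in simp_all)
      then show "\<exists>F. governed_filtration Lam L \<S> (rep_module Q d x) F" by blast
    qed
  qed
  then show ?thesis unfolding Filt_def by blast
qed

text \<open>\<open>std_from_filtration\<close> is applied to the radical powers themselves; the
  Loewy length makes the term with index \<open>Suc L\<close> zero. Fullness then expresses that the
  flag is the radical filtration.\<close>

lemma Rep_eq:
  assumes loewy: "loewy_length Lam = Suc L"
  shows "Rep Q I L d \<S> = {x \<in> rep_variety Q I d. \<exists>(g, g') \<in> GL. act g g' x \<in> std fl \<and> full (act g g' x)}"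
proof -
  have "(\<forall>l \<le> L. modules_isomorphic Lam (radical_layer Lam (rep_module Q d x) l) (\<S> l)) \<longleftrightarrow>
      (\<exists>(g, g') \<in> GL. act g g' x \<in> std fl \<and> full (act g g' x))"
    if x: "x \<in> rep_variety Q I d" for x
  proof -
    note M = rep_left_module[OF x]
    let ?R = "radical_power Lam (rep_module Q d x)"
    have iff: "modules_isomorphic Lam (radical_layer Lam (rep_module Q d x) l) (\<S> l) \<longleftrightarrow>
        (\<exists>\<psi>. layer_hom Lam (rep_module Q d x) (?R l) (?R (Suc l)) (layer l) \<psi>)" if l: "l \<le> L" for l
    proof -
      have "left_module Lam (\<S> l)" using semisimple[OF l] unfolding semisimple_module_def by blast
      then show ?thesis
        unfolding radical_layer_def layer_hom_layer_iff[OF semisimple[OF l] iso_layer[OF l], symmetric]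
        by (intro layer_hom_iso M radical_power_submodule radical_power_decreasing)
    qed
    show ?thesis
    proof
      assume "\<forall>l \<le> L. modules_isomorphic Lam (radical_layer Lam (rep_module Q d x) l) (\<S> l)"
      then have lay: "\<exists>\<psi>. layer_hom Lam (rep_module Q d x) (?R l) (?R (Suc l)) (layer l) \<psi>" if "l \<le> L" for l
        using iff[OF that] that by blast
      have "\<exists>(g, g') \<in> GL. act g g' x \<in> std fl \<and> (\<forall>l \<le> Suc L. ?R l = graded (flag g l))"
        by (rule std_from_filtration[OF x])
          (use radical_power_0[OF M] radical_power_loewy[OF M] radical_power_submodule[OF M]
            radical_power_decreasing[OF M] lay in \<open>simp_all add: loewy rep_carrier rep_zero\<close>)
      then show "\<exists>(g, g') \<in> GL. act g g' x \<in> std fl \<and> full (act g g' x)"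
        using full_if_radical_flag[OF x] by blast
    next
      assume "\<exists>(g, g') \<in> GL. act g g' x \<in> std fl \<and> full (act g g' x)"
      then obtain g g' where g: "(g, g') \<in> GL" "act g g' x \<in> std fl" "full (act g g' x)" by blast
      show "\<forall>l \<le> L. modules_isomorphic Lam (radical_layer Lam (rep_module Q d x) l) (\<S> l)"
      proof (intro allI impI)
        fix l assume l: "l \<le> L"
        show "modules_isomorphic Lam (radical_layer Lam (rep_module Q d x) l) (\<S> l)"
          unfolding iff[OF l]
          using flag_layer_hom[OF g(1) x g(2) l] radical_flag_if_full[OF x g, of l] radical_flag_if_full[OF x g, of "Suc l"] l
          by simp
      qed
    qed
  qed
  then show ?thesis unfolding Rep_def by blast
qed

end

text \<open>The line joins the two points in their standard positions and is pulled back as a whole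
  by the inverse of \<open>g\<close>, so that it passes through \<open>y\<close> at parameter 0.
  Along it \<open>f\<close> is a polynomial that is nonzero at 0, and fullness fails for at most
  finitely many parameters.\<close>

lemma truncated_dense:
  assumes inf: "infinite (UNIV :: 'k set)" and I: "I = paths_ideal Q (Suc L)"
    and y: "y \<in> rep_variety Q I d" "(g, g') \<in> GL" "act g g' y \<in> std fl"
    and r: "r \<in> rep_variety Q I d" "(h, h') \<in> GL" "act h h' r \<in> std fl" "full (act h h' r)"
    and f: "f \<in> poly_functions (rep_coords Q d)" "f y \<noteq> 0"
  shows "\<exists>x \<in> rep_variety Q I d. act g g' x \<in> std fl \<and> full (act g g' x) \<and> f x \<noteq> 0"
proof -
  let ?y = "act g g' y" and ?z = "act h h' r"
  let ?x = "\<lambda>s. act g' g (line ?y ?z s)"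
  note sp = GL_act_closed[OF y(2) variety_space[OF y(1)]] GL_act_closed[OF r(2) variety_space[OF r(1)]]
  note g' = GL_sym[OF y(2)]
  obtain p where p: "\<And>s. f (?x s) = poly p s" using act_line_poly[OF g' f(1)] by blast
  have "?x 0 = y" unfolding line_end(1)[OF sp] by (rule act_inverse[OF variety_space[OF y(1)] y(2)])
  then have "p \<noteq> 0" using p[of 0] f(2) by auto
  then obtain s where s: "poly p s \<noteq> 0" "full (line ?y ?z s)" using line_dense[OF inf y(3) r(3,4)] by blast
  have xs: "?x s \<in> rep_space Q d" by (rule GL_act_closed[OF g' line_space])
  have eq: "act g g' (?x s) = line ?y ?z s" by (rule act_inverse[OF line_space g'])
  have std: "act g g' (?x s) \<in> std fl" unfolding eq by (rule line_std[OF y(3) r(3)])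
  have "?x s \<in> rep_variety Q I d" by (rule truncated_variety[OF I xs y(2) std])
  then show ?thesis using std s p[of s] eq by metis
qed

end

theorem theoremA:
  fixes Q :: "('v, 'a) pre_digraph"
    and I :: "(('v, 'a) qpath \<Rightarrow> 'k::alg_closed_field) set"
    and L :: nat
    and d :: "'v \<Rightarrow> nat"
    and \<S> :: "nat \<Rightarrow> ((('v, 'a) qpath \<Rightarrow> 'k) set, 's) module"
  assumes "fin_digraph Q"
    and "admissible_ideal Q I"
    and "loewy_length (quiver_algebra Q I) = L + 1"
    and "semisimple_sequence Q I L d \<S>"
  shows "(\<forall>x \<in> rep_topology Q I d closure_of Rep Q I L d \<S>.
            \<forall>M :: ((('v, 'a) qpath \<Rightarrow> 'k) set, 'm) module.
              left_module (quiver_algebra Q I) M \<and>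
              modules_isomorphic (quiver_algebra Q I) M (rep_module Q d x) \<longrightarrow>
              (\<exists>F. governed_filtration (quiver_algebra Q I) L \<S> M F)) \<and>
         closedin (rep_topology Q I d) (Filt Q I L d \<S>) \<and>
         (I = paths_ideal Q (L + 1) \<and> Rep Q I L d \<S> \<noteq> {} \<longrightarrow>
            rep_topology Q I d closure_of Rep Q I L d \<S> = Filt Q I L d \<S>)"
proof -
  define m where "m l = dim_vector Q I (\<S> l)" for l
  interpret quiver_ideal Q I using assms(1,2) by (intro quiver_ideal.intro quiver_ideal_axioms.intro)
  interpret quiver_rep Q I d by (rule quiver_rep)
  interpret quiver_layers Q I d L m
    using assms(4) by unfold_locales (simp add: semisimple_sequence_def m_def)
  have ss: "semisimple_module Lam (\<S> l)" if "l \<le> L" for l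
    using assms(4) that unfolding semisimple_sequence_def by blast
  have iso: "modules_isomorphic Lam (\<S> l) (layer l)" if "l \<le> L" for l
    unfolding layer_def m_def using assms(4) that
    by (intro semisimple_iso_zero_rep) (auto simp: semisimple_sequence_def)
  let ?T = "rep_topology Q I d" and ?R = "Rep Q I L d \<S>" and ?F = "Filt Q I L d \<S>"
  have Filt: "?F = {x \<in> rep_variety Q I d. \<exists>(g, g') \<in> GL. act g g' x \<in> std fl}"
    by (rule Filt_eq) (simp_all only: ss iso)
  have loewy: "loewy_length Lam = Suc L" using assms(3) by simp
  have Rep: "?R = {x \<in> rep_variety Q I d. \<exists>(g, g') \<in> GL. act g g' x \<in> std fl \<and> full (act g g' x)}"
    by (rule Rep_eq) (simp_all only: ss iso loewy)
  have RF: "?R \<subseteq> ?F" unfolding Filt Rep by blast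
  have closed: "closedin ?T ?F"
  proof -
    let ?Z = "{x \<in> rep_space Q d. \<exists>(g, g') \<in> GL. act g g' x \<in> std fl} :: ('a \<Rightarrow> 'k mat) set"
    have "algset (rep_coords Q d) (rep_space Q d) ?Z" by (rule algset_orbit_std)
    then obtain P where P: "P \<subseteq> poly_functions (rep_coords Q d)" "?Z = {x \<in> rep_space Q d. \<forall>f \<in> P. f x = 0}"
      unfolding algset_def by (elim exE conjE)
    \<comment> \<open>The equations found on the affine space are restricted to the variety; this is
      where the relations are imposed.\<close>
    have "?F = {x \<in> rep_variety Q I d. \<forall>f \<in> P. f x = 0}"
      unfolding Filt
    proof (intro Collect_cong conj_cong refl)
      fix x assume "x \<in> rep_variety Q I d"
      then have "x \<in> rep_space Q d" by (rule variety_space)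
      then show "(\<exists>(g, g') \<in> GL. act g g' x \<in> std fl) = (\<forall>f \<in> P. f x = 0)"
        using set_eq_iff[THEN iffD1, OF P(2), rule_format, of x] by (simp only: mem_Collect_eq simp_thms)
    qed
    then show ?thesis unfolding rep_topology_def closedin_zariski using P(1) by (intro exI[of _ P] conjI)
  qed
  have sub: "?T closure_of ?R \<subseteq> ?F" by (rule closure_of_minimal[OF RF closed])
  have "\<exists>F. governed_filtration Lam L \<S> M F"
    if x: "x \<in> ?T closure_of ?R" and M: "left_module Lam M" "modules_isomorphic Lam M (rep_module Q d x)"
    for x and M :: "((('v, 'a) qpath \<Rightarrow> 'k) set, 'm) module"
  proof -
    obtain F where F: "governed_filtration Lam L \<S> (rep_module Q d x) F" and xv: "x \<in> rep_variety Q I d"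
      using x sub unfolding Filt_def by blast
    show ?thesis by (rule governed_filtration_vimage[OF M(1) rep_left_module[OF xv] M(2) _ F]) (rule ss)
  qed
  moreover have "?F \<subseteq> ?T closure_of ?R" if I: "I = paths_ideal Q (Suc L)" and ne: "?R \<noteq> {}"
  proof
    fix y assume "y \<in> ?F"
    then obtain g g' where y: "y \<in> rep_variety Q I d" "(g, g') \<in> GL" "act g g' y \<in> std fl" unfolding Filt by blast
    obtain r h h' where r: "r \<in> rep_variety Q I d" "(h, h') \<in> GL" "act h h' r \<in> std fl" "full (act h h' r)"
      using ne unfolding Rep by blast
    show "y \<in> ?T closure_of ?R"
      unfolding in_closure_of
    proof (intro conjI allI impI)
      show "y \<in> topspace ?T" unfolding rep_topology_def topspace_zariski by (rule y(1))
      \<comment> \<open>A neighbourhood of \<open>y\<close> contains the locus in the variety where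
        some \<open>f\<close> with \<open>f y \<noteq> 0\<close> does not vanish, and
        \<open>truncated_dense\<close> supplies a point of \<open>?R\<close> there.\<close>
      fix U assume U: "y \<in> U \<and> openin ?T U"
      then obtain P where P: "P \<subseteq> poly_functions (rep_coords Q d)" "U = {x \<in> rep_variety Q I d. \<exists>f \<in> P. f x \<noteq> 0}"
        unfolding rep_topology_def openin_zariski by blast
      then obtain f where f: "f \<in> P" "f y \<noteq> 0" using U by blast
      have "f \<in> poly_functions (rep_coords Q d)" using P(1) f(1) by blast
      from truncated_dense[OF alg_closed_infinite I y r this f(2)]
      obtain x where x: "x \<in> rep_variety Q I d" "act g g' x \<in> std fl" "full (act g g' x)" "f x \<noteq> 0" by blast
      have "x \<in> ?R" unfolding Rep using x(1-3) y(2) by blast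
      moreover have "x \<in> U" unfolding P(2) using x(1,4) f(1) by blast
      ultimately show "\<exists>x. x \<in> ?R \<and> x \<in> U" by blast
    qed
  qed
  ultimately show ?thesis using sub closed by simp blast
qed

end
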